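(* Let $\mathcal{G}\rightrightarrows M$ be a Lie groupoid with Lie algebroid $A$, let $\Pi\in\mathfrak{X}^k(\mathcal{G})$ be a $k$-vector field and let $\pi=\mathrm{pr}_{\wedge^kA}\Pi|_M\in\Gamma(\wedge^kA)$. Define $$\Pi_r=\Pi-\overrightarrow{\pi},\qquad \Pi_l=\Pi-\overleftarrow{\pi}.$$ Then $\Pi$ is affine if and only if $\Pi_r$ is a multiplicative $k$-vector field on $\mathcal{G}$; likewise, $\Pi$ is affine if and only if $\Pi_l$ is a multiplicative $k$-vector field on $\mathcal{G}$.
   Context: Conventions: $\mathcal{G}\rightrightarrows M$ has source $s$ and target $t$; $gh$ is defined iff $s(g)=t(h)$; $M\subset\mathcal{G}$ via units. The Lie algebroid is $A=\ker(ds)|_M$ with anchor $\rho=dt|_A$, and $T\mathcal{G}|_M=TM\oplus A$. For a $k$-vector field $\Pi$, $\mathrm{pr}_{\wedge^kA}\Pi|_M$ is the $\wedge^kA$-component of $\Pi|_M\in\Gamma(\wedge^k(TM\oplus A))$. Translations: for $u\in\Gamma(A)$, $\overrightarrow{u}(g)=dR_g(u_{t(g)})$ and $\overleftarrow{u}(g)=-dL_g(d\,\mathrm{inv}(u_{s(g)}))$, where $R_g,L_g$ are right and left multiplication and $\mathrm{inv}$ is the inversion. These are extended to $\Gamma(\wedge^kA)$ factorwise: $\overrightarrow{X_1\wedge\cdots\wedge X_k}=\overrightarrow{X_1}\wedge\cdots\wedge\overrightarrow{X_k}$ and $\overleftarrow{X_1\wedge\cdots\wedge X_k}=\overleftarrow{X_1}\wedge\cdots\wedge\overleftarrow{X_k}$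 (for $k=0$: $\overrightarrow f=t^*f$, $\overleftarrow f=s^*f$). A submanifold $S$ of a manifold $N$ is coisotropic with respect to $\Lambda\in\mathfrak{X}^k(N)$ if for all $x\in S$, $\Lambda_x(\xi_1,\dots,\xi_k)=0$ whenever all $\xi_i\in T_x^*N$ annihilate $T_xS$. $\Pi\in\mathfrak{X}^k(\mathcal{G})$ is multiplicative if $\{(g,h,gh): s(g)=t(h)\}\subset\mathcal{G}^3$ is coisotropic with respect to $\Pi\oplus\Pi\oplus(-1)^{k+1}\Pi$. It is affine if $\{(g,h,l,hg^{-1}l): s(g)=s(h),\,t(g)=t(l)\}\subset\mathcal{G}^4$ is coisotropic with respect to $\Pi\oplus(-1)^{k+1}\Pi\oplus(-1)^{k+1}\Pi\oplus\Pi$. *)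

theory Defs
  imports "HOL-Analysis.Analysis"
begin

section \<open>Smooth maps between subsets of Euclidean spaces\<close>

text \<open>Continuous differentiability of order \<open>n\<close> on an open set \<open>W\<close>.\<close>

primrec Ck :: "nat \<Rightarrow> 'a::euclidean_space set \<Rightarrow> ('a \<Rightarrow> 'b::euclidean_space) \<Rightarrow> bool" where
  "Ck 0 W f \<longleftrightarrow> continuous_on W f"
| "Ck (Suc n) W f \<longleftrightarrow>
     (\<exists>f'. (\<forall>x\<in>W. (f has_derivative f' x) (at x)) \<and> (\<forall>v. Ck n W (\<lambda>x. f' x v)))"

text \<open>Smoothness on an arbitrary subset: every point has an open neighbourhood on which
  the map extends to a smooth one.\<close>

definition smooth_on :: "'a::euclidean_space set \<Rightarrow> ('a \<Rightarrow> 'b::euclidean_space) \<Rightarrow> bool" where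
  "smooth_on S f \<longleftrightarrow>
     (\<forall>x\<in>S. \<exists>W F. open W \<and> x \<in> W \<and> (\<forall>n. Ck n W F) \<and> (\<forall>y\<in>S \<inter> W. f y = F y))"


section \<open>Smooth manifolds\<close>

text \<open>Charts are pairs \<open>(U, \<phi>)\<close> and take values in a linear subspace \<open>model\<close> of a Euclidean
  space. As the types of class \<open>euclidean_space\<close> all have positive dimension, the subspace is
  what makes dimension \<open>0\<close> available (for instance a one-point base, that is, a Lie group).
  The topology is the one determined by the atlas. Neither the Hausdorff property nor second
  countability is imposed: conventions for Lie groupoids differ on this, and every one
  of them is an instance.\<close>

record ('a, 'e) mfd =
  model :: "'e set"
  atlas :: "('a set \<times> ('a \<Rightarrow> 'e)) set"

definition points :: "('a, 'e) mfd \<Rightarrow> 'a set" where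
  "points X = (\<Union>(U, \<phi>)\<in>atlas X. U)"

definition smooth_manifold :: "('a, 'e::euclidean_space) mfd \<Rightarrow> bool" where
  "smooth_manifold X \<longleftrightarrow>
     subspace (model X) \<and>
     (\<forall>(U, \<phi>)\<in>atlas X. inj_on \<phi> U \<and> openin (top_of_set (model X)) (\<phi> ` U)) \<and>
     (\<forall>(U, \<phi>)\<in>atlas X. \<forall>(V, \<psi>)\<in>atlas X.
        openin (top_of_set (model X)) (\<phi> ` (U \<inter> V)) \<and>
        smooth_on (\<phi> ` (U \<inter> V)) (\<psi> \<circ> inv_into U \<phi>))"

definition open_subset :: "('a, 'e::euclidean_space) mfd \<Rightarrow> 'a set \<Rightarrow> bool" where
  "open_subset X W \<longleftrightarrow>
     W \<subseteq> points X \<and> (\<forall>(U, \<phi>)\<in>atlas X. openin (top_of_set (model X)) (\<phi> ` (U \<inter> W)))"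

definition euclid :: "('e::euclidean_space, 'e) mfd" where
  "euclid = \<lparr>model = UNIV, atlas = {(UNIV, \<lambda>x. x)}\<rparr>"

definition prod_mfd :: "('a, 'e) mfd \<Rightarrow> ('b, 'f) mfd \<Rightarrow> ('a \<times> 'b, 'e \<times> 'f) mfd" where
  "prod_mfd X Y =
     \<lparr>model = model X \<times> model Y,
      atlas = {(U \<times> V, map_prod \<phi> \<psi>) | U \<phi> V \<psi>. (U, \<phi>) \<in> atlas X \<and> (V, \<psi>) \<in> atlas Y}\<rparr>"

text \<open>\<open>F\<close> is a smooth map from the subset \<open>S\<close> of \<open>X\<close> to \<open>Y\<close>. For an open subset
  or an embedded submanifold \<open>S\<close> this is smoothness with respect to the induced manifold
  structure.\<close>

definition smooth_map ::
    "('a, 'e::euclidean_space) mfd \<Rightarrow> ('b, 'f::euclidean_space) mfd \<Rightarrow> 'a set \<Rightarrow> ('a \<Rightarrow> 'b) \<Rightarrow> bool" where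
  "smooth_map X Y S F \<longleftrightarrow>
     (\<forall>x\<in>S. \<exists>(U, \<phi>)\<in>atlas X. \<exists>(V, \<psi>)\<in>atlas Y. \<exists>W.
        x \<in> U \<and> open W \<and> \<phi> x \<in> W \<and>
        (\<forall>y\<in>S \<inter> U. \<phi> y \<in> W \<longrightarrow> F y \<in> V) \<and>
        smooth_on (\<phi> ` (S \<inter> U) \<inter> W) (\<psi> \<circ> F \<circ> inv_into U \<phi>))"


section \<open>Tangent vectors, differentials, cotangent vectors\<close>

text \<open>A tangent vector at \<open>x\<close> is the velocity of a smooth curve through \<open>x\<close>, recorded as
  the derivation \<open>f \<mapsto> (f \<circ> \<gamma>)'(0)\<close> on the real functions that are smooth near \<open>x\<close>
  (with value \<open>0\<close> on all other functions). Two curves have the same velocity iff their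
  derivatives at \<open>0\<close> agree in charts, and the vector space operations are the pointwise ones.\<close>

type_synonym 'a tvec = "('a \<Rightarrow> real) \<Rightarrow> real"

definition smooth_near :: "('a, 'e::euclidean_space) mfd \<Rightarrow> 'a \<Rightarrow> ('a \<Rightarrow> real) \<Rightarrow> bool" where
  "smooth_near X x f \<longleftrightarrow> (\<exists>W. open_subset X W \<and> x \<in> W \<and> smooth_map X euclid W f)"

definition velocity :: "('a, 'e::euclidean_space) mfd \<Rightarrow> (real \<Rightarrow> 'a) \<Rightarrow> 'a tvec" where
  "velocity X \<gamma> = (\<lambda>f. if smooth_near X (\<gamma> 0) f then deriv (\<lambda>\<tau>. f (\<gamma> \<tau>)) 0 else 0)"

definition curve_in ::
    "('a, 'e::euclidean_space) mfd \<Rightarrow> 'a set \<Rightarrow> 'a \<Rightarrow> (real \<Rightarrow> 'a) \<Rightarrow> bool" where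
  "curve_in X S x \<gamma> \<longleftrightarrow>
     \<gamma> 0 = x \<and>
     (\<exists>\<epsilon>>0. \<gamma> ` {-\<epsilon><..<\<epsilon>} \<subseteq> S \<and> smooth_map euclid X {-\<epsilon><..<\<epsilon>} \<gamma>)"

text \<open>\<open>tangent X S x\<close> is \<open>T\<^sub>xS\<close> as a subspace of \<open>T\<^sub>xX\<close>, for a submanifold \<open>S\<close> of \<open>X\<close>.\<close>

definition tangent :: "('a, 'e::euclidean_space) mfd \<Rightarrow> 'a set \<Rightarrow> 'a \<Rightarrow> 'a tvec set" where
  "tangent X S x = {velocity X \<gamma> | \<gamma>. curve_in X S x \<gamma>}"

abbreviation tangent_space :: "('a, 'e::euclidean_space) mfd \<Rightarrow> 'a \<Rightarrow> 'a tvec set" where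
  "tangent_space X x \<equiv> tangent X (points X) x"

text \<open>The differential at \<open>x\<close> of a smooth map \<open>F\<close> from the submanifold \<open>S\<close> of \<open>X\<close> to \<open>Y\<close>;
  the result does not depend on the curve chosen to represent \<open>v \<in> T\<^sub>xS\<close>.\<close>

definition differential ::
    "('a, 'e::euclidean_space) mfd \<Rightarrow> 'a set \<Rightarrow> ('b, 'f::euclidean_space) mfd \<Rightarrow>
     ('a \<Rightarrow> 'b) \<Rightarrow> 'a \<Rightarrow> 'a tvec \<Rightarrow> 'b tvec" where
  "differential X S Y F x v = velocity Y (F \<circ> (SOME \<gamma>. curve_in X S x \<gamma> \<and> velocity X \<gamma> = v))"

text \<open>The dual of a linear space \<open>T\<close> of tangent vectors; its elements are extended by \<open>0\<close>
  outside \<open>T\<close>, so that a linear form on \<open>T\<close> has exactly one representative.\<close>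

type_synonym 'a covec = "'a tvec \<Rightarrow> real"

definition dual :: "'a tvec set \<Rightarrow> 'a covec set" where
  "dual T = {\<xi>. (\<forall>v\<in>T. \<forall>w\<in>T. \<forall>a b. \<xi> (\<lambda>f. a * v f + b * w f) = a * \<xi> v + b * \<xi> w) \<and>
                (\<forall>v. v \<notin> T \<longrightarrow> \<xi> v = 0)}"

definition pullback :: "'a tvec set \<Rightarrow> ('a tvec \<Rightarrow> 'b tvec) \<Rightarrow> 'b covec \<Rightarrow> 'a covec" where
  "pullback T L \<eta> = (\<lambda>v. if v \<in> T then \<eta> (L v) else 0)"

definition fun_differential ::
    "('a, 'e::euclidean_space) mfd \<Rightarrow> 'a \<Rightarrow> ('a \<Rightarrow> real) \<Rightarrow> 'a covec" where
  "fun_differential X x f = (\<lambda>v. if v \<in> tangent_space X x then v f else 0)"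


section \<open>Multivector fields\<close>

text \<open>An element of the \<open>k\<close>-th exterior power of a finite-dimensional space \<open>T\<close> is an
  alternating \<open>k\<close>-linear form on the dual of \<open>T\<close>, applied here to lists of length \<open>k\<close>;
  \<open>X\<^sub>1 \<and> \<dots> \<and> X\<^sub>k\<close> is \<open>(\<xi>\<^sub>1, \<dots>, \<xi>\<^sub>k) \<mapsto> det (\<xi>\<^sub>i(X\<^sub>j))\<close>. For \<open>k = 0\<close> it is the scalar
  that is the value at the empty list.\<close>

type_synonym 'a mvec = "'a covec list \<Rightarrow> real"

definition kvector :: "nat \<Rightarrow> 'a tvec set \<Rightarrow> 'a mvec \<Rightarrow> bool" where
  "kvector k T \<Lambda> \<longleftrightarrow>
     (\<forall>\<xi>s. length \<xi>s = k \<and> set \<xi>s \<subseteq> dual T \<longrightarrow>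
        (\<forall>i<k. \<forall>\<eta>\<in>dual T. \<forall>\<zeta>\<in>dual T. \<forall>a b.
           \<Lambda> (\<xi>s[i := (\<lambda>v. a * \<eta> v + b * \<zeta> v)]) = a * \<Lambda> (\<xi>s[i := \<eta>]) + b * \<Lambda> (\<xi>s[i := \<zeta>])) \<and>
        (\<forall>i<k. \<forall>j<k. i \<noteq> j \<and> \<xi>s ! i = \<xi>s ! j \<longrightarrow> \<Lambda> \<xi>s = 0))"

text \<open>The map induced on exterior powers by a linear map \<open>L\<close> with domain \<open>T\<close>, that is,
  \<open>X\<^sub>1 \<and> \<dots> \<and> X\<^sub>k \<mapsto> L X\<^sub>1 \<and> \<dots> \<and> L X\<^sub>k\<close>.\<close>

definition pushforward :: "'a tvec set \<Rightarrow> ('a tvec \<Rightarrow> 'b tvec) \<Rightarrow> 'a mvec \<Rightarrow> 'b mvec" where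
  "pushforward T L \<Lambda> = (\<lambda>\<eta>s. \<Lambda> (map (pullback T L) \<eta>s))"

text \<open>Smoothness of a \<open>k\<close>-vector field is smoothness of its values on differentials of
  (locally defined) smooth functions, equivalently of its components in charts.\<close>

definition kvector_field ::
    "('a, 'e::euclidean_space) mfd \<Rightarrow> nat \<Rightarrow> ('a \<Rightarrow> 'a mvec) \<Rightarrow> bool" where
  "kvector_field X k P \<longleftrightarrow>
     (\<forall>x\<in>points X. kvector k (tangent_space X x) (P x)) \<and>
     (\<forall>W fs. open_subset X W \<and> length fs = k \<and> (\<forall>f\<in>set fs. smooth_map X euclid W f) \<longrightarrow>
        smooth_map X euclid W (\<lambda>x. P x (map (fun_differential X x) fs)))"

definition scale_field :: "real \<Rightarrow> ('a \<Rightarrow> 'a mvec) \<Rightarrow> 'a \<Rightarrow> 'a mvec" where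
  "scale_field c P = (\<lambda>x \<xi>s. c * P x \<xi>s)"

definition diff_field :: "('a \<Rightarrow> 'a mvec) \<Rightarrow> ('a \<Rightarrow> 'a mvec) \<Rightarrow> 'a \<Rightarrow> 'a mvec" where
  "diff_field P \<Lambda> = (\<lambda>x \<xi>s. P x \<xi>s - \<Lambda> x \<xi>s)"

text \<open>\<open>P \<oplus> \<Lambda>\<close> on \<open>X \<times> Y\<close>: each summand is pushed into \<open>T(X \<times> Y) = TX \<oplus> TY\<close> by the
  differential of the corresponding slice inclusion.\<close>

definition sum_field ::
    "('a, 'e::euclidean_space) mfd \<Rightarrow> ('b, 'f::euclidean_space) mfd \<Rightarrow>
     ('a \<Rightarrow> 'a mvec) \<Rightarrow> ('b \<Rightarrow> 'b mvec) \<Rightarrow> 'a \<times> 'b \<Rightarrow> ('a \<times> 'b) mvec" where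
  "sum_field X Y P \<Lambda> = (\<lambda>(x, y) \<xi>s.
     pushforward (tangent_space X x)
       (differential X (points X) (prod_mfd X Y) (\<lambda>x'. (x', y)) x) (P x) \<xi>s +
     pushforward (tangent_space Y y)
       (differential Y (points Y) (prod_mfd X Y) (\<lambda>y'. (x, y')) y) (\<Lambda> y) \<xi>s)"

text \<open>Used only for submanifolds \<open>S\<close> of \<open>X\<close>.\<close>

definition coisotropic ::
    "('a, 'e::euclidean_space) mfd \<Rightarrow> nat \<Rightarrow> ('a \<Rightarrow> 'a mvec) \<Rightarrow> 'a set \<Rightarrow> bool" where
  "coisotropic X k \<Lambda> S \<longleftrightarrow>
     (\<forall>x\<in>S. \<forall>\<xi>s. length \<xi>s = k \<and> set \<xi>s \<subseteq> dual (tangent_space X x) \<and>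
        (\<forall>\<xi>\<in>set \<xi>s. \<forall>v\<in>tangent X S x. \<xi> v = 0) \<longrightarrow> \<Lambda> x \<xi>s = 0)"


section \<open>Lie groupoids\<close>

record ('g, 'e, 'm, 'f) groupoid =
  arrows :: "('g, 'e) mfd"
  base :: "('m, 'f) mfd"
  src :: "'g \<Rightarrow> 'm"
  tgt :: "'g \<Rightarrow> 'm"
  mult :: "'g \<Rightarrow> 'g \<Rightarrow> 'g"
  unit :: "'m \<Rightarrow> 'g"
  invs :: "'g \<Rightarrow> 'g"

definition composable :: "('g, 'e, 'm, 'f) groupoid \<Rightarrow> ('g \<times> 'g) set" where
  "composable \<G> = {(g, h). g \<in> points (arrows \<G>) \<and> h \<in> points (arrows \<G>) \<and> src \<G> g = tgt \<G> h}"

definition algebraic_groupoid :: "('g, 'e, 'm, 'f) groupoid \<Rightarrow> bool" where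
  "algebraic_groupoid \<G> \<longleftrightarrow>
     (let G = points (arrows \<G>); M = points (base \<G>) in
       (\<forall>g\<in>G. src \<G> g \<in> M \<and> tgt \<G> g \<in> M) \<and>
       (\<forall>(g, h)\<in>composable \<G>. mult \<G> g h \<in> G \<and>
          src \<G> (mult \<G> g h) = src \<G> h \<and> tgt \<G> (mult \<G> g h) = tgt \<G> g) \<and>
       (\<forall>g h l. (g, h) \<in> composable \<G> \<and> (h, l) \<in> composable \<G> \<longrightarrow>
          mult \<G> (mult \<G> g h) l = mult \<G> g (mult \<G> h l)) \<and>
       (\<forall>x\<in>M. unit \<G> x \<in> G \<and> src \<G> (unit \<G> x) = x \<and> tgt \<G> (unit \<G> x) = x) \<and>
       (\<forall>g\<in>G. mult \<G> g (unit \<G> (src \<G> g)) = g \<and> mult \<G> (unit \<G> (tgt \<G> g)) g = g) \<and>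
       (\<forall>g\<in>G. invs \<G> g \<in> G \<and> src \<G> (invs \<G> g) = tgt \<G> g \<and> tgt \<G> (invs \<G> g) = src \<G> g \<and>
          mult \<G> g (invs \<G> g) = unit \<G> (tgt \<G> g) \<and> mult \<G> (invs \<G> g) g = unit \<G> (src \<G> g)))"

definition submersion ::
    "('a, 'e::euclidean_space) mfd \<Rightarrow> ('b, 'f::euclidean_space) mfd \<Rightarrow> ('a \<Rightarrow> 'b) \<Rightarrow> bool" where
  "submersion X Y F \<longleftrightarrow>
     smooth_map X Y (points X) F \<and>
     (\<forall>x\<in>points X. differential X (points X) Y F x ` tangent_space X x = tangent_space Y (F x))"

definition lie_groupoid ::
    "('g, 'e::euclidean_space, 'm, 'f::euclidean_space) groupoid \<Rightarrow> bool" where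
  "lie_groupoid \<G> \<longleftrightarrow>
     smooth_manifold (arrows \<G>) \<and> smooth_manifold (base \<G>) \<and> algebraic_groupoid \<G> \<and>
     submersion (arrows \<G>) (base \<G>) (src \<G>) \<and> submersion (arrows \<G>) (base \<G>) (tgt \<G>) \<and>
     smooth_map (prod_mfd (arrows \<G>) (arrows \<G>)) (arrows \<G>) (composable \<G>) (\<lambda>(g, h). mult \<G> g h) \<and>
     smooth_map (base \<G>) (arrows \<G>) (points (base \<G>)) (unit \<G>) \<and>
     smooth_map (arrows \<G>) (arrows \<G>) (points (arrows \<G>)) (invs \<G>)"

abbreviation TG :: "('g, 'e::euclidean_space, 'm, 'f) groupoid \<Rightarrow> 'g \<Rightarrow> 'g tvec set" where
  "TG \<G> g \<equiv> tangent_space (arrows \<G>) g"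

definition algebroid ::
    "('g, 'e::euclidean_space, 'm, 'f::euclidean_space) groupoid \<Rightarrow> 'm \<Rightarrow> 'g tvec set" where
  "algebroid \<G> x =
     {u \<in> TG \<G> (unit \<G> x).
        differential (arrows \<G>) (points (arrows \<G>)) (base \<G>) (src \<G>) (unit \<G> x) u = (\<lambda>_. 0)}"

text \<open>The projection \<open>T\<^sub>x\<G> = T\<^sub>xM \<oplus> A\<^sub>x \<rightarrow> A\<^sub>x\<close>, with \<open>M\<close> embedded in \<open>\<G>\<close> by the units.\<close>

definition proj_A ::
    "('g, 'e::euclidean_space, 'm, 'f::euclidean_space) groupoid \<Rightarrow> 'm \<Rightarrow> 'g tvec \<Rightarrow> 'g tvec" where
  "proj_A \<G> x v =
     (THE u. u \<in> algebroid \<G> x \<and>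
        (\<lambda>f. v f - u f) \<in> tangent (arrows \<G>) (unit \<G> ` points (base \<G>)) (unit \<G> x))"

text \<open>The \<open>\<and>\<^sup>kA\<close>-component of \<open>P|\<^sub>M\<close>: the projection of \<open>\<and>\<^sup>k(TM \<oplus> A)\<close> to \<open>\<and>\<^sup>kA\<close>
  is the one induced by the projection of \<open>TM \<oplus> A\<close> to \<open>A\<close>.\<close>

definition pr_A ::
    "('g, 'e::euclidean_space, 'm, 'f::euclidean_space) groupoid \<Rightarrow> ('g \<Rightarrow> 'g mvec) \<Rightarrow> 'm \<Rightarrow> 'g mvec" where
  "pr_A \<G> P x = pushforward (TG \<G> (unit \<G> x)) (proj_A \<G> x) (P (unit \<G> x))"

text \<open>Right multiplication by \<open>g\<close> is defined on the source fibre \<open>s\<^sup>-\<^sup>1(t(g))\<close>, whose tangent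
  space at the unit is \<open>A\<close>; left multiplication by \<open>g\<close> on the target fibre \<open>t\<^sup>-\<^sup>1(s(g))\<close>.\<close>

definition right_mult_d ::
    "('g, 'e::euclidean_space, 'm, 'f) groupoid \<Rightarrow> 'g \<Rightarrow> 'g tvec \<Rightarrow> 'g tvec" where
  "right_mult_d \<G> g =
     differential (arrows \<G>) {h \<in> points (arrows \<G>). src \<G> h = tgt \<G> g} (arrows \<G>)
       (\<lambda>h. mult \<G> h g) (unit \<G> (tgt \<G> g))"

definition left_mult_d ::
    "('g, 'e::euclidean_space, 'm, 'f) groupoid \<Rightarrow> 'g \<Rightarrow> 'g tvec \<Rightarrow> 'g tvec" where
  "left_mult_d \<G> g =
     differential (arrows \<G>) {h \<in> points (arrows \<G>). tgt \<G> h = src \<G> g} (arrows \<G>)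
       (\<lambda>h. mult \<G> g h) (unit \<G> (src \<G> g))"

definition right_translation ::
    "('g, 'e::euclidean_space, 'm, 'f::euclidean_space) groupoid \<Rightarrow> ('m \<Rightarrow> 'g mvec) \<Rightarrow> 'g \<Rightarrow> 'g mvec" where
  "right_translation \<G> \<pi> g =
     pushforward (algebroid \<G> (tgt \<G> g)) (right_mult_d \<G> g) (\<pi> (tgt \<G> g))"

definition left_translation ::
    "('g, 'e::euclidean_space, 'm, 'f::euclidean_space) groupoid \<Rightarrow> ('m \<Rightarrow> 'g mvec) \<Rightarrow> 'g \<Rightarrow> 'g mvec" where
  "left_translation \<G> \<pi> g =
     pushforward (algebroid \<G> (src \<G> g))
       (\<lambda>u f. - left_mult_d \<G> g
          (differential (arrows \<G>) (points (arrows \<G>)) (arrows \<G>) (invs \<G>) (unit \<G> (src \<G> g)) u) f)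
       (\<pi> (src \<G> g))"

definition multiplicative ::
    "('g, 'e::euclidean_space, 'm, 'f) groupoid \<Rightarrow> nat \<Rightarrow> ('g \<Rightarrow> 'g mvec) \<Rightarrow> bool" where
  "multiplicative \<G> k P \<longleftrightarrow>
     kvector_field (arrows \<G>) k P \<and>
     (let G = arrows \<G>; G2 = prod_mfd G G; G3 = prod_mfd G G2 in
       coisotropic G3 k
         (sum_field G G2 P (sum_field G G P (scale_field ((-1) ^ (k + 1)) P)))
         {(g, h, mult \<G> g h) | g h. (g, h) \<in> composable \<G>})"

definition affine_field ::
    "('g, 'e::euclidean_space, 'm, 'f) groupoid \<Rightarrow> nat \<Rightarrow> ('g \<Rightarrow> 'g mvec) \<Rightarrow> bool" where
  "affine_field \<G> k P \<longleftrightarrow>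
     kvector_field (arrows \<G>) k P \<and>
     (let G = arrows \<G>; G2 = prod_mfd G G; G3 = prod_mfd G G2; G4 = prod_mfd G G3;
          P' = scale_field ((-1) ^ (k + 1)) P in
       coisotropic G4 k
         (sum_field G G3 P (sum_field G G2 P' (sum_field G G P' P)))
         {(g, h, l, mult \<G> (mult \<G> h (invs \<G> g)) l) | g h l.
            g \<in> points G \<and> h \<in> points G \<and> l \<in> points G \<and> src \<G> g = src \<G> h \<and> tgt \<G> g = tgt \<G> l})"

end

theory Submission
  imports Defs
begin

text \<open>
  Conormal covectors are tested on velocities of curves. Write \<open>q = g\<^sup>-\<^sup>1l\<close> for a point \<open>(g, h, l, hq)\<close>
  of the affine relation, so that \<open>l = gq\<close>. Covectors conormal to the affine relation there determine a covector
  at \<open>q\<close> which completes them to covectors conormal to the graph of the multiplication at \<open>(h, q, hq)\<close> and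
  at \<open>(g, q, gq)\<close>; subtracting the two multiplicativity equations gives affinity. Conversely
  \<open>gh = g1\<^sup>-\<^sup>1h\<close>, and covectors conormal to the graph of the multiplication at \<open>(g, h, gh)\<close> are completed by a
  covector at the unit \<open>1\<close> which annihilates \<open>TM\<close>. So an affine field is multiplicative as soon as it vanishes on
  such covectors, which \<open>\<Pi> - \<pi>\<close> (translated to either side) does by the choice of \<open>\<pi>\<close>. Finally the translated
  fields are affine, because multiplying two factors of a point of the affine relation by the same
  curve moves it inside the relation. All auxiliary covectors and curves come from local
  transversals of the source and target maps, that is, from the inverse function theorem.
\<close>

section \<open>Smooth maps between Euclidean spaces\<close>

text \<open>The obstacle is that the multiplication is smooth only on the composable pairs, in
  general not an open set of the product, and that multiplication by a fixed arrow lives on a single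
  fibre; differentials of products can therefore not be split into partial differentials directly. A
  transversal corrects one factor so that the product becomes defined and smooth on an open set,
  without changing it on pairs that were composable before. This also makes the completing covectors
  explicit: the condition imposed on them, tested on the corrected curves, is a formula for them,
  and the remaining work is to check it on all other curves. A translated field is affine but in
  general not multiplicative; what affinity leaves undetermined is the value at the units on
  covectors that annihilate \<open>TM\<close>, and this value is \<pi>. The sign
  \<open>(-1) ^ (k + 1)\<close> is absorbed by negating covectors, a \<open>k\<close>-vector being
  \<open>k\<close>-linear. Since \<open>multiplicative\<close> includes smoothness of the field, the
  translated fields also have to be shown smooth.\<close>

lemma Ck_subset: "Ck n W f \<Longrightarrow> V \<subseteq> W \<Longrightarrow> Ck n V f"
proof (induction n arbitrary: f)
  case 0
  then show ?case by (auto intro: continuous_on_subset)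
next
  case (Suc n)
  then show ?case unfolding Ck.simps by (meson subsetD)
qed

lemma Ck_cong:
  assumes "open W" "\<And>x. x \<in> W \<Longrightarrow> f x = g x" "Ck n W f"
  shows "Ck n W g"
proof (cases n)
  case 0
  with assms show ?thesis by (auto cong: continuous_on_cong)
next
  case (Suc m)
  then obtain f' where f': "\<forall>x\<in>W. (f has_derivative f' x) (at x)" "\<forall>v. Ck m W (\<lambda>x. f' x v)"
    using assms(3) by auto
  have "\<forall>x\<in>W. (g has_derivative f' x) (at x)"
    using f'(1) assms(1,2) by (meson has_derivative_transform_within_open)
  with f' Suc show ?thesis by auto
qed

lemma Ck_imp_continuous_on: "Ck n W f \<Longrightarrow> continuous_on W f"
  by (cases n) (auto intro!: continuous_at_imp_continuous_on intro: has_derivative_continuous)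

lemma Ck_SucD: "Ck (Suc n) W f \<Longrightarrow> Ck n W f"
proof (induction n arbitrary: f)
  case 0
  then show ?case using Ck_imp_continuous_on by (metis Ck.simps(1))
next
  case (Suc n)
  from Suc.prems obtain f' where f': "\<forall>x\<in>W. (f has_derivative f' x) (at x)"
    "\<forall>v. Ck (Suc n) W (\<lambda>x. f' x v)"
    unfolding Ck.simps(2)[of "Suc n"] by blast
  with Suc.IH show ?case unfolding Ck.simps(2) by blast
qed

lemma Ck_const: "Ck n W (\<lambda>x. c)"
proof (induction n arbitrary: c)
  case (Suc n)
  have "\<forall>x\<in>W. ((\<lambda>x. c) has_derivative (\<lambda>v. 0)) (at x)" by auto
  with Suc show ?case unfolding Ck.simps by (intro exI[of _ "\<lambda>x v. 0"]) auto
qed auto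

lemma Ck_bounded_linear:
  assumes "bounded_linear L"
  shows "Ck n W f \<Longrightarrow> Ck n W (\<lambda>x. L (f x))"
proof (induction n arbitrary: f)
  case 0
  then show ?case using assms by (auto intro: bounded_linear.continuous_on)
next
  case (Suc n)
  then obtain f' where f': "\<forall>x\<in>W. (f has_derivative f' x) (at x)" "\<forall>v. Ck n W (\<lambda>x. f' x v)"
    by auto
  show ?case unfolding Ck.simps
    by (rule exI[of _ "\<lambda>x v. L (f' x v)"])
      (intro conjI ballI allI Suc.IH bounded_linear.has_derivative[OF assms];
        use f' in blast)
qed

lemma Ck_id: "Ck n W (\<lambda>x. x)"
  by (cases n) (auto intro!: exI[of _ "\<lambda>x v. v"] Ck_const)

lemma Ck_linear: "linear L \<Longrightarrow> Ck n W (L :: 'a::euclidean_space \<Rightarrow> 'b::euclidean_space)"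
  by (rule Ck_bounded_linear[OF _ Ck_id]) (simp add: linear_conv_bounded_linear)

lemma Ck_Pair: "Ck n W f \<Longrightarrow> Ck n W g \<Longrightarrow> Ck n W (\<lambda>x. (f x, g x))"
proof (induction n arbitrary: f g)
  case 0
  then show ?case by (auto intro: continuous_on_Pair)
next
  case (Suc n)
  then obtain f' g' where f': "\<forall>x\<in>W. (f has_derivative f' x) (at x)" "\<forall>v. Ck n W (\<lambda>x. f' x v)"
    and g': "\<forall>x\<in>W. (g has_derivative g' x) (at x)" "\<forall>v. Ck n W (\<lambda>x. g' x v)"
    by auto
  show ?case unfolding Ck.simps
    by (rule exI[of _ "\<lambda>x v. (f' x v, g' x v)"])
      (intro conjI ballI allI Suc.IH has_derivative_Pair; use f' g' in blast)
qed

lemma Ck_add: "Ck n W f \<Longrightarrow> Ck n W g \<Longrightarrow> Ck n W (\<lambda>x. f x + g x)"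
  using Ck_bounded_linear[OF bounded_linear_add[OF bounded_linear_fst bounded_linear_snd] Ck_Pair[of n W f g]]
  by simp

lemma Ck_sum:
  assumes "finite A" "\<And>i. i \<in> A \<Longrightarrow> Ck n W (f i)"
  shows "Ck n W (\<lambda>x. \<Sum>i\<in>A. f i x)"
  using assms by (induction A) (auto intro: Ck_const Ck_add)

lemma Ck_bilinear:
  assumes "bounded_bilinear B"
  shows "Ck n W f \<Longrightarrow> Ck n W g \<Longrightarrow> Ck n W (\<lambda>x. B (f x) (g x))"
proof (induction n arbitrary: f g)
  case 0
  then show ?case using bounded_bilinear.continuous_on[OF assms] by auto
next
  case (Suc n)
  then obtain f' g' where f': "\<forall>x\<in>W. (f has_derivative f' x) (at x)" "\<forall>v. Ck n W (\<lambda>x. f' x v)"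
    and g': "\<forall>x\<in>W. (g has_derivative g' x) (at x)" "\<forall>v. Ck n W (\<lambda>x. g' x v)"
    by auto
  \<comment> \<open>The product rule returns \<open>f\<close> and \<open>g\<close> themselves next
    to their derivatives; they are needed at order \<open>n\<close> only.\<close>
  have "Ck n W f" "Ck n W g" using Suc.prems Ck_SucD by blast+
  then show ?case unfolding Ck.simps
    apply -
    apply (rule exI[of _ "\<lambda>x v. B (f x) (g' x v) + B (f' x v) (g x)"])
    apply (intro conjI ballI allI Suc.IH Ck_add bounded_bilinear.FDERIV[OF assms])
    using f' g' by blast+
qed

text \<open>\<open>Ck\<close> constrains a derivative in each fixed direction. A derivative applied
  to a direction that itself varies with the point is brought into this form by expanding the
  direction in the standard basis.\<close>

lemma linear_component_expansion:
  fixes L :: "'a::euclidean_space \<Rightarrow> 'b::euclidean_space"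
  assumes "linear L" shows "L v = (\<Sum>b\<in>Basis. (v \<bullet> b) *\<^sub>R L b)"
  using assms by (metis (mono_tags, lifting) euclidean_representation linear_scale linear_sum sum.cong)

lemma Ck_compose: "Ck n W f \<Longrightarrow> Ck n V g \<Longrightarrow> f ` W \<subseteq> V \<Longrightarrow> Ck n W (\<lambda>x. g (f x))"
proof (induction n arbitrary: f g)
  case 0
  then show ?case by (auto intro: continuous_on_compose2)
next
  case (Suc n)
  then obtain f' g' where f': "\<forall>x\<in>W. (f has_derivative f' x) (at x)" "\<forall>v. Ck n W (\<lambda>x. f' x v)"
    and g': "\<forall>x\<in>V. (g has_derivative g' x) (at x)" "\<forall>v. Ck n V (\<lambda>x. g' x v)"
    by auto
  have lin: "linear (g' (f x))" if "x \<in> W" for x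
    by (rule has_derivative_linear[of g]) (use g'(1) that Suc.prems(3) in blast)
  have "Ck n W f" using Suc.prems Ck_SucD by blast
  then have *: "Ck n W (\<lambda>x. g' (f x) b)" for b
    by (rule Suc.IH) (use g'(2) Suc.prems(3) in auto)
  show ?case unfolding Ck.simps
  \<comment> \<open>The chain rule produces \<open>g' (f x) (f' x v)\<close>, with a moving
    direction. The witness is its basis expansion, whose coefficients and whose vectors
    \<open>g' (f x) b\<close> are all of order \<open>n\<close>.\<close>
  proof (rule exI[of _ "\<lambda>x v. \<Sum>b\<in>Basis. (f' x v \<bullet> b) *\<^sub>R g' (f x) b"], intro conjI ballI allI)
    fix x assume x: "x \<in> W"
    have "((\<lambda>x. g (f x)) has_derivative (\<lambda>v. g' (f x) (f' x v))) (at x)"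
      by (rule has_derivative_compose[OF f'(1)[rule_format, OF x] g'(1)[rule_format]])
        (use x Suc.prems(3) in blast)
    then show "((\<lambda>x. g (f x)) has_derivative (\<lambda>v. \<Sum>b\<in>Basis. (f' x v \<bullet> b) *\<^sub>R g' (f x) b)) (at x)"
      unfolding linear_component_expansion[OF lin[OF x], of "f' x _"] .
  next
    fix v
    show "Ck n W (\<lambda>x. \<Sum>b\<in>Basis. (f' x v \<bullet> b) *\<^sub>R g' (f x) b)"
      by (intro Ck_sum Ck_bilinear[OF bounded_bilinear_scaleR] *
          Ck_bounded_linear[OF bounded_linear_inner_left]) (use f' in auto)
  qed
qed

section \<open>Smoothness of infinite order and the inverse function theorem\<close>

definition Cinf :: "'a::euclidean_space set \<Rightarrow> ('a \<Rightarrow> 'b::euclidean_space) \<Rightarrow> bool" where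
  "Cinf W f \<longleftrightarrow> (\<forall>n. Ck n W f)"

lemma Cinf_subset: "Cinf W f \<Longrightarrow> W' \<subseteq> W \<Longrightarrow> Cinf W' f"
  and Cinf_const: "Cinf W (\<lambda>x. c)"
  and Cinf_id: "Cinf W (\<lambda>x. x)"
  and Cinf_linear: "linear L \<Longrightarrow> Cinf W L"
  and Cinf_Pair: "Cinf W f \<Longrightarrow> Cinf W g \<Longrightarrow> Cinf W (\<lambda>x. (f x, g x))"
  and Cinf_add: "Cinf W f1 \<Longrightarrow> Cinf W f2 \<Longrightarrow> Cinf W (\<lambda>x. f1 x + f2 x)"
  and Cinf_bilinear: "bounded_bilinear B \<Longrightarrow> Cinf W h1 \<Longrightarrow> Cinf W h2 \<Longrightarrow> Cinf W (\<lambda>x. B (h1 x) (h2 x))"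
  and Cinf_compose: "Cinf W k1 \<Longrightarrow> Cinf V k2 \<Longrightarrow> k1 ` W \<subseteq> V \<Longrightarrow> Cinf W (\<lambda>x. k2 (k1 x))"
  and Cinf_cong: "open W \<Longrightarrow> (\<And>x. x \<in> W \<Longrightarrow> g1 x = g2 x) \<Longrightarrow> Cinf W g1 \<Longrightarrow> Cinf W g2"
  unfolding Cinf_def
          apply (blast intro: Ck_subset)
         apply (rule allI, rule Ck_const)
        apply (rule allI, rule Ck_id)
       apply (blast intro: Ck_linear)
      apply (blast intro: Ck_Pair)
     apply (blast intro: Ck_add)
    apply (blast intro: Ck_bilinear)
   apply (blast intro: Ck_compose)
  apply (blast intro: Ck_cong)
  done

lemma Cinf_imp_continuous_on: "Cinf W f \<Longrightarrow> continuous_on W f"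
  unfolding Cinf_def using Ck_imp_continuous_on by blast

text \<open>\<open>Ck\<close> asserts a derivative anew for every order. Uniqueness of derivatives
  glues these into a single \<open>f'\<close> whose directional values are smooth to all
  orders.\<close>

lemma Cinf_derivative:
  assumes "Cinf W f" "open W"
  obtains f' where "\<And>x. x \<in> W \<Longrightarrow> (f has_derivative f' x) (at x)" "\<And>v. Cinf W (\<lambda>x. f' x v)"
proof -
  have "Ck (Suc 0) W f" using assms(1) unfolding Cinf_def by blast
  then obtain f' where f': "\<forall>x\<in>W. (f has_derivative f' x) (at x)" by auto
  have "Ck n W (\<lambda>x. f' x v)" for n v
  proof -
    have "Ck (Suc n) W f" using assms(1) unfolding Cinf_def by blast
    then obtain f'' where f'': "\<forall>x\<in>W. (f has_derivative f'' x) (at x)" "\<forall>v. Ck n W (\<lambda>x. f'' x v)" by auto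
    then have "\<forall>x\<in>W. f'' x = f' x" using f' has_derivative_unique by blast
    then show ?thesis using f''(2) Ck_cong[OF assms(2), of "\<lambda>x. f'' x v" "\<lambda>x. f' x v" n] by auto
  qed
  then show thesis using that[of f'] f' by (auto simp: Cinf_def)
qed

text \<open>The derivative of \<open>y \<mapsto> g' y v\<close> is obtained by differentiating the inverse of the tangent map
  \<open>(x, v) \<mapsto> (f x, f' x v)\<close>, which is the tangent map of \<open>g\<close>; it is a polynomial in \<open>g'\<close> and in the
  second derivatives of \<open>f\<close> at \<open>g y\<close>, so that smoothness of \<open>g\<close> and \<open>g'\<close> bootstraps.\<close>

lemma Cinf_inverse:
  fixes f :: "'a::euclidean_space \<Rightarrow> 'a"
  assumes U: "open U" and V: "open V"
    and df: "\<And>x. x \<in> U \<Longrightarrow> (f has_derivative f' x) (at x)"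
    and sf: "\<And>v. Cinf U (\<lambda>x. f' x v)"
    and gU: "g ` V \<subseteq> U" and fg: "\<And>y. y \<in> V \<Longrightarrow> f (g y) = y"
    and dg: "\<And>y. y \<in> V \<Longrightarrow> (g has_derivative g' y) (at y)"
    and inv1: "\<And>y v. y \<in> V \<Longrightarrow> f' (g y) (g' y v) = v"
    and inv2: "\<And>y v. y \<in> V \<Longrightarrow> g' y (f' (g y) v) = v"
    and cg: "continuous_on (V \<times> UNIV) (\<lambda>(y, v). g' y v)"
  shows "Cinf V g"
proof -
  have lin: "linear (f' x)" if "x \<in> U" for x using df[OF that] has_derivative_linear by blast
  have ling: "linear (g' x)" if "x \<in> V" for x using dg[OF that] has_derivative_linear by blast
  have "\<exists>F. (\<forall>x\<in>U. ((\<lambda>x. f' x v) has_derivative F x) (at x)) \<and> (\<forall>w. Cinf U (\<lambda>x. F x w))" for v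
    using Cinf_derivative[OF sf U] by metis
  then obtain F where F: "\<And>v x. x \<in> U \<Longrightarrow> ((\<lambda>x. f' x v) has_derivative F v x) (at x)"
      "\<And>v w. Cinf U (\<lambda>x. F v x w)" by metis
  define S where "S = (\<lambda>x w v. \<Sum>b\<in>Basis. (v \<bullet> b) *\<^sub>R F b x w)"
  have linS: "linear (\<lambda>w. S x w v)" if "x \<in> U" for x v
    unfolding S_def using F(1)[OF that] has_derivative_linear
    by (intro linear_compose_sum ballI linear_compose_scale_right) blast
  have contg: "continuous_on V g"
    using dg has_derivative_continuous by (blast intro!: continuous_at_imp_continuous_on)
  have dh: "((\<lambda>y. g' y v) has_derivative (\<lambda>w. - g' y (S (g y) (g' y w) (g' y v)))) (at y)"
    if y: "y \<in> V" for y v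
  proof -
    let ?x = "g y" and ?h = "g' y v"
    have xU: "?x \<in> U" using gU y by blast
    let ?f = "\<lambda>p. (f (fst p), \<Sum>b\<in>Basis. (snd p \<bullet> b) *\<^sub>R f' (fst p) b)"
    have 1: "(?f has_derivative (\<lambda>p. (f' ?x (fst p), S ?x (fst p) ?h + f' ?x (snd p)))) (at (?x, ?h))"
    proof (rule has_derivative_Pair)
      show "((\<lambda>p. f (fst p)) has_derivative (\<lambda>p. f' ?x (fst p))) (at (?x, ?h))"
        by (rule has_derivative_compose[OF has_derivative_fst[OF has_derivative_ident]])
          (use df[OF xU] in simp)
      have "((\<lambda>p. f' (fst p) b) has_derivative (\<lambda>p. F b ?x (fst p))) (at (?x, ?h))" for b
        by (rule has_derivative_compose[OF has_derivative_fst[OF has_derivative_ident]])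
          (use F(1)[OF xU] in simp)
      then have "((\<lambda>p. \<Sum>b\<in>Basis. (snd p \<bullet> b) *\<^sub>R f' (fst p) b) has_derivative
           (\<lambda>p. \<Sum>b\<in>Basis. (?h \<bullet> b) *\<^sub>R F b ?x (fst p) + (snd p \<bullet> b) *\<^sub>R f' ?x b)) (at (?x, ?h))"
        by - (rule derivative_eq_intros refl | assumption | simp)+
      moreover have "(\<Sum>b\<in>Basis. (?h \<bullet> b) *\<^sub>R F b ?x (fst p) + (snd p \<bullet> b) *\<^sub>R f' ?x b)
         = S ?x (fst p) ?h + f' ?x (snd p)" for p
        using linear_component_expansion[OF lin[OF xU], of "snd p"]
        by (simp add: S_def sum.distrib)
      ultimately show "((\<lambda>p. \<Sum>b\<in>Basis. (snd p \<bullet> b) *\<^sub>R f' (fst p) b) has_derivative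
         (\<lambda>p. S ?x (fst p) ?h + f' ?x (snd p))) (at (?x, ?h))" by simp
    qed
    let ?g = "\<lambda>p. (g (fst p), g' (fst p) (snd p))"
    let ?g' = "\<lambda>p. (g' y (fst p), g' y (snd p - S ?x (g' y (fst p)) ?h))"
    \<comment> \<open>The tangent map \<open>?f\<close> has a triangular derivative, which
      \<open>?g'\<close> inverts explicitly. For \<open>?g\<close> itself only continuity has to be
      known beforehand, and this is where the joint continuity of \<open>g'\<close> in point and
      vector enters.\<close>
    have 2: "(?g has_derivative ?g') (at (y, v))"
    proof (rule has_derivative_inverse_basic[where T = "V \<times> UNIV"])
      show "(?f has_derivative (\<lambda>p. (f' ?x (fst p), S ?x (fst p) ?h + f' ?x (snd p)))) (at (?g (y, v)))"
        using 1 by simp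
      have "linear ?g'"
      proof -
        have 1: "g' y (a + b) = g' y a + g' y b" "g' y (c *\<^sub>R a) = c *\<^sub>R g' y a" for a b c
          using ling[OF y] by (auto simp: linear_iff)
        have 2: "S ?x (a + b) ?h = S ?x a ?h + S ?x b ?h" "S ?x (c *\<^sub>R a) ?h = c *\<^sub>R S ?x a ?h" for a b c
          using linS[OF xU, of ?h] by (auto simp: linear_iff)
        have 3: "b + b' - (a + a') = (b - a) + (b' - a')" for a a' b b' :: 'a by simp
        show ?thesis
          by (rule linearI)
            (simp_all add: 1(2) 2(2) scaleR_diff_right[symmetric], simp add: 1(1) 2(1) 3)
      qed
      then show "bounded_linear ?g'" by (simp add: linear_conv_bounded_linear)
      show "?g' \<circ> (\<lambda>p. (f' ?x (fst p), S ?x (fst p) ?h + f' ?x (snd p))) = id"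
        using inv2[OF y] by (auto simp: fun_eq_iff)
      have "continuous_on (V \<times> UNIV) ?g"
      proof (intro continuous_intros)
        show "continuous_on (V \<times> UNIV) (\<lambda>p. g (fst p))"
          by (rule continuous_on_compose2[OF contg continuous_on_fst]) (auto intro: continuous_on_id)
        show "continuous_on (V \<times> UNIV) (\<lambda>p. g' (fst p) (snd p))"
          using cg by (simp add: case_prod_unfold)
      qed
      then show "continuous (at (y, v)) ?g"
        using y V by (simp add: continuous_on_eq_continuous_at open_Times)
      show "open (V \<times> (UNIV :: 'a set))" using V by (simp add: open_Times)
      show "(y, v) \<in> V \<times> UNIV" using y by simp
      fix z :: "'a \<times> 'a" assume z: "z \<in> V \<times> UNIV"
      then have "g (fst z) \<in> U" using gU by auto
      then have "(\<Sum>b\<in>Basis. (g' (fst z) (snd z) \<bullet> b) *\<^sub>R f' (g (fst z)) b) = snd z"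
        using linear_component_expansion[OF lin, symmetric] z by (simp add: inv1 mem_Times_iff)
      then show "?f (?g z) = z" using z by (auto simp: fg)
    qed
    have "((\<lambda>z. snd (?g (z, v))) has_derivative (\<lambda>w. snd (?g' (w, 0)))) (at y)"
      by (rule has_derivative_snd,
          rule has_derivative_compose[of "\<lambda>z. (z, v)" "\<lambda>w. (w, 0)" y UNIV ?g ?g', OF _ 2])
        (intro has_derivative_Pair has_derivative_ident has_derivative_const)
    then show ?thesis
      by (simp only: fst_conv snd_conv diff_0 linear_neg[OF ling[OF y]])
  qed
  have "Ck n V g \<and> (\<forall>v. Ck n V (\<lambda>y. g' y v))" for n
  proof (induction n)
    case 0
    have "continuous_on V (\<lambda>y. g' y v)" for v
      using dh has_derivative_continuous by (blast intro!: continuous_at_imp_continuous_on)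
    with contg show ?case by auto
  next
    case (Suc n)
    have "Ck (Suc n) V g" using Suc dg by auto
    moreover have "Ck (Suc n) V (\<lambda>y. g' y v)" for v
    proof -
      have Fg: "Ck n V (\<lambda>y. F b (g y) c)" for b c
        using Ck_compose[of n V g U "\<lambda>x. F b x c"] Suc F(2) gU unfolding Cinf_def by blast
      let ?S = "\<lambda>y w. \<Sum>b\<in>Basis. (g' y v \<bullet> b) *\<^sub>R (\<Sum>c\<in>Basis. (g' y w \<bullet> c) *\<^sub>R F b (g y) c)"
      have S: "S (g y) (g' y w) (g' y v) = ?S y w" if y: "y \<in> V" for y w
      proof -
        have "F b (g y) (g' y w) = (\<Sum>c\<in>Basis. (g' y w \<bullet> c) *\<^sub>R F b (g y) c)" for b
          using linear_component_expansion[of "F b (g y)"] F(1)[of "g y" b] y gU has_derivative_linear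
          by blast
        then show ?thesis by (simp add: S_def)
      qed
      let ?D = "\<lambda>y w. - (\<Sum>b\<in>Basis. (?S y w \<bullet> b) *\<^sub>R g' y b)"
      have "((\<lambda>y. g' y v) has_derivative ?D y) (at y)" if y: "y \<in> V" for y
        using dh[OF y, of v]
        unfolding S[OF y] linear_component_expansion[OF ling[OF y], of "?S y _"] .
      moreover have "Ck n V (\<lambda>y. ?D y w)" for w
        by (intro Ck_bounded_linear[OF bounded_linear_minus[OF bounded_linear_ident]] Ck_sum
              Ck_bilinear[OF bounded_bilinear_scaleR] Ck_bounded_linear[OF bounded_linear_inner_left] Fg)
          (use Suc in auto)
      ultimately show ?thesis unfolding Ck.simps by (intro exI[of _ ?D]) blast
    qed
    ultimately show ?case by blast
  qed
  then show ?thesis unfolding Cinf_def by blast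
qed

text \<open>Resolvent identity \<open>C z - C y = C z (B y - B z) C y\<close>: once
  \<open>norm (B y - B z) * norm (C y)\<close> drops below 1/2, it bounds \<open>norm (C z)\<close>
  by \<open>2 * norm (C y)\<close>, and then the same identity forces convergence.\<close>

lemma continuous_on_blinfun_inverse:
  fixes B :: "'c::topological_space \<Rightarrow> 'a::real_normed_vector \<Rightarrow>\<^sub>L 'b::real_normed_vector"
  assumes cont: "continuous_on S B"
    and BC: "\<And>y. y \<in> S \<Longrightarrow> B y o\<^sub>L C y = id_blinfun"
    and CB: "\<And>y. y \<in> S \<Longrightarrow> C y o\<^sub>L B y = id_blinfun"
  shows "continuous_on S C"
  unfolding continuous_on_def
proof
  fix y assume y: "y \<in> S"
  let ?F = "at y within S"
  have S: "\<forall>\<^sub>F z in ?F. z \<in> S" by (simp add: eventually_at_filter)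
  have lim: "((\<lambda>z. norm (B y - B z) * norm (C y)) \<longlongrightarrow> norm (B y - B y) * norm (C y)) ?F"
    by (intro tendsto_intros cont[unfolded continuous_on_def, rule_format, OF y])
  have eq: "C z - C y = C z o\<^sub>L (B y - B z) o\<^sub>L C y" if z: "z \<in> S" for z
  proof (rule blinfun_eqI)
    fix v
    have "blinfun_apply (B y) (blinfun_apply (C y) v) = v"
      using BC[OF y] by (metis blinfun_apply_blinfun_compose blinfun_apply_id_blinfun)
    moreover have "blinfun_apply (C z) (blinfun_apply (B z) w) = w" for w
      using CB[OF z] by (metis blinfun_apply_blinfun_compose blinfun_apply_id_blinfun)
    ultimately show "blinfun_apply (C z - C y) v = blinfun_apply (C z o\<^sub>L (B y - B z) o\<^sub>L C y) v"
      by (simp add: minus_blinfun.rep_eq blinfun.diff_right)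
  qed
  have est: "norm (C z - C y) \<le> norm (C z) * (norm (B y - B z) * norm (C y))" if z: "z \<in> S" for z
    unfolding eq[OF z]
    by (rule order_trans[OF norm_blinfun_compose], subst mult.assoc[symmetric],
        rule mult_right_mono[OF norm_blinfun_compose]) simp
  have "\<forall>\<^sub>F z in ?F. norm (B y - B z) * norm (C y) < 1/2"
    using order_tendstoD(2)[OF lim, of "1/2"] by simp
  then have "\<forall>\<^sub>F z in ?F. norm (C z - C y) \<le> 2 * norm (C y) * (norm (B y - B z) * norm (C y))"
    using S
  proof eventually_elim
    case (elim z)
    have "norm (C z) \<le> norm (C y) + norm (C z - C y)"
      using norm_triangle_ineq[of "C y" "C z - C y"] by simp
    also have "\<dots> \<le> norm (C y) + norm (C z) * (1/2)"
      using est[OF elim(2)] mult_left_mono[of "norm (B y - B z) * norm (C y)" "1/2" "norm (C z)"] elim(1)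
      by simp
    finally have "norm (C z) \<le> 2 * norm (C y)" by simp
    then show ?case
      using est[OF elim(2)] mult_right_mono[of "norm (C z)" "2 * norm (C y)" "norm (B y - B z) * norm (C y)"]
      by (auto intro: order_trans)
  qed
  moreover have "((\<lambda>z. 2 * norm (C y) * (norm (B y - B z) * norm (C y))) \<longlongrightarrow> 0) ?F"
    using tendsto_mult_left[OF lim, of "2 * norm (C y)"] by simp
  ultimately have "((\<lambda>z. C z - C y) \<longlongrightarrow> 0) ?F"
    by - (rule tendsto_0_le[where K = 1], assumption, erule eventually_mono, simp add: abs_mult)
  then show "(C \<longlongrightarrow> C y) ?F" using Lim_null by blast
qed

text \<open>The inverse function theorem for continuously differentiable maps yields
  \<open>g\<close> and its derivative at each point. \<open>Cinf_inverse\<close> also needs that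
  derivative to be jointly continuous in point and vector, which follows from continuity of
  inversion in the operator norm.\<close>

theorem Cinf_inverse_function:
  fixes f :: "'a::euclidean_space \<Rightarrow> 'a"
  assumes U: "open U" and x0: "x0 \<in> U" and sf: "Cinf U f"
    and d0: "(f has_derivative D) (at x0)" and bij: "bij D"
  obtains U' V g where "open U'" "U' \<subseteq> U" "x0 \<in> U'" "open V" "f x0 \<in> V" "homeomorphism U' V f g"
    "Cinf V g"
proof -
  obtain f' where f': "\<And>x. x \<in> U \<Longrightarrow> (f has_derivative f' x) (at x)" "\<And>v. Cinf U (\<lambda>x. f' x v)"
    using Cinf_derivative[OF sf U] by blast
  have D: "f' x0 = D" using f'(1)[OF x0] d0 has_derivative_unique by blast
  define B where "B x = Blinfun (f' x)" for x
  have B: "blinfun_apply (B x) = f' x" if "x \<in> U" for x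
    unfolding B_def using f'(1)[OF that] has_derivative_bounded_linear
    by (blast intro: bounded_linear_Blinfun_apply)
  have contB: "continuous_on U B"
  proof (rule continuous_on_blinfun_componentwise)
    fix v :: 'a
    have "continuous_on U (\<lambda>x. f' x v)" using f'(2) Cinf_imp_continuous_on by blast
    then show "continuous_on U (\<lambda>x. blinfun_apply (B x) v)"
      using continuous_on_cong[of U U "\<lambda>x. blinfun_apply (B x) v" "\<lambda>x. f' x v"] B by auto
  qed
  have linD: "linear D" using d0 has_derivative_linear by blast
  obtain g0 where g0: "linear g0" "g0 \<circ> D = id"
    using linear_injective_left_inverse[OF linD] bij by (auto simp: bij_def)
  define G0 where "G0 = Blinfun g0"
  have G0: "blinfun_apply G0 = g0"
    using g0(1) by (simp add: G0_def linear_conv_bounded_linear bounded_linear_Blinfun_apply)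
  have inv0: "G0 o\<^sub>L B x0 = id_blinfun"
    by (rule blinfun_eqI) (use g0(2) B[OF x0] G0 D in \<open>simp add: fun_eq_iff\<close>)
  have dB: "(f has_derivative blinfun_apply (B x)) (at x)" if "x \<in> U" for x
    using f'(1)[OF that] B[OF that] by simp
  obtain U' V g g' where g: "open U'" "U' \<subseteq> U" "x0 \<in> U'" "open V" "f x0 \<in> V" "homeomorphism U' V f g"
    and dg: "\<And>y. y \<in> V \<Longrightarrow> (g has_derivative (g' y)) (at y)"
    and g'inv: "\<And>y. y \<in> V \<Longrightarrow> g' y = inv (blinfun_apply (B (g y)))"
    and bijB: "\<And>y. y \<in> V \<Longrightarrow> bij (blinfun_apply (B (g y)))"
    using inverse_function_theorem[OF U dB contB x0 inv0] by metis
  have gU: "g ` V \<subseteq> U" using g(2,6) by (auto simp: homeomorphism_def)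
  have "Cinf V g"
  proof (rule Cinf_inverse[OF U g(4) f'(1) f'(2) gU _ dg])
    fix y v assume y: "y \<in> V"
    show "f (g y) = y" using g(6) y by (auto simp: homeomorphism_def)
    have gy: "g y \<in> U" using gU y by blast
    show "f' (g y) (g' y v) = v"
      using bijB[OF y] g'inv[OF y] B[OF gy] by (simp add: bij_is_surj surj_f_inv_f)
    show "g' y (f' (g y) v) = v"
      using bijB[OF y] g'inv[OF y] B[OF gy] by (simp add: bij_is_inj)
  next
    define C where "C y = Blinfun (g' y)" for y
    have C: "blinfun_apply (C y) = g' y" if "y \<in> V" for y
      unfolding C_def using dg[OF that] has_derivative_bounded_linear
      by (blast intro: bounded_linear_Blinfun_apply)
    have contBg: "continuous_on V (\<lambda>y. B (g y))"
      using g(6) gU by (intro continuous_on_compose2[OF contB]) (auto simp: homeomorphism_def)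
    have BC: "B (g y) o\<^sub>L C y = id_blinfun" "C y o\<^sub>L B (g y) = id_blinfun" if y: "y \<in> V" for y
      using bijB[OF y] g'inv[OF y] C[OF y]
      by (auto intro!: blinfun_eqI simp: bij_is_inj bij_is_surj surj_f_inv_f)
    have "continuous_on V C"
      by (rule continuous_on_blinfun_inverse[OF contBg BC])
    then have "continuous_on (V \<times> UNIV) (\<lambda>p. blinfun_apply (C (fst p)) (snd p))"
      by (auto intro!: continuous_intros continuous_on_compose2[of V C])
    then show "continuous_on (V \<times> UNIV) (\<lambda>(y, v). g' y v)"
      by (rule continuous_on_eq) (use C in auto)
  qed auto
  with g that show thesis by blast
qed

section \<open>Manifolds and germs of smooth maps\<close>

text \<open>For \<open>S = UNIV\<close> and \<open>F\<close> the identity this expresses smoothness of the change of charts together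
  with openness of \<open>U \<inter> V\<close> near \<open>x\<close>.\<close>

definition local_rep ::
    "'a set \<Rightarrow> ('a \<Rightarrow> 'b) \<Rightarrow> 'a \<Rightarrow> 'a set \<Rightarrow> ('a \<Rightarrow> 'e::euclidean_space) \<Rightarrow> 'b set \<Rightarrow>
     ('b \<Rightarrow> 'f::euclidean_space) \<Rightarrow> bool" where
  "local_rep S F x U \<phi> V \<psi> \<longleftrightarrow>
     (\<exists>W Fh. open W \<and> \<phi> x \<in> W \<and> Cinf W Fh \<and>
        (\<forall>y\<in>S \<inter> U. \<phi> y \<in> W \<longrightarrow> F y \<in> V \<and> \<psi> (F y) = Fh (\<phi> y)))"

lemma local_rep_subset: "local_rep S F x U \<phi> V \<psi> \<Longrightarrow> T \<subseteq> S \<Longrightarrow> local_rep T F x U \<phi> V \<psi>"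
  unfolding local_rep_def by blast

lemma open_Cinf_vimage:
  assumes "open W" "Cinf W f" "open W'"
  shows "open {z \<in> W. f z \<in> W'}"
proof -
  have "open (f -` W' \<inter> W)"
    using assms Cinf_imp_continuous_on continuous_on_open_vimage by blast
  moreover have "f -` W' \<inter> W = {z \<in> W. f z \<in> W'}" by blast
  ultimately show ?thesis by simp
qed

lemma local_rep_compose:
  assumes "local_rep S F x U \<phi> V \<psi>" "local_rep T G (F x) V \<psi> Z \<zeta>"
    and "\<And>y. y \<in> S \<Longrightarrow> F y \<in> T" "x \<in> S" "x \<in> U"
  shows "local_rep S (\<lambda>x. G (F x)) x U \<phi> Z \<zeta>"
proof -
  obtain W1 F1 where 1: "open W1" "\<phi> x \<in> W1" "Cinf W1 F1"
      "\<And>y. y \<in> S \<Longrightarrow> y \<in> U \<Longrightarrow> \<phi> y \<in> W1 \<Longrightarrow> F y \<in> V \<and> \<psi> (F y) = F1 (\<phi> y)"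
    using assms(1) unfolding local_rep_def by blast
  obtain W2 F2 where 2: "open W2" "\<psi> (F x) \<in> W2" "Cinf W2 F2"
      "\<And>y. y \<in> T \<Longrightarrow> y \<in> V \<Longrightarrow> \<psi> y \<in> W2 \<Longrightarrow> G y \<in> Z \<and> \<zeta> (G y) = F2 (\<psi> y)"
    using assms(2) unfolding local_rep_def by blast
  let ?W = "{z \<in> W1. F1 z \<in> W2}"
  have "open ?W" using open_Cinf_vimage 1 2 by blast
  moreover have "\<phi> x \<in> ?W" using 1(2) 1(4)[OF assms(4,5)] 2(2) by auto
  moreover have "Cinf ?W (\<lambda>z. F2 (F1 z))"
    by (rule Cinf_compose[OF Cinf_subset[OF 1(3)] 2(3)]) auto
  moreover have "G (F y) \<in> Z \<and> \<zeta> (G (F y)) = F2 (F1 (\<phi> y))" if "y \<in> S" "y \<in> U" "\<phi> y \<in> ?W" for y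
    using 1(4)[of y] 2(4)[of "F y"] that assms(3) by auto
  ultimately show ?thesis unfolding local_rep_def
    by (intro exI[of _ ?W] exI[of _ "\<lambda>z. F2 (F1 z)"]) auto
qed

lemma smooth_manifoldD:
  assumes "smooth_manifold X"
  shows "subspace (model X)"
    and "(U, \<phi>) \<in> atlas X \<Longrightarrow> inj_on \<phi> U"
    and "(U, \<phi>) \<in> atlas X \<Longrightarrow> openin (top_of_set (model X)) (\<phi> ` U)"
  using assms unfolding smooth_manifold_def by blast+

lemma chart_change:
  assumes X: "smooth_manifold X" and U: "(U, \<phi>) \<in> atlas X" and V: "(V, \<psi>) \<in> atlas X"
    and x: "x \<in> U" "x \<in> V"
  shows "local_rep UNIV (\<lambda>x. x) x U \<phi> V \<psi>"
proof -
  have o: "openin (top_of_set (model X)) (\<phi> ` (U \<inter> V))"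
    and s: "smooth_on (\<phi> ` (U \<inter> V)) (\<psi> \<circ> inv_into U \<phi>)"
    using X U V unfolding smooth_manifold_def by blast+
  have inj: "inj_on \<phi> U" using smooth_manifoldD[OF X] U by blast
  obtain O' where O': "open O'" "\<phi> ` (U \<inter> V) = model X \<inter> O'" using o by (auto simp: openin_open)
  have xx: "\<phi> x \<in> \<phi> ` (U \<inter> V)" using x by blast
  then obtain W F where W: "open W" "\<phi> x \<in> W" "Cinf W F"
    "\<forall>y\<in>\<phi> ` (U \<inter> V) \<inter> W. (\<psi> \<circ> inv_into U \<phi>) y = F y"
    using s unfolding smooth_on_def Cinf_def by meson
  have "\<phi> ` U \<subseteq> model X" using smooth_manifoldD(3)[OF X U] openin_imp_subset by blast
  \<comment> \<open>The image of \<open>U \<inter> V\<close> is the part of the model inside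
    \<open>O'\<close>, and charts take values in the model; so membership in \<open>V\<close> can be
    read off from the coordinates.\<close>
  then have *: "y \<in> V" if "y \<in> U" "\<phi> y \<in> O'" for y
  proof -
    have "\<phi> y \<in> \<phi> ` (U \<inter> V)" using that O'(2) \<open>\<phi> ` U \<subseteq> model X\<close> by blast
    then show ?thesis using inj_onD[OF inj _ that(1)] by auto
  qed
  show ?thesis unfolding local_rep_def
  proof (intro exI[of _ "W \<inter> O'"] exI[of _ F] conjI ballI impI)
    show "open (W \<inter> O')" "\<phi> x \<in> W \<inter> O'" "Cinf (W \<inter> O') F"
      using W O' xx Cinf_subset[OF W(3)] by auto
    fix y assume y: "y \<in> UNIV \<inter> U" "\<phi> y \<in> W \<inter> O'"
    show "y \<in> V" using * y by auto
    then have "\<phi> y \<in> \<phi> ` (U \<inter> V) \<inter> W" using y by auto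
    with W(4) have "(\<psi> \<circ> inv_into U \<phi>) (\<phi> y) = F (\<phi> y)" by blast
    then show "\<psi> y = F (\<phi> y)" using inj y by simp
  qed
qed

lemma smooth_manifoldI:
  assumes "subspace (model X)"
    and inj: "\<And>U \<phi>. (U, \<phi>) \<in> atlas X \<Longrightarrow> inj_on \<phi> U"
    and op: "\<And>U \<phi>. (U, \<phi>) \<in> atlas X \<Longrightarrow> openin (top_of_set (model X)) (\<phi> ` U)"
    and ch: "\<And>U \<phi> V \<psi> x. (U, \<phi>) \<in> atlas X \<Longrightarrow> (V, \<psi>) \<in> atlas X \<Longrightarrow> x \<in> U \<Longrightarrow> x \<in> V \<Longrightarrow>
       local_rep UNIV (\<lambda>x. x) x U \<phi> V \<psi>"
  shows "smooth_manifold X"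
proof -
  have 1: "openin (top_of_set (model X)) (\<phi> ` (U \<inter> V))"
    if UV: "(U, \<phi>) \<in> atlas X" "(V, \<psi>) \<in> atlas X" for U \<phi> V \<psi>
  proof (subst openin_subopen, intro ballI)
    fix z assume "z \<in> \<phi> ` (U \<inter> V)"
    then obtain x where x: "x \<in> U" "x \<in> V" "z = \<phi> x" by blast
    obtain W Fh where W: "open W" "\<phi> x \<in> W" "\<forall>y\<in>UNIV \<inter> U. \<phi> y \<in> W \<longrightarrow> y \<in> V \<and> \<psi> y = Fh (\<phi> y)"
      using ch[OF UV x(1,2)] unfolding local_rep_def by blast
    show "\<exists>T. openin (top_of_set (model X)) T \<and> z \<in> T \<and> T \<subseteq> \<phi> ` (U \<inter> V)"
      using W x openin_Int_open[OF op[OF UV(1)] W(1)] by (intro exI[of _ "\<phi> ` U \<inter> W"]) auto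
  qed
  have 2: "smooth_on (\<phi> ` (U \<inter> V)) (\<psi> \<circ> inv_into U \<phi>)"
    if UV: "(U, \<phi>) \<in> atlas X" "(V, \<psi>) \<in> atlas X" for U \<phi> V \<psi>
    unfolding smooth_on_def
  proof
    fix z assume "z \<in> \<phi> ` (U \<inter> V)"
    then obtain x where x: "x \<in> U" "x \<in> V" "z = \<phi> x" by blast
    obtain W Fh where W: "open W" "\<phi> x \<in> W" "Cinf W Fh" "\<forall>y\<in>UNIV \<inter> U. \<phi> y \<in> W \<longrightarrow> y \<in> V \<and> \<psi> y = Fh (\<phi> y)"
      using ch[OF UV x(1,2)] unfolding local_rep_def by blast
    show "\<exists>W F. open W \<and> z \<in> W \<and> (\<forall>n. Ck n W F) \<and> (\<forall>y\<in>\<phi> ` (U \<inter> V) \<inter> W. (\<psi> \<circ> inv_into U \<phi>) y = F y)"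
      using W x inj[OF UV(1)] unfolding Cinf_def by (intro exI[of _ W] exI[of _ Fh]) auto
  qed
  show ?thesis unfolding smooth_manifold_def using assms(1) inj op 1 2 by blast
qed

text \<open>\<open>local_rep\<close> uses an equation between coordinates at points of the chart, so
  that inverses of charts disappear and representations compose directly. Injectivity of the charts
  translates between this and the \<open>inv_into\<close> form.\<close>

lemma smooth_map_iff_local_rep:
  assumes X: "smooth_manifold X"
  shows "smooth_map X Y S F \<longleftrightarrow>
    (\<forall>x\<in>S. \<exists>(U, \<phi>)\<in>atlas X. \<exists>(V, \<psi>)\<in>atlas Y. x \<in> U \<and> local_rep S F x U \<phi> V \<psi>)"
proof -
  have "(\<exists>W. x \<in> U \<and> open W \<and> \<phi> x \<in> W \<and>
        (\<forall>y\<in>S \<inter> U. \<phi> y \<in> W \<longrightarrow> F y \<in> V) \<and>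
        smooth_on (\<phi> ` (S \<inter> U) \<inter> W) (\<psi> \<circ> F \<circ> inv_into U \<phi>)) \<longleftrightarrow> x \<in> U \<and> local_rep S F x U \<phi> V \<psi>"
    (is "?L \<longleftrightarrow> ?R") if x: "x \<in> S" and U: "(U, \<phi>) \<in> atlas X" for x U \<phi> V \<psi>
  proof
    have inj: "inj_on \<phi> U" using smooth_manifoldD[OF X] U by blast
    show ?R if ?L
    proof -
      obtain W where W: "x \<in> U" "open W" "\<phi> x \<in> W" "\<forall>y\<in>S \<inter> U. \<phi> y \<in> W \<longrightarrow> F y \<in> V"
        "smooth_on (\<phi> ` (S \<inter> U) \<inter> W) (\<psi> \<circ> F \<circ> inv_into U \<phi>)" using \<open>?L\<close> by blast
      have "\<phi> x \<in> \<phi> ` (S \<inter> U) \<inter> W" using x W by auto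
      then obtain W1 Fh where W1: "open W1" "\<phi> x \<in> W1" "Cinf W1 Fh"
        "\<forall>y\<in>(\<phi> ` (S \<inter> U) \<inter> W) \<inter> W1. (\<psi> \<circ> F \<circ> inv_into U \<phi>) y = Fh y"
        using W(5) unfolding smooth_on_def Cinf_def by meson
      show ?R unfolding local_rep_def
      proof (intro conjI exI[of _ "W \<inter> W1"] exI[of _ Fh] ballI impI)
        show "x \<in> U" "open (W \<inter> W1)" "\<phi> x \<in> W \<inter> W1" "Cinf (W \<inter> W1) Fh"
          using W W1 Cinf_subset[OF W1(3)] by auto
        fix y assume y: "y \<in> S \<inter> U" "\<phi> y \<in> W \<inter> W1"
        then show "F y \<in> V" using W by blast
        have "\<phi> y \<in> (\<phi> ` (S \<inter> U) \<inter> W) \<inter> W1" using y by auto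
        with W1(4) have "(\<psi> \<circ> F \<circ> inv_into U \<phi>) (\<phi> y) = Fh (\<phi> y)" by blast
        then show "\<psi> (F y) = Fh (\<phi> y)" using inj y by simp
      qed
    qed
    show ?L if ?R
    proof -
      obtain W Fh where W: "x \<in> U" "open W" "\<phi> x \<in> W" "Cinf W Fh"
        "\<forall>y\<in>S \<inter> U. \<phi> y \<in> W \<longrightarrow> F y \<in> V \<and> \<psi> (F y) = Fh (\<phi> y)"
        using \<open>?R\<close> unfolding local_rep_def by blast
      have "smooth_on (\<phi> ` (S \<inter> U) \<inter> W) (\<psi> \<circ> F \<circ> inv_into U \<phi>)"
        unfolding smooth_on_def
        using W inj by (intro ballI exI[of _ W] exI[of _ Fh]) (auto simp: Cinf_def)
      with W show ?L by blast
    qed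
  qed
  note key = this
  show ?thesis unfolding smooth_map_def Bex_def split_paired_Ex prod.case
    by (intro ball_cong refl iff_exI conj_cong) (rule key)
qed

text \<open>\<open>smooth_map\<close> provides one pair of charts at each point; changes of charts
  on both sides carry the coordinate representation to any other pair.\<close>

lemma local_rep_any_chart:
  assumes X: "smooth_manifold X" and Y: "smooth_manifold Y" and F: "smooth_map X Y S F"
    and x: "x \<in> S" "x \<in> U" "F x \<in> V" and U: "(U, \<phi>) \<in> atlas X" and V: "(V, \<psi>) \<in> atlas Y"
  shows "local_rep S F x U \<phi> V \<psi>"
proof -
  obtain U' \<phi>' V' \<psi>' where 1: "(U', \<phi>') \<in> atlas X" "(V', \<psi>') \<in> atlas Y" "x \<in> U'" "local_rep S F x U' \<phi>' V' \<psi>'"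
    using F x(1) unfolding smooth_map_iff_local_rep[OF X] by blast
  have "F x \<in> V'" using 1 x unfolding local_rep_def by blast
  have "local_rep S (\<lambda>x. x) x U \<phi> U' \<phi>'"
    using chart_change[OF X U 1(1) x(2) 1(3)] by (rule local_rep_subset) simp
  from local_rep_compose[OF this 1(4)] have "local_rep S F x U \<phi> V' \<psi>'" using x by simp
  from local_rep_compose[OF this chart_change[OF Y 1(2) V \<open>F x \<in> V'\<close> x(3)]] x show ?thesis by simp
qed

lemma points_chartE:
  assumes "x \<in> points X" obtains U \<phi> where "(U, \<phi>) \<in> atlas X" "x \<in> U"
  using assms unfolding points_def by blast

lemma chart_subset_points: "(U, \<phi>) \<in> atlas X \<Longrightarrow> U \<subseteq> points X"
  unfolding points_def by blast

lemma smooth_map_points: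
  assumes "smooth_map X Y S F" "x \<in> S"
  shows "x \<in> points X" "F x \<in> points Y"
proof -
  obtain U \<phi> V \<psi> W where *: "(U, \<phi>) \<in> atlas X" "(V, \<psi>) \<in> atlas Y" "x \<in> U" "\<phi> x \<in> W"
      "\<forall>y\<in>S \<inter> U. \<phi> y \<in> W \<longrightarrow> F y \<in> V"
    using assms unfolding smooth_map_def by blast
  then have "F x \<in> V" using assms(2) by blast
  with * show "x \<in> points X" "F x \<in> points Y" by (auto simp: points_def)
qed

lemma smooth_mapI:
  assumes X: "smooth_manifold X"
    and "\<And>x. x \<in> S \<Longrightarrow> \<exists>U \<phi> V \<psi>. (U, \<phi>) \<in> atlas X \<and> (V, \<psi>) \<in> atlas Y \<and> x \<in> U \<and> local_rep S F x U \<phi> V \<psi>"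
  shows "smooth_map X Y S F"
  unfolding smooth_map_iff_local_rep[OF X] using assms(2) by blast

lemma smooth_map_compose:
  assumes X: "smooth_manifold X" and Y: "smooth_manifold Y" and Z: "smooth_manifold Z"
    and F: "smooth_map X Y S F" and G: "smooth_map Y Z T G" and ST: "\<And>x. x \<in> S \<Longrightarrow> F x \<in> T"
  shows "smooth_map X Z S (\<lambda>x. G (F x))"
proof (rule smooth_mapI[OF X])
  fix x assume x: "x \<in> S"
  obtain U \<phi> where U: "(U, \<phi>) \<in> atlas X" "x \<in> U" by (rule points_chartE[OF smooth_map_points(1)[OF F x]])
  obtain V \<psi> where V: "(V, \<psi>) \<in> atlas Y" "F x \<in> V" by (rule points_chartE[OF smooth_map_points(2)[OF F x]])
  obtain C \<zeta> where C: "(C, \<zeta>) \<in> atlas Z" "G (F x) \<in> C"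
    by (rule points_chartE[OF smooth_map_points(2)[OF G ST[OF x]]])
  have "local_rep S (\<lambda>x. G (F x)) x U \<phi> C \<zeta>"
    using local_rep_compose[OF local_rep_any_chart[OF X Y F x U(2) V(2) U(1) V(1)]
        local_rep_any_chart[OF Y Z G ST[OF x] V(2) C(2) V(1) C(1)] ST x U(2)] by simp
  with U C show "\<exists>U \<phi> V \<psi>. (U, \<phi>) \<in> atlas X \<and> (V, \<psi>) \<in> atlas Z \<and> x \<in> U \<and> local_rep S (\<lambda>x. G (F x)) x U \<phi> V \<psi>"
    by blast
qed

lemma smooth_map_subset:
  assumes X: "smooth_manifold X" and F: "smooth_map X Y S F" and "T \<subseteq> S"
  shows "smooth_map X Y T F"
proof (rule smooth_mapI[OF X])
  fix x assume "x \<in> T"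
  then obtain U \<phi> V \<psi> where "(U, \<phi>) \<in> atlas X" "(V, \<psi>) \<in> atlas Y" "x \<in> U" "local_rep S F x U \<phi> V \<psi>"
    using F assms(3) unfolding smooth_map_iff_local_rep[OF X] by blast
  then show "\<exists>U \<phi> V \<psi>. (U, \<phi>) \<in> atlas X \<and> (V, \<psi>) \<in> atlas Y \<and> x \<in> U \<and> local_rep T F x U \<phi> V \<psi>"
    using local_rep_subset[OF _ assms(3)] by blast
qed

lemma open_subset_iff:
  assumes X: "smooth_manifold X"
  shows "open_subset X W \<longleftrightarrow> W \<subseteq> points X \<and>
    (\<forall>x\<in>W. \<forall>U \<phi>. (U, \<phi>) \<in> atlas X \<and> x \<in> U \<longrightarrow> (\<exists>T. open T \<and> \<phi> x \<in> T \<and> (\<forall>y\<in>U. \<phi> y \<in> T \<longrightarrow> y \<in> W)))"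
proof -
  have "openin (top_of_set (model X)) (\<phi> ` (U \<inter> W)) \<longleftrightarrow>
      (\<forall>x\<in>W \<inter> U. \<exists>T. open T \<and> \<phi> x \<in> T \<and> (\<forall>y\<in>U. \<phi> y \<in> T \<longrightarrow> y \<in> W))" (is "?L \<longleftrightarrow> ?R")
    if U: "(U, \<phi>) \<in> atlas X" for U \<phi>
  proof
    have inj: "inj_on \<phi> U" using smooth_manifoldD[OF X] U by blast
    have op: "openin (top_of_set (model X)) (\<phi> ` U)" using smooth_manifoldD[OF X] U by blast
    then have sub: "\<phi> ` U \<subseteq> model X" using openin_imp_subset by blast
    show ?R if ?L
    proof -
      obtain T where T: "open T" "\<phi> ` (U \<inter> W) = model X \<inter> T" using \<open>?L\<close> by (auto simp: openin_open)
      have "y \<in> W" if "y \<in> U" "\<phi> y \<in> T" for y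
      proof -
        have "\<phi> y \<in> \<phi> ` (U \<inter> W)" using that T(2) sub by blast
        then show ?thesis using inj_onD[OF inj _ that(1)] by auto
      qed
      with T show ?R by blast
    qed
    show ?L if ?R
    proof (subst openin_subopen, intro ballI)
      fix z assume "z \<in> \<phi> ` (U \<inter> W)"
      then obtain x where x: "x \<in> U" "x \<in> W" "z = \<phi> x" by blast
      then obtain T where T: "open T" "\<phi> x \<in> T" "\<forall>y\<in>U. \<phi> y \<in> T \<longrightarrow> y \<in> W" using \<open>?R\<close> by blast
      show "\<exists>T. openin (top_of_set (model X)) T \<and> z \<in> T \<and> T \<subseteq> \<phi> ` (U \<inter> W)"
        using T x openin_Int_open[OF op T(1)] by (intro exI[of _ "\<phi> ` U \<inter> T"]) auto
    qed
  qed
  note key = this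
  define Q where "Q U \<phi> x \<longleftrightarrow> (\<exists>T. open T \<and> \<phi> x \<in> T \<and> (\<forall>y\<in>U. \<phi> y \<in> T \<longrightarrow> y \<in> W))" for U and \<phi> :: "'a \<Rightarrow> 'b" and x
  have "open_subset X W \<longleftrightarrow> W \<subseteq> points X \<and> (\<forall>(U, \<phi>)\<in>atlas X. \<forall>x\<in>W \<inter> U. Q U \<phi> x)"
    unfolding open_subset_def Q_def by (intro conj_cong refl ball_cong) (use key in auto)
  also have "\<dots> \<longleftrightarrow> W \<subseteq> points X \<and> (\<forall>x\<in>W. \<forall>U \<phi>. (U, \<phi>) \<in> atlas X \<and> x \<in> U \<longrightarrow> Q U \<phi> x)"
    by auto
  finally show ?thesis unfolding Q_def .
qed

text \<open>One chart around each point suffices as a test, because changes of charts are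
  continuous.\<close>

lemma open_subsetI:
  assumes X: "smooth_manifold X"
    and W: "\<And>x. x \<in> W \<Longrightarrow> \<exists>U \<phi> T. (U, \<phi>) \<in> atlas X \<and> x \<in> U \<and> open T \<and> \<phi> x \<in> T \<and> (\<forall>y\<in>U. \<phi> y \<in> T \<longrightarrow> y \<in> W)"
  shows "open_subset X W"
  unfolding open_subset_iff[OF X]
proof (intro conjI ballI allI impI subsetI; (elim conjE)?)
  show "x \<in> points X" if "x \<in> W" for x using W[OF that] by (auto simp: points_def)
  fix x U' \<phi>' assume x: "x \<in> W" and U': "(U', \<phi>') \<in> atlas X" "x \<in> U'"
  obtain U \<phi> T where U: "(U, \<phi>) \<in> atlas X" "x \<in> U" "open T" "\<phi> x \<in> T" "\<forall>y\<in>U. \<phi> y \<in> T \<longrightarrow> y \<in> W"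
    using W[OF x] by blast
  obtain W1 Fh where W1: "open W1" "\<phi>' x \<in> W1" "Cinf W1 Fh" "\<forall>y\<in>UNIV \<inter> U'. \<phi>' y \<in> W1 \<longrightarrow> y \<in> U \<and> \<phi> y = Fh (\<phi>' y)"
    using chart_change[OF X U'(1) U(1) U'(2) U(2)] unfolding local_rep_def by blast
  show "\<exists>T. open T \<and> \<phi>' x \<in> T \<and> (\<forall>y\<in>U'. \<phi>' y \<in> T \<longrightarrow> y \<in> W)"
    using open_Cinf_vimage[OF W1(1,3) U(3)] W1 U U' by (intro exI[of _ "{z \<in> W1. Fh z \<in> T}"]) auto
qed

lemma open_subset_chart:
  assumes X: "smooth_manifold X" and U: "(U, \<phi>) \<in> atlas X"
  shows "open_subset X U"
proof (rule open_subsetI[OF X])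
  fix x assume "x \<in> U"
  with U show "\<exists>U' \<phi> T. (U', \<phi>) \<in> atlas X \<and> x \<in> U' \<and> open T \<and> \<phi> x \<in> T \<and> (\<forall>y\<in>U'. \<phi> y \<in> T \<longrightarrow> y \<in> U)"
    by (intro exI[of _ U] exI[of _ \<phi>] exI[of _ UNIV]) auto
qed

lemma open_subset_points:
  assumes X: "smooth_manifold X"
  shows "open_subset X (points X)"
proof (rule open_subsetI[OF X])
  fix x assume "x \<in> points X"
  then obtain U \<phi> where U: "(U, \<phi>) \<in> atlas X" "x \<in> U" by (rule points_chartE)
  with chart_subset_points[OF U(1)]
  show "\<exists>U \<phi> T. (U, \<phi>) \<in> atlas X \<and> x \<in> U \<and> open T \<and> \<phi> x \<in> T \<and> (\<forall>y\<in>U. \<phi> y \<in> T \<longrightarrow> y \<in> points X)"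
    by (intro exI[of _ U] exI[of _ \<phi>] exI[of _ UNIV]) auto
qed

lemma open_subset_Int:
  assumes X: "smooth_manifold X" and "open_subset X V" "open_subset X W"
  shows "open_subset X (V \<inter> W)"
  unfolding open_subset_iff[OF X]
proof (intro conjI ballI allI impI; (elim conjE)?)
  show "V \<inter> W \<subseteq> points X" using assms(2) unfolding open_subset_def by blast
  fix x U \<phi> assume x: "x \<in> V \<inter> W" "(U, \<phi>) \<in> atlas X" "x \<in> U"
  obtain T1 T2 where "open T1" "\<phi> x \<in> T1" "\<forall>y\<in>U. \<phi> y \<in> T1 \<longrightarrow> y \<in> V"
      "open T2" "\<phi> x \<in> T2" "\<forall>y\<in>U. \<phi> y \<in> T2 \<longrightarrow> y \<in> W"
    using assms x unfolding open_subset_iff[OF X] by (metis IntD1 IntD2)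
  then show "\<exists>T. open T \<and> \<phi> x \<in> T \<and> (\<forall>y\<in>U. \<phi> y \<in> T \<longrightarrow> y \<in> V \<inter> W)"
    by (intro exI[of _ "T1 \<inter> T2"]) auto
qed

lemma open_subset_vimage:
  assumes X: "smooth_manifold X" and Y: "smooth_manifold Y" and F: "smooth_map X Y W F"
    and W: "open_subset X W" and V: "open_subset Y V"
  shows "open_subset X {x \<in> W. F x \<in> V}"
proof (rule open_subsetI[OF X])
  fix x assume x: "x \<in> {x \<in> W. F x \<in> V}"
  then have xW: "x \<in> W" by simp
  obtain U \<phi> where U: "(U, \<phi>) \<in> atlas X" "x \<in> U"
    by (rule points_chartE[OF smooth_map_points(1)[OF F xW]])
  obtain C \<psi> where C: "(C, \<psi>) \<in> atlas Y" "F x \<in> C"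
    by (rule points_chartE[OF smooth_map_points(2)[OF F xW]])
  obtain T where T: "open T" "\<phi> x \<in> T" "\<forall>y\<in>U. \<phi> y \<in> T \<longrightarrow> y \<in> W"
    using W U x unfolding open_subset_iff[OF X] by blast
  obtain T2 where T2: "open T2" "\<psi> (F x) \<in> T2" "\<forall>y\<in>C. \<psi> y \<in> T2 \<longrightarrow> y \<in> V"
    using V C x unfolding open_subset_iff[OF Y] by blast
  obtain W1 Fh where W1: "open W1" "\<phi> x \<in> W1" "Cinf W1 Fh"
      "\<forall>y\<in>W \<inter> U. \<phi> y \<in> W1 \<longrightarrow> F y \<in> C \<and> \<psi> (F y) = Fh (\<phi> y)"
    using local_rep_any_chart[OF X Y F _ U(2) C(2) U(1) C(1)] x unfolding local_rep_def by blast
  have "open ({z \<in> W1. Fh z \<in> T2} \<inter> T)" using open_Cinf_vimage W1 T T2 by blast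
  moreover have "\<phi> x \<in> {z \<in> W1. Fh z \<in> T2} \<inter> T" using W1 T T2 U x by auto
  moreover have "\<forall>y\<in>U. \<phi> y \<in> {z \<in> W1. Fh z \<in> T2} \<inter> T \<longrightarrow> y \<in> {x \<in> W. F x \<in> V}"
    using W1 T T2 by auto
  ultimately show "\<exists>U \<phi> T. (U, \<phi>) \<in> atlas X \<and> x \<in> U \<and> open T \<and> \<phi> x \<in> T \<and> (\<forall>y\<in>U. \<phi> y \<in> T \<longrightarrow> y \<in> {x \<in> W. F x \<in> V})"
    using U by blast
qed

section \<open>Neighbourhood filters and germs of smooth maps\<close>

definition nh :: "('a, 'e::euclidean_space) mfd \<Rightarrow> 'a \<Rightarrow> 'a filter" where
  "nh X x = (INF W\<in>{W. open_subset X W \<and> x \<in> W}. principal W)"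

text \<open>Closure under intersections makes the open sets containing \<open>x\<close> a filter
  base. For \<open>x\<close> outside \<open>points X\<close> there is no such set, and
  \<open>nh X x\<close> is the filter \<open>top\<close>.\<close>

lemma eventually_nh:
  assumes X: "smooth_manifold X" and x: "x \<in> points X"
  shows "eventually P (nh X x) \<longleftrightarrow> (\<exists>W. open_subset X W \<and> x \<in> W \<and> (\<forall>y\<in>W. P y))"
proof -
  have "eventually P (nh X x) \<longleftrightarrow> (\<exists>W\<in>{W. open_subset X W \<and> x \<in> W}. eventually P (principal W))"
    unfolding nh_def
  proof (rule eventually_INF_base)
    show "{W. open_subset X W \<and> x \<in> W} \<noteq> {}" using open_subset_points[OF X] x by blast
    fix A B assume "A \<in> {W. open_subset X W \<and> x \<in> W}" "B \<in> {W. open_subset X W \<and> x \<in> W}"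
    then show "\<exists>W\<in>{W. open_subset X W \<and> x \<in> W}. principal W \<le> inf (principal A) (principal B)"
      using open_subset_Int[OF X] by (intro bexI[of _ "A \<inter> B"]) auto
  qed
  then show ?thesis by (auto simp: eventually_principal)
qed

lemma eventually_nh_self:
  "smooth_manifold X \<Longrightarrow> x \<in> points X \<Longrightarrow> eventually P (nh X x) \<Longrightarrow> P x"
  by (auto simp: eventually_nh)

lemma eventually_nh_eventually:
  assumes X: "smooth_manifold X" and x: "x \<in> points X" and P: "eventually P (nh X x)"
  shows "\<forall>\<^sub>F y in nh X x. eventually P (nh X y)"
proof -
  obtain W where W: "open_subset X W" "x \<in> W" "\<forall>y\<in>W. P y" using P unfolding eventually_nh[OF X x] by blast
  have "eventually P (nh X y)" if y: "y \<in> W" for y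
  proof -
    have "y \<in> points X" using W(1) y unfolding open_subset_def by blast
    then show ?thesis using W y by (auto simp: eventually_nh[OF X])
  qed
  with W show ?thesis by (subst eventually_nh[OF X x]) blast
qed

lemma eventually_nh_points:
  "smooth_manifold X \<Longrightarrow> x \<in> points X \<Longrightarrow> \<forall>\<^sub>F y in nh X x. y \<in> points X"
  using open_subset_points by (auto simp: eventually_nh)

text \<open>Smoothness of a germ. Transversals and the products built from them are controlled only
  near one point, and this form avoids carrying their domains along.\<close>

definition smooth_at ::
    "('a, 'e::euclidean_space) mfd \<Rightarrow> ('b, 'f::euclidean_space) mfd \<Rightarrow> 'a \<Rightarrow> ('a \<Rightarrow> 'b) \<Rightarrow> bool" where
  "smooth_at X Y x F \<longleftrightarrow> (\<exists>W. open_subset X W \<and> x \<in> W \<and> smooth_map X Y W F)"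

lemma smooth_near_iff: "smooth_near X x f \<longleftrightarrow> smooth_at X euclid x f"
  unfolding smooth_near_def smooth_at_def ..

lemma smooth_at_points:
  assumes "smooth_at X Y x F"
  shows "x \<in> points X" "F x \<in> points Y"
proof -
  obtain W where W: "x \<in> W" "smooth_map X Y W F" using assms unfolding smooth_at_def by blast
  show "x \<in> points X" "F x \<in> points Y" using smooth_map_points[OF W(2,1)] .
qed

lemma smooth_map_imp_smooth_at: "open_subset X W \<Longrightarrow> smooth_map X Y W F \<Longrightarrow> x \<in> W \<Longrightarrow> smooth_at X Y x F"
  unfolding smooth_at_def by blast

lemma smooth_at_imp_smooth_map:
  assumes X: "smooth_manifold X" and Y: "smooth_manifold Y"
    and F: "\<And>x. x \<in> W \<Longrightarrow> smooth_at X Y x F"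
  shows "smooth_map X Y W F"
proof (rule smooth_mapI[OF X])
  fix x assume x: "x \<in> W"
  obtain W' where W': "open_subset X W'" "x \<in> W'" "smooth_map X Y W' F"
    using F[OF x] unfolding smooth_at_def by blast
  obtain U \<phi> where U: "(U, \<phi>) \<in> atlas X" "x \<in> U"
    by (rule points_chartE[OF smooth_map_points(1)[OF W'(3,2)]])
  obtain V \<psi> where V: "(V, \<psi>) \<in> atlas Y" "F x \<in> V"
    by (rule points_chartE[OF smooth_map_points(2)[OF W'(3,2)]])
  obtain T where T: "open T" "\<phi> x \<in> T" "\<forall>y\<in>U. \<phi> y \<in> T \<longrightarrow> y \<in> W'"
    using W' U unfolding open_subset_iff[OF X] by blast
  obtain W1 Fh where W1: "open W1" "\<phi> x \<in> W1" "Cinf W1 Fh"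
      "\<forall>y\<in>W' \<inter> U. \<phi> y \<in> W1 \<longrightarrow> F y \<in> V \<and> \<psi> (F y) = Fh (\<phi> y)"
    using local_rep_any_chart[OF X Y W'(3,2) U(2) V(2) U(1) V(1)] unfolding local_rep_def by blast
  have "local_rep W F x U \<phi> V \<psi>"
    unfolding local_rep_def using T W1 Cinf_subset[OF W1(3)]
    by (intro exI[of _ "W1 \<inter> T"] exI[of _ Fh]) auto
  with U V show "\<exists>U \<phi> V \<psi>. (U, \<phi>) \<in> atlas X \<and> (V, \<psi>) \<in> atlas Y \<and> x \<in> U \<and> local_rep W F x U \<phi> V \<psi>"
    by blast
qed

lemma smooth_at_eventually:
  assumes X: "smooth_manifold X" and F: "smooth_at X Y x F"
  shows "\<forall>\<^sub>F y in nh X x. smooth_at X Y y F"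
  unfolding eventually_nh[OF X smooth_at_points(1)[OF F]]
  using F unfolding smooth_at_def by blast

lemma smooth_at_filterlim:
  assumes X: "smooth_manifold X" and Y: "smooth_manifold Y" and F: "smooth_at X Y x F"
  shows "filterlim F (nh Y (F x)) (nh X x)"
  unfolding filterlim_iff
proof (intro allI impI)
  fix P assume "eventually P (nh Y (F x))"
  then obtain V where V: "open_subset Y V" "F x \<in> V" "\<forall>y\<in>V. P y"
    unfolding eventually_nh[OF Y smooth_at_points(2)[OF F]] by blast
  obtain W where W: "open_subset X W" "x \<in> W" "smooth_map X Y W F" using F unfolding smooth_at_def by blast
  show "\<forall>\<^sub>F x in nh X x. P (F x)"
    unfolding eventually_nh[OF X smooth_at_points(1)[OF F]]
    using open_subset_vimage[OF X Y W(3,1) V(1)] V W by (intro exI[of _ "{x \<in> W. F x \<in> V}"]) auto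
qed

text \<open>The set \<open>S\<close> may fail to be open: this is the form in which the
  multiplication, smooth on the set of composable pairs only, is composed with maps into that
  set.\<close>

lemma smooth_at_compose_map:
  assumes X: "smooth_manifold X" and Y: "smooth_manifold Y" and Z: "smooth_manifold Z"
    and F: "smooth_at X Y x F" and G: "smooth_map Y Z S G" and S: "\<forall>\<^sub>F y in nh X x. F y \<in> S"
  shows "smooth_at X Z x (\<lambda>x. G (F x))"
proof -
  obtain W where W: "open_subset X W" "x \<in> W" "smooth_map X Y W F" using F unfolding smooth_at_def by blast
  obtain V where V: "open_subset X V" "x \<in> V" "\<forall>y\<in>V. F y \<in> S"
    using S unfolding eventually_nh[OF X smooth_at_points(1)[OF F]] by blast
  have "smooth_map X Z (V \<inter> W) (\<lambda>x. G (F x))"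
    by (rule smooth_map_compose[OF X Y Z smooth_map_subset[OF X W(3)] G]) (use V in auto)
  then show ?thesis unfolding smooth_at_def using open_subset_Int[OF X V(1) W(1)] V W by blast
qed

lemma smooth_at_compose:
  assumes X: "smooth_manifold X" and Y: "smooth_manifold Y" and Z: "smooth_manifold Z"
    and F: "smooth_at X Y x F" and G: "smooth_at Y Z (F x) G"
  shows "smooth_at X Z x (\<lambda>x. G (F x))"
proof -
  obtain W where W: "open_subset Y W" "F x \<in> W" "smooth_map Y Z W G" using G unfolding smooth_at_def by blast
  have "\<forall>\<^sub>F y in nh Y (F x). y \<in> W"
    unfolding eventually_nh[OF Y smooth_at_points(2)[OF F]] using W by blast
  then have "\<forall>\<^sub>F y in nh X x. F y \<in> W" using smooth_at_filterlim[OF X Y F] by (auto simp: filterlim_iff)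
  then show ?thesis by (rule smooth_at_compose_map[OF X Y Z F W(3)])
qed

lemma smooth_map_cong:
  assumes X: "smooth_manifold X" and F: "smooth_map X Y S F" and eq: "\<And>y. y \<in> S \<Longrightarrow> F y = G y"
  shows "smooth_map X Y S G"
  using F unfolding smooth_map_iff_local_rep[OF X] local_rep_def using eq by simp

lemma smooth_at_cong:
  assumes X: "smooth_manifold X" and F: "smooth_at X Y x F" and eq: "\<forall>\<^sub>F y in nh X x. F y = G y"
  shows "smooth_at X Y x G"
proof -
  obtain W where W: "open_subset X W" "x \<in> W" "smooth_map X Y W F" using F unfolding smooth_at_def by blast
  obtain V where V: "open_subset X V" "x \<in> V" "\<forall>y\<in>V. F y = G y"
    using eq unfolding eventually_nh[OF X smooth_at_points(1)[OF F]] by blast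
  have "smooth_map X Y (V \<inter> W) G"
    by (rule smooth_map_cong[OF X smooth_map_subset[OF X W(3)]]) (use V in auto)
  then show ?thesis unfolding smooth_at_def using open_subset_Int[OF X V(1) W(1)] V W by blast
qed

lemma smooth_at_id:
  assumes X: "smooth_manifold X" and x: "x \<in> points X"
  shows "smooth_at X X x (\<lambda>x. x)"
proof -
  have "smooth_map X X (points X) (\<lambda>x. x)"
  proof (rule smooth_mapI[OF X])
    fix x assume "x \<in> points X"
    then obtain U \<phi> where U: "(U, \<phi>) \<in> atlas X" "x \<in> U" by (rule points_chartE)
    have "local_rep (points X) (\<lambda>x. x) x U \<phi> U \<phi>"
      using chart_change[OF X U(1) U(1) U(2) U(2)] by (rule local_rep_subset) simp
    with U show "\<exists>U \<phi> V \<psi>. (U, \<phi>) \<in> atlas X \<and> (V, \<psi>) \<in> atlas X \<and> x \<in> U \<and> local_rep (points X) (\<lambda>x. x) x U \<phi> V \<psi>"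
      by blast
  qed
  then show ?thesis using smooth_map_imp_smooth_at[OF open_subset_points[OF X]] x by blast
qed

lemma smooth_at_const:
  assumes X: "smooth_manifold X" and Y: "smooth_manifold Y" and x: "x \<in> points X" and c: "c \<in> points Y"
  shows "smooth_at X Y x (\<lambda>x. c)"
proof -
  obtain V \<psi> where V: "(V, \<psi>) \<in> atlas Y" "c \<in> V" by (rule points_chartE[OF c])
  have "smooth_map X Y (points X) (\<lambda>x. c)"
  proof (rule smooth_mapI[OF X])
    fix x assume "x \<in> points X"
    then obtain U \<phi> where U: "(U, \<phi>) \<in> atlas X" "x \<in> U" by (rule points_chartE)
    have "local_rep (points X) (\<lambda>x. c) x U \<phi> V \<psi>"
      unfolding local_rep_def using V Cinf_const by (intro exI[of _ UNIV] exI[of _ "\<lambda>_. \<psi> c"]) auto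
    with U V show "\<exists>U \<phi> V \<psi>. (U, \<phi>) \<in> atlas X \<and> (V, \<psi>) \<in> atlas Y \<and> x \<in> U \<and> local_rep (points X) (\<lambda>x. c) x U \<phi> V \<psi>"
      by blast
  qed
  then show ?thesis using smooth_map_imp_smooth_at[OF open_subset_points[OF X]] x by blast
qed

section \<open>Euclidean spaces and products as manifolds\<close>

lemma euclid_simps [simp]:
  "model euclid = UNIV" "atlas euclid = {(UNIV, \<lambda>x. x)}" "points euclid = UNIV"
  by (auto simp: euclid_def points_def)

lemma smooth_manifold_euclid [simp]: "smooth_manifold (euclid :: ('e::euclidean_space, 'e) mfd)"
proof (rule smooth_manifoldI)
  fix U V :: "'e set" and \<phi> \<psi> :: "'e \<Rightarrow> 'e" and x :: 'e
  assume "(U, \<phi>) \<in> atlas euclid" "(V, \<psi>) \<in> atlas euclid"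
  then show "local_rep UNIV (\<lambda>x. x) x U \<phi> V \<psi>"
    unfolding local_rep_def by (auto intro!: exI[of _ UNIV] exI[of _ "\<lambda>x. x"] Cinf_id)
qed (auto)

lemma open_subset_euclid: "open_subset euclid W \<longleftrightarrow> open W"
  unfolding open_subset_def by simp

lemma nh_euclid [simp]: "nh euclid x = nhds x"
  unfolding nh_def nhds_def open_subset_euclid by (simp add: conj_commute)

lemma smooth_at_euclid_iff:
  "smooth_at euclid euclid x f \<longleftrightarrow> (\<exists>W. open W \<and> x \<in> W \<and> Cinf W f)"
proof
  assume "smooth_at euclid euclid x f"
  then obtain W where W: "open W" "x \<in> W" "smooth_map euclid euclid W f"
    unfolding smooth_at_def open_subset_euclid by blast
  have "local_rep W f x UNIV (\<lambda>x. x) UNIV (\<lambda>x. x)"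
    by (rule local_rep_any_chart[OF _ _ W(3)]) (use W in auto)
  then obtain W1 Fh where W1: "open W1" "x \<in> W1" "Cinf W1 Fh" "\<forall>y\<in>W. y \<in> W1 \<longrightarrow> f y = Fh y"
    unfolding local_rep_def by auto
  have "Cinf (W \<inter> W1) f"
    by (rule Cinf_cong[of _ Fh]) (use W W1 Cinf_subset[OF W1(3)] in auto)
  with W W1 show "\<exists>W. open W \<and> x \<in> W \<and> Cinf W f" by (intro exI[of _ "W \<inter> W1"]) auto
next
  assume "\<exists>W. open W \<and> x \<in> W \<and> Cinf W f"
  then obtain W where W: "open W" "x \<in> W" "Cinf W f" by blast
  have "smooth_map euclid euclid W f"
    by (rule smooth_mapI) (use W in \<open>auto simp: local_rep_def intro!: exI[of _ W] exI[of _ f]\<close>)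
  with W show "smooth_at euclid euclid x f"
    unfolding smooth_at_def open_subset_euclid by blast
qed

lemma prod_mfd_simps:
  "model (prod_mfd X Y) = model X \<times> model Y"
  "atlas (prod_mfd X Y) = {(U \<times> V, map_prod \<phi> \<psi>) | U \<phi> V \<psi>. (U, \<phi>) \<in> atlas X \<and> (V, \<psi>) \<in> atlas Y}"
  by (simp_all add: prod_mfd_def)

lemma points_prod_mfd [simp]: "points (prod_mfd X Y) = points X \<times> points Y"
  unfolding points_def prod_mfd_simps by (auto; blast)

lemma prod_mfd_euclid [simp]: "prod_mfd euclid euclid = euclid"
  by (simp add: prod_mfd_def euclid_def map_prod_def id_def[symmetric] case_prod_unfold)

lemma smooth_manifold_prod [simp]:
  assumes X: "smooth_manifold X" and Y: "smooth_manifold Y"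
  shows "smooth_manifold (prod_mfd X Y)"
proof (rule smooth_manifoldI)
  show "subspace (model (prod_mfd X Y))"
    using subspace_Times[OF smooth_manifoldD(1)[OF X] smooth_manifoldD(1)[OF Y]] by (simp add: prod_mfd_simps)
  fix U \<phi> assume "(U, \<phi>) \<in> atlas (prod_mfd X Y)"
  then obtain U1 \<phi>1 U2 \<phi>2 where U: "U = U1 \<times> U2" "\<phi> = map_prod \<phi>1 \<phi>2" "(U1, \<phi>1) \<in> atlas X" "(U2, \<phi>2) \<in> atlas Y"
    unfolding prod_mfd_simps by blast
  show "inj_on \<phi> U" using smooth_manifoldD(2)[OF X U(3)] smooth_manifoldD(2)[OF Y U(4)] U
    by (auto simp: inj_on_def)
  have "\<phi> ` U = \<phi>1 ` U1 \<times> \<phi>2 ` U2" using U by auto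
  then show "openin (top_of_set (model (prod_mfd X Y))) (\<phi> ` U)"
    using smooth_manifoldD(3)[OF X U(3)] smooth_manifoldD(3)[OF Y U(4)]
    by (simp add: prod_mfd_simps openin_Times)
  fix V \<psi> x assume "(V, \<psi>) \<in> atlas (prod_mfd X Y)" and x: "x \<in> U" "x \<in> V"
  then obtain V1 \<psi>1 V2 \<psi>2 where V: "V = V1 \<times> V2" "\<psi> = map_prod \<psi>1 \<psi>2" "(V1, \<psi>1) \<in> atlas X" "(V2, \<psi>2) \<in> atlas Y"
    unfolding prod_mfd_simps by blast
  obtain x1 x2 where xx: "x = (x1, x2)" by force
  obtain W1 F1 where 1: "open W1" "\<phi>1 x1 \<in> W1" "Cinf W1 F1" "\<forall>y\<in>U1. \<phi>1 y \<in> W1 \<longrightarrow> y \<in> V1 \<and> \<psi>1 y = F1 (\<phi>1 y)"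
    using chart_change[OF X U(3) V(3), of x1] x U V xx unfolding local_rep_def by auto
  obtain W2 F2 where 2: "open W2" "\<phi>2 x2 \<in> W2" "Cinf W2 F2" "\<forall>y\<in>U2. \<phi>2 y \<in> W2 \<longrightarrow> y \<in> V2 \<and> \<psi>2 y = F2 (\<phi>2 y)"
    using chart_change[OF Y U(4) V(4), of x2] x U V xx unfolding local_rep_def by auto
  have "Cinf (W1 \<times> W2) (\<lambda>z. (F1 (fst z), F2 (snd z)))"
    by (rule Cinf_Pair; rule Cinf_compose[OF Cinf_linear])
      (use 1 2 in \<open>auto simp: linear_fst linear_snd\<close>)
  then show "local_rep UNIV (\<lambda>x. x) x U \<phi> V \<psi>"
    unfolding local_rep_def using 1 2 U V xx
    by (intro exI[of _ "W1 \<times> W2"] exI[of _ "\<lambda>z. (F1 (fst z), F2 (snd z))"]) (auto intro: open_Times)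
qed

lemma smooth_at_fst:
  assumes X: "smooth_manifold X" and Y: "smooth_manifold Y" and p: "p \<in> points X \<times> points Y"
  shows "smooth_at (prod_mfd X Y) X p fst"
proof -
  have "smooth_map (prod_mfd X Y) X (points X \<times> points Y) fst"
  proof (rule smooth_mapI[OF smooth_manifold_prod[OF X Y]])
    fix x assume "x \<in> points X \<times> points Y"
    then have "fst x \<in> points X" "snd x \<in> points Y" by auto
    then obtain U \<phi> V \<psi> where U: "(U, \<phi>) \<in> atlas X" "fst x \<in> U" "(V, \<psi>) \<in> atlas Y" "snd x \<in> V"
      using points_chartE by metis
    have "local_rep (points X \<times> points Y) fst x (U \<times> V) (map_prod \<phi> \<psi>) U \<phi>"
      unfolding local_rep_def using Cinf_linear[OF linear_fst]
      by (intro exI[of _ UNIV] exI[of _ fst]) auto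
    moreover have "(U \<times> V, map_prod \<phi> \<psi>) \<in> atlas (prod_mfd X Y)" "x \<in> U \<times> V"
      using U by (auto simp: prod_mfd_simps mem_Times_iff)
    ultimately show "\<exists>U' \<phi>' V \<psi>. (U', \<phi>') \<in> atlas (prod_mfd X Y) \<and> (V, \<psi>) \<in> atlas X \<and> x \<in> U' \<and>
        local_rep (points X \<times> points Y) fst x U' \<phi>' V \<psi>" using U by blast
  qed
  then show ?thesis
    using smooth_map_imp_smooth_at[OF open_subset_points[OF smooth_manifold_prod[OF X Y]]] p by simp
qed

lemma smooth_at_snd:
  assumes X: "smooth_manifold X" and Y: "smooth_manifold Y" and p: "p \<in> points X \<times> points Y"
  shows "smooth_at (prod_mfd X Y) Y p snd"
proof -
  have "smooth_map (prod_mfd X Y) Y (points X \<times> points Y) snd"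
  proof (rule smooth_mapI[OF smooth_manifold_prod[OF X Y]])
    fix x assume "x \<in> points X \<times> points Y"
    then have "fst x \<in> points X" "snd x \<in> points Y" by auto
    then obtain U \<phi> V \<psi> where U: "(U, \<phi>) \<in> atlas X" "fst x \<in> U" "(V, \<psi>) \<in> atlas Y" "snd x \<in> V"
      using points_chartE by metis
    have "local_rep (points X \<times> points Y) snd x (U \<times> V) (map_prod \<phi> \<psi>) V \<psi>"
      unfolding local_rep_def using Cinf_linear[OF linear_snd]
      by (intro exI[of _ UNIV] exI[of _ snd]) auto
    moreover have "(U \<times> V, map_prod \<phi> \<psi>) \<in> atlas (prod_mfd X Y)" "x \<in> U \<times> V"
      using U by (auto simp: prod_mfd_simps mem_Times_iff)
    ultimately show "\<exists>U' \<phi>' V \<psi>. (U', \<phi>') \<in> atlas (prod_mfd X Y) \<and> (V, \<psi>) \<in> atlas Y \<and> x \<in> U' \<and>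
        local_rep (points X \<times> points Y) snd x U' \<phi>' V \<psi>" using U by blast
  qed
  then show ?thesis
    using smooth_map_imp_smooth_at[OF open_subset_points[OF smooth_manifold_prod[OF X Y]]] p by simp
qed

lemma smooth_at_Pair:
  assumes Z: "smooth_manifold Z" and X: "smooth_manifold X" and Y: "smooth_manifold Y"
    and F: "smooth_at Z X z F" and G: "smooth_at Z Y z G"
  shows "smooth_at Z (prod_mfd X Y) z (\<lambda>z. (F z, G z))"
proof -
  obtain V where V: "open_subset Z V" "z \<in> V" "smooth_map Z X V F" using F unfolding smooth_at_def by blast
  obtain W where W: "open_subset Z W" "z \<in> W" "smooth_map Z Y W G" using G unfolding smooth_at_def by blast
  have "smooth_map Z (prod_mfd X Y) (V \<inter> W) (\<lambda>z. (F z, G z))"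
  proof (rule smooth_mapI[OF Z])
    fix x assume x: "x \<in> V \<inter> W"
    obtain U \<phi> where U: "(U, \<phi>) \<in> atlas Z" "x \<in> U"
      by (rule points_chartE[OF smooth_map_points(1)[OF V(3)]]) (use x in auto)
    obtain A \<alpha> where A: "(A, \<alpha>) \<in> atlas X" "F x \<in> A"
      by (rule points_chartE[OF smooth_map_points(2)[OF V(3)]]) (use x in auto)
    obtain B \<beta> where B: "(B, \<beta>) \<in> atlas Y" "G x \<in> B"
      by (rule points_chartE[OF smooth_map_points(2)[OF W(3)]]) (use x in auto)
    have "local_rep V F x U \<phi> A \<alpha>" using local_rep_any_chart[OF Z X V(3) _ U(2) A(2) U(1) A(1)] x by blast
    then obtain W1 F1 where 1: "open W1" "\<phi> x \<in> W1" "Cinf W1 F1" "\<forall>y\<in>V \<inter> U. \<phi> y \<in> W1 \<longrightarrow> F y \<in> A \<and> \<alpha> (F y) = F1 (\<phi> y)"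
      unfolding local_rep_def by blast
    have "local_rep W G x U \<phi> B \<beta>" using local_rep_any_chart[OF Z Y W(3) _ U(2) B(2) U(1) B(1)] x by blast
    then obtain W2 F2 where 2: "open W2" "\<phi> x \<in> W2" "Cinf W2 F2" "\<forall>y\<in>W \<inter> U. \<phi> y \<in> W2 \<longrightarrow> G y \<in> B \<and> \<beta> (G y) = F2 (\<phi> y)"
      unfolding local_rep_def by blast
    have "Cinf (W1 \<inter> W2) (\<lambda>z. (F1 z, F2 z))"
      by (intro Cinf_Pair Cinf_subset[OF 1(3)] Cinf_subset[OF 2(3)]) auto
    then have "local_rep (V \<inter> W) (\<lambda>z. (F z, G z)) x U \<phi> (A \<times> B) (map_prod \<alpha> \<beta>)"
      unfolding local_rep_def using 1 2
      by (intro exI[of _ "W1 \<inter> W2"] exI[of _ "\<lambda>z. (F1 z, F2 z)"]) auto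
    moreover have "(A \<times> B, map_prod \<alpha> \<beta>) \<in> atlas (prod_mfd X Y)" using A B by (auto simp: prod_mfd_simps)
    ultimately show "\<exists>U \<phi> C \<psi>. (U, \<phi>) \<in> atlas Z \<and> (C, \<psi>) \<in> atlas (prod_mfd X Y) \<and> x \<in> U \<and>
        local_rep (V \<inter> W) (\<lambda>z. (F z, G z)) x U \<phi> C \<psi>" using U by blast
  qed
  then show ?thesis unfolding smooth_at_def using open_subset_Int[OF Z V(1) W(1)] V W by blast
qed

section \<open>Projections onto models and inverses of charts\<close>

definition lin_proj :: "'e::euclidean_space set \<Rightarrow> 'e \<Rightarrow> 'e" where
  "lin_proj S = (SOME p. linear p \<and> range p \<subseteq> S \<and> (\<forall>x\<in>S. p x = x))"

lemma lin_proj: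
  assumes "subspace S"
  shows "linear (lin_proj S)" "lin_proj S x \<in> S" "x \<in> S \<Longrightarrow> lin_proj S x = x"
proof -
  have "\<exists>p. linear p \<and> range p \<subseteq> S \<and> (\<forall>x\<in>S. p x = x)"
    using linear_exists_left_inverse_on[of "\<lambda>x. x" S] assms by (auto simp: linear_id[unfolded id_def])
  from someI_ex[OF this] show "linear (lin_proj S)" "lin_proj S x \<in> S" "x \<in> S \<Longrightarrow> lin_proj S x = x"
    unfolding lin_proj_def by auto
qed

lemma smooth_at_chart:
  assumes X: "smooth_manifold X" and U: "(U, \<phi>) \<in> atlas X" and x: "x \<in> U"
  shows "smooth_at X euclid x \<phi>"
proof -
  have "smooth_map X euclid U \<phi>"
  proof (rule smooth_mapI[OF X])
    fix x assume x: "x \<in> U"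
    have "local_rep U \<phi> x U \<phi> UNIV (\<lambda>x. x)"
      unfolding local_rep_def using Cinf_id by (intro exI[of _ UNIV] exI[of _ "\<lambda>x. x"]) auto
    with U x show "\<exists>U' \<phi>' V \<psi>. (U', \<phi>') \<in> atlas X \<and> (V, \<psi>) \<in> atlas euclid \<and> x \<in> U' \<and>
        local_rep U \<phi> x U' \<phi>' V \<psi>" by auto
  qed
  then show ?thesis using smooth_map_imp_smooth_at[OF open_subset_chart[OF X U]] x by blast
qed

text \<open>A chart has an inverse only on a relatively open part of the model. Precomposing with a
  linear projection onto the model extends it to an open set of the Euclidean space, where
  derivatives make sense; going back to the chart then gives the projection instead of the
  identity.\<close>

definition chart_inv :: "('a, 'e::euclidean_space) mfd \<Rightarrow> 'a set \<Rightarrow> ('a \<Rightarrow> 'e) \<Rightarrow> 'e \<Rightarrow> 'a" where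
  "chart_inv X U \<phi> z = inv_into U \<phi> (lin_proj (model X) z)"

lemma chart_inv:
  assumes X: "smooth_manifold X" and U: "(U, \<phi>) \<in> atlas X" and x: "x \<in> U"
  shows "chart_inv X U \<phi> (\<phi> x) = x"
    and "smooth_at euclid X (\<phi> x) (chart_inv X U \<phi>)"
    and "\<forall>\<^sub>F z in nhds (\<phi> x). chart_inv X U \<phi> z \<in> U \<and> \<phi> (chart_inv X U \<phi> z) = lin_proj (model X) z"
    and "\<phi> x \<in> model X"
proof -
  have inj: "inj_on \<phi> U" and op: "openin (top_of_set (model X)) (\<phi> ` U)"
    using smooth_manifoldD[OF X] U by blast+
  let ?p = "lin_proj (model X)"
  note p = lin_proj[OF smooth_manifoldD(1)[OF X]]
  show xM: "\<phi> x \<in> model X" using op x openin_imp_subset by blast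
  show 1: "chart_inv X U \<phi> (\<phi> x) = x" unfolding chart_inv_def using p(3)[OF xM] inj x by simp
  obtain T where T: "open T" "\<phi> ` U = model X \<inter> T" using op by (auto simp: openin_open)
  \<comment> \<open>Near \<open>\<phi> x\<close> the projected vector lies in the image of the
    chart, because that image is relatively open in the model.\<close>
  let ?W = "{z \<in> UNIV. ?p z \<in> T}"
  have W: "open ?W" by (rule open_Cinf_vimage[OF _ Cinf_linear[OF p(1)] T(1)]) simp
  have xW: "\<phi> x \<in> ?W" using p(3)[OF xM] T x by auto
  have 2: "chart_inv X U \<phi> z \<in> U \<and> \<phi> (chart_inv X U \<phi> z) = ?p z" if "z \<in> ?W" for z
  proof -
    have "?p z \<in> \<phi> ` U" using that p(2) T(2) by auto
    then show ?thesis unfolding chart_inv_def by (simp add: f_inv_into_f inv_into_into)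
  qed
  with W xW show "\<forall>\<^sub>F z in nhds (\<phi> x). chart_inv X U \<phi> z \<in> U \<and> \<phi> (chart_inv X U \<phi> z) = ?p z"
    unfolding eventually_nhds by blast
  have "smooth_map euclid X ?W (chart_inv X U \<phi>)"
  proof (rule smooth_mapI)
    fix z assume z: "z \<in> ?W"
    have "local_rep ?W (chart_inv X U \<phi>) z UNIV (\<lambda>x. x) U \<phi>"
      unfolding local_rep_def using W z 2 Cinf_linear[OF p(1)]
      by (intro exI[of _ ?W] exI[of _ ?p]) auto
    with U show "\<exists>U' \<phi>' V \<psi>. (U', \<phi>') \<in> atlas euclid \<and> (V, \<psi>) \<in> atlas X \<and> z \<in> U' \<and>
       local_rep ?W (chart_inv X U \<phi>) z U' \<phi>' V \<psi>" by auto
  qed simp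
  with W xW show "smooth_at euclid X (\<phi> x) (chart_inv X U \<phi>)"
    unfolding smooth_at_def open_subset_euclid by blast
qed

section \<open>Curves and tangent spaces\<close>

lemma eventually_nh_open:
  assumes X: "smooth_manifold X" and W: "open_subset X W" and x: "x \<in> W"
  shows "\<forall>\<^sub>F y in nh X x. y \<in> W"
proof -
  have "x \<in> points X" using W x unfolding open_subset_def by blast
  then show ?thesis using W x by (auto simp: eventually_nh[OF X])
qed

text \<open>Curves through \<open>x\<close> as germs at time 0. Lying in a subset is stated
  separately as an eventual property, so that several such conditions combine without matching
  intervals.\<close>

definition curve_at :: "('a, 'e::euclidean_space) mfd \<Rightarrow> 'a \<Rightarrow> (real \<Rightarrow> 'a) \<Rightarrow> bool" where
  "curve_at X x \<gamma> \<longleftrightarrow> \<gamma> 0 = x \<and> smooth_at euclid X 0 \<gamma>"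

lemma curve_at_points: "curve_at X x \<gamma> \<Longrightarrow> x \<in> points X"
  unfolding curve_at_def using smooth_at_points(2) by metis

lemma curve_in_iff:
  assumes X: "smooth_manifold X"
  shows "curve_in X S x \<gamma> \<longleftrightarrow> curve_at X x \<gamma> \<and> (\<forall>\<^sub>F \<tau> in nhds 0. \<gamma> \<tau> \<in> S)"
proof
  assume "curve_in X S x \<gamma>"
  then obtain \<epsilon> :: real where e: "\<gamma> 0 = x" "\<epsilon> > 0" "\<gamma> ` {-\<epsilon><..<\<epsilon>} \<subseteq> S" "smooth_map euclid X {-\<epsilon><..<\<epsilon>} \<gamma>"
    unfolding curve_in_def by blast
  have "smooth_at euclid X 0 \<gamma>"
    by (rule smooth_map_imp_smooth_at[OF _ e(4)]) (use e in \<open>auto simp: open_subset_euclid\<close>)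
  moreover have "\<forall>\<^sub>F \<tau> in nhds 0. \<gamma> \<tau> \<in> S"
    unfolding eventually_nhds using e by (intro exI[of _ "{-\<epsilon><..<\<epsilon>}"]) auto
  ultimately show "curve_at X x \<gamma> \<and> (\<forall>\<^sub>F \<tau> in nhds 0. \<gamma> \<tau> \<in> S)"
    unfolding curve_at_def using e(1) by blast
next
  assume *: "curve_at X x \<gamma> \<and> (\<forall>\<^sub>F \<tau> in nhds 0. \<gamma> \<tau> \<in> S)"
  then obtain W where W: "open W" "0 \<in> W" "smooth_map euclid X W \<gamma>"
    unfolding curve_at_def smooth_at_def open_subset_euclid by blast
  obtain T where T: "open T" "0 \<in> T" "\<forall>\<tau>\<in>T. \<gamma> \<tau> \<in> S"
    using * unfolding eventually_nhds by blast
  obtain \<epsilon> where e: "\<epsilon> > 0" "ball 0 \<epsilon> \<subseteq> W \<inter> T"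
    using open_contains_ball[of "W \<inter> T"] W T by blast
  have b: "{-\<epsilon><..<\<epsilon>} = ball 0 \<epsilon>" by (auto simp: dist_real_def)
  have "smooth_map euclid X {-\<epsilon><..<\<epsilon>} \<gamma>"
    by (rule smooth_map_subset[OF _ W(3)]) (use e b in auto)
  moreover have "\<gamma> ` {-\<epsilon><..<\<epsilon>} \<subseteq> S" using e b T by auto
  ultimately show "curve_in X S x \<gamma>" unfolding curve_in_def using * e(1)
    unfolding curve_at_def by blast
qed

lemma tangent_iff:
  assumes X: "smooth_manifold X"
  shows "v \<in> tangent X S x \<longleftrightarrow> (\<exists>\<gamma>. curve_at X x \<gamma> \<and> (\<forall>\<^sub>F \<tau> in nhds 0. \<gamma> \<tau> \<in> S) \<and> v = velocity X \<gamma>)"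
  unfolding tangent_def curve_in_iff[OF X] by blast

lemma eventually_curve:
  assumes X: "smooth_manifold X" and c: "curve_at X x \<gamma>" and P: "eventually P (nh X x)"
  shows "\<forall>\<^sub>F \<tau> in nhds 0. P (\<gamma> \<tau>)"
proof -
  have "filterlim \<gamma> (nh X x) (nhds 0)"
    using smooth_at_filterlim[OF _ X, of euclid 0 \<gamma>] c unfolding curve_at_def by simp
  then show ?thesis using P unfolding filterlim_iff by blast
qed

lemma tangent_space_iff:
  assumes X: "smooth_manifold X"
  shows "v \<in> tangent_space X x \<longleftrightarrow> (\<exists>\<gamma>. curve_at X x \<gamma> \<and> v = velocity X \<gamma>)"
proof -
  have "\<forall>\<^sub>F \<tau> in nhds 0. \<gamma> \<tau> \<in> points X" if "curve_at X x \<gamma>" for \<gamma>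
    using eventually_curve[OF X that eventually_nh_points[OF X curve_at_points[OF that]]] .
  then show ?thesis unfolding tangent_iff[OF X] by blast
qed

lemma velocity_in_tangent_space:
  "smooth_manifold X \<Longrightarrow> curve_at X x \<gamma> \<Longrightarrow> velocity X \<gamma> \<in> tangent_space X x"
  by (auto simp: tangent_space_iff)

lemma tangent_subset_tangent_space:
  assumes X: "smooth_manifold X"
  shows "tangent X S x \<subseteq> tangent_space X x"
  using tangent_iff[OF X] tangent_space_iff[OF X] by (metis subsetI)

lemma curve_at_compose:
  assumes X: "smooth_manifold X" and Y: "smooth_manifold Y"
    and c: "curve_at X x \<gamma>" and F: "smooth_at X Y x F"
  shows "curve_at Y (F x) (\<lambda>\<tau>. F (\<gamma> \<tau>))"
  using c F smooth_at_compose[OF smooth_manifold_euclid X Y, of 0 \<gamma> F] unfolding curve_at_def by auto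

lemma curve_at_const: "smooth_manifold X \<Longrightarrow> x \<in> points X \<Longrightarrow> curve_at X x (\<lambda>\<tau>. x)"
  unfolding curve_at_def using smooth_at_const[OF smooth_manifold_euclid] by auto

lemma curve_at_cong:
  assumes X: "smooth_manifold X" and c: "curve_at X x \<gamma>" and eq: "\<forall>\<^sub>F \<tau> in nhds 0. \<gamma> \<tau> = \<gamma>' \<tau>"
  shows "curve_at X x \<gamma>'" "velocity X \<gamma> = velocity X \<gamma>'"
proof -
  have 0: "\<gamma> 0 = \<gamma>' 0" using eventually_nhds_x_imp_x[OF eq] .
  then show "curve_at X x \<gamma>'"
    using c smooth_at_cong[OF smooth_manifold_euclid, of X 0 \<gamma> \<gamma>'] eq unfolding curve_at_def by auto
  have "deriv (\<lambda>\<tau>. f (\<gamma> \<tau>)) 0 = deriv (\<lambda>\<tau>. f (\<gamma>' \<tau>)) 0" for f :: "'a \<Rightarrow> real"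
    by (rule deriv_cong_ev) (use eq in \<open>auto elim: eventually_mono\<close>)
  note d = this
  show "velocity X \<gamma> = velocity X \<gamma>'"
  proof
    fix f show "velocity X \<gamma> f = velocity X \<gamma>' f" using d[of f] by (simp add: velocity_def 0)
  qed
qed

lemma smooth_at_euclid_has_derivative:
  assumes "smooth_at euclid euclid x f"
  obtains f' where "(f has_derivative f') (at x)"
  using assms Cinf_derivative unfolding smooth_at_euclid_iff by metis

lemma has_real_derivative_velocity:
  assumes X: "smooth_manifold X" and c: "curve_at X x \<gamma>" and f: "smooth_at X euclid x f"
  shows "((\<lambda>\<tau>. f (\<gamma> \<tau>)) has_real_derivative velocity X \<gamma> f) (at 0)"
proof -
  have "smooth_at euclid euclid 0 (\<lambda>\<tau>. f (\<gamma> \<tau>))"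
    using curve_at_compose[OF X _ c f] unfolding curve_at_def by simp
  then obtain f' where f': "((\<lambda>\<tau>. f (\<gamma> \<tau>)) has_derivative f') (at 0)"
    by (rule smooth_at_euclid_has_derivative)
  have "f' t = f' 1 * t" for t
    using linear_scale[OF has_derivative_linear[OF f'], of t 1] by simp
  then have "f' = (*) (f' 1)" by (rule ext)
  with f' have "((\<lambda>\<tau>. f (\<gamma> \<tau>)) has_real_derivative f' 1) (at 0)"
    unfolding has_field_derivative_def by simp
  moreover have "velocity X \<gamma> f = deriv (\<lambda>\<tau>. f (\<gamma> \<tau>)) 0"
    using c f unfolding velocity_def smooth_near_iff curve_at_def by auto
  ultimately show ?thesis using DERIV_imp_deriv by metis
qed

lemma velocity_eqI:
  assumes "((\<lambda>\<tau>. f (\<gamma> \<tau>)) has_real_derivative d) (at 0)" and "smooth_at X euclid (\<gamma> 0) f"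
  shows "velocity X \<gamma> f = d"
  using assms DERIV_imp_deriv unfolding velocity_def smooth_near_iff by auto

lemma velocity_not_smooth:
  assumes "curve_at X x \<gamma>" "\<not> smooth_at X euclid x f"
  shows "velocity X \<gamma> f = 0"
  using assms unfolding velocity_def smooth_near_iff curve_at_def by auto

lemma velocity_const [simp]: "velocity X (\<lambda>\<tau>. x) = (\<lambda>f. 0)"
  unfolding velocity_def by auto

text \<open>The derivative of \<open>f\<close> read in the chart is one linear map \<open>A\<close>
  for all curves through \<open>x\<close>; velocities are therefore determined by, and linear in,
  the derivative of the coordinates.\<close>

lemma chart_velocity:
  assumes X: "smooth_manifold X" and U: "(U, \<phi>) \<in> atlas X" and x: "x \<in> U" and f: "smooth_at X euclid x f"
  obtains A where "linear A"
    and "\<And>\<gamma> a. curve_at X x \<gamma> \<Longrightarrow> ((\<lambda>\<tau>. \<phi> (\<gamma> \<tau>)) has_vector_derivative a) (at 0) \<Longrightarrow> velocity X \<gamma> f = A a"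
proof -
  let ?f = "\<lambda>z. f (chart_inv X U \<phi> z)"
  note ci = chart_inv[OF X U x]
  have "smooth_at euclid euclid (\<phi> x) ?f"
    using smooth_at_compose[OF smooth_manifold_euclid X smooth_manifold_euclid ci(2)] f ci(1) by auto
  then obtain A where A: "(?f has_derivative A) (at (\<phi> x))" by (rule smooth_at_euclid_has_derivative)
  show thesis
  proof (rule that[of A])
    show "linear A" using A by (rule has_derivative_linear)
    fix \<gamma> a assume c: "curve_at X x \<gamma>" and a: "((\<lambda>\<tau>. \<phi> (\<gamma> \<tau>)) has_vector_derivative a) (at 0)"
    have g0: "\<gamma> 0 = x" using c unfolding curve_at_def by blast
    have "((\<lambda>\<tau>. ?f (\<phi> (\<gamma> \<tau>))) has_derivative (\<lambda>t. A (t *\<^sub>R a))) (at 0)"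
      by (rule has_derivative_compose[where g = ?f]) (use a A g0 in \<open>auto simp: has_vector_derivative_def\<close>)
    moreover have "(\<lambda>t. A (t *\<^sub>R a)) = (*) (A a)"
      using linear_scale[OF has_derivative_linear[OF A]] by auto
    ultimately have 1: "((\<lambda>\<tau>. ?f (\<phi> (\<gamma> \<tau>))) has_real_derivative A a) (at 0)"
      unfolding has_field_derivative_def by simp
    have "\<forall>\<^sub>F y in nh X x. y \<in> U"
      by (rule eventually_nh_open[OF X open_subset_chart[OF X U] x])
    then have "\<forall>\<^sub>F \<tau> in nhds 0. \<gamma> \<tau> \<in> U" using eventually_curve[OF X c] by blast
    then have "\<forall>\<^sub>F \<tau> in nhds 0. ?f (\<phi> (\<gamma> \<tau>)) = f (\<gamma> \<tau>)"
      using chart_inv(1)[OF X U] by (auto elim!: eventually_mono)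
    from DERIV_cong_ev[OF refl this refl] 1
    have "((\<lambda>\<tau>. f (\<gamma> \<tau>)) has_real_derivative A a) (at 0)" by blast
    then show "velocity X \<gamma> f = A a" by (rule velocity_eqI) (use g0 f in simp)
  qed
qed

text \<open>A linear projection onto \<open>S\<close> fixes the curve near 0, hence by uniqueness of
  derivatives also its derivative.\<close>

lemma closed_derivative_in_subspace:
  fixes c :: "real \<Rightarrow> 'a::euclidean_space"
  assumes S: "subspace S" and c: "\<forall>\<^sub>F \<tau> in nhds 0. c \<tau> \<in> S" and d: "(c has_vector_derivative a) (at 0)"
  shows "a \<in> S"
proof -
  let ?p = "lin_proj S"
  have "((\<lambda>\<tau>. ?p (c \<tau>)) has_vector_derivative ?p a) (at 0)"
    using bounded_linear.has_vector_derivative[OF _ d] lin_proj(1)[OF S] linear_conv_bounded_linear by blast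
  moreover have "\<forall>\<^sub>F \<tau> in nhds 0. \<tau> \<in> UNIV \<longrightarrow> ?p (c \<tau>) = c \<tau>"
    using c by eventually_elim (simp add: lin_proj(3)[OF S])
  ultimately have "(c has_vector_derivative ?p a) (at 0)"
    using has_vector_derivative_cong_ev[where x = 0 and S = UNIV and f = "\<lambda>\<tau>. ?p (c \<tau>)" and g = c and f' = "?p a"]
      eventually_nhds_x_imp_x[OF c] lin_proj(3)[OF S] by simp
  then have "a = ?p a" using d vector_derivative_unique_at by blast
  then show ?thesis using lin_proj(2)[OF S] by metis
qed

lemma chart_coordinate_curve:
  assumes X: "smooth_manifold X" and U: "(U, \<phi>) \<in> atlas X" and x: "x \<in> U" and c: "curve_at X x \<gamma>"
  obtains a where "a \<in> model X" "((\<lambda>\<tau>. \<phi> (\<gamma> \<tau>)) has_vector_derivative a) (at 0)"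
proof -
  have "smooth_at euclid euclid 0 (\<lambda>\<tau>. \<phi> (\<gamma> \<tau>))"
    using curve_at_compose[OF X _ c smooth_at_chart[OF X U x]] unfolding curve_at_def by simp
  then obtain f' where f': "((\<lambda>\<tau>. \<phi> (\<gamma> \<tau>)) has_derivative f') (at 0)"
    by (rule smooth_at_euclid_has_derivative)
  have "f' t = t *\<^sub>R f' 1" for t
    using linear_scale[OF has_derivative_linear[OF f'], of t 1] by simp
  then have "f' = (\<lambda>t. t *\<^sub>R f' 1)" by (rule ext)
  with f' have d: "((\<lambda>\<tau>. \<phi> (\<gamma> \<tau>)) has_vector_derivative f' 1) (at 0)"
    unfolding has_vector_derivative_def by simp
  have "\<forall>\<^sub>F y in nh X x. y \<in> U"
    by (rule eventually_nh_open[OF X open_subset_chart[OF X U] x])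
  then have "\<forall>\<^sub>F \<tau> in nhds 0. \<phi> (\<gamma> \<tau>) \<in> model X"
    by (rule eventually_mono[OF eventually_curve[OF X c]]) (rule chart_inv(4)[OF X U])
  then have "f' 1 \<in> model X"
    using closed_derivative_in_subspace[OF smooth_manifoldD(1)[OF X] _ d] by blast
  with d that show thesis by blast
qed

definition chart_line :: "('a, 'e::euclidean_space) mfd \<Rightarrow> 'a set \<Rightarrow> ('a \<Rightarrow> 'e) \<Rightarrow> 'a \<Rightarrow> 'e \<Rightarrow> real \<Rightarrow> 'a" where
  "chart_line X U \<phi> x a \<tau> = chart_inv X U \<phi> (\<phi> x + \<tau> *\<^sub>R a)"

lemma chart_line:
  assumes X: "smooth_manifold X" and U: "(U, \<phi>) \<in> atlas X" and x: "x \<in> U" and a: "a \<in> model X"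
  shows "curve_at X x (chart_line X U \<phi> x a)"
    and "((\<lambda>\<tau>. \<phi> (chart_line X U \<phi> x a \<tau>)) has_vector_derivative a) (at 0)"
proof -
  note ci = chart_inv[OF X U x]
  have l: "smooth_at euclid euclid (0::real) (\<lambda>\<tau>. \<phi> x + \<tau> *\<^sub>R a)"
    unfolding smooth_at_euclid_iff
    by (intro exI[of _ UNIV] conjI Cinf_add Cinf_const Cinf_bilinear[OF bounded_bilinear_scaleR] Cinf_id) auto
  have "smooth_at euclid X 0 (chart_line X U \<phi> x a)"
    unfolding chart_line_def
    by (rule smooth_at_compose[OF smooth_manifold_euclid smooth_manifold_euclid X l]) (use ci in simp)
  then show "curve_at X x (chart_line X U \<phi> x a)"
    unfolding curve_at_def using ci by (simp add: chart_line_def)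
  have "((\<lambda>\<tau>. \<phi> x + \<tau> *\<^sub>R a) \<longlongrightarrow> \<phi> x + 0 *\<^sub>R a) (nhds 0)" by (intro tendsto_intros) (rule filterlim_ident)
  then have "\<forall>\<^sub>F \<tau> in nhds 0. \<phi> (chart_line X U \<phi> x a \<tau>) = lin_proj (model X) (\<phi> x + \<tau> *\<^sub>R a)"
    using ci(3) unfolding filterlim_iff chart_line_def by (auto elim: eventually_mono)
  moreover have "lin_proj (model X) (\<phi> x + \<tau> *\<^sub>R a) = \<phi> x + \<tau> *\<^sub>R a" for \<tau>
    using smooth_manifoldD(1)[OF X] ci(4) a
    by (intro lin_proj(3)) (auto intro: subspace_add subspace_scale)
  ultimately have *: "\<forall>\<^sub>F \<tau> in nhds 0. \<phi> x + \<tau> *\<^sub>R a = \<phi> (chart_line X U \<phi> x a \<tau>)"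
    by (auto elim: eventually_mono)
  have "((\<lambda>\<tau>. \<phi> x + \<tau> *\<^sub>R a) has_vector_derivative a) (at 0)"
    by (auto intro!: derivative_eq_intros)
  then show "((\<lambda>\<tau>. \<phi> (chart_line X U \<phi> x a \<tau>)) has_vector_derivative a) (at 0)"
    using has_vector_derivative_cong_ev[where x = 0 and S = UNIV and f = "\<lambda>\<tau>. \<phi> x + \<tau> *\<^sub>R a" and g = "\<lambda>\<tau>. \<phi> (chart_line X U \<phi> x a \<tau>)" and f' = a]
      * eventually_nhds_x_imp_x[OF *] by simp
qed

lemma velocity_linear_combination:
  assumes X: "smooth_manifold X" and U: "(U, \<phi>) \<in> atlas X" and x: "x \<in> U"
    and c: "curve_at X x \<gamma>" "((\<lambda>\<tau>. \<phi> (\<gamma> \<tau>)) has_vector_derivative r *\<^sub>R a + s *\<^sub>R b) (at 0)"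
    and c1: "curve_at X x \<gamma>1" "((\<lambda>\<tau>. \<phi> (\<gamma>1 \<tau>)) has_vector_derivative a) (at 0)"
    and c2: "curve_at X x \<gamma>2" "((\<lambda>\<tau>. \<phi> (\<gamma>2 \<tau>)) has_vector_derivative b) (at 0)"
  shows "velocity X \<gamma> = (\<lambda>f. r * velocity X \<gamma>1 f + s * velocity X \<gamma>2 f)"
proof
  fix f
  show "velocity X \<gamma> f = r * velocity X \<gamma>1 f + s * velocity X \<gamma>2 f"
  proof (cases "smooth_at X euclid x f")
    case False
    then show ?thesis using velocity_not_smooth c(1) c1(1) c2(1) by (metis add.right_neutral mult_zero_right)
  next
    case True
    obtain A where A: "linear A"
      "\<And>\<gamma> a. curve_at X x \<gamma> \<Longrightarrow> ((\<lambda>\<tau>. \<phi> (\<gamma> \<tau>)) has_vector_derivative a) (at 0) \<Longrightarrow> velocity X \<gamma> f = A a"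
      using chart_velocity[OF X U x True] by blast
    show ?thesis using A(2)[OF c] A(2)[OF c1] A(2)[OF c2] A(1) by (simp add: linear_add linear_scale)
  qed
qed

text \<open>Tangent vectors are added in a chart: the coordinate line in the combined direction has
  the combined velocity.\<close>

lemma tangent_space_combination:
  assumes X: "smooth_manifold X" and v: "v \<in> tangent_space X x" and w: "w \<in> tangent_space X x"
  shows "(\<lambda>f. r * v f + s * w f) \<in> tangent_space X x"
proof -
  obtain c1 c2 where c: "curve_at X x c1" "v = velocity X c1" "curve_at X x c2" "w = velocity X c2"
    using v w unfolding tangent_space_iff[OF X] by blast
  obtain U \<phi> where U: "(U, \<phi>) \<in> atlas X" "x \<in> U" by (rule points_chartE[OF curve_at_points[OF c(1)]])
  obtain a where a: "a \<in> model X" "((\<lambda>\<tau>. \<phi> (c1 \<tau>)) has_vector_derivative a) (at 0)"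
    by (rule chart_coordinate_curve[OF X U c(1)])
  obtain b where b: "b \<in> model X" "((\<lambda>\<tau>. \<phi> (c2 \<tau>)) has_vector_derivative b) (at 0)"
    by (rule chart_coordinate_curve[OF X U c(3)])
  have "r *\<^sub>R a + s *\<^sub>R b \<in> model X"
    using a b smooth_manifoldD(1)[OF X] by (auto intro: subspace_add subspace_scale)
  note l = chart_line[OF X U this]
  show ?thesis
    using velocity_linear_combination[OF X U l c(1) a(2) c(3) b(2)] velocity_in_tangent_space[OF X l(1)] c
    by simp
qed

lemma tangent_space_zero:
  assumes X: "smooth_manifold X" and x: "x \<in> points X"
  shows "(\<lambda>f. 0) \<in> tangent_space X x"
  using velocity_in_tangent_space[OF X curve_at_const[OF X x]] velocity_const by simp

text \<open>The differential of \<open>F\<close> as a map of derivations. In contrast to \<^const>\<open>differential\<close>, no curve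
  is chosen, so that it is linear by definition.\<close>

definition push :: "('b, 'f::euclidean_space) mfd \<Rightarrow> ('a \<Rightarrow> 'b) \<Rightarrow> 'a \<Rightarrow> 'a tvec \<Rightarrow> 'b tvec" where
  "push Y F x v = (\<lambda>f. if smooth_at Y euclid (F x) f then v (\<lambda>y. f (F y)) else 0)"

lemma push_combination:
  "push Y F x (\<lambda>f. r * v f + s * w f) = (\<lambda>f. r * push Y F x v f + s * push Y F x w f)"
  unfolding push_def by auto

lemma push_velocity:
  assumes X: "smooth_manifold X" and Y: "smooth_manifold Y"
    and F: "smooth_at X Y x F" and c: "curve_at X x \<gamma>"
  shows "push Y F x (velocity X \<gamma>) = velocity Y (\<lambda>\<tau>. F (\<gamma> \<tau>))"
proof
  fix f
  have g0: "\<gamma> 0 = x" using c unfolding curve_at_def by blast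
  show "push Y F x (velocity X \<gamma>) f = velocity Y (\<lambda>\<tau>. F (\<gamma> \<tau>)) f"
  proof (cases "smooth_at Y euclid (F x) f")
    case True
    have "smooth_at X euclid x (\<lambda>y. f (F y))"
      by (rule smooth_at_compose[OF X Y smooth_manifold_euclid F True])
    with True g0 show ?thesis unfolding push_def velocity_def smooth_near_iff by simp
  next
    case False
    with g0 show ?thesis unfolding push_def velocity_def smooth_near_iff by simp
  qed
qed

lemma push_in_tangent_space:
  assumes X: "smooth_manifold X" and Y: "smooth_manifold Y"
    and F: "smooth_at X Y x F" and v: "v \<in> tangent_space X x"
  shows "push Y F x v \<in> tangent_space Y (F x)"
  using v push_velocity[OF X Y F] velocity_in_tangent_space[OF Y curve_at_compose[OF X Y _ F]]
  unfolding tangent_space_iff[OF X] by auto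

text \<open>Removes the chosen curve: the differential along \<open>S\<close> is the
  \<open>push\<close> of any smooth germ \<open>F'\<close> that agrees with \<open>F\<close> on
  \<open>S\<close> near \<open>x\<close>. For multiplication by an arrow, \<open>S\<close> is a
  fibre and \<open>F'\<close> is built from a transversal.\<close>

lemma differential_velocity:
  assumes X: "smooth_manifold X" and Y: "smooth_manifold Y" and F: "smooth_at X Y x F'"
    and eq: "\<forall>\<^sub>F y in nh X x. y \<in> S \<longrightarrow> F y = F' y" and v: "v \<in> tangent X S x"
  shows "differential X S Y F x v = push Y F' x v"
proof -
  let ?c = "SOME \<gamma>. curve_in X S x \<gamma> \<and> velocity X \<gamma> = v"
  have "\<exists>\<gamma>. curve_in X S x \<gamma> \<and> velocity X \<gamma> = v" using v unfolding tangent_def by blast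
  from someI_ex[OF this] have c: "curve_at X x ?c" "\<forall>\<^sub>F \<tau> in nhds 0. ?c \<tau> \<in> S" "velocity X ?c = v"
    unfolding curve_in_iff[OF X] by blast+
  have "\<forall>\<^sub>F \<tau> in nhds 0. F (?c \<tau>) = F' (?c \<tau>)"
    using c(2) eventually_curve[OF X c(1) eq] by eventually_elim auto
  then have "\<forall>\<^sub>F \<tau> in nhds 0. F' (?c \<tau>) = (F \<circ> ?c) \<tau>"
    by eventually_elim (simp only: o_apply)
  from curve_at_cong(2)[OF Y curve_at_compose[OF X Y c(1) F] this]
  have "velocity Y (F \<circ> ?c) = velocity Y (\<lambda>\<tau>. F' (?c \<tau>))" by (simp add: comp_def)
  also have "\<dots> = push Y F' x v" using push_velocity[OF X Y F c(1)] c(3) by simp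
  finally show ?thesis unfolding differential_def .
qed

lemma differential_points:
  assumes X: "smooth_manifold X" and Y: "smooth_manifold Y" and F: "smooth_at X Y x F"
    and v: "v \<in> tangent_space X x"
  shows "differential X (points X) Y F x v = push Y F x v"
  by (rule differential_velocity[OF X Y F _ v]) simp

lemma curve_at_Pair:
  assumes X: "smooth_manifold X" and Y: "smooth_manifold Y" and "curve_at X x c1" "curve_at Y y c2"
  shows "curve_at (prod_mfd X Y) (x, y) (\<lambda>\<tau>. (c1 \<tau>, c2 \<tau>))"
  using assms smooth_at_Pair[OF smooth_manifold_euclid X Y, of 0 c1 c2] unfolding curve_at_def by auto

lemma curve_at_fst_snd:
  assumes X: "smooth_manifold X" and Y: "smooth_manifold Y" and c: "curve_at (prod_mfd X Y) (x, y) c"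
  shows "curve_at X x (\<lambda>\<tau>. fst (c \<tau>))" "curve_at Y y (\<lambda>\<tau>. snd (c \<tau>))"
proof -
  note XY = smooth_manifold_prod[OF X Y]
  have p: "(x, y) \<in> points X \<times> points Y" using curve_at_points[OF c] by simp
  show "curve_at X x (\<lambda>\<tau>. fst (c \<tau>))"
    using curve_at_compose[OF XY X c smooth_at_fst[OF X Y p]] by simp
  show "curve_at Y y (\<lambda>\<tau>. snd (c \<tau>))"
    using curve_at_compose[OF XY Y c smooth_at_snd[OF X Y p]] by simp
qed

text \<open>In product coordinates the derivative \<open>(a, b)\<close> is the sum of
  \<open>(a, 0)\<close> and \<open>(0, b)\<close>, which belong to the curves with one factor at
  rest.\<close>

lemma velocity_Pair:
  assumes X: "smooth_manifold X" and Y: "smooth_manifold Y" and c1: "curve_at X x c1" and c2: "curve_at Y y c2"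
  shows "velocity (prod_mfd X Y) (\<lambda>\<tau>. (c1 \<tau>, c2 \<tau>)) =
    (\<lambda>f. velocity (prod_mfd X Y) (\<lambda>\<tau>. (c1 \<tau>, y)) f + velocity (prod_mfd X Y) (\<lambda>\<tau>. (x, c2 \<tau>)) f)"
proof -
  note XY = smooth_manifold_prod[OF X Y]
  note px = curve_at_points[OF c1] and py = curve_at_points[OF c2]
  obtain U \<phi> where U: "(U, \<phi>) \<in> atlas X" "x \<in> U" by (rule points_chartE[OF px])
  obtain V \<psi> where V: "(V, \<psi>) \<in> atlas Y" "y \<in> V" by (rule points_chartE[OF py])
  obtain a where a: "((\<lambda>\<tau>. \<phi> (c1 \<tau>)) has_vector_derivative a) (at 0)"
    by (rule chart_coordinate_curve[OF X U c1])
  obtain b where b: "((\<lambda>\<tau>. \<psi> (c2 \<tau>)) has_vector_derivative b) (at 0)"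
    by (rule chart_coordinate_curve[OF Y V c2])
  have C: "(U \<times> V, map_prod \<phi> \<psi>) \<in> atlas (prod_mfd X Y)" "(x, y) \<in> U \<times> V"
    using U V by (auto simp: prod_mfd_simps)
  have k: "((\<lambda>\<tau>. k) has_vector_derivative 0) (at 0)" for k by (rule has_vector_derivative_const)
  have P: "((\<lambda>\<tau>. map_prod \<phi> \<psi> (d1 \<tau>, d2 \<tau>)) has_vector_derivative (a', b')) (at 0)"
    if "((\<lambda>\<tau>. \<phi> (d1 \<tau>)) has_vector_derivative a') (at 0)" "((\<lambda>\<tau>. \<psi> (d2 \<tau>)) has_vector_derivative b') (at 0)"
    for d1 d2 a' b' using has_vector_derivative_Pair[OF that] by simp
  have ab: "(1::real) *\<^sub>R (a, 0) + (1::real) *\<^sub>R (0, b) = (a, b)" by simp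
  note r = velocity_linear_combination[OF XY C, of "\<lambda>\<tau>. (c1 \<tau>, c2 \<tau>)" 1 "(a, 0)" 1 "(0, b)", unfolded ab,
      OF curve_at_Pair[OF X Y c1 c2] P[OF a b]
      curve_at_Pair[OF X Y c1 curve_at_const[OF Y py]] P[OF a k]
      curve_at_Pair[OF X Y curve_at_const[OF X px] c2] P[OF k b]]
  then show ?thesis by simp
qed

text \<open>The differential is the sum of the partial differentials. This is why \<open>K\<close>
  must be smooth on a full neighbourhood in the product: the curves with one argument frozen have to
  stay in its domain.\<close>

lemma velocity_split:
  assumes X: "smooth_manifold X" and Y: "smooth_manifold Y" and Z: "smooth_manifold Z"
    and K: "smooth_at (prod_mfd X Y) Z (x, y) K" and c1: "curve_at X x c1" and c2: "curve_at Y y c2"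
  shows "velocity Z (\<lambda>\<tau>. K (c1 \<tau>, c2 \<tau>)) =
    (\<lambda>f. velocity Z (\<lambda>\<tau>. K (c1 \<tau>, y)) f + velocity Z (\<lambda>\<tau>. K (x, c2 \<tau>)) f)"
proof -
  note XY = smooth_manifold_prod[OF X Y]
  note px = curve_at_points[OF c1] and py = curve_at_points[OF c2]
  note * = push_velocity[OF XY Z K]
  have "velocity Z (\<lambda>\<tau>. K (c1 \<tau>, c2 \<tau>)) = push Z K (x, y) (velocity (prod_mfd X Y) (\<lambda>\<tau>. (c1 \<tau>, c2 \<tau>)))"
    using *[OF curve_at_Pair[OF X Y c1 c2]] by simp
  also have "\<dots> = (\<lambda>f. push Z K (x, y) (velocity (prod_mfd X Y) (\<lambda>\<tau>. (c1 \<tau>, y))) f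
      + push Z K (x, y) (velocity (prod_mfd X Y) (\<lambda>\<tau>. (x, c2 \<tau>))) f)"
    unfolding velocity_Pair[OF X Y c1 c2]
    using push_combination[of Z K "(x, y)" 1 _ 1] by simp
  finally show ?thesis
    unfolding *[OF curve_at_Pair[OF X Y c1 curve_at_const[OF Y py]]]
      *[OF curve_at_Pair[OF X Y curve_at_const[OF X px] c2]] .
qed

section \<open>Covectors and their pullbacks\<close>

lemma dualD:
  "\<xi> \<in> dual T \<Longrightarrow> v \<in> T \<Longrightarrow> w \<in> T \<Longrightarrow> \<xi> (\<lambda>f. r * v f + s * w f) = r * \<xi> v + s * \<xi> w"
  "\<xi> \<in> dual T \<Longrightarrow> v \<notin> T \<Longrightarrow> \<xi> v = 0"
  unfolding dual_def by blast+

lemma dual_add: "\<xi> \<in> dual T \<Longrightarrow> v \<in> T \<Longrightarrow> w \<in> T \<Longrightarrow> \<xi> (\<lambda>f. v f + w f) = \<xi> v + \<xi> w"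
  using dualD(1)[of \<xi> T v w 1 1] by simp

lemma dual_zero: "\<xi> \<in> dual T \<Longrightarrow> v \<in> T \<Longrightarrow> \<xi> (\<lambda>f. 0) = 0"
  using dualD(1)[of \<xi> T v v 0 0] by simp

lemma dual_uminus: "\<xi> \<in> dual T \<Longrightarrow> v \<in> T \<Longrightarrow> \<xi> (\<lambda>f. - v f) = - \<xi> v"
  using dualD(1)[of \<xi> T v v "-1" 0] by simp

lemma dual_diff: "\<xi> \<in> dual T \<Longrightarrow> v \<in> T \<Longrightarrow> w \<in> T \<Longrightarrow> \<xi> (\<lambda>f. v f - w f) = \<xi> v - \<xi> w"
  using dualD(1)[of \<xi> T v w 1 "-1"] by simp

text \<open>The empty set qualifies, so that \<open>tangent_space X x\<close> has this property for
  every \<open>x\<close>, also when \<open>x\<close> is not a point of \<open>X\<close>.\<close>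

definition linear_closed :: "'a tvec set \<Rightarrow> bool" where
  "linear_closed T \<longleftrightarrow> (\<forall>v\<in>T. \<forall>w\<in>T. \<forall>r s. (\<lambda>f. r * v f + s * w f) \<in> T)"

lemma linear_closed_tangent_space: "smooth_manifold X \<Longrightarrow> linear_closed (tangent_space X x)"
  unfolding linear_closed_def by (simp add: tangent_space_combination)

lemma dual_combination:
  assumes "linear_closed T" "\<xi> \<in> dual T" "\<eta> \<in> dual T"
  shows "(\<lambda>v. r * \<xi> v + s * \<eta> v) \<in> dual T"
  using assms unfolding dual_def by (auto simp: algebra_simps)

lemma pullback_in_dual:
  assumes T: "linear_closed T" and \<xi>: "\<xi> \<in> dual T'" and L: "\<And>v. v \<in> T \<Longrightarrow> L v \<in> T'"
    and lin: "\<And>v w r s. v \<in> T \<Longrightarrow> w \<in> T \<Longrightarrow> L (\<lambda>f. r * v f + s * w f) = (\<lambda>f. r * L v f + s * L w f)"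
  shows "pullback T L \<xi> \<in> dual T"
  using T L unfolding dual_def pullback_def linear_closed_def by (auto simp: lin dualD(1)[OF \<xi>])

lemma fun_differential_in_dual:
  assumes X: "smooth_manifold X"
  shows "fun_differential X x f \<in> dual (tangent_space X x)"
  using tangent_space_combination[OF X] unfolding dual_def fun_differential_def by auto

lemma tangentI:
  "smooth_manifold X \<Longrightarrow> curve_at X x c \<Longrightarrow> \<forall>\<^sub>F \<tau> in nhds 0. c \<tau> \<in> S \<Longrightarrow> velocity X c \<in> tangent X S x"
  by (auto simp: tangent_iff)

lemma tangentE:
  assumes "smooth_manifold X" "v \<in> tangent X S x"
  obtains c where "curve_at X x c" "\<forall>\<^sub>F \<tau> in nhds 0. c \<tau> \<in> S" "v = velocity X c"
  using assms by (auto simp: tangent_iff)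

lemma push_diff: "push Y F x (\<lambda>f. v f - w f) = (\<lambda>f. push Y F x v f - push Y F x w f)"
  using push_combination[of Y F x 1 v "-1" w] by simp

lemma tangent_space_diff:
  assumes X: "smooth_manifold X" and "v \<in> tangent_space X x" "w \<in> tangent_space X x"
  shows "(\<lambda>f. v f - w f) \<in> tangent_space X x"
  using tangent_space_combination[OF assms, of 1 "-1"] by simp

text \<open>A pullback is truncated to 0 outside its space, so functoriality relies on
  \<open>K\<close> landing in \<open>A\<close>.\<close>

lemma pullback_pullback:
  assumes "\<And>v. v \<in> T \<Longrightarrow> K v \<in> A"
  shows "pullback T K (pullback A L \<xi>) = pullback T (\<lambda>v. L (K v)) \<xi>"
  using assms unfolding pullback_def by auto

lemma map_pullback_eqI:
  assumes "length \<eta>s = k" "length \<alpha>s = k" "\<And>i v. i < k \<Longrightarrow> v \<in> T \<Longrightarrow> (\<eta>s ! i) (L v) = (\<alpha>s ! i) (L' v)"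
  shows "map (pullback T L) \<eta>s = map (pullback T L') \<alpha>s"
  using assms by (intro nth_equalityI) (auto simp: pullback_def fun_eq_iff)

section \<open>Submersions\<close>

lemma smooth_at_eventually_in:
  assumes X: "smooth_manifold X" and Y: "smooth_manifold Y" and F: "smooth_at X Y x F"
    and W: "open_subset Y W" "F x \<in> W"
  shows "\<forall>\<^sub>F y in nh X x. F y \<in> W"
  using smooth_at_filterlim[OF X Y F] eventually_nh_open[OF Y W] unfolding filterlim_iff by blast

lemma smooth_at_linear: "linear L \<Longrightarrow> smooth_at euclid euclid x L"
  unfolding smooth_at_euclid_iff using Cinf_linear by blast

text \<open>Coordinate functions recover the coordinate derivative from the velocity, so that equal
  velocities have equal coordinate derivatives.\<close>

lemma velocity_chart_component:
  assumes X: "smooth_manifold X" and U: "(U, \<phi>) \<in> atlas X" and x: "x \<in> U" and c: "curve_at X x \<gamma>"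
    and a: "((\<lambda>\<tau>. \<phi> (\<gamma> \<tau>)) has_vector_derivative a) (at 0)"
  shows "velocity X \<gamma> (\<lambda>y. \<phi> y \<bullet> e) = a \<bullet> e"
proof (rule velocity_eqI)
  have "((\<lambda>\<tau>. \<phi> (\<gamma> \<tau>) \<bullet> e) has_vector_derivative a \<bullet> e) (at 0)"
    by (rule bounded_linear.has_vector_derivative[OF bounded_linear_inner_left a])
  then show "((\<lambda>\<tau>. \<phi> (\<gamma> \<tau>) \<bullet> e) has_real_derivative a \<bullet> e) (at 0)"
    by (simp add: has_real_derivative_iff_has_vector_derivative)
  have "smooth_at X euclid x (\<lambda>y. \<phi> y \<bullet> e)"
    by (rule smooth_at_compose[OF X smooth_manifold_euclid smooth_manifold_euclid smooth_at_chart[OF X U x]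
          smooth_at_linear]) (simp add: linear_iff inner_left_distrib)
  then show "smooth_at X euclid (\<gamma> 0) (\<lambda>y. \<phi> y \<bullet> e)" using c unfolding curve_at_def by simp
qed

text \<open>The map \<open>\<sigma>\<close> moves a point \<open>x\<close> to a nearby point of the fibre over \<open>y\<close>. In charts it solves
  \<open>f (z + R w) = y\<close> for \<open>w\<close>, where \<open>R\<close> is a right inverse of the derivative of \<open>f\<close>; the summand
  \<open>w - ?pY w\<close> of \<open>\<Phi>\<close> makes the inverse function theorem applicable in the whole Euclidean space,
  of which the models are only subspaces.\<close>

lemma submersion_transversal:
  assumes X: "smooth_manifold X" and Y: "smooth_manifold Y" and sub: "submersion X Y F" and x0: "x0 \<in> points X"
  obtains \<sigma> where "smooth_at (prod_mfd Y X) X (F x0, x0) \<sigma>"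
    and "\<forall>\<^sub>F p in nh (prod_mfd Y X) (F x0, x0). F (\<sigma> p) = fst p"
    and "\<forall>\<^sub>F x in nh X x0. \<sigma> (F x, x) = x"
proof -
  note YX = smooth_manifold_prod[OF Y X]
  note E = smooth_manifold_euclid
  have sF: "smooth_map X Y (points X) F" and surj: "differential X (points X) Y F x0 ` tangent_space X x0 = tangent_space Y (F x0)"
    using sub x0 unfolding submersion_def by blast+
  have F: "smooth_at X Y x0 F" by (rule smooth_map_imp_smooth_at[OF open_subset_points[OF X] sF x0])
  obtain U \<phi> where U: "(U, \<phi>) \<in> atlas X" "x0 \<in> U" by (rule points_chartE[OF x0])
  obtain V \<psi> where V: "(V, \<psi>) \<in> atlas Y" "F x0 \<in> V" by (rule points_chartE[OF smooth_at_points(2)[OF F]])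
  note ci = chart_inv[OF X U]
  have subX: "subspace (model X)" and subY: "subspace (model Y)" using smooth_manifoldD(1) X Y by auto
  let ?z0 = "\<phi> x0" and ?f = "\<lambda>z. \<psi> (F (chart_inv X U \<phi> z))" and ?pY = "lin_proj (model Y)"
  have Fci: "smooth_at euclid Y ?z0 (\<lambda>z. F (chart_inv X U \<phi> z))"
    by (rule smooth_at_compose[OF E X Y ci(2)]) (use F ci(1) in simp)
  have sf: "smooth_at euclid euclid ?z0 ?f"
    by (rule smooth_at_compose[OF E Y E Fci smooth_at_chart[OF Y V(1)]]) (use V ci(1) in simp)
  then obtain W where W: "open W" "?z0 \<in> W" "Cinf W ?f" unfolding smooth_at_euclid_iff by blast
  obtain D where D: "(?f has_derivative D) (at ?z0)" by (rule smooth_at_euclid_has_derivative[OF sf])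
  have linD: "linear D" by (rule has_derivative_linear[OF D])
  \<comment> \<open>Surjectivity of the differential, read in charts: a vector of the model of
    \<open>Y\<close> is the velocity of a coordinate line, which has the same velocity as the image
    of some curve in \<open>X\<close>.\<close>
  have ex: "\<exists>a\<in>model X. D a = b" if b: "b \<in> model Y" for b
  proof -
    note l = chart_line[OF Y V b]
    have "velocity Y (chart_line Y V \<psi> (F x0) b) \<in> tangent_space Y (F x0)"
      by (rule velocity_in_tangent_space[OF Y l(1)])
    then obtain v where v: "v \<in> tangent_space X x0"
      "velocity Y (chart_line Y V \<psi> (F x0) b) = differential X (points X) Y F x0 v"
      unfolding surj[symmetric] by blast
    obtain c where c: "curve_at X x0 c" "v = velocity X c" using v(1) unfolding tangent_space_iff[OF X] by blast
    have eq: "velocity Y (chart_line Y V \<psi> (F x0) b) = velocity Y (\<lambda>\<tau>. F (c \<tau>))"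
      using push_velocity[OF X Y F c(1)] differential_points[OF X Y F v(1)] v(2) c(2) by simp
    obtain a where a: "a \<in> model X" "((\<lambda>\<tau>. \<phi> (c \<tau>)) has_vector_derivative a) (at 0)"
      by (rule chart_coordinate_curve[OF X U c(1)])
    have c0: "c 0 = x0" using c unfolding curve_at_def by blast
    have "((\<lambda>\<tau>. ?f (\<phi> (c \<tau>))) has_derivative (\<lambda>t. D (t *\<^sub>R a))) (at 0)"
      by (rule has_derivative_compose[where g = ?f]) (use a D c0 in \<open>auto simp: has_vector_derivative_def\<close>)
    then have d: "((\<lambda>\<tau>. ?f (\<phi> (c \<tau>))) has_vector_derivative D a) (at 0)"
      unfolding has_vector_derivative_def linear_scale[OF linD] .
    have "\<forall>\<^sub>F \<tau> in nhds 0. c \<tau> \<in> U"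
      by (rule eventually_curve[OF X c(1) eventually_nh_open[OF X open_subset_chart[OF X U(1)] U(2)]])
    then have "\<forall>\<^sub>F \<tau> in nhds 0. \<tau> \<in> UNIV \<longrightarrow> ?f (\<phi> (c \<tau>)) = \<psi> (F (c \<tau>))"
      using chart_inv(1)[OF X U(1)] by (auto elim!: eventually_mono)
    then have d: "((\<lambda>\<tau>. \<psi> (F (c \<tau>))) has_vector_derivative D a) (at 0)"
      using d has_vector_derivative_cong_ev[where x = 0 and S = UNIV and f = "\<lambda>\<tau>. ?f (\<phi> (c \<tau>))"
          and g = "\<lambda>\<tau>. \<psi> (F (c \<tau>))" and f' = "D a"] ci(1) c0 by simp
    have "D a \<bullet> e = b \<bullet> e" for e
      using velocity_chart_component[OF Y V curve_at_compose[OF X Y c(1) F] d, of e]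
        velocity_chart_component[OF Y V l, of e] unfolding eq by simp
    then have "D a = b" by (rule euclidean_eqI)
    with a show ?thesis by blast
  qed
  obtain g where g: "range g \<subseteq> model X" "linear g" "\<forall>v\<in>D ` model X. D (g v) = v"
    using linear_exists_right_inverse_on[OF linD subX] by blast
  \<comment> \<open>\<open>R\<close> is a right inverse of \<open>D\<close> on the model of
    \<open>Y\<close>, extended to the whole Euclidean space by the projection.\<close>
  define R where "R w = g (?pY w)" for w
  have linR: "linear R" unfolding R_def using linear_compose[OF lin_proj(1)[OF subY] g(2)] by (simp add: comp_def)
  have DR: "D (R w) = ?pY w" for w
    unfolding R_def using g(3) ex[OF lin_proj(2)[OF subY]] by (metis imageI)
  define \<Phi> where "\<Phi> p = (fst p, ?f (fst p + R (snd p)) + (snd p - ?pY (snd p)))" for p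
  let ?W = "{p \<in> UNIV. fst p + R (snd p) \<in> W}"
  have L1: "linear (\<lambda>p::'b \<times> 'd. fst p + R (snd p))"
    using linear_compose_add[OF linear_fst linear_compose[OF linear_snd linR]] by (simp add: comp_def)
  have L2: "linear (\<lambda>p::'b \<times> 'd. snd p - ?pY (snd p))"
    using linear_compose_sub[OF linear_snd linear_compose[OF linear_snd lin_proj(1)[OF subY]]] by (simp add: comp_def)
  have oW: "open ?W" by (rule open_Cinf_vimage[OF open_UNIV Cinf_linear[OF L1] W(1)])
  have s\<Phi>: "Cinf ?W \<Phi>" unfolding \<Phi>_def
    by (intro Cinf_Pair Cinf_add Cinf_linear[OF linear_fst] Cinf_linear[OF L2]
        Cinf_compose[OF Cinf_linear[OF L1] W(3)]) auto
  have R0: "R 0 = 0" using linear_0[OF linR] .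
  have p0: "(?z0, 0) \<in> ?W" using R0 W(2) by simp
  have L1': "((\<lambda>p::'b \<times> 'd. fst p + R (snd p)) has_derivative (\<lambda>p. fst p + R (snd p))) (at q)" for q
    using L1 by (simp add: linear_conv_bounded_linear bounded_linear_imp_has_derivative)
  have L2': "((\<lambda>p::'b \<times> 'd. snd p - ?pY (snd p)) has_derivative (\<lambda>p. snd p - ?pY (snd p))) (at q)" for q
    using L2 by (simp add: linear_conv_bounded_linear bounded_linear_imp_has_derivative)
  have "((\<lambda>p. ?f (fst p + R (snd p))) has_derivative (\<lambda>p. D (fst p + R (snd p)))) (at (?z0, 0))"
    by (rule has_derivative_compose[OF L1', where g = ?f]) (use D R0 in simp)
  from has_derivative_Pair[OF has_derivative_fst[OF has_derivative_ident] has_derivative_add[OF this L2']]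
  have d\<Phi>: "(\<Phi> has_derivative (\<lambda>p. (fst p, D (fst p + R (snd p)) + (snd p - ?pY (snd p))))) (at (?z0, 0))"
    unfolding \<Phi>_def .
  \<comment> \<open>Since \<open>D (R w) = ?pY w\<close>, the projection terms cancel and the
    derivative of \<open>\<Phi>\<close> is triangular with identities on the diagonal.\<close>
  have e\<Phi>: "(\<lambda>p. (fst p, D (fst p + R (snd p)) + (snd p - ?pY (snd p)))) = (\<lambda>p. (fst p, D (fst p) + snd p))"
    by (auto simp: linear_add[OF linD] DR)
  have bij: "bij (\<lambda>p. (fst p, D (fst p) + snd p))"
    by (rule bij_betw_byWitness[where f' = "\<lambda>p. (fst p, snd p - D (fst p))"]) auto
  obtain U' V' \<Psi> where \<Psi>: "open U'" "U' \<subseteq> ?W" "(?z0, 0) \<in> U'" "open V'" "\<Phi> (?z0, 0) \<in> V'"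
      "homeomorphism U' V' \<Phi> \<Psi>" "Cinf V' \<Psi>"
    using Cinf_inverse_function[OF oW p0 s\<Phi> d\<Phi>[unfolded e\<Phi>] bij] by blast
  have \<Phi>0: "\<Phi> (z, 0) = (z, ?f z)" for z
    unfolding \<Phi>_def using R0 linear_0[OF lin_proj(1)[OF subY]] by simp
  have \<Psi>\<Phi>: "\<Psi> (\<Phi> p) = p" if "p \<in> U'" for p using \<Psi>(6) that unfolding homeomorphism_def by blast
  have \<Phi>\<Psi>: "\<Phi> (\<Psi> p) = p" if "p \<in> V'" for p using \<Psi>(6) that unfolding homeomorphism_def by blast
  \<comment> \<open>The corrected coordinate vector \<open>z + R w\<close>, with the correction
    \<open>w\<close> read off from the local inverse of \<open>\<Phi>\<close>.\<close>
  define G where "G p = fst p + R (snd (\<Psi> p))" for p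
  let ?q0 = "(?z0, \<psi> (F x0))"
  have q0: "\<Phi> (?z0, 0) = ?q0" using \<Phi>0 ci(1) by simp
  have q0V: "?q0 \<in> V'" using \<Psi>(5) q0 by simp
  have G0: "G ?q0 = ?z0" unfolding G_def q0[symmetric] \<Psi>\<Phi>[OF \<Psi>(3)] using q0 R0 by simp
  have "Cinf V' G" unfolding G_def
    by (intro Cinf_add Cinf_linear[OF linear_fst] Cinf_compose[OF \<Psi>(7) Cinf_linear[OF linear_compose[OF linear_snd linR], unfolded comp_def]]) auto
  then have sG: "smooth_at euclid euclid ?q0 G" unfolding smooth_at_euclid_iff using \<Psi>(4) q0V by blast
  let ?c = "\<lambda>p. (\<phi> (snd p), \<psi> (fst p))"
  have pts: "(F x0, x0) \<in> points Y \<times> points X" using smooth_at_points[OF F] by simp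
  have sc: "smooth_at (prod_mfd Y X) euclid (F x0, x0) ?c"
    unfolding prod_mfd_euclid[symmetric]
    by (rule smooth_at_Pair[OF YX E E];
        rule smooth_at_compose[OF YX _ E])
      (auto intro: X Y smooth_at_fst[OF Y X pts] smooth_at_snd[OF Y X pts] simp: smooth_at_chart[OF X U] smooth_at_chart[OF Y V])
  have sGc: "smooth_at (prod_mfd Y X) euclid (F x0, x0) (\<lambda>p. G (?c p))"
    by (rule smooth_at_compose[OF YX E E sc]) (use sG in simp)
  define \<sigma> where "\<sigma> p = chart_inv X U \<phi> (G (?c p))" for p
  have \<sigma>0: "\<sigma> (F x0, x0) = x0" unfolding \<sigma>_def using G0 ci(1) by simp
  have s\<sigma>: "smooth_at (prod_mfd Y X) X (F x0, x0) \<sigma>"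
    unfolding \<sigma>_def by (rule smooth_at_compose[OF YX E X sGc]) (use G0 ci(2) in simp)
  have sF\<sigma>: "smooth_at (prod_mfd Y X) Y (F x0, x0) (\<lambda>p. F (\<sigma> p))"
    by (rule smooth_at_compose[OF YX X Y s\<sigma>]) (use F \<sigma>0 in simp)
  have "\<forall>\<^sub>F p in nh (prod_mfd Y X) (F x0, x0). F (\<sigma> p) \<in> V"
    by (rule smooth_at_eventually_in[OF YX Y sF\<sigma> open_subset_chart[OF Y V(1)]]) (use V \<sigma>0 in simp)
  moreover have "\<forall>\<^sub>F p in nh (prod_mfd Y X) (F x0, x0). fst p \<in> V"
    by (rule smooth_at_eventually_in[OF YX Y smooth_at_fst[OF Y X pts] open_subset_chart[OF Y V(1)]]) (use V in simp)
  moreover have "\<forall>\<^sub>F p in nh (prod_mfd Y X) (F x0, x0). ?c p \<in> V'"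
    by (rule smooth_at_eventually_in[OF YX E sc]) (use \<Psi>(4) q0V in \<open>auto simp: open_subset_euclid\<close>)
  ultimately have "\<forall>\<^sub>F p in nh (prod_mfd Y X) (F x0, x0). F (\<sigma> p) = fst p"
  proof eventually_elim
    case (elim p)
    let ?w = "snd (\<Psi> (?c p))"
    have *: "\<Phi> (\<Psi> (?c p)) = ?c p" using \<Phi>\<Psi>[OF elim(3)] .
    then have "fst (\<Psi> (?c p)) = \<phi> (snd p)" unfolding \<Phi>_def by simp
    with * have "?f (\<phi> (snd p) + R ?w) + (?w - ?pY ?w) = \<psi> (fst p)"
      unfolding \<Phi>_def by simp
    then have 1: "\<psi> (F (\<sigma> p)) + (?w - ?pY ?w) = \<psi> (fst p)" unfolding \<sigma>_def G_def by simp
    \<comment> \<open>The surplus \<open>?w - ?pY ?w\<close> is a difference of coordinate vectors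
      of \<open>Y\<close>, hence lies in the model and is fixed by \<open>?pY\<close>. But
      \<open>?pY\<close> also annihilates it, so it is 0 and \<open>\<sigma> p\<close> lies exactly
      over \<open>fst p\<close>.\<close>
    have "\<psi> (F (\<sigma> p)) \<in> model Y" "\<psi> (fst p) \<in> model Y" using chart_inv(4)[OF Y V(1)] elim by auto
    with 1 have "?w - ?pY ?w \<in> model Y"
      using subspace_diff[OF subY] by (metis add_diff_cancel_left')
    then have "?w - ?pY ?w = ?pY (?w - ?pY ?w)" using lin_proj(3)[OF subY] by simp
    also have "\<dots> = 0"
      using linear_diff[OF lin_proj(1)[OF subY]] lin_proj(3)[OF subY lin_proj(2)[OF subY]] by simp
    finally have "\<psi> (F (\<sigma> p)) = \<psi> (fst p)" using 1 by simp
    then show ?case using inj_onD[OF smooth_manifoldD(2)[OF Y V(1)]] elim by blast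
  qed
  moreover have "\<forall>\<^sub>F x in nh X x0. \<sigma> (F x, x) = x"
  proof -
    have "smooth_at X (prod_mfd euclid euclid) x0 (\<lambda>x. (\<phi> x, 0::'d))"
      by (rule smooth_at_Pair[OF X E E smooth_at_chart[OF X U] smooth_at_const[OF X E x0]]) simp
    then have "smooth_at X euclid x0 (\<lambda>x. (\<phi> x, 0::'d))" by simp
    then have "\<forall>\<^sub>F x in nh X x0. (\<phi> x, 0) \<in> U'"
      by (rule smooth_at_eventually_in[OF X E]) (use \<Psi>(1,3) in \<open>auto simp: open_subset_euclid\<close>)
    moreover have "\<forall>\<^sub>F x in nh X x0. x \<in> U"
      by (rule eventually_nh_open[OF X open_subset_chart[OF X U(1)] U(2)])
    ultimately show ?thesis
    proof eventually_elim
      case (elim x)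
      have "?f (\<phi> x) = \<psi> (F x)" using chart_inv(1)[OF X U(1) elim(2)] by simp
      \<comment> \<open>A point already over the prescribed value needs no correction:
        \<open>\<Phi>\<close> sends \<open>(\<phi> x, 0)\<close> to the prescribed data, and
        \<open>\<Psi>\<close> inverts it there.\<close>
      then have "\<Psi> (\<phi> x, \<psi> (F x)) = (\<phi> x, 0)" using \<Psi>\<Phi>[OF elim(1)] \<Phi>0 by simp
      then have "G (\<phi> x, \<psi> (F x)) = \<phi> x" unfolding G_def using R0 by simp
      then show ?case unfolding \<sigma>_def using chart_inv(1)[OF X U(1) elim(2)] by simp
    qed
  qed
  ultimately show thesis using that s\<sigma> by blast
qed

text \<open>Correct \<open>\<beta>\<close> to \<open>\<sigma> (c \<tau>, \<beta> \<tau>)\<close>. In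
  the partial derivative along the base only the velocity of \<open>c\<close> enters, so
  \<open>c\<close> may be exchanged for the image of \<open>\<beta>\<close>; and a curve corrected
  towards its own image is unchanged.\<close>

lemma submersion_lift:
  assumes X: "smooth_manifold X" and Y: "smooth_manifold Y" and sub: "submersion X Y F"
    and b: "curve_at X x \<beta>" and c: "curve_at Y (F x) c"
    and eq: "velocity Y (\<lambda>\<tau>. F (\<beta> \<tau>)) = velocity Y c"
  obtains \<gamma> where "curve_at X x \<gamma>" "velocity X \<gamma> = velocity X \<beta>" "\<forall>\<^sub>F \<tau> in nhds 0. F (\<gamma> \<tau>) = c \<tau>"
proof -
  note YX = smooth_manifold_prod[OF Y X] and x = curve_at_points[OF b]
  obtain \<sigma> where s: "smooth_at (prod_mfd Y X) X (F x, x) \<sigma>"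
    and s1: "\<forall>\<^sub>F p in nh (prod_mfd Y X) (F x, x). F (\<sigma> p) = fst p"
    and s2: "\<forall>\<^sub>F x in nh X x. \<sigma> (F x, x) = x"
    using submersion_transversal[OF X Y sub x] by blast
  have F: "smooth_at X Y x F"
    using sub smooth_map_imp_smooth_at[OF open_subset_points[OF X] _ x] unfolding submersion_def by blast
  have \<sigma>0: "\<sigma> (F x, x) = x" by (rule eventually_nh_self[OF X x s2])
  have cb: "curve_at (prod_mfd Y X) (F x, x) (\<lambda>\<tau>. (c \<tau>, \<beta> \<tau>))" by (rule curve_at_Pair[OF Y X c b])
  have g: "curve_at X x (\<lambda>\<tau>. \<sigma> (c \<tau>, \<beta> \<tau>))" using curve_at_compose[OF YX X cb s] \<sigma>0 by simp
  have Fb: "curve_at Y (F x) (\<lambda>\<tau>. F (\<beta> \<tau>))" by (rule curve_at_compose[OF X Y b F])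
  have sx: "smooth_at Y X (F x) (\<lambda>y. \<sigma> (y, x))"
    by (rule smooth_at_compose[OF Y YX X smooth_at_Pair[OF Y Y X smooth_at_id[OF Y] smooth_at_const[OF Y X]]])
      (use s smooth_at_points[OF F] in auto)
  have "velocity X (\<lambda>\<tau>. \<sigma> (c \<tau>, x)) = velocity X (\<lambda>\<tau>. \<sigma> (F (\<beta> \<tau>), x))"
    using push_velocity[OF Y X sx c] push_velocity[OF Y X sx Fb] eq by simp
  then have "velocity X (\<lambda>\<tau>. \<sigma> (c \<tau>, \<beta> \<tau>)) = velocity X (\<lambda>\<tau>. \<sigma> (F (\<beta> \<tau>), \<beta> \<tau>))"
    unfolding velocity_split[OF Y X X s c b] velocity_split[OF Y X X s Fb b] by simp
  also have "\<dots> = velocity X \<beta>"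
  proof -
    have e: "\<forall>\<^sub>F \<tau> in nhds 0. \<beta> \<tau> = \<sigma> (F (\<beta> \<tau>), \<beta> \<tau>)"
      using eventually_curve[OF X b s2] by eventually_elim simp
    show ?thesis using curve_at_cong(2)[OF X b e] by simp
  qed
  finally have v: "velocity X (\<lambda>\<tau>. \<sigma> (c \<tau>, \<beta> \<tau>)) = velocity X \<beta>" .
  have "\<forall>\<^sub>F \<tau> in nhds 0. F (\<sigma> (c \<tau>, \<beta> \<tau>)) = c \<tau>"
    using eventually_curve[OF YX cb s1] by simp
  with g v show thesis by (rule that)
qed

section \<open>Coisotropic submanifolds of products\<close>

abbreviation inl_pullback where
  "inl_pullback X Y x y \<equiv> pullback (tangent_space X x) (differential X (points X) (prod_mfd X Y) (\<lambda>x'. (x', y)) x)"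

abbreviation inr_pullback where
  "inr_pullback X Y x y \<equiv> pullback (tangent_space Y y) (differential Y (points Y) (prod_mfd X Y) (\<lambda>y'. (x, y')) y)"

lemma smooth_at_slices:
  assumes X: "smooth_manifold X" and Y: "smooth_manifold Y" and x: "x \<in> points X" and y: "y \<in> points Y"
  shows "smooth_at X (prod_mfd X Y) x (\<lambda>x'. (x', y))" "smooth_at Y (prod_mfd X Y) y (\<lambda>y'. (x, y'))"
  using smooth_at_Pair[OF X X Y smooth_at_id[OF X x] smooth_at_const[OF X Y x y]]
    smooth_at_Pair[OF Y X Y smooth_at_const[OF Y X y x] smooth_at_id[OF Y y]] by auto

lemma push_pullback_in_dual:
  assumes X: "smooth_manifold X" and Y: "smooth_manifold Y" and F: "smooth_at X Y x F"
    and \<xi>: "\<xi> \<in> dual (tangent_space Y (F x))"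
  shows "pullback (tangent_space X x) (push Y F x) \<xi> \<in> dual (tangent_space X x)"
  by (rule pullback_in_dual[OF linear_closed_tangent_space[OF X] \<xi> push_in_tangent_space[OF X Y F] push_combination])

lemma push_pullback_velocity:
  assumes X: "smooth_manifold X" and Y: "smooth_manifold Y" and F: "smooth_at X Y x F" and c: "curve_at X x c"
  shows "pullback (tangent_space X x) (push Y F x) \<xi> (velocity X c) = \<xi> (velocity Y (\<lambda>\<tau>. F (c \<tau>)))"
  unfolding pullback_def using velocity_in_tangent_space[OF X c] push_velocity[OF X Y F c] by simp

lemma differential_pullback:
  assumes X: "smooth_manifold X" and Y: "smooth_manifold Y" and F: "smooth_at X Y x F"
  shows "pullback (tangent_space X x) (differential X (points X) Y F x) = pullback (tangent_space X x) (push Y F x)"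
  unfolding pullback_def using differential_points[OF X Y F] by (intro ext) simp

lemma slice_pullbacks:
  assumes X: "smooth_manifold X" and Y: "smooth_manifold Y" and x: "x \<in> points X" and y: "y \<in> points Y"
    and \<xi>: "\<xi> \<in> dual (tangent_space (prod_mfd X Y) (x, y))"
  shows "inl_pullback X Y x y \<xi> \<in> dual (tangent_space X x)"
    and "inr_pullback X Y x y \<xi> \<in> dual (tangent_space Y y)"
    and "\<And>c1 c2. curve_at X x c1 \<Longrightarrow> curve_at Y y c2 \<Longrightarrow> \<xi> (velocity (prod_mfd X Y) (\<lambda>\<tau>. (c1 \<tau>, c2 \<tau>))) =
      inl_pullback X Y x y \<xi> (velocity X c1) + inr_pullback X Y x y \<xi> (velocity Y c2)"
proof -
  note XY = smooth_manifold_prod[OF X Y] and sl = smooth_at_slices[OF X Y x y]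
  note d1 = differential_pullback[OF X XY sl(1)] and d2 = differential_pullback[OF Y XY sl(2)]
  show "inl_pullback X Y x y \<xi> \<in> dual (tangent_space X x)"
    unfolding d1 by (rule push_pullback_in_dual[OF X XY sl(1)]) (use \<xi> in simp)
  show "inr_pullback X Y x y \<xi> \<in> dual (tangent_space Y y)"
    unfolding d2 by (rule push_pullback_in_dual[OF Y XY sl(2)]) (use \<xi> in simp)
  fix c1 c2 assume c: "curve_at X x c1" "curve_at Y y c2"
  have "velocity (prod_mfd X Y) (\<lambda>\<tau>. (c1 \<tau>, y)) \<in> tangent_space (prod_mfd X Y) (x, y)"
    "velocity (prod_mfd X Y) (\<lambda>\<tau>. (x, c2 \<tau>)) \<in> tangent_space (prod_mfd X Y) (x, y)"
    using velocity_in_tangent_space[OF XY] curve_at_Pair[OF X Y c(1) curve_at_const[OF Y y]]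
      curve_at_Pair[OF X Y curve_at_const[OF X x] c(2)] by blast+
  then show "\<xi> (velocity (prod_mfd X Y) (\<lambda>\<tau>. (c1 \<tau>, c2 \<tau>))) =
      inl_pullback X Y x y \<xi> (velocity X c1) + inr_pullback X Y x y \<xi> (velocity Y c2)"
    unfolding velocity_Pair[OF X Y c] d1 d2 push_pullback_velocity[OF X XY sl(1) c(1)]
      push_pullback_velocity[OF Y XY sl(2) c(2)]
    by (rule dual_add[OF \<xi>])
qed

text \<open>The inverse of the splitting in \<open>slice_pullbacks\<close>: pull
  \<open>\<alpha>\<close> and \<open>\<beta>\<close> back along the two projections and add.\<close>

lemma slice_pullbacks_surj:
  assumes X: "smooth_manifold X" and Y: "smooth_manifold Y" and x: "x \<in> points X" and y: "y \<in> points Y"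
    and \<alpha>: "\<alpha> \<in> dual (tangent_space X x)" and \<beta>: "\<beta> \<in> dual (tangent_space Y y)"
  shows "\<exists>\<xi>\<in>dual (tangent_space (prod_mfd X Y) (x, y)). inl_pullback X Y x y \<xi> = \<alpha> \<and> inr_pullback X Y x y \<xi> = \<beta>"
proof -
  note XY = smooth_manifold_prod[OF X Y] and sl = smooth_at_slices[OF X Y x y]
  note d1 = differential_pullback[OF X XY sl(1)] and d2 = differential_pullback[OF Y XY sl(2)]
  have p: "(x, y) \<in> points X \<times> points Y" using x y by simp
  let ?T = "tangent_space (prod_mfd X Y) (x, y)"
  let ?\<alpha> = "pullback ?T (push X fst (x, y)) \<alpha>" and ?\<beta> = "pullback ?T (push Y snd (x, y)) \<beta>"
  define \<xi> where "\<xi> v = 1 * ?\<alpha> v + 1 * ?\<beta> v" for v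
  have f: "smooth_at (prod_mfd X Y) X (x, y) fst" and s: "smooth_at (prod_mfd X Y) Y (x, y) snd"
    using smooth_at_fst[OF X Y p] smooth_at_snd[OF X Y p] by auto
  have "\<xi> \<in> dual ?T" unfolding \<xi>_def
    by (intro dual_combination linear_closed_tangent_space[OF XY] push_pullback_in_dual[OF XY X f]
        push_pullback_in_dual[OF XY Y s]) (use \<alpha> \<beta> in auto)
  have z\<alpha>: "\<alpha> (\<lambda>f. 0) = 0" using dual_zero[OF \<alpha> tangent_space_zero[OF X x]] .
  have z\<beta>: "\<beta> (\<lambda>f. 0) = 0" using dual_zero[OF \<beta> tangent_space_zero[OF Y y]] .
  have v: "\<xi> (velocity (prod_mfd X Y) (\<lambda>\<tau>. (c1 \<tau>, c2 \<tau>))) = \<alpha> (velocity X c1) + \<beta> (velocity Y c2)"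
    if c: "curve_at X x c1" "curve_at Y y c2" for c1 c2
    unfolding \<xi>_def push_pullback_velocity[OF XY X f curve_at_Pair[OF X Y c]]
      push_pullback_velocity[OF XY Y s curve_at_Pair[OF X Y c]] by simp
  have "inl_pullback X Y x y \<xi> = \<alpha>"
  proof
    fix v show "inl_pullback X Y x y \<xi> v = \<alpha> v"
    proof (cases "v \<in> tangent_space X x")
      case True
      then obtain c where c: "curve_at X x c" "v = velocity X c" unfolding tangent_space_iff[OF X] by blast
      then show ?thesis unfolding d1 c(2) push_pullback_velocity[OF X XY sl(1) c(1)]
        using v[OF c(1) curve_at_const[OF Y y]] velocity_const z\<beta> by simp
    next
      case False
      then show ?thesis using dualD(2)[OF \<alpha>] unfolding pullback_def by simp
    qed
  qed
  moreover have "inr_pullback X Y x y \<xi> = \<beta>"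
  proof
    fix v show "inr_pullback X Y x y \<xi> v = \<beta> v"
    proof (cases "v \<in> tangent_space Y y")
      case True
      then obtain c where c: "curve_at Y y c" "v = velocity Y c" unfolding tangent_space_iff[OF Y] by blast
      then show ?thesis unfolding d2 c(2) push_pullback_velocity[OF Y XY sl(2) c(1)]
        using v[OF curve_at_const[OF X x] c(1)] velocity_const z\<alpha> by simp
    next
      case False
      then show ?thesis using dualD(2)[OF \<beta>] unfolding pullback_def by simp
    qed
  qed
  ultimately show ?thesis using \<open>\<xi> \<in> dual ?T\<close> by blast
qed

lemma slice_pullbacks_list_surj:
  assumes X: "smooth_manifold X" and Y: "smooth_manifold Y" and x: "x \<in> points X" and y: "y \<in> points Y"
    and \<alpha>: "set \<alpha>s \<subseteq> dual (tangent_space X x)" and \<beta>: "set \<beta>s \<subseteq> dual (tangent_space Y y)"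
    and len: "length \<alpha>s = k" "length \<beta>s = k"
  obtains \<xi>s where "length \<xi>s = k" "set \<xi>s \<subseteq> dual (tangent_space (prod_mfd X Y) (x, y))"
    "map (inl_pullback X Y x y) \<xi>s = \<alpha>s" "map (inr_pullback X Y x y) \<xi>s = \<beta>s"
proof -
  have "\<forall>i<k. \<exists>\<xi>. \<xi> \<in> dual (tangent_space (prod_mfd X Y) (x, y)) \<and>
      inl_pullback X Y x y \<xi> = \<alpha>s ! i \<and> inr_pullback X Y x y \<xi> = \<beta>s ! i"
  proof (intro allI impI)
    fix i assume "i < k"
    then have "\<alpha>s ! i \<in> dual (tangent_space X x)" "\<beta>s ! i \<in> dual (tangent_space Y y)"
      using \<alpha> \<beta> len by (auto dest: nth_mem)
    from slice_pullbacks_surj[OF X Y x y this]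
    show "\<exists>\<xi>. \<xi> \<in> dual (tangent_space (prod_mfd X Y) (x, y)) \<and>
      inl_pullback X Y x y \<xi> = \<alpha>s ! i \<and> inr_pullback X Y x y \<xi> = \<beta>s ! i" by blast
  qed
  then obtain \<xi>s where "length \<xi>s = k" "\<forall>i<k. \<xi>s ! i \<in> dual (tangent_space (prod_mfd X Y) (x, y)) \<and>
      inl_pullback X Y x y (\<xi>s ! i) = \<alpha>s ! i \<and> inr_pullback X Y x y (\<xi>s ! i) = \<beta>s ! i"
    unfolding Skolem_list_nth by blast
  with len show thesis
    by (intro that[of \<xi>s]) (auto simp: in_set_conv_nth intro!: nth_equalityI)
qed

lemma sum_field_apply:
  "sum_field X Y P Q (x, y) \<xi>s = P x (map (inl_pullback X Y x y) \<xi>s) + Q y (map (inr_pullback X Y x y) \<xi>s)"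
  unfolding sum_field_def pushforward_def by simp

text \<open>Covectors of a product correspond to pairs of covectors of the factors, and a curve in
  \<open>S\<close> is a pair of curves. Afterwards neither tangent spaces of products nor slice
  inclusions have to be handled.\<close>

lemma coisotropic_prod2:
  fixes X :: "('a, 'e::euclidean_space) mfd" and Y :: "('b, 'f::euclidean_space) mfd"
  assumes X: "smooth_manifold X" and Y: "smooth_manifold Y" and S: "S \<subseteq> points X \<times> points Y"
  shows "coisotropic (prod_mfd X Y) k (sum_field X Y P Q) S \<longleftrightarrow>
    (\<forall>x y \<alpha>s \<beta>s. (x, y) \<in> S \<and> length \<alpha>s = k \<and> length \<beta>s = k \<and>
       set \<alpha>s \<subseteq> dual (tangent_space X x) \<and> set \<beta>s \<subseteq> dual (tangent_space Y y) \<and>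
       (\<forall>i<k. \<forall>c1 c2. curve_at X x c1 \<and> curve_at Y y c2 \<and> (\<forall>\<^sub>F \<tau> in nhds 0. (c1 \<tau>, c2 \<tau>) \<in> S) \<longrightarrow>
          (\<alpha>s ! i) (velocity X c1) + (\<beta>s ! i) (velocity Y c2) = 0) \<longrightarrow>
       P x \<alpha>s + Q y \<beta>s = 0)" (is "?L \<longleftrightarrow> ?R")
proof -
  note XY = smooth_manifold_prod[OF X Y]
  have key: "(\<forall>\<xi>\<in>set \<xi>s. \<forall>v\<in>tangent (prod_mfd X Y) S (x, y). \<xi> v = 0) \<longleftrightarrow>
      (\<forall>i<k. \<forall>c1 c2. curve_at X x c1 \<and> curve_at Y y c2 \<and> (\<forall>\<^sub>F \<tau> in nhds 0. (c1 \<tau>, c2 \<tau>) \<in> S) \<longrightarrow>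
          (map (inl_pullback X Y x y) \<xi>s ! i) (velocity X c1) + (map (inr_pullback X Y x y) \<xi>s ! i) (velocity Y c2) = 0)"
    (is "?A \<longleftrightarrow> ?B")
    if xy: "(x, y) \<in> S" and \<xi>s: "length \<xi>s = k" "set \<xi>s \<subseteq> dual (tangent_space (prod_mfd X Y) (x, y))" for x y \<xi>s
  proof -
    have p: "x \<in> points X" "y \<in> points Y" using xy S by auto
    have e: "(map (inl_pullback X Y x y) \<xi>s ! i) (velocity X c1) + (map (inr_pullback X Y x y) \<xi>s ! i) (velocity Y c2)
        = (\<xi>s ! i) (velocity (prod_mfd X Y) (\<lambda>\<tau>. (c1 \<tau>, c2 \<tau>)))"
      if "i < k" "curve_at X x c1" "curve_at Y y c2" for i c1 c2
    proof -
      have "\<xi>s ! i \<in> dual (tangent_space (prod_mfd X Y) (x, y))" using \<xi>s that(1) nth_mem by blast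
      from slice_pullbacks(3)[OF X Y p this that(2,3)] show ?thesis using \<xi>s(1) that(1) by simp
    qed
    show ?thesis
    proof
      assume A: ?A
      show ?B
      proof (intro allI impI, elim conjE)
        fix i c1 c2 assume i: "i < k" and c: "curve_at X x c1" "curve_at Y y c2" "\<forall>\<^sub>F \<tau> in nhds 0. (c1 \<tau>, c2 \<tau>) \<in> S"
        have "velocity (prod_mfd X Y) (\<lambda>\<tau>. (c1 \<tau>, c2 \<tau>)) \<in> tangent (prod_mfd X Y) S (x, y)"
          using tangent_iff[OF XY, of "velocity (prod_mfd X Y) (\<lambda>\<tau>. (c1 \<tau>, c2 \<tau>))" S "(x, y)"]
            curve_at_Pair[OF X Y c(1,2)] c(3) by auto
        moreover have "\<xi>s ! i \<in> set \<xi>s" using i \<xi>s(1) by simp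
        ultimately show "(map (inl_pullback X Y x y) \<xi>s ! i) (velocity X c1) + (map (inr_pullback X Y x y) \<xi>s ! i) (velocity Y c2) = 0"
          unfolding e[OF i c(1,2)] using A by simp
      qed
    next
      assume B: ?B
      show ?A
      proof -
        have *: "(\<xi>s ! i) (velocity (prod_mfd X Y) c) = 0"
          if i: "i < k" and c: "curve_at (prod_mfd X Y) (x, y) c" "\<forall>\<^sub>F \<tau> in nhds 0. c \<tau> \<in> S" for i c
        proof -
          note cc = curve_at_fst_snd[OF X Y c(1)]
          have "\<forall>\<^sub>F \<tau> in nhds 0. (fst (c \<tau>), snd (c \<tau>)) \<in> S" using c(2) by simp
          with cc have "curve_at X x (\<lambda>\<tau>. fst (c \<tau>)) \<and> curve_at Y y (\<lambda>\<tau>. snd (c \<tau>)) \<and>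
            (\<forall>\<^sub>F \<tau> in nhds 0. (fst (c \<tau>), snd (c \<tau>)) \<in> S)" by blast
          with B i have "(map (inl_pullback X Y x y) \<xi>s ! i) (velocity X (\<lambda>\<tau>. fst (c \<tau>))) +
              (map (inr_pullback X Y x y) \<xi>s ! i) (velocity Y (\<lambda>\<tau>. snd (c \<tau>))) = 0" by blast
          then have "(\<xi>s ! i) (velocity (prod_mfd X Y) (\<lambda>\<tau>. (fst (c \<tau>), snd (c \<tau>)))) = 0"
            unfolding e[OF i cc] .
          then show ?thesis by simp
        qed
        show ?thesis
          using * \<xi>s(1) by (auto simp: tangent_iff[OF XY] in_set_conv_nth)
      qed
    qed
  qed
  show ?thesis
  proof
    assume L: ?L
    show ?R
    proof (intro allI impI, elim conjE)
      fix x y \<alpha>s \<beta>s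
      assume xy: "(x, y) \<in> S" and len: "length \<alpha>s = k" "length \<beta>s = k"
        and d: "set \<alpha>s \<subseteq> dual (tangent_space X x)" "set \<beta>s \<subseteq> dual (tangent_space Y y)"
        and con: "\<forall>i<k. \<forall>c1 c2. curve_at X x c1 \<and> curve_at Y y c2 \<and> (\<forall>\<^sub>F \<tau> in nhds 0. (c1 \<tau>, c2 \<tau>) \<in> S) \<longrightarrow>
          (\<alpha>s ! i) (velocity X c1) + (\<beta>s ! i) (velocity Y c2) = 0"
      have p: "x \<in> points X" "y \<in> points Y" using xy S by auto
      obtain \<xi>s where \<xi>s: "length \<xi>s = k" "set \<xi>s \<subseteq> dual (tangent_space (prod_mfd X Y) (x, y))"
        "map (inl_pullback X Y x y) \<xi>s = \<alpha>s" "map (inr_pullback X Y x y) \<xi>s = \<beta>s"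
        by (rule slice_pullbacks_list_surj[OF X Y p d len])
      have "\<forall>\<xi>\<in>set \<xi>s. \<forall>v\<in>tangent (prod_mfd X Y) S (x, y). \<xi> v = 0"
        unfolding key[OF xy \<xi>s(1,2)] \<xi>s(3,4) by (rule con)
      then have "sum_field X Y P Q (x, y) \<xi>s = 0" using L xy \<xi>s(1,2) unfolding coisotropic_def by blast
      then show "P x \<alpha>s + Q y \<beta>s = 0" unfolding sum_field_apply \<xi>s(3,4) .
    qed
  next
    assume R: ?R
    show ?L unfolding coisotropic_def
    proof (intro ballI allI impI, elim conjE)
      fix p \<xi>s assume p: "p \<in> S" and \<xi>s: "length \<xi>s = k" "set \<xi>s \<subseteq> dual (tangent_space (prod_mfd X Y) p)"
        and con: "\<forall>\<xi>\<in>set \<xi>s. \<forall>v\<in>tangent (prod_mfd X Y) S p. \<xi> v = 0"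
      obtain x y where xy: "p = (x, y)" by force
      have pp: "x \<in> points X" "y \<in> points Y" using p S xy by auto
      note k = key[OF p[unfolded xy] \<xi>s[unfolded xy]]
      have "set (map (inl_pullback X Y x y) \<xi>s) \<subseteq> dual (tangent_space X x)"
        "set (map (inr_pullback X Y x y) \<xi>s) \<subseteq> dual (tangent_space Y y)"
        using slice_pullbacks(1,2)[OF X Y pp] \<xi>s(2) xy by auto
      moreover have "length (map (inl_pullback X Y x y) \<xi>s) = k" "length (map (inr_pullback X Y x y) \<xi>s) = k"
        using \<xi>s(1) by simp_all
      ultimately show "sum_field X Y P Q p \<xi>s = 0"
        unfolding xy sum_field_apply using R[rule_format, of x y "map (inl_pullback X Y x y) \<xi>s" "map (inr_pullback X Y x y) \<xi>s"]
          con[unfolded xy k] p[unfolded xy] by blast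
    qed
  qed
qed

lemma slice_pullbacks_lists:
  assumes X: "smooth_manifold X" and Y: "smooth_manifold Y" and x: "x \<in> points X" and y: "y \<in> points Y"
    and \<xi>s: "length \<xi>s = k" "set \<xi>s \<subseteq> dual (tangent_space (prod_mfd X Y) (x, y))"
  shows "length (map (inl_pullback X Y x y) \<xi>s) = k" "set (map (inl_pullback X Y x y) \<xi>s) \<subseteq> dual (tangent_space X x)"
    and "length (map (inr_pullback X Y x y) \<xi>s) = k" "set (map (inr_pullback X Y x y) \<xi>s) \<subseteq> dual (tangent_space Y y)"
    and "\<And>i c1 c2. i < k \<Longrightarrow> curve_at X x c1 \<Longrightarrow> curve_at Y y c2 \<Longrightarrow>
      (\<xi>s ! i) (velocity (prod_mfd X Y) (\<lambda>\<tau>. (c1 \<tau>, c2 \<tau>))) =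
      (map (inl_pullback X Y x y) \<xi>s ! i) (velocity X c1) + (map (inr_pullback X Y x y) \<xi>s ! i) (velocity Y c2)"
proof -
  show "length (map (inl_pullback X Y x y) \<xi>s) = k" "length (map (inr_pullback X Y x y) \<xi>s) = k"
    using \<xi>s(1) by simp_all
  show "set (map (inl_pullback X Y x y) \<xi>s) \<subseteq> dual (tangent_space X x)"
    "set (map (inr_pullback X Y x y) \<xi>s) \<subseteq> dual (tangent_space Y y)"
    using slice_pullbacks(1,2)[OF X Y x y] \<xi>s(2) by auto
  fix i c1 c2 assume i: "i < k" and c: "curve_at X x c1" "curve_at Y y c2"
  have "\<xi>s ! i \<in> dual (tangent_space (prod_mfd X Y) (x, y))" using \<xi>s i nth_mem by blast
  from slice_pullbacks(3)[OF X Y x y this c] show "(\<xi>s ! i) (velocity (prod_mfd X Y) (\<lambda>\<tau>. (c1 \<tau>, c2 \<tau>))) =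
      (map (inl_pullback X Y x y) \<xi>s ! i) (velocity X c1) + (map (inr_pullback X Y x y) \<xi>s ! i) (velocity Y c2)"
    using \<xi>s(1) i by simp
qed

text \<open>The two-factor criterion with second factor \<open>Y \<times> Z\<close>, whose covectors
  and curves are split once more.\<close>

lemma coisotropic_prod3:
  fixes X :: "('a, 'e::euclidean_space) mfd" and Y :: "('b, 'f::euclidean_space) mfd" and Z :: "('c, 'h::euclidean_space) mfd"
  assumes X: "smooth_manifold X" and Y: "smooth_manifold Y" and Z: "smooth_manifold Z"
    and S: "S \<subseteq> points X \<times> (points Y \<times> points Z)"
  shows "coisotropic (prod_mfd X (prod_mfd Y Z)) k (sum_field X (prod_mfd Y Z) P (sum_field Y Z Q R)) S \<longleftrightarrow>
    (\<forall>x y z \<alpha>s \<beta>s \<gamma>s. (x, y, z) \<in> S \<and> length \<alpha>s = k \<and> length \<beta>s = k \<and> length \<gamma>s = k \<and>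
       set \<alpha>s \<subseteq> dual (tangent_space X x) \<and> set \<beta>s \<subseteq> dual (tangent_space Y y) \<and> set \<gamma>s \<subseteq> dual (tangent_space Z z) \<and>
       (\<forall>i<k. \<forall>c1 c2 c3. curve_at X x c1 \<and> curve_at Y y c2 \<and> curve_at Z z c3 \<and>
            (\<forall>\<^sub>F \<tau> in nhds 0. (c1 \<tau>, c2 \<tau>, c3 \<tau>) \<in> S) \<longrightarrow>
          (\<alpha>s ! i) (velocity X c1) + (\<beta>s ! i) (velocity Y c2) + (\<gamma>s ! i) (velocity Z c3) = 0) \<longrightarrow>
       P x \<alpha>s + Q y \<beta>s + R z \<gamma>s = 0)" (is "?L \<longleftrightarrow> ?R")
proof -
  note YZ = smooth_manifold_prod[OF Y Z]
  have S': "S \<subseteq> points X \<times> points (prod_mfd Y Z)" using S by simp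
  note two = coisotropic_prod2[OF X YZ S', of k P "sum_field Y Z Q R"]
  show ?thesis
  proof
    assume L: ?L
    show ?R
    proof (intro allI impI, elim conjE)
      fix x y z \<alpha>s \<beta>s \<gamma>s
      assume xyz: "(x, y, z) \<in> S" and len: "length \<alpha>s = k" "length \<beta>s = k" "length \<gamma>s = k"
        and d: "set \<alpha>s \<subseteq> dual (tangent_space X x)" "set \<beta>s \<subseteq> dual (tangent_space Y y)" "set \<gamma>s \<subseteq> dual (tangent_space Z z)"
        and con: "\<forall>i<k. \<forall>c1 c2 c3. curve_at X x c1 \<and> curve_at Y y c2 \<and> curve_at Z z c3 \<and>
            (\<forall>\<^sub>F \<tau> in nhds 0. (c1 \<tau>, c2 \<tau>, c3 \<tau>) \<in> S) \<longrightarrow>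
          (\<alpha>s ! i) (velocity X c1) + (\<beta>s ! i) (velocity Y c2) + (\<gamma>s ! i) (velocity Z c3) = 0"
      have p: "x \<in> points X" "y \<in> points Y" "z \<in> points Z" using xyz S by auto
      obtain \<xi>s where \<xi>s: "length \<xi>s = k" "set \<xi>s \<subseteq> dual (tangent_space (prod_mfd Y Z) (y, z))"
        "map (inl_pullback Y Z y z) \<xi>s = \<beta>s" "map (inr_pullback Y Z y z) \<xi>s = \<gamma>s"
        by (rule slice_pullbacks_list_surj[OF Y Z p(2,3) d(2,3) len(2,3)])
      note e = slice_pullbacks_lists(5)[OF Y Z p(2,3) \<xi>s(1,2), unfolded \<xi>s(3,4)]
      have "\<forall>i<k. \<forall>c1 c2. curve_at X x c1 \<and> curve_at (prod_mfd Y Z) (y, z) c2 \<and> (\<forall>\<^sub>F \<tau> in nhds 0. (c1 \<tau>, c2 \<tau>) \<in> S) \<longrightarrow>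
          (\<alpha>s ! i) (velocity X c1) + (\<xi>s ! i) (velocity (prod_mfd Y Z) c2) = 0"
      proof (intro allI impI, elim conjE)
        fix i c1 c2 assume i: "i < k" and c: "curve_at X x c1" "curve_at (prod_mfd Y Z) (y, z) c2" "\<forall>\<^sub>F \<tau> in nhds 0. (c1 \<tau>, c2 \<tau>) \<in> S"
        note cc = curve_at_fst_snd[OF Y Z c(2)]
        have "\<forall>\<^sub>F \<tau> in nhds 0. (c1 \<tau>, fst (c2 \<tau>), snd (c2 \<tau>)) \<in> S" using c(3) by simp
        then show "(\<alpha>s ! i) (velocity X c1) + (\<xi>s ! i) (velocity (prod_mfd Y Z) c2) = 0"
          using con[rule_format, OF i, of c1 "\<lambda>\<tau>. fst (c2 \<tau>)" "\<lambda>\<tau>. snd (c2 \<tau>)"] c(1) cc e[OF i cc] by simp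
      qed
      then have "P x \<alpha>s + sum_field Y Z Q R (y, z) \<xi>s = 0"
        using L[unfolded two, rule_format, of x "(y, z)" \<alpha>s \<xi>s] xyz len(1) d(1) \<xi>s(1,2) by blast
      then show "P x \<alpha>s + Q y \<beta>s + R z \<gamma>s = 0" unfolding sum_field_apply \<xi>s(3,4) by simp
    qed
  next
    assume R: ?R
    show ?L unfolding two
    proof (intro allI impI, elim conjE)
      fix x p \<alpha>s \<xi>s
      assume xp: "(x, p) \<in> S" and len: "length \<alpha>s = k" and \<xi>s: "length \<xi>s = k"
        and d: "set \<alpha>s \<subseteq> dual (tangent_space X x)" and \<xi>d: "set \<xi>s \<subseteq> dual (tangent_space (prod_mfd Y Z) p)"
        and con: "\<forall>i<k. \<forall>c1 c2. curve_at X x c1 \<and> curve_at (prod_mfd Y Z) p c2 \<and> (\<forall>\<^sub>F \<tau> in nhds 0. (c1 \<tau>, c2 \<tau>) \<in> S) \<longrightarrow>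
          (\<alpha>s ! i) (velocity X c1) + (\<xi>s ! i) (velocity (prod_mfd Y Z) c2) = 0"
      obtain y z where yz: "p = (y, z)" by force
      have p: "x \<in> points X" "y \<in> points Y" "z \<in> points Z" using xp yz S by auto
      note l = slice_pullbacks_lists[OF Y Z p(2,3) \<xi>s \<xi>d[unfolded yz]]
      let ?\<beta> = "map (inl_pullback Y Z y z) \<xi>s" and ?\<gamma> = "map (inr_pullback Y Z y z) \<xi>s"
      have c: "\<forall>i<k. \<forall>c1 c2 c3. curve_at X x c1 \<and> curve_at Y y c2 \<and> curve_at Z z c3 \<and>
            (\<forall>\<^sub>F \<tau> in nhds 0. (c1 \<tau>, c2 \<tau>, c3 \<tau>) \<in> S) \<longrightarrow>
          (\<alpha>s ! i) (velocity X c1) + (?\<beta> ! i) (velocity Y c2) + (?\<gamma> ! i) (velocity Z c3) = 0"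
      proof (intro allI impI, elim conjE)
        fix i c1 c2 c3 assume i: "i < k" and c: "curve_at X x c1" "curve_at Y y c2" "curve_at Z z c3"
          "\<forall>\<^sub>F \<tau> in nhds 0. (c1 \<tau>, c2 \<tau>, c3 \<tau>) \<in> S"
        have "(\<alpha>s ! i) (velocity X c1) + (\<xi>s ! i) (velocity (prod_mfd Y Z) (\<lambda>\<tau>. (c2 \<tau>, c3 \<tau>))) = 0"
          by (rule con[rule_format, OF i]) (use c curve_at_Pair[OF Y Z c(2,3)] yz in simp)
        then show "(\<alpha>s ! i) (velocity X c1) + (?\<beta> ! i) (velocity Y c2) + (?\<gamma> ! i) (velocity Z c3) = 0"
          unfolding l(5)[OF i c(2,3)] by (simp only: add.assoc)
      qed
      have "P x \<alpha>s + Q y ?\<beta> + R z ?\<gamma> = 0"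
        using R[rule_format, of x y z \<alpha>s ?\<beta> ?\<gamma>] c xp yz len d l(1-4) by blast
      then show "P x \<alpha>s + sum_field Y Z Q R p \<xi>s = 0" unfolding yz sum_field_apply by (simp only: add.assoc)
    qed
  qed
qed

text \<open>The last covector of the three-factor criterion is split in the same way.\<close>

lemma coisotropic_prod4:
  fixes X :: "('a, 'e::euclidean_space) mfd" and Y :: "('b, 'f::euclidean_space) mfd" and Z :: "('c, 'h::euclidean_space) mfd"
    and V :: "('d, 'i::euclidean_space) mfd"
  assumes X: "smooth_manifold X" and Y: "smooth_manifold Y" and Z: "smooth_manifold Z" and V: "smooth_manifold V"
    and S: "S \<subseteq> points X \<times> (points Y \<times> (points Z \<times> points V))"
  shows "coisotropic (prod_mfd X (prod_mfd Y (prod_mfd Z V))) k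
      (sum_field X (prod_mfd Y (prod_mfd Z V)) P (sum_field Y (prod_mfd Z V) Q (sum_field Z V R N))) S \<longleftrightarrow>
    (\<forall>x y z w \<alpha>s \<beta>s \<gamma>s \<delta>s. (x, y, z, w) \<in> S \<and> length \<alpha>s = k \<and> length \<beta>s = k \<and> length \<gamma>s = k \<and> length \<delta>s = k \<and>
       set \<alpha>s \<subseteq> dual (tangent_space X x) \<and> set \<beta>s \<subseteq> dual (tangent_space Y y) \<and>
       set \<gamma>s \<subseteq> dual (tangent_space Z z) \<and> set \<delta>s \<subseteq> dual (tangent_space V w) \<and>
       (\<forall>i<k. \<forall>c1 c2 c3 c4. curve_at X x c1 \<and> curve_at Y y c2 \<and> curve_at Z z c3 \<and> curve_at V w c4 \<and>
            (\<forall>\<^sub>F \<tau> in nhds 0. (c1 \<tau>, c2 \<tau>, c3 \<tau>, c4 \<tau>) \<in> S) \<longrightarrow>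
          (\<alpha>s ! i) (velocity X c1) + (\<beta>s ! i) (velocity Y c2) + (\<gamma>s ! i) (velocity Z c3) + (\<delta>s ! i) (velocity V c4) = 0) \<longrightarrow>
       P x \<alpha>s + Q y \<beta>s + R z \<gamma>s + N w \<delta>s = 0)" (is "?L \<longleftrightarrow> ?R")
proof -
  note ZV = smooth_manifold_prod[OF Z V]
  have S': "S \<subseteq> points X \<times> (points Y \<times> points (prod_mfd Z V))" using S by simp
  note three = coisotropic_prod3[OF X Y ZV S', of k P Q "sum_field Z V R N"]
  show ?thesis
  proof
    assume L: ?L
    show ?R
    proof (intro allI impI, elim conjE)
      fix x y z w \<alpha>s \<beta>s \<gamma>s \<delta>s
      assume xyz: "(x, y, z, w) \<in> S" and len: "length \<alpha>s = k" "length \<beta>s = k" "length \<gamma>s = k" "length \<delta>s = k"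
        and d: "set \<alpha>s \<subseteq> dual (tangent_space X x)" "set \<beta>s \<subseteq> dual (tangent_space Y y)"
          "set \<gamma>s \<subseteq> dual (tangent_space Z z)" "set \<delta>s \<subseteq> dual (tangent_space V w)"
        and con: "\<forall>i<k. \<forall>c1 c2 c3 c4. curve_at X x c1 \<and> curve_at Y y c2 \<and> curve_at Z z c3 \<and> curve_at V w c4 \<and>
            (\<forall>\<^sub>F \<tau> in nhds 0. (c1 \<tau>, c2 \<tau>, c3 \<tau>, c4 \<tau>) \<in> S) \<longrightarrow>
          (\<alpha>s ! i) (velocity X c1) + (\<beta>s ! i) (velocity Y c2) + (\<gamma>s ! i) (velocity Z c3) + (\<delta>s ! i) (velocity V c4) = 0"
      have p: "z \<in> points Z" "w \<in> points V" using xyz S by auto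
      obtain \<xi>s where \<xi>s: "length \<xi>s = k" "set \<xi>s \<subseteq> dual (tangent_space (prod_mfd Z V) (z, w))"
        "map (inl_pullback Z V z w) \<xi>s = \<gamma>s" "map (inr_pullback Z V z w) \<xi>s = \<delta>s"
        by (rule slice_pullbacks_list_surj[OF Z V p d(3,4) len(3,4)])
      note e = slice_pullbacks_lists(5)[OF Z V p \<xi>s(1,2), unfolded \<xi>s(3,4)]
      have "\<forall>i<k. \<forall>c1 c2 c3. curve_at X x c1 \<and> curve_at Y y c2 \<and> curve_at (prod_mfd Z V) (z, w) c3 \<and>
            (\<forall>\<^sub>F \<tau> in nhds 0. (c1 \<tau>, c2 \<tau>, c3 \<tau>) \<in> S) \<longrightarrow>
          (\<alpha>s ! i) (velocity X c1) + (\<beta>s ! i) (velocity Y c2) + (\<xi>s ! i) (velocity (prod_mfd Z V) c3) = 0"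
      proof (intro allI impI, elim conjE)
        fix i c1 c2 c3 assume i: "i < k" and c: "curve_at X x c1" "curve_at Y y c2" "curve_at (prod_mfd Z V) (z, w) c3"
          "\<forall>\<^sub>F \<tau> in nhds 0. (c1 \<tau>, c2 \<tau>, c3 \<tau>) \<in> S"
        note cc = curve_at_fst_snd[OF Z V c(3)]
        have "\<forall>\<^sub>F \<tau> in nhds 0. (c1 \<tau>, c2 \<tau>, fst (c3 \<tau>), snd (c3 \<tau>)) \<in> S" using c(4) by simp
        then show "(\<alpha>s ! i) (velocity X c1) + (\<beta>s ! i) (velocity Y c2) + (\<xi>s ! i) (velocity (prod_mfd Z V) c3) = 0"
          using con[rule_format, OF i, of c1 c2 "\<lambda>\<tau>. fst (c3 \<tau>)" "\<lambda>\<tau>. snd (c3 \<tau>)"] c(1,2) cc e[OF i cc] by simp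
      qed
      then have "P x \<alpha>s + Q y \<beta>s + sum_field Z V R N (z, w) \<xi>s = 0"
        using L[unfolded three, rule_format, of x y "(z, w)" \<alpha>s \<beta>s \<xi>s] xyz len(1,2) d(1,2) \<xi>s(1,2) by blast
      then show "P x \<alpha>s + Q y \<beta>s + R z \<gamma>s + N w \<delta>s = 0" unfolding sum_field_apply \<xi>s(3,4) by simp
    qed
  next
    assume R: ?R
    show ?L unfolding three
    proof (intro allI impI, elim conjE)
      fix x y p \<alpha>s \<beta>s \<xi>s
      assume xp: "(x, y, p) \<in> S" and len: "length \<alpha>s = k" "length \<beta>s = k" and \<xi>s: "length \<xi>s = k"
        and d: "set \<alpha>s \<subseteq> dual (tangent_space X x)" "set \<beta>s \<subseteq> dual (tangent_space Y y)"
        and \<xi>d: "set \<xi>s \<subseteq> dual (tangent_space (prod_mfd Z V) p)"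
        and con: "\<forall>i<k. \<forall>c1 c2 c3. curve_at X x c1 \<and> curve_at Y y c2 \<and> curve_at (prod_mfd Z V) p c3 \<and>
            (\<forall>\<^sub>F \<tau> in nhds 0. (c1 \<tau>, c2 \<tau>, c3 \<tau>) \<in> S) \<longrightarrow>
          (\<alpha>s ! i) (velocity X c1) + (\<beta>s ! i) (velocity Y c2) + (\<xi>s ! i) (velocity (prod_mfd Z V) c3) = 0"
      obtain z w where zw: "p = (z, w)" by force
      have p: "z \<in> points Z" "w \<in> points V" using xp zw S by auto
      note l = slice_pullbacks_lists[OF Z V p \<xi>s \<xi>d[unfolded zw]]
      let ?\<gamma> = "map (inl_pullback Z V z w) \<xi>s" and ?\<delta> = "map (inr_pullback Z V z w) \<xi>s"
      have c: "\<forall>i<k. \<forall>c1 c2 c3 c4. curve_at X x c1 \<and> curve_at Y y c2 \<and> curve_at Z z c3 \<and> curve_at V w c4 \<and>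
            (\<forall>\<^sub>F \<tau> in nhds 0. (c1 \<tau>, c2 \<tau>, c3 \<tau>, c4 \<tau>) \<in> S) \<longrightarrow>
          (\<alpha>s ! i) (velocity X c1) + (\<beta>s ! i) (velocity Y c2) + (?\<gamma> ! i) (velocity Z c3) + (?\<delta> ! i) (velocity V c4) = 0"
      proof (intro allI impI, elim conjE)
        fix i c1 c2 c3 c4 assume i: "i < k" and c: "curve_at X x c1" "curve_at Y y c2" "curve_at Z z c3" "curve_at V w c4"
          "\<forall>\<^sub>F \<tau> in nhds 0. (c1 \<tau>, c2 \<tau>, c3 \<tau>, c4 \<tau>) \<in> S"
        have "(\<alpha>s ! i) (velocity X c1) + (\<beta>s ! i) (velocity Y c2) + (\<xi>s ! i) (velocity (prod_mfd Z V) (\<lambda>\<tau>. (c3 \<tau>, c4 \<tau>))) = 0"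
          by (rule con[rule_format, OF i]) (use c curve_at_Pair[OF Z V c(3,4)] zw in simp)
        then show "(\<alpha>s ! i) (velocity X c1) + (\<beta>s ! i) (velocity Y c2) + (?\<gamma> ! i) (velocity Z c3) + (?\<delta> ! i) (velocity V c4) = 0"
          unfolding l(5)[OF i c(3,4)] by (simp only: add.assoc)
      qed
      have "P x \<alpha>s + Q y \<beta>s + R z ?\<gamma> + N w ?\<delta> = 0"
        using R[rule_format, of x y z w \<alpha>s \<beta>s ?\<gamma> ?\<delta>] c xp zw len d l(1-4) by blast
      then show "P x \<alpha>s + Q y \<beta>s + sum_field Z V R N p \<xi>s = 0" unfolding zw sum_field_apply by (simp only: add.assoc)
    qed
  qed
qed

section \<open>Signs of multivectors on negated covectors\<close>

lemma kvector_linear: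
  assumes "kvector k T \<Lambda>" "length \<xi>s = k" "set \<xi>s \<subseteq> dual T" "i < k" "\<eta> \<in> dual T" "\<zeta> \<in> dual T"
  shows "\<Lambda> (\<xi>s[i := (\<lambda>v. a * \<eta> v + b * \<zeta> v)]) = a * \<Lambda> (\<xi>s[i := \<eta>]) + b * \<Lambda> (\<xi>s[i := \<zeta>])"
  using assms unfolding kvector_def by simp

text \<open>Entries are negated one at a time from the left, each contributing a factor -1. This
  trades the factor \<open>(-1) ^ (k + 1)\<close> in the coisotropy conditions for a change of sign
  of covectors.\<close>

lemma kvector_uminus:
  assumes T: "linear_closed T" and \<Lambda>: "kvector k T \<Lambda>" and \<xi>s: "length \<xi>s = k" "set \<xi>s \<subseteq> dual T"
  shows "\<Lambda> (map (\<lambda>\<xi> v. - \<xi> v) \<xi>s) = (-1) ^ k * \<Lambda> \<xi>s"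
proof -
  let ?m = "\<lambda>(\<xi> :: 'a covec) v. - \<xi> v"
  have neg: "?m \<xi> \<in> dual T" if "\<xi> \<in> dual T" for \<xi>
    using dual_combination[OF T that that, of "-1" 0] by simp
  have "\<Lambda> (map ?m (take n \<xi>s) @ drop n \<xi>s) = (-1) ^ n * \<Lambda> \<xi>s" if "n \<le> k" for n
    using that
  proof (induction n)
    case (Suc n)
    let ?xs = "map ?m (take n \<xi>s) @ drop n \<xi>s"
    have n: "n < length \<xi>s" using Suc.prems \<xi>s(1) by simp
    have xin: "\<xi>s ! n \<in> dual T" using n \<xi>s(2) nth_mem by blast
    have len: "length ?xs = k" using n \<xi>s(1) by simp
    have sub: "set ?xs \<subseteq> dual T"
      using \<xi>s(2) neg by (auto dest!: in_set_takeD in_set_dropD)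
    have upd: "?xs[n := y] = map ?m (take n \<xi>s) @ y # drop (Suc n) \<xi>s" for y
      using n by (simp add: list_update_append Cons_nth_drop_Suc[symmetric])
    have "\<Lambda> (?xs[n := (\<lambda>v. (-1) * (\<xi>s ! n) v + 0 * (\<xi>s ! n) v)]) =
        (-1) * \<Lambda> (?xs[n := \<xi>s ! n]) + 0 * \<Lambda> (?xs[n := \<xi>s ! n])"
      by (rule kvector_linear[OF \<Lambda> len sub _ xin xin]) (use n \<xi>s(1) in simp)
    moreover have "?xs[n := \<xi>s ! n] = ?xs"
      unfolding upd using Cons_nth_drop_Suc[OF n] by simp
    moreover have "?xs[n := (\<lambda>v. (-1) * (\<xi>s ! n) v + 0 * (\<xi>s ! n) v)] = map ?m (take (Suc n) \<xi>s) @ drop (Suc n) \<xi>s"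
      unfolding upd using n by (simp add: take_Suc_conv_app_nth)
    ultimately show ?case using Suc by simp
  qed simp
  from this[of k] \<xi>s(1) show ?thesis by simp
qed

lemma map_uminus_covectors: "map (\<lambda>\<xi> v. - \<xi> v) (map (\<lambda>\<xi> v. - \<xi> v) \<xi>s) = (\<xi>s :: ('a \<Rightarrow> real) list)"
  by (simp add: comp_def)

lemma uminus_covectors_dual:
  assumes T: "linear_closed T" and \<xi>s: "set \<xi>s \<subseteq> dual T"
  shows "set (map (\<lambda>\<xi> v. - \<xi> v) \<xi>s) \<subseteq> dual T"
proof -
  have "(\<lambda>v. - \<xi> v) \<in> dual T" if "\<xi> \<in> dual T" for \<xi>
    using dual_combination[OF T that that, of "-1" 0] by simp
  then show ?thesis using \<xi>s by auto
qed

section \<open>Smoothness of multivector fields\<close>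

lemma smooth_at_euclid_Pair:
  assumes X: "smooth_manifold X" and "smooth_at X euclid x f" "smooth_at X euclid x g"
  shows "smooth_at X euclid x (\<lambda>y. (f y, g y))"
  using smooth_at_Pair[OF X smooth_manifold_euclid smooth_manifold_euclid assms(2,3)] by simp

lemma smooth_at_bilinear:
  assumes X: "smooth_manifold X" and B: "bounded_bilinear B"
    and f: "smooth_at X euclid x f" and g: "smooth_at X euclid x g"
  shows "smooth_at X euclid x (\<lambda>y. B (f y) (g y))"
proof -
  have "Cinf UNIV (\<lambda>p. B (fst p) (snd p))"
    by (rule Cinf_bilinear[OF B Cinf_linear[OF linear_fst] Cinf_linear[OF linear_snd]])
  then have "smooth_at euclid euclid (f x, g x) (\<lambda>p. B (fst p) (snd p))"
    unfolding smooth_at_euclid_iff by blast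
  from smooth_at_compose[OF X smooth_manifold_euclid smooth_manifold_euclid smooth_at_euclid_Pair[OF X f g], of "\<lambda>p. B (fst p) (snd p)"] this
  show ?thesis by simp
qed

lemma smooth_at_euclid_linear:
  assumes X: "smooth_manifold X" and L: "linear L" and f: "smooth_at X euclid x f"
  shows "smooth_at X euclid x (\<lambda>y. L (f y))"
  by (rule smooth_at_compose[OF X smooth_manifold_euclid smooth_manifold_euclid f smooth_at_linear[OF L]])

lemma smooth_at_add:
  assumes X: "smooth_manifold X" and f: "smooth_at X euclid x f" and g: "smooth_at X euclid x g"
  shows "smooth_at X euclid x (\<lambda>y. f y + g y)"
  using smooth_at_euclid_linear[OF X linear_compose_add[OF linear_fst linear_snd] smooth_at_euclid_Pair[OF X f g]] by simp

lemma smooth_at_diff: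
  assumes X: "smooth_manifold X" and f: "smooth_at X euclid x f" and g: "smooth_at X euclid x g"
  shows "smooth_at X euclid x (\<lambda>y. f y - g y)"
  using smooth_at_euclid_linear[OF X linear_compose_sub[OF linear_fst linear_snd] smooth_at_euclid_Pair[OF X f g]] by simp

lemma smooth_at_sum:
  assumes X: "smooth_manifold X" and x: "x \<in> points X" and "finite A" "\<And>a. a \<in> A \<Longrightarrow> smooth_at X euclid x (f a)"
  shows "smooth_at X euclid x (\<lambda>y. \<Sum>a\<in>A. f a y)"
  using assms(3,4)
proof (induction A)
  case empty
  show ?case using smooth_at_const[OF X smooth_manifold_euclid x] by simp
next
  case (insert a A)
  then show ?case using smooth_at_add[OF X, of x "f a" "\<lambda>y. \<Sum>a\<in>A. f a y"] by simp
qed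

text \<open>In a chart of \<open>X\<close> this derivative is the partial derivative in the
  direction \<open>(0, 1)\<close> of a smooth function of coordinates and time, restricted to time
  0.\<close>

lemma smooth_at_deriv_parameter:
  fixes H :: "'a \<times> real \<Rightarrow> real" and X :: "('a, 'e::euclidean_space) mfd"
  assumes X: "smooth_manifold X" and H: "smooth_at (prod_mfd X euclid) euclid (x0, 0) H"
  shows "smooth_at X euclid x0 (\<lambda>x. deriv (\<lambda>\<tau>. H (x, \<tau>)) 0)"
proof -
  note E = smooth_manifold_euclid
  have x0: "x0 \<in> points X" using smooth_at_points(1)[OF H] by simp
  obtain U \<phi> where U: "(U, \<phi>) \<in> atlas X" "x0 \<in> U" by (rule points_chartE[OF x0])
  note ci = chart_inv[OF X U]
  have "smooth_at euclid X (\<phi> x0, 0::real) (\<lambda>p. chart_inv X U \<phi> (fst p))"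
    by (rule smooth_at_compose[OF E E X smooth_at_linear[OF linear_fst]]) (use ci(2) in simp)
  from smooth_at_Pair[OF E X E this smooth_at_linear[OF linear_snd]]
  have "smooth_at euclid (prod_mfd X euclid) (\<phi> x0, 0::real) (\<lambda>p. (chart_inv X U \<phi> (fst p), snd p))" .
  then have "smooth_at euclid euclid (\<phi> x0, 0::real) (\<lambda>p. H (chart_inv X U \<phi> (fst p), snd p))"
    by (rule smooth_at_compose[OF E smooth_manifold_prod[OF X E] E]) (use H ci(1) in simp)
  then obtain W where W: "open W" "(\<phi> x0, 0) \<in> W" "Cinf W (\<lambda>p. H (chart_inv X U \<phi> (fst p), snd p))"
    unfolding smooth_at_euclid_iff by blast
  have "\<exists>D. (\<forall>p\<in>W. ((\<lambda>p. H (chart_inv X U \<phi> (fst p), snd p)) has_derivative D p) (at p)) \<and> (\<forall>v. Cinf W (\<lambda>p. D p v))"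
    by (rule Cinf_derivative[OF W(3,1)]) (intro exI conjI ballI allI; assumption)
  then obtain D where D: "\<forall>p\<in>W. ((\<lambda>p. H (chart_inv X U \<phi> (fst p), snd p)) has_derivative D p) (at p)"
    "\<forall>v. Cinf W (\<lambda>p. D p v)" by blast
  have d: "deriv (\<lambda>\<tau>. H (chart_inv X U \<phi> z, \<tau>)) 0 = D (z, 0) (0, 1)" if z: "(z, 0) \<in> W" for z
  proof -
    have Dz: "((\<lambda>p. H (chart_inv X U \<phi> (fst p), snd p)) has_derivative D (z, 0)) (at (z, 0))" using D(1) z by blast
    have "((\<lambda>\<tau>. (z, \<tau>)) has_derivative (\<lambda>\<tau>. (0, \<tau>))) (at (0::real))"
      by (intro has_derivative_Pair has_derivative_const has_derivative_ident)
    from has_derivative_compose[OF this Dz]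
    have "((\<lambda>\<tau>. H (chart_inv X U \<phi> z, \<tau>)) has_derivative (\<lambda>\<tau>. D (z, 0) (0, \<tau>))) (at 0)" by simp
    moreover have "(\<lambda>\<tau>. D (z, 0) (0, \<tau>)) = (*) (D (z, 0) (0, 1))"
    proof
      fix \<tau> :: real
      have "D (z, 0) (\<tau> *\<^sub>R (0, 1)) = \<tau> *\<^sub>R D (z, 0) (0, 1)"
        by (rule linear_scale[OF has_derivative_linear[OF Dz]])
      then show "D (z, 0) (0, \<tau>) = D (z, 0) (0, 1) * \<tau>" by simp
    qed
    ultimately show ?thesis by (intro DERIV_imp_deriv) (simp add: has_field_derivative_def)
  qed
  have c: "smooth_at X euclid x0 (\<lambda>x. (\<phi> x, 0::real))"
    by (rule smooth_at_euclid_Pair[OF X smooth_at_chart[OF X U] smooth_at_const[OF X E x0]]) simp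
  have "smooth_at euclid euclid (\<phi> x0, 0) (\<lambda>p. D p (0, 1))"
    unfolding smooth_at_euclid_iff using W D(2) by blast
  from smooth_at_compose[OF X E E c, of "\<lambda>p. D p (0, 1)"] this
  have s: "smooth_at X euclid x0 (\<lambda>x. D (\<phi> x, 0) (0, 1))" by simp
  have "\<forall>\<^sub>F x in nh X x0. (\<phi> x, 0) \<in> W"
    by (rule smooth_at_eventually_in[OF X E c]) (use W in \<open>auto simp: open_subset_euclid\<close>)
  moreover have "\<forall>\<^sub>F x in nh X x0. x \<in> U"
    by (rule eventually_nh_open[OF X open_subset_chart[OF X U(1)] U(2)])
  ultimately have "\<forall>\<^sub>F x in nh X x0. D (\<phi> x, 0) (0, 1) = deriv (\<lambda>\<tau>. H (x, \<tau>)) 0"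
  proof eventually_elim
    case (elim x)
    then show ?case using d[OF elim(1)] chart_inv(1)[OF X U(1) elim(2)] by simp
  qed
  from smooth_at_cong[OF X s this] show ?thesis .
qed

lemma linear_closedD:
  "linear_closed T \<Longrightarrow> v \<in> T \<Longrightarrow> w \<in> T \<Longrightarrow> (\<lambda>f. r * v f + s * w f) \<in> T"
  unfolding linear_closed_def by simp

lemma dual_sum:
  assumes T: "linear_closed T" and z: "(\<lambda>f. 0) \<in> T" and \<omega>: "\<omega> \<in> dual T"
    and "finite S" "\<And>b. b \<in> S \<Longrightarrow> w b \<in> T"
  shows "\<omega> (\<lambda>f. \<Sum>b\<in>S. c b * w b f) = (\<Sum>b\<in>S. c b * \<omega> (w b)) \<and> (\<lambda>f. \<Sum>b\<in>S. c b * w b f) \<in> T"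
  using assms(4,5)
proof (induction S)
  case empty
  show ?case using dual_zero[OF \<omega> z] z by simp
next
  case (insert b S)
  then have IH: "\<omega> (\<lambda>f. \<Sum>b\<in>S. c b * w b f) = (\<Sum>b\<in>S. c b * \<omega> (w b))" "(\<lambda>f. \<Sum>b\<in>S. c b * w b f) \<in> T"
    and wb: "w b \<in> T" by auto
  have e: "(\<lambda>f. \<Sum>b\<in>insert b S. c b * w b f) = (\<lambda>f. c b * w b f + 1 * (\<Sum>b\<in>S. c b * w b f))"
    using insert(1,2) by simp
  have "(\<lambda>f. c b * w b f + 1 * (\<Sum>b\<in>S. c b * w b f)) \<in> T"
    by (rule linear_closedD[OF T wb IH(2)])
  then show ?case unfolding e using dualD(1)[OF \<omega> wb IH(2), of "c b" 1] IH(1) insert(1,2) by simp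
qed

text \<open>The projected basis vectors span the model but may be linearly dependent; the expansion
  still holds because the projection fixes \<open>a\<close>.\<close>

lemma velocity_expansion:
  assumes X: "smooth_manifold X" and U: "(U, \<phi>) \<in> atlas X" and x: "x \<in> U" and c: "curve_at X x c"
    and a: "a \<in> model X" "((\<lambda>\<tau>. \<phi> (c \<tau>)) has_vector_derivative a) (at 0)"
  shows "velocity X c = (\<lambda>f. \<Sum>b\<in>Basis. (a \<bullet> b) * velocity X (chart_line X U \<phi> x (lin_proj (model X) b)) f)"
proof
  fix f
  let ?p = "lin_proj (model X)"
  note p = lin_proj[OF smooth_manifoldD(1)[OF X]]
  note l = chart_line[OF X U x p(2)]
  show "velocity X c f = (\<Sum>b\<in>Basis. (a \<bullet> b) * velocity X (chart_line X U \<phi> x (?p b)) f)"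
  proof (cases "smooth_at X euclid x f")
    case False
    then show ?thesis using velocity_not_smooth[OF c] velocity_not_smooth[OF l(1)] by simp
  next
    case True
    obtain A where A: "linear A"
      "\<And>\<gamma> a. curve_at X x \<gamma> \<Longrightarrow> ((\<lambda>\<tau>. \<phi> (\<gamma> \<tau>)) has_vector_derivative a) (at 0) \<Longrightarrow> velocity X \<gamma> f = A a"
      using chart_velocity[OF X U x True] by blast
    have "A (?p a) = (\<Sum>b\<in>Basis. (a \<bullet> b) *\<^sub>R A (?p b))"
      using linear_component_expansion[OF linear_compose[OF p(1) A(1)], of a] by simp
    then show ?thesis using A(2)[OF c a(2)] A(2)[OF l] p(3)[OF a(1)] by simp
  qed
qed

text \<open>Chart differentials span the covectors, with the values on coordinate lines as
  coefficients. Smoothness of a family of covectors can thus be measured by these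
  coefficients.\<close>

lemma covector_expansion:
  assumes X: "smooth_manifold X" and U: "(U, \<phi>) \<in> atlas X" and x: "x \<in> U" and \<omega>: "\<omega> \<in> dual (tangent_space X x)"
  shows "\<omega> = (\<lambda>v. \<Sum>b\<in>Basis. \<omega> (velocity X (chart_line X U \<phi> x (lin_proj (model X) b))) *
      fun_differential X x (\<lambda>y. \<phi> y \<bullet> b) v)"
proof
  fix v
  let ?l = "\<lambda>b. velocity X (chart_line X U \<phi> x (lin_proj (model X) b))"
  have xp: "x \<in> points X" using x chart_subset_points[OF U] by blast
  show "\<omega> v = (\<Sum>b\<in>Basis. \<omega> (?l b) * fun_differential X x (\<lambda>y. \<phi> y \<bullet> b) v)"
  proof (cases "v \<in> tangent_space X x")
    case False
    then show ?thesis using dualD(2)[OF \<omega>] by (simp add: fun_differential_def)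
  next
    case True
    then obtain c where c: "curve_at X x c" "v = velocity X c" using tangent_space_iff[OF X] by metis
    obtain a where a: "a \<in> model X" "((\<lambda>\<tau>. \<phi> (c \<tau>)) has_vector_derivative a) (at 0)"
      by (rule chart_coordinate_curve[OF X U x c(1)])
    have "?l b \<in> tangent_space X x" for b
      by (rule velocity_in_tangent_space[OF X chart_line(1)[OF X U x lin_proj(2)[OF smooth_manifoldD(1)[OF X]]]])
    then have "\<omega> (\<lambda>f. \<Sum>b\<in>Basis. (a \<bullet> b) * ?l b f) = (\<Sum>b\<in>Basis. (a \<bullet> b) * \<omega> (?l b))"
      by (rule conjunct1[OF dual_sum[OF linear_closed_tangent_space[OF X] tangent_space_zero[OF X xp] \<omega> finite_Basis]])
    then have "\<omega> v = (\<Sum>b\<in>Basis. (a \<bullet> b) * \<omega> (?l b))"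
      using velocity_expansion[OF X U x c(1) a] c(2) by simp
    moreover have "fun_differential X x (\<lambda>y. \<phi> y \<bullet> b) v = a \<bullet> b" for b
      using True velocity_chart_component[OF X U x c(1) a(2)] c(2) by (simp add: fun_differential_def)
    ultimately show ?thesis by (simp add: mult.commute)
  qed
qed

text \<open>Multilinearity in one slot for finite sums. The second conjunct keeps the induction
  going: linearity applies to a partial sum only once it is known to be a covector.\<close>

lemma kvector_sum:
  assumes T: "linear_closed T" and \<Lambda>: "kvector k T \<Lambda>" and A: "set A \<subseteq> dual T" and B: "set B \<subseteq> dual T"
    and len: "Suc (length A + length B) = k" and "finite S" "\<And>b. b \<in> S \<Longrightarrow> \<eta> b \<in> dual T"
  shows "\<Lambda> (A @ (\<lambda>v. \<Sum>b\<in>S. c b * \<eta> b v) # B) = (\<Sum>b\<in>S. c b * \<Lambda> (A @ \<eta> b # B)) \<and>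
    (\<lambda>v. \<Sum>b\<in>S. c b * \<eta> b v) \<in> dual T"
  using assms(6,7)
proof (induction S)
  case empty
  have z: "(\<lambda>v. 0) \<in> dual T" by (simp add: dual_def)
  have "\<Lambda> ((A @ (\<lambda>v. 0) # B)[length A := (\<lambda>v. 0 * (\<lambda>v. 0) v + 0 * (\<lambda>v. 0) v)]) =
      0 * \<Lambda> ((A @ (\<lambda>v. 0) # B)[length A := (\<lambda>v. 0)]) + 0 * \<Lambda> ((A @ (\<lambda>v. 0) # B)[length A := (\<lambda>v. 0)])"
    by (rule kvector_linear[OF \<Lambda> _ _ _ z z]) (use len A B z in auto)
  then show ?case using z by simp
next
  case (insert b S)
  let ?\<zeta> = "\<lambda>v. \<Sum>b\<in>S. c b * \<eta> b v"
  have IH: "\<Lambda> (A @ ?\<zeta> # B) = (\<Sum>b\<in>S. c b * \<Lambda> (A @ \<eta> b # B))" and \<zeta>: "?\<zeta> \<in> dual T" and \<eta>: "\<eta> b \<in> dual T"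
    using insert by auto
  have e: "(\<lambda>v. \<Sum>b\<in>insert b S. c b * \<eta> b v) = (\<lambda>v. c b * \<eta> b v + 1 * ?\<zeta> v)" using insert(1,2) by simp
  have "\<Lambda> ((A @ \<eta> b # B)[length A := (\<lambda>v. c b * \<eta> b v + 1 * ?\<zeta> v)]) =
      c b * \<Lambda> ((A @ \<eta> b # B)[length A := \<eta> b]) + 1 * \<Lambda> ((A @ \<eta> b # B)[length A := ?\<zeta>])"
    by (rule kvector_linear[OF \<Lambda> _ _ _ \<eta> \<zeta>]) (use len A B \<eta> in auto)
  then show ?case unfolding e using IH dual_combination[OF T \<eta> \<zeta>, of "c b" 1] insert(1,2)
    by (simp only: list_update_length sum.insert mult_1) simp
qed

text \<open>Smoothness of \<open>P\<close> is given on differentials of functions only. Starting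
  from the last entry, covectors are replaced by their expansions in chart differentials; in the
  induction \<open>bs\<close> records the entries already replaced.\<close>

lemma smooth_at_kvector_field:
  assumes X: "smooth_manifold X" and Y: "smooth_manifold Y" and P: "kvector_field Y k P"
    and x: "smooth_at X Y z0 x" and U: "(U, \<phi>) \<in> atlas Y" "x z0 \<in> U" and len: "length \<omega>s = k"
    and dual: "\<And>\<omega>. \<omega> \<in> set \<omega>s \<Longrightarrow> \<forall>\<^sub>F z in nh X z0. \<omega> z \<in> dual (tangent_space Y (x z))"
    and coeff: "\<And>\<omega> b. \<omega> \<in> set \<omega>s \<Longrightarrow> b \<in> Basis \<Longrightarrow>
      smooth_at X euclid z0 (\<lambda>z. \<omega> z (velocity Y (chart_line Y U \<phi> (x z) (lin_proj (model Y) b))))"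
  shows "smooth_at X euclid z0 (\<lambda>z. P (x z) (map (\<lambda>\<omega>. \<omega> z) \<omega>s))"
proof -
  note E = smooth_manifold_euclid
  have z0: "z0 \<in> points X" using smooth_at_points[OF x] by simp
  let ?d = "\<lambda>z b. fun_differential Y (x z) (\<lambda>y. \<phi> y \<bullet> b)"
  have xU: "\<forall>\<^sub>F z in nh X z0. x z \<in> U"
    by (rule smooth_at_eventually_in[OF X Y x open_subset_chart[OF Y U(1)] U(2)])
  have "length \<omega>s + length bs = k \<Longrightarrow> smooth_at X euclid z0 (\<lambda>z. P (x z) (map (\<lambda>\<omega>. \<omega> z) \<omega>s @ map (?d z) bs))" for bs
    using dual coeff
  proof (induction \<omega>s arbitrary: bs rule: rev_induct)
    case Nil
    let ?fs = "map (\<lambda>b y. \<phi> y \<bullet> b) bs"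
    have "smooth_at Y euclid y (\<lambda>y. \<phi> y \<bullet> b)" if "y \<in> U" for y b
      by (rule smooth_at_euclid_linear[OF Y _ smooth_at_chart[OF Y U(1) that]])
        (simp add: linear_iff inner_left_distrib)
    then have "\<forall>f\<in>set ?fs. smooth_map Y euclid U f"
      by (auto intro!: smooth_at_imp_smooth_map[OF Y E])
    moreover have "length ?fs = k" using Nil(1) by simp
    ultimately have "smooth_map Y euclid U (\<lambda>y. P y (map (fun_differential Y y) ?fs))"
      using P open_subset_chart[OF Y U(1)] unfolding kvector_field_def by blast
    then have "smooth_at Y euclid (x z0) (\<lambda>y. P y (map (fun_differential Y y) ?fs))"
      by (rule smooth_map_imp_smooth_at[OF open_subset_chart[OF Y U(1)] _ U(2)])
    from smooth_at_compose[OF X Y E x this] show ?case by (simp add: comp_def)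
  next
    case (snoc \<omega> \<omega>s)
    let ?l = "\<lambda>z b. velocity Y (chart_line Y U \<phi> (x z) (lin_proj (model Y) b))"
    have IH: "smooth_at X euclid z0 (\<lambda>z. P (x z) (map (\<lambda>\<omega>. \<omega> z) \<omega>s @ map (?d z) (b # bs)))" for b
      by (rule snoc.IH) (use snoc.prems in auto)
    have s: "smooth_at X euclid z0 (\<lambda>z. \<Sum>b\<in>Basis. \<omega> z (?l z b) * P (x z) (map (\<lambda>\<omega>. \<omega> z) \<omega>s @ map (?d z) (b # bs)))"
      by (rule smooth_at_sum[OF X z0 finite_Basis], rule smooth_at_bilinear[OF X bounded_bilinear_mult _ IH])
        (use snoc.prems(3) in auto)
    have "\<forall>\<^sub>F z in nh X z0. \<forall>\<omega>\<in>set (\<omega>s @ [\<omega>]). \<omega> z \<in> dual (tangent_space Y (x z))"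
      using snoc.prems(2) by (intro eventually_ball_finite) auto
    then have "\<forall>\<^sub>F z in nh X z0. (\<Sum>b\<in>Basis. \<omega> z (?l z b) * P (x z) (map (\<lambda>\<omega>. \<omega> z) \<omega>s @ map (?d z) (b # bs)))
        = P (x z) (map (\<lambda>\<omega>. \<omega> z) (\<omega>s @ [\<omega>]) @ map (?d z) bs)"
      using xU
    proof eventually_elim
      case (elim z)
      have "x z \<in> points Y" using elim(2) chart_subset_points[OF U(1)] by blast
      then have kv: "kvector k (tangent_space Y (x z)) (P (x z))" using P unfolding kvector_field_def by blast
      have \<omega>: "\<omega> z \<in> dual (tangent_space Y (x z))" using elim(1) by simp
      have "P (x z) (map (\<lambda>\<omega>. \<omega> z) \<omega>s @ (\<lambda>v. \<Sum>b\<in>Basis. \<omega> z (?l z b) * ?d z b v) # map (?d z) bs)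
          = (\<Sum>b\<in>Basis. \<omega> z (?l z b) * P (x z) (map (\<lambda>\<omega>. \<omega> z) \<omega>s @ ?d z b # map (?d z) bs))"
        by (rule conjunct1[OF kvector_sum[OF linear_closed_tangent_space[OF Y] kv]])
          (use elim(1) snoc.prems(1) fun_differential_in_dual[OF Y] in auto)
      then show ?case unfolding covector_expansion[OF Y U(1) elim(2) \<omega>, symmetric] by simp
    qed
    from smooth_at_cong[OF X s this] show ?case .
  qed
  from this[of "[]"] len show ?thesis by simp
qed

lemma kvector_pushforward:
  assumes T: "linear_closed T" and \<Lambda>: "kvector k T \<Lambda>" and L: "\<And>v. v \<in> T \<Longrightarrow> L v \<in> T'"
    and lin: "\<And>v w r s. v \<in> T \<Longrightarrow> w \<in> T \<Longrightarrow> L (\<lambda>f. r * v f + s * w f) = (\<lambda>f. r * L v f + s * L w f)"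
  shows "kvector k T' (\<lambda>\<xi>s. \<Lambda> (map (pullback T L) \<xi>s))"
proof -
  have pd: "pullback T L \<xi> \<in> dual T" if "\<xi> \<in> dual T'" for \<xi> by (rule pullback_in_dual[OF T that L lin])
  have pl: "pullback T L (\<lambda>v. a * \<eta> v + b * \<zeta> v) = (\<lambda>v. a * pullback T L \<eta> v + b * pullback T L \<zeta> v)" for a b \<eta> \<zeta>
    unfolding pullback_def by auto
  show ?thesis unfolding kvector_def
  proof (intro allI impI conjI ballI; elim conjE)
    fix \<xi>s i \<eta> \<zeta> and a b :: real
    assume "length \<xi>s = k" "set \<xi>s \<subseteq> dual T'" "i < k" "\<eta> \<in> dual T'" "\<zeta> \<in> dual T'"
    then show "\<Lambda> (map (pullback T L) (\<xi>s[i := \<lambda>v. a * \<eta> v + b * \<zeta> v])) =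
        a * \<Lambda> (map (pullback T L) (\<xi>s[i := \<eta>])) + b * \<Lambda> (map (pullback T L) (\<xi>s[i := \<zeta>]))"
      unfolding map_update pl by (intro kvector_linear[OF \<Lambda>]) (auto intro: pd)
  next
    fix \<xi>s i j
    assume l: "length \<xi>s = k" "set \<xi>s \<subseteq> dual T'" and ij: "i < k" "j < k" "i \<noteq> j" "\<xi>s ! i = \<xi>s ! j"
    have "length (map (pullback T L) \<xi>s) = k" "set (map (pullback T L) \<xi>s) \<subseteq> dual T" using l by (auto intro: pd)
    moreover have "map (pullback T L) \<xi>s ! i = map (pullback T L) \<xi>s ! j" using ij l by simp
    ultimately show "\<Lambda> (map (pullback T L) \<xi>s) = 0" using \<Lambda> ij unfolding kvector_def by blast
  qed
qed

lemma kvector_diff: "kvector k T \<Lambda> \<Longrightarrow> kvector k T \<Lambda>' \<Longrightarrow> kvector k T (\<lambda>\<xi>s. \<Lambda> \<xi>s - \<Lambda>' \<xi>s)"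
  unfolding kvector_def by (simp add: algebra_simps)

lemma kvector_field_diff:
  assumes X: "smooth_manifold X" and P: "kvector_field X k P" and Q: "kvector_field X k Q"
  shows "kvector_field X k (diff_field P Q)"
  unfolding kvector_field_def
proof (intro conjI ballI allI impI)
  fix x assume "x \<in> points X"
  then show "kvector k (tangent_space X x) (diff_field P Q x)"
    using P Q kvector_diff unfolding kvector_field_def diff_field_def by blast
next
  fix W and fs :: "('a \<Rightarrow> real) list" assume *: "open_subset X W \<and> length fs = k \<and> (\<forall>f\<in>set fs. smooth_map X euclid W f)"
  have W: "open_subset X W" using * by blast
  have "smooth_map X euclid W (\<lambda>x. P x (map (fun_differential X x) fs))"
    "smooth_map X euclid W (\<lambda>x. Q x (map (fun_differential X x) fs))"
    using P Q * unfolding kvector_field_def by blast+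
  then show "smooth_map X euclid W (\<lambda>x. diff_field P Q x (map (fun_differential X x) fs))"
    unfolding diff_field_def
    by (intro smooth_at_imp_smooth_map[OF X smooth_manifold_euclid] smooth_at_diff[OF X])
      (auto intro: smooth_map_imp_smooth_at[OF W])
qed

section \<open>Conormal covectors on Lie groupoids\<close>

locale lie_groupoid_loc =
  fixes \<G> :: "('g, 'e::euclidean_space, 'm, 'f::euclidean_space) groupoid"
  assumes lie: "lie_groupoid \<G>"
begin

abbreviation "G \<equiv> arrows \<G>"
abbreviation "M \<equiv> base \<G>"
abbreviation "pt \<equiv> points G"
abbreviation "s \<equiv> src \<G>"
abbreviation "t \<equiv> tgt \<G>"
abbreviation mul (infixl "\<cdot>" 70) where "g \<cdot> h \<equiv> mult \<G> g h"
abbreviation "e \<equiv> unit \<G>"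
abbreviation "iv \<equiv> invs \<G>"

section \<open>Groupoid identities and smoothness of the structure maps\<close>

lemma G: "smooth_manifold G" and M: "smooth_manifold M" and alg: "algebraic_groupoid \<G>"
  and sub_s: "submersion G M s" and sub_t: "submersion G M t"
  and smooth_mult: "smooth_map (prod_mfd G G) G (composable \<G>) (\<lambda>(g, h). g \<cdot> h)"
  and smooth_unit: "smooth_map M G (points M) e"
  and smooth_inv: "smooth_map G G pt iv"
  using lie unfolding lie_groupoid_def by blast+

lemma s_in: "g \<in> pt \<Longrightarrow> s g \<in> points M" and t_in: "g \<in> pt \<Longrightarrow> t g \<in> points M"
  and e_in: "x \<in> points M \<Longrightarrow> e x \<in> pt" and s_e: "x \<in> points M \<Longrightarrow> s (e x) = x" and t_e: "x \<in> points M \<Longrightarrow> t (e x) = x"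
  and iv_in: "g \<in> pt \<Longrightarrow> iv g \<in> pt" and s_iv: "g \<in> pt \<Longrightarrow> s (iv g) = t g" and t_iv: "g \<in> pt \<Longrightarrow> t (iv g) = s g"
  and mul_e: "g \<in> pt \<Longrightarrow> g \<cdot> e (s g) = g" and e_mul: "g \<in> pt \<Longrightarrow> e (t g) \<cdot> g = g"
  and mul_iv: "g \<in> pt \<Longrightarrow> g \<cdot> iv g = e (t g)" and iv_mul: "g \<in> pt \<Longrightarrow> iv g \<cdot> g = e (s g)"
  using alg unfolding algebraic_groupoid_def Let_def by blast+

lemma mul_in: "g \<in> pt \<Longrightarrow> h \<in> pt \<Longrightarrow> s g = t h \<Longrightarrow> g \<cdot> h \<in> pt"
  and s_mul: "g \<in> pt \<Longrightarrow> h \<in> pt \<Longrightarrow> s g = t h \<Longrightarrow> s (g \<cdot> h) = s h"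
  and t_mul: "g \<in> pt \<Longrightarrow> h \<in> pt \<Longrightarrow> s g = t h \<Longrightarrow> t (g \<cdot> h) = t g"
  using alg unfolding algebraic_groupoid_def Let_def composable_def by blast+

lemma assoc: "g \<in> pt \<Longrightarrow> h \<in> pt \<Longrightarrow> l \<in> pt \<Longrightarrow> s g = t h \<Longrightarrow> s h = t l \<Longrightarrow> (g \<cdot> h) \<cdot> l = g \<cdot> (h \<cdot> l)"
  using alg unfolding algebraic_groupoid_def Let_def composable_def by blast

text \<open>Substituting \<open>l = g \<cdot> q\<close> collapses the fourth entry of the affine
  relation to \<open>h \<cdot> q\<close>.\<close>

lemma mul_iv_cancel: "g \<in> pt \<Longrightarrow> h \<in> pt \<Longrightarrow> q \<in> pt \<Longrightarrow> s h = s g \<Longrightarrow> s g = t q \<Longrightarrow> (h \<cdot> iv g) \<cdot> (g \<cdot> q) = h \<cdot> q"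
  by (metis assoc iv_in iv_mul mul_in s_iv t_iv t_mul s_mul e_mul)

lemma iv_e: "x \<in> points M \<Longrightarrow> iv (e x) = e x"
  by (metis e_in iv_in mul_e mul_iv s_e s_iv t_e t_iv e_mul)

lemma s_at: "g \<in> pt \<Longrightarrow> smooth_at G M g s" and t_at: "g \<in> pt \<Longrightarrow> smooth_at G M g t"
  using sub_s sub_t smooth_map_imp_smooth_at[OF open_subset_points[OF G]] unfolding submersion_def by blast+

lemma e_at: "x \<in> points M \<Longrightarrow> smooth_at M G x e" and iv_at: "g \<in> pt \<Longrightarrow> smooth_at G G g iv"
  using smooth_map_imp_smooth_at[OF open_subset_points[OF M] smooth_unit]
    smooth_map_imp_smooth_at[OF open_subset_points[OF G] smooth_inv] by blast+

text \<open>Composability of \<open>A y\<close> and \<open>B y\<close> near \<open>x\<close> takes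
  the place of openness of the set of composable pairs.\<close>

lemma mul_at:
  assumes X: "smooth_manifold X" and A: "smooth_at X G x A" and B: "smooth_at X G x B"
    and AB: "\<forall>\<^sub>F y in nh X x. s (A y) = t (B y)"
  shows "smooth_at X G x (\<lambda>y. A y \<cdot> B y)"
proof -
  have "\<forall>\<^sub>F y in nh X x. A y \<in> pt"
    by (rule smooth_at_eventually_in[OF X G A open_subset_points[OF G] smooth_at_points(2)[OF A]])
  moreover have "\<forall>\<^sub>F y in nh X x. B y \<in> pt"
    by (rule smooth_at_eventually_in[OF X G B open_subset_points[OF G] smooth_at_points(2)[OF B]])
  ultimately have "\<forall>\<^sub>F y in nh X x. (A y, B y) \<in> composable \<G>"
    using AB by eventually_elim (simp add: composable_def)
  from smooth_at_compose_map[OF X smooth_manifold_prod[OF G G] G smooth_at_Pair[OF X G G A B] smooth_mult this]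
  show ?thesis by simp
qed

lemma curve_mul:
  assumes "curve_at G g c1" "curve_at G h c2" "\<forall>\<^sub>F \<tau> in nhds 0. s (c1 \<tau>) = t (c2 \<tau>)"
  shows "curve_at G (g \<cdot> h) (\<lambda>\<tau>. c1 \<tau> \<cdot> c2 \<tau>)"
  using assms mul_at[OF smooth_manifold_euclid, of 0 c1 c2] unfolding curve_at_def by auto

lemma curve_iv:
  assumes c: "curve_at G g c"
  shows "curve_at G (iv g) (\<lambda>\<tau>. iv (c \<tau>))"
  by (rule curve_at_compose[OF G G c iv_at[OF curve_at_points[OF c]]])

lemma curve_pt:
  assumes c: "curve_at G g c"
  shows "\<forall>\<^sub>F \<tau> in nhds 0. c \<tau> \<in> pt"
  by (rule eventually_curve[OF G c eventually_nh_points[OF G curve_at_points[OF c]]])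

text \<open>Freezing the second argument of a transversal at \<open>g\<close> gives arrows over a
  moving base point. By the last clause the section equals \<open>g\<close> wherever the base point
  has not moved, so products with it extend multiplication by \<open>g\<close> on a fibre.\<close>

lemma transversal_section:
  assumes sub: "submersion G M f" and X: "smooth_manifold X" and g: "g \<in> pt" and A: "smooth_at X M x A" and eq: "A x = f g"
  obtains E where "smooth_at X G x E" "E x = g" "\<forall>\<^sub>F y in nh X x. f (E y) = A y"
    "\<forall>y. A y = A x \<longrightarrow> E y = g"
proof -
  note MG = smooth_manifold_prod[OF M G]
  obtain \<sigma> where \<sigma>: "smooth_at (prod_mfd M G) G (f g, g) \<sigma>"
    and 1: "\<forall>\<^sub>F p in nh (prod_mfd M G) (f g, g). f (\<sigma> p) = fst p"
    and 2: "\<forall>\<^sub>F x in nh G g. \<sigma> (f x, x) = x" by (rule submersion_transversal[OF G M sub g])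
  have P: "smooth_at X (prod_mfd M G) x (\<lambda>y. (A y, g))"
    by (rule smooth_at_Pair[OF X M G A smooth_at_const[OF X G smooth_at_points(1)[OF A] g]])
  show thesis
  proof (rule that)
    show "smooth_at X G x (\<lambda>y. \<sigma> (A y, g))" by (rule smooth_at_compose[OF X MG G P]) (use \<sigma> eq in simp)
    show *: "\<sigma> (A x, g) = g" using eventually_nh_self[OF G g 2] eq by simp
    show "\<forall>y. A y = A x \<longrightarrow> \<sigma> (A y, g) = g" using * by simp
    show "\<forall>\<^sub>F y in nh X x. f (\<sigma> (A y, g)) = A y"
      using smooth_at_filterlim[OF X MG P] 1 eq unfolding filterlim_iff by auto
  qed
qed

text \<open>The covectors \<open>(\<alpha>, \<beta>, - \<eta>)\<close> are conormal to the graph of the multiplication at \<open>(g, h, g \<cdot> h)\<close>.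
  The sign, like those of \<open>\<alpha>\<close> and \<open>\<beta>\<close> in \<open>affine_cov\<close>, absorbs the factor \<open>(-1) ^ (k + 1)\<close>.\<close>

definition mult_cov :: "'g \<Rightarrow> 'g \<Rightarrow> 'g covec \<Rightarrow> 'g covec \<Rightarrow> 'g covec \<Rightarrow> bool" where
  "mult_cov g h \<eta> \<alpha> \<beta> \<longleftrightarrow> (\<forall>c1 c2. curve_at G g c1 \<longrightarrow> curve_at G h c2 \<longrightarrow> (\<forall>\<^sub>F \<tau> in nhds 0. s (c1 \<tau>) = t (c2 \<tau>)) \<longrightarrow>
     \<eta> (velocity G (\<lambda>\<tau>. c1 \<tau> \<cdot> c2 \<tau>)) = \<alpha> (velocity G c1) + \<beta> (velocity G c2))"

text \<open>The covectors \<open>(\<gamma>, - \<alpha>, - \<beta>, \<eta>)\<close> are conormal to the affine relation.\<close>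

definition affine_cov ::
    "'g \<Rightarrow> 'g \<Rightarrow> 'g \<Rightarrow> 'g covec \<Rightarrow> 'g covec \<Rightarrow> 'g covec \<Rightarrow> 'g covec \<Rightarrow> bool" where
  "affine_cov g h l \<gamma> \<alpha> \<beta> \<eta> \<longleftrightarrow> (\<forall>cg ch cl. curve_at G g cg \<longrightarrow> curve_at G h ch \<longrightarrow> curve_at G l cl \<longrightarrow>
     (\<forall>\<^sub>F \<tau> in nhds 0. s (cg \<tau>) = s (ch \<tau>)) \<longrightarrow> (\<forall>\<^sub>F \<tau> in nhds 0. t (cg \<tau>) = t (cl \<tau>)) \<longrightarrow>
     \<eta> (velocity G (\<lambda>\<tau>. (ch \<tau> \<cdot> iv (cg \<tau>)) \<cdot> cl \<tau>)) + \<gamma> (velocity G cg) = \<alpha> (velocity G ch) + \<beta> (velocity G cl))"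

text \<open>The section \<open>E\<close> forces \<open>\<theta>\<close>: it must be
  \<open>\<eta>\<close> of the velocity of \<open>E y \<cdot> y\<close> minus
  \<open>\<alpha>\<close> of that of \<open>E y\<close>. That it also works for the other curves
  through \<open>h\<close> or \<open>g\<close> follows from instances of \<open>main\<close> in
  which one curve is replaced by a section.\<close>

lemma affine_imp_mult_cov:
  assumes g: "g \<in> pt" and h: "h \<in> pt" and l: "l \<in> pt" and sgh: "s g = s h" and tgl: "t g = t l"
    and \<alpha>: "\<alpha> \<in> dual (TG \<G> h)" and \<eta>: "\<eta> \<in> dual (TG \<G> ((h \<cdot> iv g) \<cdot> l))"
    and aff: "affine_cov g h l \<gamma> \<alpha> \<beta> \<eta>"
  shows "\<exists>\<theta>\<in>dual (TG \<G> (iv g \<cdot> l)). mult_cov h (iv g \<cdot> l) \<eta> \<alpha> \<theta> \<and> mult_cov g (iv g \<cdot> l) \<beta> \<gamma> \<theta>"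
proof -
  let ?q = "iv g \<cdot> l"
  have q: "?q \<in> pt" using g l tgl by (simp add: mul_in iv_in s_iv)
  have tq: "t ?q = s g" using g l tgl by (simp add: t_mul iv_in s_iv t_iv)
  have hq: "h \<cdot> ?q = (h \<cdot> iv g) \<cdot> l" using g h l sgh tgl by (simp add: assoc iv_in s_iv t_iv)
  have gq: "g \<cdot> ?q = l"
    using g l tgl by (simp add: assoc[symmetric] iv_in s_iv t_iv mul_iv e_mul)
  obtain E where E: "smooth_at G G ?q E" "E ?q = h" "\<forall>\<^sub>F y in nh G ?q. s (E y) = t y"
    "\<forall>y. t y = t ?q \<longrightarrow> E y = h"
    by (rule transversal_section[OF sub_s G h t_at[OF q]]) (use tq sgh in simp)
  obtain Eg where Eg: "smooth_at G G ?q Eg" "Eg ?q = g" "\<forall>\<^sub>F y in nh G ?q. s (Eg y) = t y"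
    "\<forall>y. t y = t ?q \<longrightarrow> Eg y = g"
    by (rule transversal_section[OF sub_s G g t_at[OF q]]) (use tq in simp)
  let ?N = "\<lambda>y. E y \<cdot> y"
  have N: "smooth_at G G ?q ?N" by (rule mul_at[OF G E(1) smooth_at_id[OF G q] E(3)])
  let ?T = "TG \<G> ?q"
  define \<theta> where "\<theta> v = 1 * pullback ?T (push G ?N ?q) \<eta> v + (-1) * pullback ?T (push G E ?q) \<alpha> v" for v
  have \<theta>d: "\<theta> \<in> dual ?T" unfolding \<theta>_def
    by (intro dual_combination linear_closed_tangent_space[OF G] push_pullback_in_dual[OF G G N] push_pullback_in_dual[OF G G E(1)])
      (use \<alpha> \<eta> E(2) hq in auto)
  have \<theta>: "\<theta> (velocity G c) = \<eta> (velocity G (\<lambda>\<tau>. E (c \<tau>) \<cdot> c \<tau>)) - \<alpha> (velocity G (\<lambda>\<tau>. E (c \<tau>)))"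
    if "curve_at G ?q c" for c
    unfolding \<theta>_def push_pullback_velocity[OF G G N that] push_pullback_velocity[OF G G E(1) that] by simp
  \<comment> \<open>Conormality to the affine relation, tested with the third curve equal to
    \<open>cg \<cdot> cq\<close>; the fourth curve is then \<open>ch \<cdot> cq\<close>.\<close>
  have main: "\<eta> (velocity G (\<lambda>\<tau>. ch \<tau> \<cdot> cq \<tau>)) + \<gamma> (velocity G cg) = \<alpha> (velocity G ch) + \<beta> (velocity G (\<lambda>\<tau>. cg \<tau> \<cdot> cq \<tau>))"
    if c: "curve_at G g cg" "curve_at G h ch" "curve_at G ?q cq"
      and ev: "\<forall>\<^sub>F \<tau> in nhds 0. s (cg \<tau>) = t (cq \<tau>)" "\<forall>\<^sub>F \<tau> in nhds 0. s (ch \<tau>) = t (cq \<tau>)" for cg ch cq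
  proof -
    note pp = curve_pt[OF c(1)] curve_pt[OF c(2)] curve_pt[OF c(3)]
    have cl: "curve_at G l (\<lambda>\<tau>. cg \<tau> \<cdot> cq \<tau>)" using curve_mul[OF c(1,3) ev(1)] gq by simp
    have 1: "\<forall>\<^sub>F \<tau> in nhds 0. s (cg \<tau>) = s (ch \<tau>)" using ev by eventually_elim simp
    have 2: "\<forall>\<^sub>F \<tau> in nhds 0. t (cg \<tau>) = t (cg \<tau> \<cdot> cq \<tau>)"
      using ev(1) pp by eventually_elim (simp add: t_mul)
    have 3: "\<forall>\<^sub>F \<tau> in nhds 0. ch \<tau> \<cdot> cq \<tau> = (ch \<tau> \<cdot> iv (cg \<tau>)) \<cdot> (cg \<tau> \<cdot> cq \<tau>)"
      using ev pp by eventually_elim (simp add: mul_iv_cancel)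
    show ?thesis
      using aff[unfolded affine_cov_def, rule_format, OF c(1,2) cl 1 2]
      unfolding curve_at_cong(2)[OF G curve_mul[OF c(2,3) ev(2)] 3] .
  qed
  have Ec: "curve_at G h (\<lambda>\<tau>. E (cq \<tau>))" "\<forall>\<^sub>F \<tau> in nhds 0. s (E (cq \<tau>)) = t (cq \<tau>)" if "curve_at G ?q cq" for cq
    using curve_at_compose[OF G G that E(1)] E(2) eventually_curve[OF G that E(3)] by auto
  have Egc: "curve_at G g (\<lambda>\<tau>. Eg (cq \<tau>))" "\<forall>\<^sub>F \<tau> in nhds 0. s (Eg (cq \<tau>)) = t (cq \<tau>)" if "curve_at G ?q cq" for cq
    using curve_at_compose[OF G G that Eg(1)] Eg(2) eventually_curve[OF G that Eg(3)] by auto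
  have "mult_cov h ?q \<eta> \<alpha> \<theta>" unfolding mult_cov_def
  proof (intro allI impI)
    fix ch cq assume c: "curve_at G h ch" "curve_at G ?q cq" "\<forall>\<^sub>F \<tau> in nhds 0. s (ch \<tau>) = t (cq \<tau>)"
    \<comment> \<open>Both instances contain the same \<open>\<gamma>\<close> and
      \<open>\<beta>\<close> terms, coming from the section \<open>Eg\<close>. Their difference
      compares \<open>ch\<close> with the section \<open>E\<close>, for which
      \<open>\<theta>\<close> was defined.\<close>
    from main[OF Egc(1)[OF c(2)] c(1,2) Egc(2)[OF c(2)] c(3)]
      main[OF Egc(1)[OF c(2)] Ec(1)[OF c(2)] c(2) Egc(2)[OF c(2)] Ec(2)[OF c(2)]] \<theta>[OF c(2)]
    show "\<eta> (velocity G (\<lambda>\<tau>. ch \<tau> \<cdot> cq \<tau>)) = \<alpha> (velocity G ch) + \<theta> (velocity G cq)" by simp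
  qed
  moreover have "mult_cov g ?q \<beta> \<gamma> \<theta>" unfolding mult_cov_def
  proof (intro allI impI)
    fix cg cq assume c: "curve_at G g cg" "curve_at G ?q cq" "\<forall>\<^sub>F \<tau> in nhds 0. s (cg \<tau>) = t (cq \<tau>)"
    from main[OF c(1) Ec(1)[OF c(2)] c(2,3) Ec(2)[OF c(2)]] \<theta>[OF c(2)]
    show "\<beta> (velocity G (\<lambda>\<tau>. cg \<tau> \<cdot> cq \<tau>)) = \<gamma> (velocity G cg) + \<theta> (velocity G cq)" by simp
  qed
  ultimately show ?thesis using \<theta>d by blast
qed

lemma dual_velocity_add:
  assumes \<xi>: "\<xi> \<in> dual (TG \<G> p)" and c: "curve_at G p c1" "curve_at G p c2"
    and v: "velocity G c = (\<lambda>f. velocity G c1 f + velocity G c2 f)"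
  shows "\<xi> (velocity G c) = \<xi> (velocity G c1) + \<xi> (velocity G c2)"
  unfolding v by (rule dual_add[OF \<xi> velocity_in_tangent_space[OF G c(1)] velocity_in_tangent_space[OF G c(2)]])

text \<open>The map \<open>K\<close> of the proof extends \<open>(u, g, h) \<mapsto> g u\<^sup>-\<^sup>1 h\<close> to a neighbourhood in the triple product,
  so that its differential splits into three partial differentials.\<close>

lemma mult_imp_affine_cov:
  assumes g: "g \<in> pt" and h: "h \<in> pt" and sg: "s g = t h"
    and \<alpha>: "\<alpha> \<in> dual (TG \<G> g)" and \<beta>: "\<beta> \<in> dual (TG \<G> h)" and \<eta>: "\<eta> \<in> dual (TG \<G> (g \<cdot> h))"
    and mc: "mult_cov g h \<eta> \<alpha> \<beta>"
  shows "\<exists>\<epsilon>\<in>dual (TG \<G> (e (s g))). affine_cov (e (s g)) g h \<epsilon> \<alpha> \<beta> \<eta> \<and>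
    (\<forall>v\<in>tangent G (e ` points M) (e (s g)). \<epsilon> v = 0)"
proof -
  define x where "x = s g"
  have x: "x \<in> points M" and sgx: "s g = x" and thx: "t h = x" using s_in[OF g] sg by (simp_all add: x_def)
  let ?u = "e x"
  have u: "?u \<in> pt" "s ?u = x" "t ?u = x" "iv ?u = ?u" using e_in s_e t_e iv_e x by auto
  have gu: "g \<cdot> ?u = g" using mul_e[OF g] sgx by simp
  have uh: "?u \<cdot> h = h" using e_mul[OF h] thx by simp
  let ?GG = "prod_mfd G G" and ?G3 = "prod_mfd G (prod_mfd G G)" and ?q = "(?u, g, h)"
  note GG = smooth_manifold_prod[OF G G]
  note G3 = smooth_manifold_prod[OF G GG] and MG = smooth_manifold_prod[OF M G]
  obtain \<sigma> where \<sigma>: "smooth_at (prod_mfd M G) G (s g, g) \<sigma>"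
    and \<sigma>1: "\<forall>\<^sub>F p in nh (prod_mfd M G) (s g, g). s (\<sigma> p) = fst p"
    and \<sigma>2: "\<forall>\<^sub>F y in nh G g. \<sigma> (s y, y) = y" by (rule submersion_transversal[OF G M sub_s g])
  obtain \<rho> where \<rho>: "smooth_at (prod_mfd M G) G (t h, h) \<rho>"
    and \<rho>1: "\<forall>\<^sub>F p in nh (prod_mfd M G) (t h, h). t (\<rho> p) = fst p"
    and \<rho>2: "\<forall>\<^sub>F y in nh G h. \<rho> (t y, y) = y" by (rule submersion_transversal[OF G M sub_t h])
  have \<sigma>0: "\<sigma> (x, g) = g" using eventually_nh_self[OF G g \<sigma>2] sgx by simp
  have \<rho>0: "\<rho> (x, h) = h" using eventually_nh_self[OF G h \<rho>2] thx by simp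
  have q: "?q \<in> pt \<times> points ?GG" using u g h by simp
  have f1: "smooth_at ?G3 G ?q fst" and f2: "smooth_at ?G3 ?GG ?q snd"
    using smooth_at_fst[OF G GG q] smooth_at_snd[OF G GG q] by auto
  have f3: "smooth_at ?G3 G ?q (\<lambda>q. fst (snd q))" and f4: "smooth_at ?G3 G ?q (\<lambda>q. snd (snd q))"
    by (rule smooth_at_compose[OF G3 GG G f2], use smooth_at_fst[OF G G, of "(g, h)"] smooth_at_snd[OF G G, of "(g, h)"] g h in simp)+
  have fs: "smooth_at ?G3 M ?q (\<lambda>q. s (fst q))" and ft: "smooth_at ?G3 M ?q (\<lambda>q. t (fst q))"
    by (rule smooth_at_compose[OF G3 G M f1], use s_at[OF u(1)] t_at[OF u(1)] in simp)+
  have A1: "smooth_at ?G3 (prod_mfd M G) ?q (\<lambda>q. (s (fst q), fst (snd q)))" by (rule smooth_at_Pair[OF G3 M G fs f3])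
  have A2: "smooth_at ?G3 (prod_mfd M G) ?q (\<lambda>q. (t (fst q), snd (snd q)))" by (rule smooth_at_Pair[OF G3 M G ft f4])
  \<comment> \<open>\<open>a1\<close> replaces \<open>g\<close> by a nearby arrow with the source of
    \<open>u\<close>, and \<open>a2\<close> replaces \<open>h\<close> by one with the target of
    \<open>u\<close>; at the given unit both leave the arrow unchanged.\<close>
  define a1 where "a1 q = \<sigma> (s (fst q), fst (snd q))" for q :: "'g \<times> 'g \<times> 'g"
  define a2 where "a2 q = \<rho> (t (fst q), snd (snd q))" for q :: "'g \<times> 'g \<times> 'g"
  have a1: "smooth_at ?G3 G ?q a1" unfolding a1_def by (rule smooth_at_compose[OF G3 MG G A1]) (use \<sigma> sgx u in simp)
  have a2: "smooth_at ?G3 G ?q a2" unfolding a2_def by (rule smooth_at_compose[OF G3 MG G A2]) (use \<rho> thx u in simp)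
  have ev1: "\<forall>\<^sub>F q in nh ?G3 ?q. s (a1 q) = s (fst q)"
    using smooth_at_filterlim[OF G3 MG A1] \<sigma>1 sgx u unfolding filterlim_iff a1_def by auto
  have ev2: "\<forall>\<^sub>F q in nh ?G3 ?q. t (a2 q) = t (fst q)"
    using smooth_at_filterlim[OF G3 MG A2] \<rho>1 thx u unfolding filterlim_iff a2_def by auto
  have ev3: "\<forall>\<^sub>F q in nh ?G3 ?q. fst q \<in> pt"
    by (rule smooth_at_eventually_in[OF G3 G f1 open_subset_points[OF G]]) (use u in simp)
  have ev4: "\<forall>\<^sub>F q in nh ?G3 ?q. a1 q \<in> pt"
    by (rule smooth_at_eventually_in[OF G3 G a1 open_subset_points[OF G] smooth_at_points(2)[OF a1]])
  have fi: "smooth_at ?G3 G ?q (\<lambda>q. iv (fst q))"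
    by (rule smooth_at_compose[OF G3 G G f1]) (use iv_at[OF u(1)] in simp)
  have b1: "smooth_at ?G3 G ?q (\<lambda>q. a1 q \<cdot> iv (fst q))"
    by (rule mul_at[OF G3 a1 fi]) (use ev1 ev3 in \<open>eventually_elim, simp add: t_iv\<close>)
  define K where "K q = (a1 q \<cdot> iv (fst q)) \<cdot> a2 q" for q
  have K: "smooth_at ?G3 G ?q K" unfolding K_def
    by (rule mul_at[OF G3 b1 a2])
      (use ev1 ev2 ev3 ev4 in \<open>eventually_elim, simp add: s_mul s_iv t_iv iv_in\<close>)
  have K0: "K ?q = g \<cdot> h" unfolding K_def a1_def a2_def using u \<sigma>0 \<rho>0 gu by simp
  have gh: "(g, h) \<in> points ?GG" using g h by simp
  note sl = smooth_at_slices[OF G GG u(1) gh]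
  let ?E1 = "\<lambda>y. a1 (y, g, h)" and ?E2 = "\<lambda>y. a2 (y, g, h)" and ?N = "\<lambda>y. K (y, g, h)"
  have E1: "smooth_at G G ?u ?E1" and E2: "smooth_at G G ?u ?E2" and N: "smooth_at G G ?u ?N"
    by (rule smooth_at_compose[OF G G3 G sl(1)], use a1 a2 K in simp)+
  have E10: "?E1 ?u = g" and E20: "?E2 ?u = h" unfolding a1_def a2_def using u \<sigma>0 \<rho>0 by simp_all
  let ?T = "TG \<G> ?u"
  \<comment> \<open>The condition to be proved, applied to a curve at the unit together with its
    images under \<open>?E1\<close> and \<open>?E2\<close>, dictates
    \<open>\<epsilon>\<close>.\<close>
  define \<epsilon>' where "\<epsilon>' v = 1 * pullback ?T (push G ?E1 ?u) \<alpha> v + 1 * pullback ?T (push G ?E2 ?u) \<beta> v" for v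
  define \<epsilon> where "\<epsilon> v = 1 * \<epsilon>' v + (-1) * pullback ?T (push G ?N ?u) \<eta> v" for v
  note lc = linear_closed_tangent_space[OF G, of ?u]
  have "\<epsilon>' \<in> dual ?T" unfolding \<epsilon>'_def
    by (rule dual_combination[OF lc push_pullback_in_dual[OF G G E1] push_pullback_in_dual[OF G G E2]])
      (use \<alpha> \<beta> E10 E20 in simp_all)
  then have \<epsilon>d: "\<epsilon> \<in> dual ?T" unfolding \<epsilon>_def
    by (rule dual_combination[OF lc _ push_pullback_in_dual[OF G G N]]) (use \<eta> K0 in simp)
  have \<epsilon>: "\<epsilon> (velocity G c) = \<alpha> (velocity G (\<lambda>\<tau>. ?E1 (c \<tau>))) + \<beta> (velocity G (\<lambda>\<tau>. ?E2 (c \<tau>))) - \<eta> (velocity G (\<lambda>\<tau>. ?N (c \<tau>)))"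
    if "curve_at G ?u c" for c
    unfolding \<epsilon>_def \<epsilon>'_def push_pullback_velocity[OF G G E1 that] push_pullback_velocity[OF G G E2 that]
      push_pullback_velocity[OF G G N that] by simp
  have K2: "smooth_at ?GG G (g, h) (\<lambda>p. K (?u, p))"
    by (rule smooth_at_compose[OF GG G3 G sl(2)]) (use K in simp)
  have cg0: "curve_at G g (\<lambda>\<tau>. g)" and ch0: "curve_at G h (\<lambda>\<tau>. h)"
    using curve_at_const[OF G] g h by auto
  have s\<sigma>: "smooth_at G G g (\<lambda>y. \<sigma> (x, y))"
    using smooth_at_compose[OF G MG G smooth_at_slices(2)[OF M G x g]] \<sigma> sgx by simp
  have s\<rho>: "smooth_at G G h (\<lambda>y. \<rho> (x, y))"
    using smooth_at_compose[OF G MG G smooth_at_slices(2)[OF M G x h]] \<rho> thx by simp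
  have "affine_cov ?u g h \<epsilon> \<alpha> \<beta> \<eta>" unfolding affine_cov_def
  proof (intro allI impI)
    fix cu cg ch assume cu: "curve_at G ?u cu" and cg: "curve_at G g cg" and ch: "curve_at G h ch"
      and es: "\<forall>\<^sub>F \<tau> in nhds 0. s (cu \<tau>) = s (cg \<tau>)" and et: "\<forall>\<^sub>F \<tau> in nhds 0. t (cu \<tau>) = t (ch \<tau>)"
    note evg = eventually_curve[OF G cg \<sigma>2] and evh = eventually_curve[OF G ch \<rho>2]
    note cgh = curve_at_Pair[OF G G cg ch]
    note cugh = curve_at_Pair[OF G GG cu cgh]
    have cK: "curve_at G (g \<cdot> h) (\<lambda>\<tau>. K (cu \<tau>, cg \<tau>, ch \<tau>))" using curve_at_compose[OF G3 G cugh K] K0 by simp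
    have "\<forall>\<^sub>F \<tau> in nhds 0. K (cu \<tau>, cg \<tau>, ch \<tau>) = (cg \<tau> \<cdot> iv (cu \<tau>)) \<cdot> ch \<tau>"
      using es et evg evh by eventually_elim (simp add: K_def a1_def a2_def)
    from curve_at_cong(2)[OF G cK this]
    have v0: "velocity G (\<lambda>\<tau>. (cg \<tau> \<cdot> iv (cu \<tau>)) \<cdot> ch \<tau>) = velocity G (\<lambda>\<tau>. K (cu \<tau>, cg \<tau>, ch \<tau>))" by simp
    have cN: "curve_at G (g \<cdot> h) (\<lambda>\<tau>. ?N (cu \<tau>))" using curve_at_compose[OF G G cu N] K0 by simp
    have cK2: "curve_at G (g \<cdot> h) (\<lambda>\<tau>. K (?u, cg \<tau>, ch \<tau>))" using curve_at_compose[OF GG G cgh K2] K0 by simp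
    have v1: "\<eta> (velocity G (\<lambda>\<tau>. K (cu \<tau>, cg \<tau>, ch \<tau>))) = \<eta> (velocity G (\<lambda>\<tau>. ?N (cu \<tau>))) + \<eta> (velocity G (\<lambda>\<tau>. K (?u, cg \<tau>, ch \<tau>)))"
      by (rule dual_velocity_add[OF \<eta> cN cK2 velocity_split[OF G GG G K cu cgh]])
    have cK3: "curve_at G (g \<cdot> h) (\<lambda>\<tau>. K (?u, cg \<tau>, h))"
      using curve_at_compose[OF GG G curve_at_Pair[OF G G cg ch0] K2] K0 by simp
    have cK4: "curve_at G (g \<cdot> h) (\<lambda>\<tau>. K (?u, g, ch \<tau>))"
      using curve_at_compose[OF GG G curve_at_Pair[OF G G cg0 ch] K2] K0 by simp
    have v2: "\<eta> (velocity G (\<lambda>\<tau>. K (?u, cg \<tau>, ch \<tau>))) = \<eta> (velocity G (\<lambda>\<tau>. K (?u, cg \<tau>, h))) + \<eta> (velocity G (\<lambda>\<tau>. K (?u, g, ch \<tau>)))"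
      by (rule dual_velocity_add[OF \<eta> cK3 cK4 velocity_split[OF G G G K2 cg ch]])
    \<comment> \<open>The parts of \<open>cg\<close> and \<open>ch\<close> inside the fibres over
      \<open>x\<close>. Along them the unit stays fixed, and \<open>mult_cov\<close> applies with
      the other arrow constant.\<close>
    let ?a = "\<lambda>\<tau>. \<sigma> (x, cg \<tau>)" and ?b = "\<lambda>\<tau>. \<rho> (x, ch \<tau>)"
    have ca: "curve_at G g ?a" using curve_at_compose[OF G G cg s\<sigma>] \<sigma>0 by simp
    have cb: "curve_at G h ?b" using curve_at_compose[OF G G ch s\<rho>] \<rho>0 by simp
    have sa: "\<forall>\<^sub>F \<tau> in nhds 0. s (?a \<tau>) = x"
      using eventually_curve[OF MG curve_at_Pair[OF M G curve_at_const[OF M x] cg]] \<sigma>1 sgx by fastforce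
    have tb: "\<forall>\<^sub>F \<tau> in nhds 0. t (?b \<tau>) = x"
      using eventually_curve[OF MG curve_at_Pair[OF M G curve_at_const[OF M x] ch]] \<rho>1 thx by fastforce
    have "\<forall>\<^sub>F \<tau> in nhds 0. K (?u, cg \<tau>, h) = ?a \<tau> \<cdot> h"
      using sa curve_pt[OF ca]
    proof eventually_elim
      case (elim \<tau>)
      then show ?case using mul_e[OF elim(2)] by (simp add: K_def a1_def a2_def u \<rho>0)
    qed
    from curve_at_cong(2)[OF G cK3 this]
    have "\<eta> (velocity G (\<lambda>\<tau>. K (?u, cg \<tau>, h))) = \<alpha> (velocity G ?a) + \<beta> (velocity G (\<lambda>\<tau>. h))"
      using mc[unfolded mult_cov_def, rule_format, OF ca ch0] sa thx by simp
    then have v3: "\<eta> (velocity G (\<lambda>\<tau>. K (?u, cg \<tau>, h))) = \<alpha> (velocity G ?a)"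
      using velocity_const dual_zero[OF \<beta> tangent_space_zero[OF G h]] by simp
    have "\<forall>\<^sub>F \<tau> in nhds 0. K (?u, g, ch \<tau>) = g \<cdot> ?b \<tau>"
      by (simp add: K_def a1_def a2_def u \<sigma>0 gu)
    from curve_at_cong(2)[OF G cK4 this]
    have "\<eta> (velocity G (\<lambda>\<tau>. K (?u, g, ch \<tau>))) = \<alpha> (velocity G (\<lambda>\<tau>. g)) + \<beta> (velocity G ?b)"
      using mc[unfolded mult_cov_def, rule_format, OF cg0 cb] tb sgx by (simp add: eq_commute)
    then have v4: "\<eta> (velocity G (\<lambda>\<tau>. K (?u, g, ch \<tau>))) = \<beta> (velocity G ?b)"
      using velocity_const dual_zero[OF \<alpha> tangent_space_zero[OF G g]] by simp
    have scu: "curve_at M x (\<lambda>\<tau>. s (cu \<tau>))" using curve_at_compose[OF G M cu s_at[OF u(1)]] u by simp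
    have tcu: "curve_at M x (\<lambda>\<tau>. t (cu \<tau>))" using curve_at_compose[OF G M cu t_at[OF u(1)]] u by simp
    have cE1: "curve_at G g (\<lambda>\<tau>. ?E1 (cu \<tau>))" using curve_at_compose[OF G G cu E1] E10 by simp
    have cE2: "curve_at G h (\<lambda>\<tau>. ?E2 (cu \<tau>))" using curve_at_compose[OF G G cu E2] E20 by simp
    \<comment> \<open>As \<open>cg\<close> and \<open>cu\<close> have equal sources near 0,
      \<open>cg\<close> is not changed by the transversal with base point
      \<open>s (cu \<tau>)\<close>. Its velocity splits into a part that follows \<open>cu\<close>
      and the part inside the fibre; likewise for \<open>ch\<close> and targets.\<close>
    have \<sigma>': "smooth_at (prod_mfd M G) G (x, g) \<sigma>" and \<rho>': "smooth_at (prod_mfd M G) G (x, h) \<rho>"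
      using \<sigma> \<rho> sgx thx by simp_all
    have "\<forall>\<^sub>F \<tau> in nhds 0. cg \<tau> = \<sigma> (s (cu \<tau>), cg \<tau>)" using evg es by eventually_elim simp
    from curve_at_cong(2)[OF G cg this] velocity_split[OF M G G \<sigma>' scu cg]
    have "velocity G cg = (\<lambda>f. velocity G (\<lambda>\<tau>. ?E1 (cu \<tau>)) f + velocity G ?a f)" by (simp add: a1_def)
    from dual_velocity_add[OF \<alpha> cE1 ca this]
    have v5: "\<alpha> (velocity G cg) = \<alpha> (velocity G (\<lambda>\<tau>. ?E1 (cu \<tau>))) + \<alpha> (velocity G ?a)" .
    have "\<forall>\<^sub>F \<tau> in nhds 0. ch \<tau> = \<rho> (t (cu \<tau>), ch \<tau>)" using evh et by eventually_elim simp
    from curve_at_cong(2)[OF G ch this] velocity_split[OF M G G \<rho>' tcu ch]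
    have "velocity G ch = (\<lambda>f. velocity G (\<lambda>\<tau>. ?E2 (cu \<tau>)) f + velocity G ?b f)" by (simp add: a2_def)
    from dual_velocity_add[OF \<beta> cE2 cb this]
    have v6: "\<beta> (velocity G ch) = \<beta> (velocity G (\<lambda>\<tau>. ?E2 (cu \<tau>))) + \<beta> (velocity G ?b)" .
    show "\<eta> (velocity G (\<lambda>\<tau>. (cg \<tau> \<cdot> iv (cu \<tau>)) \<cdot> ch \<tau>)) + \<epsilon> (velocity G cu) = \<alpha> (velocity G cg) + \<beta> (velocity G ch)"
      unfolding v0 v1 v2 v3 v4 v5 v6 \<epsilon>[OF cu] by simp
  qed
  moreover have "\<epsilon> v = 0" if "v \<in> tangent G (e ` points M) ?u" for v
  proof -
    obtain c where c: "curve_at G ?u c" "\<forall>\<^sub>F \<tau> in nhds 0. c \<tau> \<in> e ` points M" "v = velocity G c"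
      using \<open>v \<in> _\<close> tangent_iff[OF G] by metis
    have cE1: "curve_at G g (\<lambda>\<tau>. ?E1 (c \<tau>))" using curve_at_compose[OF G G c(1) E1] E10 by simp
    have cE2: "curve_at G h (\<lambda>\<tau>. ?E2 (c \<tau>))" using curve_at_compose[OF G G c(1) E2] E20 by simp
    have cN: "curve_at G (g \<cdot> h) (\<lambda>\<tau>. ?N (c \<tau>))" using curve_at_compose[OF G G c(1) N] K0 by simp
    have cc: "curve_at ?G3 ?q (\<lambda>\<tau>. (c \<tau>, g, h))" by (rule curve_at_Pair[OF G GG c(1) curve_at_const[OF GG gh]])
    have 1: "\<forall>\<^sub>F \<tau> in nhds 0. s (?E1 (c \<tau>)) = s (c \<tau>)" using eventually_curve[OF G3 cc ev1] by simp
    have 2: "\<forall>\<^sub>F \<tau> in nhds 0. t (?E2 (c \<tau>)) = t (c \<tau>)" using eventually_curve[OF G3 cc ev2] by simp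
    \<comment> \<open>Along units source and target agree, so the two corrected arrows are
      composable and \<open>?N\<close> is their product; \<open>mult_cov\<close> then makes the
      three terms of \<open>\<epsilon>\<close> cancel.\<close>
    have 3: "\<forall>\<^sub>F \<tau> in nhds 0. s (?E1 (c \<tau>)) = t (?E2 (c \<tau>))"
      using 1 2 c(2) by eventually_elim (auto simp: s_e t_e)
    have 4: "\<forall>\<^sub>F \<tau> in nhds 0. ?N (c \<tau>) = ?E1 (c \<tau>) \<cdot> ?E2 (c \<tau>)"
      using 1 c(2) curve_pt[OF cE1]
    proof eventually_elim
      case (elim \<tau>)
      then obtain y where y: "y \<in> points M" "c \<tau> = e y" by blast
      have "?E1 (c \<tau>) \<cdot> iv (c \<tau>) = ?E1 (c \<tau>)"
        using mul_e[OF elim(3)] elim(1) y by (simp add: iv_e s_e)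
      then show ?case by (simp add: K_def)
    qed
    have "\<eta> (velocity G (\<lambda>\<tau>. ?N (c \<tau>))) = \<alpha> (velocity G (\<lambda>\<tau>. ?E1 (c \<tau>))) + \<beta> (velocity G (\<lambda>\<tau>. ?E2 (c \<tau>)))"
      using mc[unfolded mult_cov_def, rule_format, OF cE1 cE2 3] curve_at_cong(2)[OF G cN 4] by simp
    then show ?thesis unfolding c(3) \<epsilon>[OF c(1)] by simp
  qed
  ultimately show ?thesis using \<epsilon>d unfolding x_def by blast
qed

section \<open>Multiplicativity and affinity in terms of covectors on the single arrows\<close>

definition mult_rel :: "nat \<Rightarrow> ('g \<Rightarrow> 'g mvec) \<Rightarrow> bool" where
  "mult_rel k P \<longleftrightarrow> (\<forall>g h \<eta>s \<alpha>s \<beta>s. g \<in> pt \<longrightarrow> h \<in> pt \<longrightarrow> s g = t h \<longrightarrow>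
     length \<eta>s = k \<longrightarrow> length \<alpha>s = k \<longrightarrow> length \<beta>s = k \<longrightarrow>
     set \<eta>s \<subseteq> dual (TG \<G> (g \<cdot> h)) \<longrightarrow> set \<alpha>s \<subseteq> dual (TG \<G> g) \<longrightarrow> set \<beta>s \<subseteq> dual (TG \<G> h) \<longrightarrow>
     (\<forall>i<k. mult_cov g h (\<eta>s ! i) (\<alpha>s ! i) (\<beta>s ! i)) \<longrightarrow>
     P (g \<cdot> h) \<eta>s = P g \<alpha>s + P h \<beta>s)"

definition affine_rel :: "nat \<Rightarrow> ('g \<Rightarrow> 'g mvec) \<Rightarrow> bool" where
  "affine_rel k P \<longleftrightarrow> (\<forall>g h l \<gamma>s \<alpha>s \<beta>s \<eta>s. g \<in> pt \<longrightarrow> h \<in> pt \<longrightarrow> l \<in> pt \<longrightarrow> s g = s h \<longrightarrow> t g = t l \<longrightarrow>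
     length \<gamma>s = k \<longrightarrow> length \<alpha>s = k \<longrightarrow> length \<beta>s = k \<longrightarrow> length \<eta>s = k \<longrightarrow>
     set \<gamma>s \<subseteq> dual (TG \<G> g) \<longrightarrow> set \<alpha>s \<subseteq> dual (TG \<G> h) \<longrightarrow> set \<beta>s \<subseteq> dual (TG \<G> l) \<longrightarrow>
     set \<eta>s \<subseteq> dual (TG \<G> ((h \<cdot> iv g) \<cdot> l)) \<longrightarrow>
     (\<forall>i<k. affine_cov g h l (\<gamma>s ! i) (\<alpha>s ! i) (\<beta>s ! i) (\<eta>s ! i)) \<longrightarrow>
     P ((h \<cdot> iv g) \<cdot> l) \<eta>s + P g \<gamma>s = P h \<alpha>s + P l \<beta>s)"

text \<open>Covectors that annihilate the tangent space of the units are the covectors of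
  \<open>A\<close>, so this is the vanishing of the component of \<open>P\<close> in the exterior
  power of \<open>A\<close> along the units. For \<open>k = 0\<close> it reads
  \<open>P (e x) [] = 0\<close>.\<close>

definition unit_vanishing :: "nat \<Rightarrow> ('g \<Rightarrow> 'g mvec) \<Rightarrow> bool" where
  "unit_vanishing k P \<longleftrightarrow> (\<forall>x \<epsilon>s. x \<in> points M \<longrightarrow> length \<epsilon>s = k \<longrightarrow> set \<epsilon>s \<subseteq> dual (TG \<G> (e x)) \<longrightarrow>
     (\<forall>\<epsilon>\<in>set \<epsilon>s. \<forall>v\<in>tangent G (e ` points M) (e x). \<epsilon> v = 0) \<longrightarrow> P (e x) \<epsilon>s = 0)"

lemma mult_rel_imp_affine_rel:
  assumes m: "mult_rel k P"
  shows "affine_rel k P"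
  unfolding affine_rel_def
proof (intro allI impI)
  fix g h l \<gamma>s \<alpha>s \<beta>s \<eta>s
  assume p: "g \<in> pt" "h \<in> pt" "l \<in> pt" and st: "s g = s h" "t g = t l"
    and len: "length \<gamma>s = k" "length \<alpha>s = k" "length \<beta>s = k" "length \<eta>s = k"
    and d: "set \<gamma>s \<subseteq> dual (TG \<G> g)" "set \<alpha>s \<subseteq> dual (TG \<G> h)" "set \<beta>s \<subseteq> dual (TG \<G> l)"
      "set \<eta>s \<subseteq> dual (TG \<G> ((h \<cdot> iv g) \<cdot> l))"
    and cov: "\<forall>i<k. affine_cov g h l (\<gamma>s ! i) (\<alpha>s ! i) (\<beta>s ! i) (\<eta>s ! i)"
  let ?q = "iv g \<cdot> l"
  have q: "?q \<in> pt" using p st by (simp add: mul_in iv_in s_iv)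
  have tq: "t ?q = s g" using p st by (simp add: t_mul iv_in s_iv t_iv)
  have hq: "h \<cdot> ?q = (h \<cdot> iv g) \<cdot> l" using p st by (simp add: assoc iv_in s_iv t_iv)
  have gq: "g \<cdot> ?q = l"
    using p st by (simp add: assoc[symmetric] iv_in s_iv t_iv mul_iv e_mul)
  have "\<forall>i<k. \<exists>\<theta>. \<theta> \<in> dual (TG \<G> ?q) \<and> mult_cov h ?q (\<eta>s ! i) (\<alpha>s ! i) \<theta> \<and> mult_cov g ?q (\<beta>s ! i) (\<gamma>s ! i) \<theta>"
  proof (intro allI impI)
    fix i assume i: "i < k"
    have "\<alpha>s ! i \<in> dual (TG \<G> h)" "\<eta>s ! i \<in> dual (TG \<G> ((h \<cdot> iv g) \<cdot> l))"
      using d len i by (auto dest: nth_mem)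
    from affine_imp_mult_cov[OF p st this cov[rule_format, OF i]]
    show "\<exists>\<theta>. \<theta> \<in> dual (TG \<G> ?q) \<and> mult_cov h ?q (\<eta>s ! i) (\<alpha>s ! i) \<theta> \<and> mult_cov g ?q (\<beta>s ! i) (\<gamma>s ! i) \<theta>" by blast
  qed
  then obtain \<theta>s where \<theta>s: "length \<theta>s = k" "\<forall>i<k. \<theta>s ! i \<in> dual (TG \<G> ?q) \<and>
      mult_cov h ?q (\<eta>s ! i) (\<alpha>s ! i) (\<theta>s ! i) \<and> mult_cov g ?q (\<beta>s ! i) (\<gamma>s ! i) (\<theta>s ! i)"
    unfolding Skolem_list_nth by blast
  then have \<theta>d: "set \<theta>s \<subseteq> dual (TG \<G> ?q)" by (auto simp: in_set_conv_nth)
  have "P (h \<cdot> ?q) \<eta>s = P h \<alpha>s + P ?q \<theta>s"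
    using m[unfolded mult_rel_def, rule_format, of h ?q \<eta>s \<alpha>s \<theta>s] p q st tq len d \<theta>s \<theta>d hq by simp
  moreover have "P (g \<cdot> ?q) \<beta>s = P g \<gamma>s + P ?q \<theta>s"
    using m[unfolded mult_rel_def, rule_format, of g ?q \<beta>s \<gamma>s \<theta>s] p q st tq len d \<theta>s \<theta>d gq by simp
  ultimately show "P ((h \<cdot> iv g) \<cdot> l) \<eta>s + P g \<gamma>s = P h \<alpha>s + P l \<beta>s" using hq gq by simp
qed

lemma affine_rel_imp_mult_rel:
  assumes a: "affine_rel k P" and u: "unit_vanishing k P"
  shows "mult_rel k P"
  unfolding mult_rel_def
proof (intro allI impI)
  fix g h \<eta>s \<alpha>s \<beta>s
  assume p: "g \<in> pt" "h \<in> pt" and st: "s g = t h"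
    and len: "length \<eta>s = k" "length \<alpha>s = k" "length \<beta>s = k"
    and d: "set \<eta>s \<subseteq> dual (TG \<G> (g \<cdot> h))" "set \<alpha>s \<subseteq> dual (TG \<G> g)" "set \<beta>s \<subseteq> dual (TG \<G> h)"
    and cov: "\<forall>i<k. mult_cov g h (\<eta>s ! i) (\<alpha>s ! i) (\<beta>s ! i)"
  let ?u = "e (s g)"
  have x: "s g \<in> points M" using s_in p by blast
  have gh: "(g \<cdot> iv ?u) \<cdot> h = g \<cdot> h" using iv_e[OF x] mul_e[OF p(1)] by simp
  have "\<forall>i<k. \<exists>\<epsilon>. \<epsilon> \<in> dual (TG \<G> ?u) \<and> affine_cov ?u g h \<epsilon> (\<alpha>s ! i) (\<beta>s ! i) (\<eta>s ! i) \<and>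
    (\<forall>v\<in>tangent G (e ` points M) ?u. \<epsilon> v = 0)"
  proof (intro allI impI)
    fix i assume i: "i < k"
    have "\<alpha>s ! i \<in> dual (TG \<G> g)" "\<beta>s ! i \<in> dual (TG \<G> h)" "\<eta>s ! i \<in> dual (TG \<G> (g \<cdot> h))"
      using d len i by (auto dest: nth_mem)
    from mult_imp_affine_cov[OF p st this cov[rule_format, OF i]]
    show "\<exists>\<epsilon>. \<epsilon> \<in> dual (TG \<G> ?u) \<and> affine_cov ?u g h \<epsilon> (\<alpha>s ! i) (\<beta>s ! i) (\<eta>s ! i) \<and>
      (\<forall>v\<in>tangent G (e ` points M) ?u. \<epsilon> v = 0)" by blast
  qed
  then obtain \<epsilon>s where \<epsilon>s: "length \<epsilon>s = k" "\<forall>i<k. \<epsilon>s ! i \<in> dual (TG \<G> ?u) \<and>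
      affine_cov ?u g h (\<epsilon>s ! i) (\<alpha>s ! i) (\<beta>s ! i) (\<eta>s ! i) \<and> (\<forall>v\<in>tangent G (e ` points M) ?u. (\<epsilon>s ! i) v = 0)"
    unfolding Skolem_list_nth by blast
  then have \<epsilon>d: "set \<epsilon>s \<subseteq> dual (TG \<G> ?u)" and \<epsilon>0: "\<forall>\<epsilon>\<in>set \<epsilon>s. \<forall>v\<in>tangent G (e ` points M) ?u. \<epsilon> v = 0"
    by (auto simp: in_set_conv_nth)
  have "P ((g \<cdot> iv ?u) \<cdot> h) \<eta>s + P ?u \<epsilon>s = P g \<alpha>s + P h \<beta>s"
    using a[unfolded affine_rel_def, rule_format, of ?u g h \<epsilon>s \<alpha>s \<beta>s \<eta>s] p st x len d \<epsilon>s \<epsilon>d gh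
    by (simp add: e_in s_e t_e)
  moreover have "P ?u \<epsilon>s = 0"
    using u x \<epsilon>s(1) \<epsilon>d \<epsilon>0 unfolding unit_vanishing_def by blast
  ultimately show "P (g \<cdot> h) \<eta>s = P g \<alpha>s + P h \<beta>s" using gh by simp
qed

text \<open>On the graph the third curve is determined by the first two, so conormality can be
  tested on pairs of curves with matching source and target.\<close>

lemma mult_cov_iff:
  assumes "g \<in> pt" "h \<in> pt" "s g = t h"
  shows "mult_cov g h (\<lambda>v. - \<gamma> v) \<alpha> \<beta> \<longleftrightarrow>
    (\<forall>c1 c2 c3. curve_at G g c1 \<and> curve_at G h c2 \<and> curve_at G (g \<cdot> h) c3 \<and>
       (\<forall>\<^sub>F \<tau> in nhds 0. (c1 \<tau>, c2 \<tau>, c3 \<tau>) \<in> {(g, h, g \<cdot> h) | g h. (g, h) \<in> composable \<G>}) \<longrightarrow>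
       \<alpha> (velocity G c1) + \<beta> (velocity G c2) + \<gamma> (velocity G c3) = 0)" (is "?L \<longleftrightarrow> ?R")
proof
  assume L: ?L
  show ?R
  proof (intro allI impI, elim conjE)
    fix c1 c2 c3 assume c: "curve_at G g c1" "curve_at G h c2" "curve_at G (g \<cdot> h) c3"
      and ev: "\<forall>\<^sub>F \<tau> in nhds 0. (c1 \<tau>, c2 \<tau>, c3 \<tau>) \<in> {(g, h, g \<cdot> h) | g h. (g, h) \<in> composable \<G>}"
    have 1: "\<forall>\<^sub>F \<tau> in nhds 0. s (c1 \<tau>) = t (c2 \<tau>)" using ev by eventually_elim (auto simp: composable_def)
    have 2: "\<forall>\<^sub>F \<tau> in nhds 0. c3 \<tau> = c1 \<tau> \<cdot> c2 \<tau>" using ev by eventually_elim auto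
    show "\<alpha> (velocity G c1) + \<beta> (velocity G c2) + \<gamma> (velocity G c3) = 0"
      using L[unfolded mult_cov_def, rule_format, OF c(1,2) 1] unfolding curve_at_cong(2)[OF G c(3) 2] by linarith
  qed
next
  assume R: ?R
  show ?L unfolding mult_cov_def
  proof (intro allI impI)
    fix c1 c2 assume c: "curve_at G g c1" "curve_at G h c2" and ev: "\<forall>\<^sub>F \<tau> in nhds 0. s (c1 \<tau>) = t (c2 \<tau>)"
    have "\<forall>\<^sub>F \<tau> in nhds 0. (c1 \<tau>, c2 \<tau>, c1 \<tau> \<cdot> c2 \<tau>) \<in> {(g, h, g \<cdot> h) | g h. (g, h) \<in> composable \<G>}"
      using ev curve_pt[OF c(1)] curve_pt[OF c(2)] by eventually_elim (auto simp: composable_def)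
    with R c curve_mul[OF c ev]
    have "\<alpha> (velocity G c1) + \<beta> (velocity G c2) + \<gamma> (velocity G (\<lambda>\<tau>. c1 \<tau> \<cdot> c2 \<tau>)) = 0" by blast
    then show "- \<gamma> (velocity G (\<lambda>\<tau>. c1 \<tau> \<cdot> c2 \<tau>)) = \<alpha> (velocity G c1) + \<beta> (velocity G c2)" by simp
  qed
qed

lemma multiplicative_iff:
  assumes P: "kvector_field G k P"
  shows "multiplicative \<G> k P \<longleftrightarrow> mult_rel k P"
proof -
  let ?S = "{(g, h, g \<cdot> h) | g h. (g, h) \<in> composable \<G>}"
  have S: "?S \<subseteq> pt \<times> (pt \<times> pt)" by (auto simp: composable_def mul_in)
  have kv: "kvector k (TG \<G> g) (P g)" if "g \<in> pt" for g using P that unfolding kvector_field_def by blast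
  note lc = linear_closed_tangent_space[OF G]
  let ?m = "map (\<lambda>(\<xi>::'g covec) v. - \<xi> v)"
  \<comment> \<open>Negating all \<open>k\<close> covectors contributes \<open>(-1) ^ k\<close>;
    against the prescribed \<open>(-1) ^ (k + 1)\<close> a single minus sign is left, which moves
    the term to the other side of the equation.\<close>
  have sgn: "(-1) ^ (k + 1) * P g \<gamma>s = - P g (?m \<gamma>s)"
    if "g \<in> pt" "length \<gamma>s = k" "set \<gamma>s \<subseteq> dual (TG \<G> g)" for g \<gamma>s
    using kvector_uminus[OF lc kv[OF that(1)] that(2,3)] by simp
  have S_iff: "(g, h, p) \<in> ?S \<longleftrightarrow> g \<in> pt \<and> h \<in> pt \<and> s g = t h \<and> p = g \<cdot> h" for g h p
    by (auto simp: composable_def)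
  have "multiplicative \<G> k P \<longleftrightarrow> coisotropic (prod_mfd G (prod_mfd G G)) k
      (sum_field G (prod_mfd G G) P (sum_field G G P (scale_field ((-1) ^ (k + 1)) P))) ?S"
    unfolding multiplicative_def Let_def using P by blast
  also have "\<dots> \<longleftrightarrow> mult_rel k P" (is "?L \<longleftrightarrow> _")
  proof
    assume L: ?L
    show "mult_rel k P" unfolding mult_rel_def
    proof (intro allI impI)
      fix g h \<eta>s \<alpha>s \<beta>s
      assume p: "g \<in> pt" "h \<in> pt" and st: "s g = t h"
        and len: "length \<eta>s = k" "length \<alpha>s = k" "length \<beta>s = k"
        and d: "set \<eta>s \<subseteq> dual (TG \<G> (g \<cdot> h))" "set \<alpha>s \<subseteq> dual (TG \<G> g)" "set \<beta>s \<subseteq> dual (TG \<G> h)"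
        and cov: "\<forall>i<k. mult_cov g h (\<eta>s ! i) (\<alpha>s ! i) (\<beta>s ! i)"
      have gh: "g \<cdot> h \<in> pt" using p st by (rule mul_in)
      have dm: "set (?m \<eta>s) \<subseteq> dual (TG \<G> (g \<cdot> h))" by (rule uminus_covectors_dual[OF lc d(1)])
      have cov': "\<forall>i<k. \<forall>c1 c2 c3. curve_at G g c1 \<and> curve_at G h c2 \<and> curve_at G (g \<cdot> h) c3 \<and>
         (\<forall>\<^sub>F \<tau> in nhds 0. (c1 \<tau>, c2 \<tau>, c3 \<tau>) \<in> ?S) \<longrightarrow>
         (\<alpha>s ! i) (velocity G c1) + (\<beta>s ! i) (velocity G c2) + (?m \<eta>s ! i) (velocity G c3) = 0"
      proof (intro allI impI)
        fix i c1 c2 c3 assume i: "i < k" and c: "curve_at G g c1 \<and> curve_at G h c2 \<and> curve_at G (g \<cdot> h) c3 \<and>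
         (\<forall>\<^sub>F \<tau> in nhds 0. (c1 \<tau>, c2 \<tau>, c3 \<tau>) \<in> ?S)"
        have "mult_cov g h (\<lambda>v. - (?m \<eta>s ! i) v) (\<alpha>s ! i) (\<beta>s ! i)" using cov i len(1) by simp
        from this[unfolded mult_cov_iff[OF p st], rule_format, OF c]
        show "(\<alpha>s ! i) (velocity G c1) + (\<beta>s ! i) (velocity G c2) + (?m \<eta>s ! i) (velocity G c3) = 0" .
      qed
      have inS: "(g, h, g \<cdot> h) \<in> ?S" unfolding S_iff using p st by simp
      have lm: "length (?m \<eta>s) = k" using len(1) by simp
      have "P g \<alpha>s + P h \<beta>s + scale_field ((-1) ^ (k + 1)) P (g \<cdot> h) (?m \<eta>s) = 0"
        by (rule L[unfolded coisotropic_prod3[OF G G G S], rule_format, of g h "g \<cdot> h" \<alpha>s \<beta>s "?m \<eta>s"])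
          (intro conjI inS len lm d dm cov')
      then show "P (g \<cdot> h) \<eta>s = P g \<alpha>s + P h \<beta>s"
        unfolding scale_field_def using sgn[OF gh _ dm] len(1) map_uminus_covectors[of \<eta>s] by simp
    qed
  next
    assume R: "mult_rel k P"
    show ?L unfolding coisotropic_prod3[OF G G G S]
    proof (intro allI impI, elim conjE)
      fix g h q \<alpha>s \<beta>s \<gamma>s
      assume ghq: "(g, h, q) \<in> ?S"
        and len: "length \<alpha>s = k" "length \<beta>s = k" "length \<gamma>s = k"
        and d: "set \<alpha>s \<subseteq> dual (TG \<G> g)" "set \<beta>s \<subseteq> dual (TG \<G> h)" "set \<gamma>s \<subseteq> dual (TG \<G> q)"
        and cov: "\<forall>i<k. \<forall>c1 c2 c3. curve_at G g c1 \<and> curve_at G h c2 \<and> curve_at G q c3 \<and>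
         (\<forall>\<^sub>F \<tau> in nhds 0. (c1 \<tau>, c2 \<tau>, c3 \<tau>) \<in> ?S) \<longrightarrow>
         (\<alpha>s ! i) (velocity G c1) + (\<beta>s ! i) (velocity G c2) + (\<gamma>s ! i) (velocity G c3) = 0"
      have p: "g \<in> pt" "h \<in> pt" and st: "s g = t h" and q: "q = g \<cdot> h" using ghq unfolding S_iff by auto
      have gh: "g \<cdot> h \<in> pt" using p st by (rule mul_in)
      have dm: "set (?m \<gamma>s) \<subseteq> dual (TG \<G> (g \<cdot> h))" using uminus_covectors_dual[OF lc d(3)] q by simp
      have "\<forall>i<k. mult_cov g h (?m \<gamma>s ! i) (\<alpha>s ! i) (\<beta>s ! i)"
      proof (intro allI impI)
        fix i assume i: "i < k"
        have "mult_cov g h (\<lambda>v. - (\<gamma>s ! i) v) (\<alpha>s ! i) (\<beta>s ! i)"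
          unfolding mult_cov_iff[OF p st] using cov[unfolded q] i by blast
        then show "mult_cov g h (?m \<gamma>s ! i) (\<alpha>s ! i) (\<beta>s ! i)" using i len(3) by simp
      qed
      then have "P (g \<cdot> h) (?m \<gamma>s) = P g \<alpha>s + P h \<beta>s"
        using R[unfolded mult_rel_def, rule_format, of g h "?m \<gamma>s" \<alpha>s \<beta>s] p st len d(1,2) dm by simp
      then show "P g \<alpha>s + P h \<beta>s + scale_field ((-1) ^ (k + 1)) P q \<gamma>s = 0"
        unfolding scale_field_def using sgn[OF gh len(3)] d(3) q by simp
    qed
  qed
  finally show ?thesis .
qed

text \<open>The covectors at \<open>h\<close> and \<open>l\<close> are negated here, matching the
  two middle summands that carry \<open>(-1) ^ (k + 1)\<close>.\<close>

lemma affine_cov_iff: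
  assumes "g \<in> pt" "h \<in> pt" "l \<in> pt" "s g = s h" "t g = t l"
  shows "affine_cov g h l \<gamma> (\<lambda>v. - \<alpha> v) (\<lambda>v. - \<beta> v) \<eta> \<longleftrightarrow>
    (\<forall>cg ch cl cp. curve_at G g cg \<and> curve_at G h ch \<and> curve_at G l cl \<and> curve_at G ((h \<cdot> iv g) \<cdot> l) cp \<and>
       (\<forall>\<^sub>F \<tau> in nhds 0. (cg \<tau>, ch \<tau>, cl \<tau>, cp \<tau>) \<in>
          {(g, h, l, (h \<cdot> iv g) \<cdot> l) | g h l. g \<in> pt \<and> h \<in> pt \<and> l \<in> pt \<and> s g = s h \<and> t g = t l}) \<longrightarrow>
       \<gamma> (velocity G cg) + \<alpha> (velocity G ch) + \<beta> (velocity G cl) + \<eta> (velocity G cp) = 0)" (is "?L \<longleftrightarrow> ?R")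
proof
  assume L: ?L
  show ?R
  proof (intro allI impI, elim conjE)
    fix cg ch cl cp assume c: "curve_at G g cg" "curve_at G h ch" "curve_at G l cl" "curve_at G ((h \<cdot> iv g) \<cdot> l) cp"
      and ev: "\<forall>\<^sub>F \<tau> in nhds 0. (cg \<tau>, ch \<tau>, cl \<tau>, cp \<tau>) \<in>
          {(g, h, l, (h \<cdot> iv g) \<cdot> l) | g h l. g \<in> pt \<and> h \<in> pt \<and> l \<in> pt \<and> s g = s h \<and> t g = t l}"
    have 1: "\<forall>\<^sub>F \<tau> in nhds 0. s (cg \<tau>) = s (ch \<tau>)" using ev by eventually_elim auto
    have 2: "\<forall>\<^sub>F \<tau> in nhds 0. t (cg \<tau>) = t (cl \<tau>)" using ev by eventually_elim auto
    have 3: "\<forall>\<^sub>F \<tau> in nhds 0. cp \<tau> = (ch \<tau> \<cdot> iv (cg \<tau>)) \<cdot> cl \<tau>" using ev by eventually_elim auto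
    show "\<gamma> (velocity G cg) + \<alpha> (velocity G ch) + \<beta> (velocity G cl) + \<eta> (velocity G cp) = 0"
      using L[unfolded affine_cov_def, rule_format, OF c(1-3) 1 2] unfolding curve_at_cong(2)[OF G c(4) 3] by linarith
  qed
next
  assume R: ?R
  show ?L unfolding affine_cov_def
  proof (intro allI impI)
    fix cg ch cl assume c: "curve_at G g cg" "curve_at G h ch" "curve_at G l cl"
      and ev: "\<forall>\<^sub>F \<tau> in nhds 0. s (cg \<tau>) = s (ch \<tau>)" "\<forall>\<^sub>F \<tau> in nhds 0. t (cg \<tau>) = t (cl \<tau>)"
    note pp = curve_pt[OF c(1)] curve_pt[OF c(2)] curve_pt[OF c(3)]
    have "\<forall>\<^sub>F \<tau> in nhds 0. s (ch \<tau>) = t (iv (cg \<tau>))" using ev(1) pp(1) by eventually_elim (simp add: t_iv)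
    note m1 = curve_mul[OF c(2) curve_iv[OF c(1)] this]
    have "\<forall>\<^sub>F \<tau> in nhds 0. s (ch \<tau> \<cdot> iv (cg \<tau>)) = t (cl \<tau>)"
      using ev pp by eventually_elim (simp add: s_mul iv_in t_iv s_iv)
    note m2 = curve_mul[OF m1 c(3) this]
    have "\<forall>\<^sub>F \<tau> in nhds 0. (cg \<tau>, ch \<tau>, cl \<tau>, (ch \<tau> \<cdot> iv (cg \<tau>)) \<cdot> cl \<tau>) \<in>
          {(g, h, l, (h \<cdot> iv g) \<cdot> l) | g h l. g \<in> pt \<and> h \<in> pt \<and> l \<in> pt \<and> s g = s h \<and> t g = t l}"
      using ev pp by eventually_elim blast
    with R c m2
    have "\<gamma> (velocity G cg) + \<alpha> (velocity G ch) + \<beta> (velocity G cl) + \<eta> (velocity G (\<lambda>\<tau>. (ch \<tau> \<cdot> iv (cg \<tau>)) \<cdot> cl \<tau>)) = 0" by blast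
    then show "\<eta> (velocity G (\<lambda>\<tau>. (ch \<tau> \<cdot> iv (cg \<tau>)) \<cdot> cl \<tau>)) + \<gamma> (velocity G cg) = - \<alpha> (velocity G ch) + - \<beta> (velocity G cl)" by simp
  qed
qed

lemma affine_field_iff:
  assumes P: "kvector_field G k P"
  shows "affine_field \<G> k P \<longleftrightarrow> affine_rel k P"
proof -
  let ?S = "{(g, h, l, (h \<cdot> iv g) \<cdot> l) | g h l. g \<in> pt \<and> h \<in> pt \<and> l \<in> pt \<and> s g = s h \<and> t g = t l}"
  have pin: "(h \<cdot> iv g) \<cdot> l \<in> pt" if "g \<in> pt" "h \<in> pt" "l \<in> pt" "s g = s h" "t g = t l" for g h l
    using that by (simp add: mul_in s_mul iv_in s_iv t_iv)
  have S: "?S \<subseteq> pt \<times> (pt \<times> (pt \<times> pt))" using pin by auto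
  have kv: "kvector k (TG \<G> g) (P g)" if "g \<in> pt" for g using P that unfolding kvector_field_def by blast
  note lc = linear_closed_tangent_space[OF G]
  let ?m = "map (\<lambda>(\<xi>::'g covec) v. - \<xi> v)"
  have sgn: "(-1) ^ (k + 1) * P g \<gamma>s = - P g (?m \<gamma>s)"
    if "g \<in> pt" "length \<gamma>s = k" "set \<gamma>s \<subseteq> dual (TG \<G> g)" for g \<gamma>s
    using kvector_uminus[OF lc kv[OF that(1)] that(2,3)] by simp
  have S_iff: "(g, h, l, p) \<in> ?S \<longleftrightarrow> g \<in> pt \<and> h \<in> pt \<and> l \<in> pt \<and> s g = s h \<and> t g = t l \<and> p = (h \<cdot> iv g) \<cdot> l" for g h l p
    by auto
  let ?P' = "scale_field ((-1) ^ (k + 1)) P"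
  have "affine_field \<G> k P \<longleftrightarrow> coisotropic (prod_mfd G (prod_mfd G (prod_mfd G G))) k
      (sum_field G (prod_mfd G (prod_mfd G G)) P (sum_field G (prod_mfd G G) ?P' (sum_field G G ?P' P))) ?S"
    unfolding affine_field_def Let_def using P by blast
  also have "\<dots> \<longleftrightarrow> affine_rel k P" (is "?L \<longleftrightarrow> _")
  proof
    assume L: ?L
    show "affine_rel k P" unfolding affine_rel_def
    proof (intro allI impI)
      fix g h l \<gamma>s \<alpha>s \<beta>s \<eta>s
      assume p: "g \<in> pt" "h \<in> pt" "l \<in> pt" and st: "s g = s h" "t g = t l"
        and len: "length \<gamma>s = k" "length \<alpha>s = k" "length \<beta>s = k" "length \<eta>s = k"
        and d: "set \<gamma>s \<subseteq> dual (TG \<G> g)" "set \<alpha>s \<subseteq> dual (TG \<G> h)" "set \<beta>s \<subseteq> dual (TG \<G> l)"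
          "set \<eta>s \<subseteq> dual (TG \<G> ((h \<cdot> iv g) \<cdot> l))"
        and cov: "\<forall>i<k. affine_cov g h l (\<gamma>s ! i) (\<alpha>s ! i) (\<beta>s ! i) (\<eta>s ! i)"
      have dm: "set (?m \<alpha>s) \<subseteq> dual (TG \<G> h)" "set (?m \<beta>s) \<subseteq> dual (TG \<G> l)"
        using uminus_covectors_dual[OF lc d(2)] uminus_covectors_dual[OF lc d(3)] by auto
      have cov': "\<forall>i<k. \<forall>cg ch cl cp. curve_at G g cg \<and> curve_at G h ch \<and> curve_at G l cl \<and> curve_at G ((h \<cdot> iv g) \<cdot> l) cp \<and>
         (\<forall>\<^sub>F \<tau> in nhds 0. (cg \<tau>, ch \<tau>, cl \<tau>, cp \<tau>) \<in> ?S) \<longrightarrow>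
         (\<gamma>s ! i) (velocity G cg) + (?m \<alpha>s ! i) (velocity G ch) + (?m \<beta>s ! i) (velocity G cl) + (\<eta>s ! i) (velocity G cp) = 0"
      proof (intro allI impI)
        fix i cg ch cl cp assume i: "i < k" and c: "curve_at G g cg \<and> curve_at G h ch \<and> curve_at G l cl \<and> curve_at G ((h \<cdot> iv g) \<cdot> l) cp \<and>
         (\<forall>\<^sub>F \<tau> in nhds 0. (cg \<tau>, ch \<tau>, cl \<tau>, cp \<tau>) \<in> ?S)"
        have "affine_cov g h l (\<gamma>s ! i) (\<lambda>v. - (?m \<alpha>s ! i) v) (\<lambda>v. - (?m \<beta>s ! i) v) (\<eta>s ! i)" using cov i len by simp
        from this[unfolded affine_cov_iff[OF p st], rule_format, OF c]
        show "(\<gamma>s ! i) (velocity G cg) + (?m \<alpha>s ! i) (velocity G ch) + (?m \<beta>s ! i) (velocity G cl) + (\<eta>s ! i) (velocity G cp) = 0" .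
      qed
      have inS: "(g, h, l, (h \<cdot> iv g) \<cdot> l) \<in> ?S" unfolding S_iff using p st by simp
      have lm: "length (?m \<alpha>s) = k" "length (?m \<beta>s) = k" using len by simp_all
      have "P g \<gamma>s + ?P' h (?m \<alpha>s) + ?P' l (?m \<beta>s) + P ((h \<cdot> iv g) \<cdot> l) \<eta>s = 0"
        by (rule L[unfolded coisotropic_prod4[OF G G G G S], rule_format, of g h l "(h \<cdot> iv g) \<cdot> l" \<gamma>s "?m \<alpha>s" "?m \<beta>s" \<eta>s])
          (intro conjI inS len lm d dm cov')
      then show "P ((h \<cdot> iv g) \<cdot> l) \<eta>s + P g \<gamma>s = P h \<alpha>s + P l \<beta>s"
        unfolding scale_field_def using sgn[OF p(2) _ dm(1)] sgn[OF p(3) _ dm(2)] len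
          map_uminus_covectors[of \<alpha>s] map_uminus_covectors[of \<beta>s] by simp
    qed
  next
    assume R: "affine_rel k P"
    show ?L unfolding coisotropic_prod4[OF G G G G S]
    proof (intro allI impI, elim conjE)
      fix g h l q \<gamma>s \<alpha>s \<beta>s \<eta>s
      assume ghq: "(g, h, l, q) \<in> ?S"
        and len: "length \<gamma>s = k" "length \<alpha>s = k" "length \<beta>s = k" "length \<eta>s = k"
        and d: "set \<gamma>s \<subseteq> dual (TG \<G> g)" "set \<alpha>s \<subseteq> dual (TG \<G> h)" "set \<beta>s \<subseteq> dual (TG \<G> l)" "set \<eta>s \<subseteq> dual (TG \<G> q)"
        and cov: "\<forall>i<k. \<forall>cg ch cl cp. curve_at G g cg \<and> curve_at G h ch \<and> curve_at G l cl \<and> curve_at G q cp \<and>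
         (\<forall>\<^sub>F \<tau> in nhds 0. (cg \<tau>, ch \<tau>, cl \<tau>, cp \<tau>) \<in> ?S) \<longrightarrow>
         (\<gamma>s ! i) (velocity G cg) + (\<alpha>s ! i) (velocity G ch) + (\<beta>s ! i) (velocity G cl) + (\<eta>s ! i) (velocity G cp) = 0"
      have p: "g \<in> pt" "h \<in> pt" "l \<in> pt" and st: "s g = s h" "t g = t l" and q: "q = (h \<cdot> iv g) \<cdot> l"
        using ghq unfolding S_iff by auto
      have dm: "set (?m \<alpha>s) \<subseteq> dual (TG \<G> h)" "set (?m \<beta>s) \<subseteq> dual (TG \<G> l)"
        using uminus_covectors_dual[OF lc d(2)] uminus_covectors_dual[OF lc d(3)] by auto
      have "\<forall>i<k. affine_cov g h l (\<gamma>s ! i) (?m \<alpha>s ! i) (?m \<beta>s ! i) (\<eta>s ! i)"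
      proof (intro allI impI)
        fix i assume i: "i < k"
        have "affine_cov g h l (\<gamma>s ! i) (\<lambda>v. - (\<alpha>s ! i) v) (\<lambda>v. - (\<beta>s ! i) v) (\<eta>s ! i)"
          unfolding affine_cov_iff[OF p st] using cov[unfolded q] i by blast
        then show "affine_cov g h l (\<gamma>s ! i) (?m \<alpha>s ! i) (?m \<beta>s ! i) (\<eta>s ! i)" using i len by simp
      qed
      then have "P ((h \<cdot> iv g) \<cdot> l) \<eta>s + P g \<gamma>s = P h (?m \<alpha>s) + P l (?m \<beta>s)"
        using R[unfolded affine_rel_def, rule_format, of g h l \<gamma>s "?m \<alpha>s" "?m \<beta>s" \<eta>s] p st len d q dm by simp
      then show "P g \<gamma>s + ?P' h \<alpha>s + ?P' l \<beta>s + P q \<eta>s = 0"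
        unfolding scale_field_def using sgn[OF p(2) len(2) d(2)] sgn[OF p(3) len(3) d(3)] q by simp
    qed
  qed
  finally show ?thesis .
qed

section \<open>Translations\<close>

text \<open>The retraction onto the units along the source fibres. Its differential at a unit is the
  projection to \<open>TM\<close> with kernel \<open>A\<close>, which makes the decomposition
  \<open>TM \<oplus> A\<close> explicit.\<close>

definition retr :: "'g \<Rightarrow> 'g" where "retr g = e (s g)"

lemma retr_at:
  assumes x: "x \<in> points M"
  shows "smooth_at G G (e x) retr" "retr (e x) = e x"
proof -
  show "smooth_at G G (e x) retr" unfolding retr_def
    by (rule smooth_at_compose[OF G M G s_at[OF e_in[OF x]]]) (use e_at x s_e in simp)
  show "retr (e x) = e x" using x by (simp add: retr_def s_e)
qed

definition proj :: "'m \<Rightarrow> 'g tvec \<Rightarrow> 'g tvec" where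
  "proj x v = (\<lambda>f. v f - push G retr (e x) v f)"

lemma algebroid_iff:
  assumes x: "x \<in> points M"
  shows "u \<in> algebroid \<G> x \<longleftrightarrow> u \<in> TG \<G> (e x) \<and> push M s (e x) u = (\<lambda>_. 0)"
  unfolding algebroid_def using differential_points[OF G M s_at[OF e_in[OF x]]] by auto

lemma push_retr_tangent_units:
  assumes x: "x \<in> points M" and v: "v \<in> TG \<G> (e x)"
  shows "push G retr (e x) v \<in> tangent G (e ` points M) (e x)"
proof -
  obtain c where c: "curve_at G (e x) c" "v = velocity G c" using v tangent_space_iff[OF G] by metis
  have r: "curve_at G (e x) (\<lambda>\<tau>. retr (c \<tau>))" using curve_at_compose[OF G G c(1) retr_at(1)[OF x]] retr_at(2)[OF x] by simp
  have "\<forall>\<^sub>F \<tau> in nhds 0. retr (c \<tau>) \<in> e ` points M"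
    using curve_pt[OF c(1)] by eventually_elim (auto simp: retr_def s_in)
  then show ?thesis
    unfolding c(2) push_velocity[OF G G retr_at(1)[OF x] c(1)] tangent_iff[OF G] using r by blast
qed

lemma push_retr_in: "x \<in> points M \<Longrightarrow> v \<in> TG \<G> (e x) \<Longrightarrow> push G retr (e x) v \<in> TG \<G> (e x)"
  using push_retr_tangent_units tangent_subset_tangent_space[OF G] by blast

text \<open>Because \<open>retr\<close> preserves sources, a vector and its image under the
  differential of \<open>retr\<close> have the same image under \<open>ds\<close>.\<close>

lemma proj_in_algebroid:
  assumes x: "x \<in> points M" and v: "v \<in> TG \<G> (e x)"
  shows "proj x v \<in> algebroid \<G> x"
  unfolding algebroid_iff[OF x]
proof
  show "proj x v \<in> TG \<G> (e x)" unfolding proj_def by (rule tangent_space_diff[OF G v push_retr_in[OF x v]])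
  obtain c where c: "curve_at G (e x) c" "v = velocity G c" using v tangent_space_iff[OF G] by metis
  have r: "curve_at G (e x) (\<lambda>\<tau>. retr (c \<tau>))" using curve_at_compose[OF G G c(1) retr_at(1)[OF x]] retr_at(2)[OF x] by simp
  note sx = s_at[OF e_in[OF x]]
  have "\<forall>\<^sub>F \<tau> in nhds 0. s (retr (c \<tau>)) = s (c \<tau>)"
    using curve_pt[OF c(1)] by eventually_elim (simp add: retr_def s_e s_in)
  from curve_at_cong(2)[OF M curve_at_compose[OF G M r sx] this]
  show "push M s (e x) (proj x v) = (\<lambda>_. 0)"
    unfolding proj_def push_diff c(2) push_velocity[OF G G retr_at(1)[OF x] c(1)]
      push_velocity[OF G M sx c(1)] push_velocity[OF G M sx r] by simp
qed

lemma push_retr_algebroid: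
  assumes x: "x \<in> points M" and u: "u \<in> algebroid \<G> x"
  shows "push G retr (e x) u = (\<lambda>_. 0)"
proof -
  have "u \<in> TG \<G> (e x)" and 0: "push M s (e x) u = (\<lambda>_. 0)" using u algebroid_iff[OF x] by auto
  then obtain c where c: "curve_at G (e x) c" "u = velocity G c" using tangent_space_iff[OF G] by metis
  note sx = s_at[OF e_in[OF x]]
  have cs: "curve_at M x (\<lambda>\<tau>. s (c \<tau>))" using curve_at_compose[OF G M c(1) sx] s_e[OF x] by simp
  have "push G retr (e x) u = push G e x (push M s (e x) u)"
    unfolding c(2) push_velocity[OF G G retr_at(1)[OF x] c(1)] push_velocity[OF G M sx c(1)]
      push_velocity[OF M G e_at[OF x] cs] by (simp add: retr_def)
  moreover have "push G e x (\<lambda>_. 0) = (\<lambda>_. 0)" by (simp add: push_def)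
  ultimately show ?thesis using 0 by simp
qed

text \<open>Uniqueness behind the definite description: if \<open>v - u\<close> is tangent to the
  units, the differential of \<open>retr\<close> fixes it; as this differential kills
  \<open>u\<close>, the vector \<open>v - u\<close> must be the image of \<open>v\<close>.\<close>

lemma proj_A_eq:
  assumes x: "x \<in> points M" and v: "v \<in> TG \<G> (e x)"
  shows "proj_A \<G> x v = proj x v"
  unfolding proj_A_def
proof (rule the_equality)
  have "(\<lambda>f. v f - proj x v f) = push G retr (e x) v" by (simp add: proj_def)
  then show "proj x v \<in> algebroid \<G> x \<and> (\<lambda>f. v f - proj x v f) \<in> tangent G (e ` points M) (e x)"
    using proj_in_algebroid[OF x v] push_retr_tangent_units[OF x v] by simp
  fix u assume "u \<in> algebroid \<G> x \<and> (\<lambda>f. v f - u f) \<in> tangent G (e ` points M) (e x)"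
  then have u: "u \<in> algebroid \<G> x" and w: "(\<lambda>f. v f - u f) \<in> tangent G (e ` points M) (e x)" by auto
  obtain d where d: "curve_at G (e x) d" "\<forall>\<^sub>F \<tau> in nhds 0. d \<tau> \<in> e ` points M" "(\<lambda>f. v f - u f) = velocity G d"
    by (rule tangentE[OF G w])
  have "\<forall>\<^sub>F \<tau> in nhds 0. d \<tau> = retr (d \<tau>)" using d(2) by eventually_elim (auto simp: retr_def s_e)
  from curve_at_cong(2)[OF G d(1) this]
  have "(\<lambda>f. v f - u f) = push G retr (e x) (\<lambda>f. v f - u f)"
    unfolding d(3) push_velocity[OF G G retr_at(1)[OF x] d(1)] .
  also have "\<dots> = push G retr (e x) v" unfolding push_diff push_retr_algebroid[OF x u] by simp
  finally have eq: "(\<lambda>f. v f - u f) = push G retr (e x) v" .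
  show "u = proj x v"
  proof
    fix f show "u f = proj x v f" using fun_cong[OF eq, of f] by (simp add: proj_def)
  qed
qed

text \<open>A vector in the kernel of \<open>ds\<close> is a priori the velocity of some curve.
  Lifting the constant curve \<open>x\<close> replaces it by a curve that stays in the source fibre,
  where right multiplication is defined.\<close>

lemma algebroid_curve:
  assumes x: "x \<in> points M" and u: "u \<in> algebroid \<G> x"
  obtains a where "curve_at G (e x) a" "velocity G a = u" "\<forall>\<^sub>F \<tau> in nhds 0. s (a \<tau>) = x"
proof -
  have "u \<in> TG \<G> (e x)" and 0: "push M s (e x) u = (\<lambda>_. 0)" using u algebroid_iff[OF x] by auto
  then obtain c where c: "curve_at G (e x) c" "u = velocity G c" using tangent_space_iff[OF G] by metis
  have cx: "curve_at M (s (e x)) (\<lambda>\<tau>. x)" using curve_at_const[OF M x] s_e[OF x] by simp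
  have "velocity M (\<lambda>\<tau>. s (c \<tau>)) = velocity M (\<lambda>\<tau>. x)"
    using 0 unfolding c(2) push_velocity[OF G M s_at[OF e_in[OF x]] c(1)] velocity_const .
  from submersion_lift[OF G M sub_s c(1) cx this] that c(2) show thesis by metis
qed

text \<open>The map \<open>y \<cdot> E y\<close> is defined on an open set around the unit and
  equals \<open>y \<cdot> g\<close> on the source fibre, so its differential computes the one along
  the fibre.\<close>

lemma right_mult_d_push:
  assumes g: "g \<in> pt" and E: "smooth_at G G (e (t g)) E" and E0: "\<And>y. s y = t g \<Longrightarrow> E y = g"
    and ev: "\<forall>\<^sub>F y in nh G (e (t g)). t (E y) = s y" and u: "u \<in> algebroid \<G> (t g)"
  shows "smooth_at G G (e (t g)) (\<lambda>y. y \<cdot> E y)"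
    and "right_mult_d \<G> g u = push G (\<lambda>y. y \<cdot> E y) (e (t g)) u"
    and "\<And>a. curve_at G (e (t g)) a \<Longrightarrow> \<forall>\<^sub>F \<tau> in nhds 0. s (a \<tau>) = t g \<Longrightarrow> velocity G a = u \<Longrightarrow>
      curve_at G g (\<lambda>\<tau>. a \<tau> \<cdot> g) \<and> right_mult_d \<G> g u = velocity G (\<lambda>\<tau>. a \<tau> \<cdot> g)"
proof -
  have x: "t g \<in> points M" using t_in[OF g] .
  let ?F = "\<lambda>y. y \<cdot> E y"
  show F: "smooth_at G G (e (t g)) ?F"
    by (rule mul_at[OF G smooth_at_id[OF G e_in[OF x]] E]) (use ev in eventually_elim, simp)
  have F0: "?F (e (t g)) = g" using E0 s_e[OF x] e_mul[OF g] by simp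
  let ?S = "{h \<in> pt. s h = t g}"
  obtain a where a: "curve_at G (e (t g)) a" "velocity G a = u" "\<forall>\<^sub>F \<tau> in nhds 0. s (a \<tau>) = t g"
    by (rule algebroid_curve[OF x u])
  have "\<forall>\<^sub>F \<tau> in nhds 0. a \<tau> \<in> ?S" using a(3) curve_pt[OF a(1)] by eventually_elim simp
  then have "u \<in> tangent G ?S (e (t g))" using tangentI[OF G a(1)] a(2) by simp
  then show 1: "right_mult_d \<G> g u = push G ?F (e (t g)) u"
    unfolding right_mult_d_def by (intro differential_velocity[OF G G F]) (simp add: E0)
  fix a assume a: "curve_at G (e (t g)) a" "\<forall>\<^sub>F \<tau> in nhds 0. s (a \<tau>) = t g" "velocity G a = u"
  have Fa: "curve_at G g (\<lambda>\<tau>. ?F (a \<tau>))" using curve_at_compose[OF G G a(1) F] F0 by simp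
  have "\<forall>\<^sub>F \<tau> in nhds 0. ?F (a \<tau>) = a \<tau> \<cdot> g" using a(2) by eventually_elim (simp add: E0)
  note c = curve_at_cong[OF G Fa this]
  show "curve_at G g (\<lambda>\<tau>. a \<tau> \<cdot> g) \<and> right_mult_d \<G> g u = velocity G (\<lambda>\<tau>. a \<tau> \<cdot> g)"
    using c push_velocity[OF G G F a(1)] a(3) 1 by simp
qed

lemma left_mult_d_push:
  assumes g: "g \<in> pt" and E: "smooth_at G G (e (s g)) E" and E0: "\<And>y. t y = s g \<Longrightarrow> E y = g"
    and ev: "\<forall>\<^sub>F y in nh G (e (s g)). s (E y) = t y"
    and b: "curve_at G (e (s g)) b" "\<forall>\<^sub>F \<tau> in nhds 0. t (b \<tau>) = s g"
  shows "smooth_at G G (e (s g)) (\<lambda>y. E y \<cdot> y)"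
    and "left_mult_d \<G> g (velocity G b) = push G (\<lambda>y. E y \<cdot> y) (e (s g)) (velocity G b)"
    and "curve_at G g (\<lambda>\<tau>. g \<cdot> b \<tau>)" "left_mult_d \<G> g (velocity G b) = velocity G (\<lambda>\<tau>. g \<cdot> b \<tau>)"
proof -
  have x: "s g \<in> points M" using s_in[OF g] .
  let ?F = "\<lambda>y. E y \<cdot> y"
  show F: "smooth_at G G (e (s g)) ?F"
    by (rule mul_at[OF G E smooth_at_id[OF G e_in[OF x]] ev])
  have F0: "?F (e (s g)) = g" using E0 t_e[OF x] mul_e[OF g] by simp
  let ?S = "{h \<in> pt. t h = s g}"
  have "\<forall>\<^sub>F \<tau> in nhds 0. b \<tau> \<in> ?S" using b(2) curve_pt[OF b(1)] by eventually_elim simp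
  then have "velocity G b \<in> tangent G ?S (e (s g))" by (rule tangentI[OF G b(1)])
  then show 1: "left_mult_d \<G> g (velocity G b) = push G ?F (e (s g)) (velocity G b)"
    unfolding left_mult_d_def by (intro differential_velocity[OF G G F]) (simp add: E0)
  have Fa: "curve_at G g (\<lambda>\<tau>. ?F (b \<tau>))" using curve_at_compose[OF G G b(1) F] F0 by simp
  have "\<forall>\<^sub>F \<tau> in nhds 0. ?F (b \<tau>) = g \<cdot> b \<tau>" using b(2) by eventually_elim (simp add: E0)
  note c = curve_at_cong[OF G Fa this]
  show "curve_at G g (\<lambda>\<tau>. g \<cdot> b \<tau>)" "left_mult_d \<G> g (velocity G b) = velocity G (\<lambda>\<tau>. g \<cdot> b \<tau>)"
    using c push_velocity[OF G G F b(1)] 1 by simp_all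
qed

text \<open>The translation of \<open>pr_A \<G> P\<close> to \<open>g\<close> is the image of \<open>P\<close> at the unit of \<open>t g\<close> under \<open>right_op g\<close>,
  respectively of \<open>P\<close> at the unit of \<open>s g\<close> under \<open>left_op g\<close>.\<close>

definition right_op :: "'g \<Rightarrow> 'g tvec \<Rightarrow> 'g tvec" where
  "right_op g v = right_mult_d \<G> g (proj_A \<G> (t g) v)"

definition left_op :: "'g \<Rightarrow> 'g tvec \<Rightarrow> 'g tvec" where
  "left_op g v = (\<lambda>f. - left_mult_d \<G> g (differential G pt G iv (e (s g)) (proj_A \<G> (s g) v)) f)"

text \<open>The curve \<open>a\<close> does not depend on \<open>g\<close>. Hence several arrows
  with the same target can be moved simultaneously by one curve.\<close>

lemma right_op_curve:
  assumes x: "x \<in> points M" and v: "v \<in> TG \<G> (e x)"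
  obtains a where "curve_at G (e x) a" "velocity G a = proj x v" "\<forall>\<^sub>F \<tau> in nhds 0. s (a \<tau>) = x"
    "\<forall>g. g \<in> pt \<longrightarrow> t g = x \<longrightarrow> curve_at G g (\<lambda>\<tau>. a \<tau> \<cdot> g) \<and> right_op g v = velocity G (\<lambda>\<tau>. a \<tau> \<cdot> g)"
proof -
  note u = proj_in_algebroid[OF x v]
  obtain a where a: "curve_at G (e x) a" "velocity G a = proj x v" "\<forall>\<^sub>F \<tau> in nhds 0. s (a \<tau>) = x"
    by (rule algebroid_curve[OF x u])
  have "curve_at G g (\<lambda>\<tau>. a \<tau> \<cdot> g) \<and> right_op g v = velocity G (\<lambda>\<tau>. a \<tau> \<cdot> g)" if g: "g \<in> pt" "t g = x" for g
  proof -
    obtain E where E: "smooth_at G G (e x) E" "E (e x) = g" "\<forall>\<^sub>F y in nh G (e x). t (E y) = s y"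
        "\<forall>y. s y = s (e x) \<longrightarrow> E y = g"
      by (rule transversal_section[OF sub_t G g(1) s_at[OF e_in[OF x]]]) (use g s_e[OF x] in simp)
    show ?thesis
      using right_mult_d_push(3)[OF g(1), of E "proj x v" a] E a u s_e[OF x] g(2) proj_A_eq[OF x v]
      by (simp add: right_op_def)
  qed
  with a that show thesis by blast
qed

text \<open>Inversion turns the curve in the source fibre into one in the target fibre, by which
  \<open>g\<close> can be multiplied; the minus sign of the left translation stays in front.\<close>

lemma left_op_curve:
  assumes x: "x \<in> points M" and v: "v \<in> TG \<G> (e x)"
  obtains a where "curve_at G (e x) a" "velocity G a = proj x v" "\<forall>\<^sub>F \<tau> in nhds 0. s (a \<tau>) = x"
    "\<forall>g. g \<in> pt \<longrightarrow> s g = x \<longrightarrow> curve_at G g (\<lambda>\<tau>. g \<cdot> iv (a \<tau>)) \<and> left_op g v = (\<lambda>f. - velocity G (\<lambda>\<tau>. g \<cdot> iv (a \<tau>)) f)"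
proof -
  note u = proj_in_algebroid[OF x v] and ex = e_in[OF x]
  obtain a where a: "curve_at G (e x) a" "velocity G a = proj x v" "\<forall>\<^sub>F \<tau> in nhds 0. s (a \<tau>) = x"
    by (rule algebroid_curve[OF x u])
  have ia: "curve_at G (e x) (\<lambda>\<tau>. iv (a \<tau>))" using curve_iv[OF a(1)] iv_e[OF x] by simp
  have ti: "\<forall>\<^sub>F \<tau> in nhds 0. t (iv (a \<tau>)) = x" using a(3) curve_pt[OF a(1)] by eventually_elim (simp add: t_iv)
  have d: "differential G pt G iv (e x) (proj_A \<G> x v) = velocity G (\<lambda>\<tau>. iv (a \<tau>))"
    unfolding proj_A_eq[OF x v] a(2)[symmetric]
    using differential_points[OF G G iv_at[OF ex] velocity_in_tangent_space[OF G a(1)]] push_velocity[OF G G iv_at[OF ex] a(1)] by simp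
  have "curve_at G g (\<lambda>\<tau>. g \<cdot> iv (a \<tau>)) \<and> left_op g v = (\<lambda>f. - velocity G (\<lambda>\<tau>. g \<cdot> iv (a \<tau>)) f)"
    if g: "g \<in> pt" "s g = x" for g
  proof -
    obtain E where E: "smooth_at G G (e x) E" "E (e x) = g" "\<forall>\<^sub>F y in nh G (e x). s (E y) = t y"
        "\<forall>y. t y = t (e x) \<longrightarrow> E y = g"
      by (rule transversal_section[OF sub_s G g(1) t_at[OF e_in[OF x]]]) (use g t_e[OF x] in simp)
    show ?thesis
      using left_mult_d_push(3,4)[OF g(1), of E "\<lambda>\<tau>. iv (a \<tau>)"] E ia ti t_e[OF x] g(2) d
      by (simp add: left_op_def)
  qed
  with a that show thesis by blast
qed

text \<open>The projection to \<open>A\<close> is the identity minus the differential of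
  \<open>retr\<close>. The first term contributes \<open>y \<cdot> \<sigma> (s y, g)\<close>; in the
  second, \<open>retr y\<close> is a unit and only \<open>\<sigma> (s y, g)\<close> is left. Both
  maps are smooth around the unit, off the fibre as well.\<close>

lemma right_op_smooth:
  assumes g: "g \<in> pt" and \<sigma>: "smooth_at (prod_mfd M G) G (t g, g) \<sigma>"
    and ev: "\<forall>\<^sub>F p in nh (prod_mfd M G) (t g, g). t (\<sigma> p) = fst p" and \<sigma>0: "\<sigma> (t g, g) = g"
    and v: "v \<in> TG \<G> (e (t g))"
  shows "right_op g v = (\<lambda>f. push G (\<lambda>y. y \<cdot> \<sigma> (s y, g)) (e (t g)) v f - push G (\<lambda>y. \<sigma> (s y, g)) (e (t g)) v f)"
    and "smooth_at G G (e (t g)) (\<lambda>y. y \<cdot> \<sigma> (s y, g))" "smooth_at G G (e (t g)) (\<lambda>y. \<sigma> (s y, g))"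
proof -
  let ?x = "t g" and ?E = "\<lambda>y. \<sigma> (s y, g)"
  note x = t_in[OF g] and MG = smooth_manifold_prod[OF M G]
  note ex = e_in[OF x]
  have sec: "smooth_at G (prod_mfd M G) (e ?x) (\<lambda>y. (s y, g))"
    by (rule smooth_at_Pair[OF G M G s_at[OF ex] smooth_at_const[OF G G ex g]])
  show E: "smooth_at G G (e ?x) ?E" by (rule smooth_at_compose[OF G MG G sec]) (use \<sigma> s_e[OF x] in simp)
  have tE: "\<forall>\<^sub>F y in nh G (e ?x). t (?E y) = s y"
    using smooth_at_filterlim[OF G MG sec] ev s_e[OF x] unfolding filterlim_iff by auto
  have E0: "?E y = g" if "s y = ?x" for y using that \<sigma>0 by simp
  note rp = right_mult_d_push[OF g E E0 tE proj_in_algebroid[OF x v]]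
  let ?F = "\<lambda>y. y \<cdot> ?E y"
  show F: "smooth_at G G (e ?x) ?F" by (rule rp(1))
  obtain c where c: "curve_at G (e ?x) c" "v = velocity G c" using v tangent_space_iff[OF G] by metis
  have r: "curve_at G (e ?x) (\<lambda>\<tau>. retr (c \<tau>))" using curve_at_compose[OF G G c(1) retr_at(1)[OF x]] retr_at(2)[OF x] by simp
  have "\<forall>\<^sub>F \<tau> in nhds 0. ?F (retr (c \<tau>)) = ?E (c \<tau>)"
    using curve_pt[OF c(1)] eventually_curve[OF G c(1) tE] curve_pt[OF curve_at_compose[OF G G c(1) E]]
  proof eventually_elim
    case (elim \<tau>)
    then show ?case using e_mul[OF elim(3)] by (simp add: retr_def s_e s_in)
  qed
  from curve_at_cong(2)[OF G curve_at_compose[OF G G r F] this]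
  have "push G ?F (e ?x) (push G retr (e ?x) v) = push G ?E (e ?x) v"
    unfolding c(2) push_velocity[OF G G retr_at(1)[OF x] c(1)] push_velocity[OF G G F r] push_velocity[OF G G E c(1)] .
  moreover have "right_op g v = push G ?F (e ?x) (proj ?x v)"
    unfolding right_op_def proj_A_eq[OF x v] by (rule rp(2))
  ultimately show "right_op g v = (\<lambda>f. push G ?F (e ?x) v f - push G ?E (e ?x) v f)"
    by (simp add: proj_def push_diff)
qed

text \<open>As for right translations, except that the minus sign in the left translation exchanges
  the two terms: the one containing \<open>iv y\<close> is subtracted.\<close>

lemma left_op_smooth:
  assumes g: "g \<in> pt" and \<sigma>: "smooth_at (prod_mfd M G) G (s g, g) \<sigma>"
    and ev: "\<forall>\<^sub>F p in nh (prod_mfd M G) (s g, g). s (\<sigma> p) = fst p" and \<sigma>0: "\<sigma> (s g, g) = g"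
    and v: "v \<in> TG \<G> (e (s g))"
  shows "left_op g v = (\<lambda>f. push G (\<lambda>y. \<sigma> (s y, g)) (e (s g)) v f - push G (\<lambda>y. \<sigma> (s y, g) \<cdot> iv y) (e (s g)) v f)"
    and "smooth_at G G (e (s g)) (\<lambda>y. \<sigma> (s y, g) \<cdot> iv y)" "smooth_at G G (e (s g)) (\<lambda>y. \<sigma> (s y, g))"
proof -
  let ?x = "s g" and ?E = "\<lambda>y. \<sigma> (s y, g)"
  note x = s_in[OF g] and MG = smooth_manifold_prod[OF M G]
  note ex = e_in[OF x]
  have sec: "smooth_at G (prod_mfd M G) (e ?x) (\<lambda>y. (s y, g))"
    by (rule smooth_at_Pair[OF G M G s_at[OF ex] smooth_at_const[OF G G ex g]])
  show E: "smooth_at G G (e ?x) ?E" by (rule smooth_at_compose[OF G MG G sec]) (use \<sigma> s_e[OF x] in simp)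
  have sE: "\<forall>\<^sub>F y in nh G (e ?x). s (?E y) = s y"
    using smooth_at_filterlim[OF G MG sec] ev s_e[OF x] unfolding filterlim_iff by auto
  let ?J = "\<lambda>y. ?E y \<cdot> iv y"
  show J: "smooth_at G G (e ?x) ?J"
    by (rule mul_at[OF G E iv_at[OF ex]])
      (use sE eventually_nh_points[OF G ex] in eventually_elim, simp add: t_iv)
  obtain c where c: "curve_at G (e ?x) c" "v = velocity G c" using v tangent_space_iff[OF G] by metis
  have r: "curve_at G (e ?x) (\<lambda>\<tau>. retr (c \<tau>))" using curve_at_compose[OF G G c(1) retr_at(1)[OF x]] retr_at(2)[OF x] by simp
  have "\<forall>\<^sub>F \<tau> in nhds 0. ?J (retr (c \<tau>)) = ?E (c \<tau>)"
    using curve_pt[OF c(1)] eventually_curve[OF G c(1) sE] curve_pt[OF curve_at_compose[OF G G c(1) E]]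
  proof eventually_elim
    case (elim \<tau>)
    then show ?case using mul_e[OF elim(3)] by (simp add: retr_def s_e s_in iv_e)
  qed
  from curve_at_cong(2)[OF G curve_at_compose[OF G G r J] this]
  have 1: "push G ?J (e ?x) (push G retr (e ?x) v) = push G ?E (e ?x) v"
    unfolding c(2) push_velocity[OF G G retr_at(1)[OF x] c(1)] push_velocity[OF G G J r] push_velocity[OF G G E c(1)] .
  obtain a where a: "curve_at G (e ?x) a" "velocity G a = proj ?x v" "\<forall>\<^sub>F \<tau> in nhds 0. s (a \<tau>) = ?x"
    "\<forall>g'. g' \<in> pt \<longrightarrow> s g' = ?x \<longrightarrow> curve_at G g' (\<lambda>\<tau>. g' \<cdot> iv (a \<tau>)) \<and> left_op g' v = (\<lambda>f. - velocity G (\<lambda>\<tau>. g' \<cdot> iv (a \<tau>)) f)"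
    by (rule left_op_curve[OF x v])
  have "\<forall>\<^sub>F \<tau> in nhds 0. ?J (a \<tau>) = g \<cdot> iv (a \<tau>)" using a(3) by eventually_elim (simp add: \<sigma>0)
  from curve_at_cong(2)[OF G curve_at_compose[OF G G a(1) J] this]
  have "left_op g v = (\<lambda>f. - push G ?J (e ?x) (proj ?x v) f)"
    unfolding a(2)[symmetric] push_velocity[OF G G J a(1)] using a(4) g by simp
  then show "left_op g v = (\<lambda>f. push G ?E (e ?x) v f - push G ?J (e ?x) v f)"
    unfolding proj_def push_diff 1 by simp
qed

text \<open>Multiplying by a curve \<open>a\<close> from the left, both
  \<open>(g, a h, l, a h g^-1 l)\<close> and \<open>(a g, h, a l, h g^-1 l)\<close> stay in the
  affine relation, the latter because \<open>a\<close> cancels. Conormality along each motion leaves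
  only the two moving entries.\<close>

lemma right_op_affine:
  assumes p: "g \<in> pt" "h \<in> pt" "l \<in> pt" and st: "s g = s h" "t g = t l"
    and d: "\<gamma> \<in> dual (TG \<G> g)" "\<alpha> \<in> dual (TG \<G> h)" "\<beta> \<in> dual (TG \<G> l)" "\<eta> \<in> dual (TG \<G> ((h \<cdot> iv g) \<cdot> l))"
    and cov: "affine_cov g h l \<gamma> \<alpha> \<beta> \<eta>"
  shows "v \<in> TG \<G> (e (t h)) \<Longrightarrow> \<eta> (right_op ((h \<cdot> iv g) \<cdot> l) v) = \<alpha> (right_op h v)"
    and "v \<in> TG \<G> (e (t g)) \<Longrightarrow> \<gamma> (right_op g v) = \<beta> (right_op l v)"
proof -
  let ?q = "(h \<cdot> iv g) \<cdot> l"
  have hg: "h \<cdot> iv g \<in> pt" "s (h \<cdot> iv g) = t l" "t (h \<cdot> iv g) = t h"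
    using p st by (simp_all add: mul_in s_mul t_mul iv_in s_iv t_iv)
  have q: "?q \<in> pt" "t ?q = t h" using hg p by (simp_all add: mul_in t_mul)
  have c0: "curve_at G g (\<lambda>\<tau>. g)" "curve_at G h (\<lambda>\<tau>. h)" "curve_at G l (\<lambda>\<tau>. l)" "curve_at G ?q (\<lambda>\<tau>. ?q)"
    using curve_at_const[OF G] p q by auto
  have z: "\<gamma> (velocity G (\<lambda>\<tau>. g)) = 0" "\<alpha> (velocity G (\<lambda>\<tau>. h)) = 0" "\<beta> (velocity G (\<lambda>\<tau>. l)) = 0" "\<eta> (velocity G (\<lambda>\<tau>. ?q)) = 0"
    using d p q velocity_const dual_zero[OF _ tangent_space_zero[OF G]] by simp_all
  note c = cov[unfolded affine_cov_def, rule_format]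
  show "\<eta> (right_op ?q v) = \<alpha> (right_op h v)" if v: "v \<in> TG \<G> (e (t h))"
  proof -
    obtain a where a: "curve_at G (e (t h)) a" "velocity G a = proj (t h) v" "\<forall>\<^sub>F \<tau> in nhds 0. s (a \<tau>) = t h"
      "\<forall>g'. g' \<in> pt \<longrightarrow> t g' = t h \<longrightarrow> curve_at G g' (\<lambda>\<tau>. a \<tau> \<cdot> g') \<and> right_op g' v = velocity G (\<lambda>\<tau>. a \<tau> \<cdot> g')"
      by (rule right_op_curve[OF t_in[OF p(2)] v])
    have ah: "curve_at G h (\<lambda>\<tau>. a \<tau> \<cdot> h)" "right_op h v = velocity G (\<lambda>\<tau>. a \<tau> \<cdot> h)"
      and aq: "curve_at G ?q (\<lambda>\<tau>. a \<tau> \<cdot> ?q)" "right_op ?q v = velocity G (\<lambda>\<tau>. a \<tau> \<cdot> ?q)"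
      using a(4) p q by auto
    have 1: "\<forall>\<^sub>F \<tau> in nhds 0. s g = s (a \<tau> \<cdot> h)" using a(3) curve_pt[OF a(1)] by eventually_elim (simp add: s_mul p st)
    have 2: "\<forall>\<^sub>F \<tau> in nhds (0::real). t g = t l" using st by simp
    have 3: "\<forall>\<^sub>F \<tau> in nhds 0. a \<tau> \<cdot> ?q = ((a \<tau> \<cdot> h) \<cdot> iv g) \<cdot> l"
      using a(3) curve_pt[OF a(1)] by eventually_elim (simp add: assoc p st hg iv_in t_iv s_iv mul_in t_mul s_mul)
    show ?thesis
      using c[OF c0(1) ah(1) c0(3) 1 2] z unfolding ah(2) aq(2) curve_at_cong(2)[OF G aq(1) 3] by simp
  qed
  show "\<gamma> (right_op g v) = \<beta> (right_op l v)" if v: "v \<in> TG \<G> (e (t g))"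
  proof -
    obtain a where a: "curve_at G (e (t g)) a" "velocity G a = proj (t g) v" "\<forall>\<^sub>F \<tau> in nhds 0. s (a \<tau>) = t g"
      "\<forall>g'. g' \<in> pt \<longrightarrow> t g' = t g \<longrightarrow> curve_at G g' (\<lambda>\<tau>. a \<tau> \<cdot> g') \<and> right_op g' v = velocity G (\<lambda>\<tau>. a \<tau> \<cdot> g')"
      by (rule right_op_curve[OF t_in[OF p(1)] v])
    have ag: "curve_at G g (\<lambda>\<tau>. a \<tau> \<cdot> g)" "right_op g v = velocity G (\<lambda>\<tau>. a \<tau> \<cdot> g)"
      and al: "curve_at G l (\<lambda>\<tau>. a \<tau> \<cdot> l)" "right_op l v = velocity G (\<lambda>\<tau>. a \<tau> \<cdot> l)"
      using a(4) p st by auto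
    have 1: "\<forall>\<^sub>F \<tau> in nhds 0. s (a \<tau> \<cdot> g) = s h" using a(3) curve_pt[OF a(1)] by eventually_elim (simp add: s_mul p st)
    have 2: "\<forall>\<^sub>F \<tau> in nhds 0. t (a \<tau> \<cdot> g) = t (a \<tau> \<cdot> l)"
      using a(3) curve_pt[OF a(1)] by eventually_elim (simp add: t_mul p st)
    have 3: "\<forall>\<^sub>F \<tau> in nhds 0. ?q = (h \<cdot> iv (a \<tau> \<cdot> g)) \<cdot> (a \<tau> \<cdot> l)"
      using a(3) curve_pt[OF a(1)]
    proof eventually_elim
      case (elim \<tau>)
      have "iv g \<cdot> l \<in> pt" "t (iv g \<cdot> l) = s g" using p st by (simp_all add: mul_in t_mul iv_in s_iv t_iv)
      moreover have "a \<tau> \<cdot> l = (a \<tau> \<cdot> g) \<cdot> (iv g \<cdot> l)"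
      proof -
        have "g \<cdot> (iv g \<cdot> l) = l" using p st by (simp add: assoc[symmetric] iv_in s_iv t_iv mul_iv e_mul)
        then show ?thesis using elim p st by (simp add: assoc mul_in t_mul iv_in s_iv t_iv)
      qed
      moreover have "a \<tau> \<cdot> g \<in> pt" "s (a \<tau> \<cdot> g) = s g" using elim p by (simp_all add: mul_in s_mul)
      ultimately have "(h \<cdot> iv (a \<tau> \<cdot> g)) \<cdot> (a \<tau> \<cdot> l) = h \<cdot> (iv g \<cdot> l)"
        using mul_iv_cancel p st by simp
      then show ?case using p st by (simp add: assoc iv_in s_iv t_iv)
    qed
    show ?thesis
      using c[OF ag(1) c0(2) al(1) 1 2] z curve_at_cong(2)[OF G c0(4) 3] unfolding ag(2) al(2) by simp
  qed
qed

text \<open>With \<open>b\<close> the inverse of the curve \<open>a\<close>, the motions are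
  \<open>(g, h, l b, h g^-1 l b)\<close> and \<open>(g b, h b, l, h g^-1 l)\<close>. The fourth
  arrow is thus paired with \<open>l\<close>, and \<open>g\<close> with \<open>h\<close>.\<close>

lemma left_op_affine:
  assumes p: "g \<in> pt" "h \<in> pt" "l \<in> pt" and st: "s g = s h" "t g = t l"
    and d: "\<gamma> \<in> dual (TG \<G> g)" "\<alpha> \<in> dual (TG \<G> h)" "\<beta> \<in> dual (TG \<G> l)" "\<eta> \<in> dual (TG \<G> ((h \<cdot> iv g) \<cdot> l))"
    and cov: "affine_cov g h l \<gamma> \<alpha> \<beta> \<eta>"
  shows "v \<in> TG \<G> (e (s l)) \<Longrightarrow> \<eta> (left_op ((h \<cdot> iv g) \<cdot> l) v) = \<beta> (left_op l v)"
    and "v \<in> TG \<G> (e (s g)) \<Longrightarrow> \<gamma> (left_op g v) = \<alpha> (left_op h v)"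
proof -
  let ?q = "(h \<cdot> iv g) \<cdot> l"
  have hg: "h \<cdot> iv g \<in> pt" "s (h \<cdot> iv g) = t l" "t (h \<cdot> iv g) = t h"
    using p st by (simp_all add: mul_in s_mul t_mul iv_in s_iv t_iv)
  have q: "?q \<in> pt" "s ?q = s l" using hg p by (simp_all add: mul_in s_mul)
  have c0: "curve_at G g (\<lambda>\<tau>. g)" "curve_at G h (\<lambda>\<tau>. h)" "curve_at G l (\<lambda>\<tau>. l)" "curve_at G ?q (\<lambda>\<tau>. ?q)"
    using curve_at_const[OF G] p q by auto
  have z: "\<gamma> (velocity G (\<lambda>\<tau>. g)) = 0" "\<alpha> (velocity G (\<lambda>\<tau>. h)) = 0" "\<beta> (velocity G (\<lambda>\<tau>. l)) = 0" "\<eta> (velocity G (\<lambda>\<tau>. ?q)) = 0"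
    using d p q velocity_const dual_zero[OF _ tangent_space_zero[OF G]] by simp_all
  have um: "\<xi> (\<lambda>f. - velocity G c f) = - \<xi> (velocity G c)" if "\<xi> \<in> dual (TG \<G> y)" "curve_at G y c" for \<xi> y c
    by (rule dual_uminus[OF that(1) velocity_in_tangent_space[OF G that(2)]])
  note c = cov[unfolded affine_cov_def, rule_format]
  show "\<eta> (left_op ?q v) = \<beta> (left_op l v)" if v: "v \<in> TG \<G> (e (s l))"
  proof -
    obtain a where a: "curve_at G (e (s l)) a" "velocity G a = proj (s l) v" "\<forall>\<^sub>F \<tau> in nhds 0. s (a \<tau>) = s l"
      "\<forall>g'. g' \<in> pt \<longrightarrow> s g' = s l \<longrightarrow> curve_at G g' (\<lambda>\<tau>. g' \<cdot> iv (a \<tau>)) \<and> left_op g' v = (\<lambda>f. - velocity G (\<lambda>\<tau>. g' \<cdot> iv (a \<tau>)) f)"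
      by (rule left_op_curve[OF s_in[OF p(3)] v])
    have al: "curve_at G l (\<lambda>\<tau>. l \<cdot> iv (a \<tau>))" "left_op l v = (\<lambda>f. - velocity G (\<lambda>\<tau>. l \<cdot> iv (a \<tau>)) f)"
      and aq: "curve_at G ?q (\<lambda>\<tau>. ?q \<cdot> iv (a \<tau>))" "left_op ?q v = (\<lambda>f. - velocity G (\<lambda>\<tau>. ?q \<cdot> iv (a \<tau>)) f)"
      using a(4) p q by auto
    have 1: "\<forall>\<^sub>F \<tau> in nhds (0::real). s g = s h" using st by simp
    have 2: "\<forall>\<^sub>F \<tau> in nhds 0. t g = t (l \<cdot> iv (a \<tau>))"
      using a(3) curve_pt[OF a(1)] by eventually_elim (simp add: t_mul iv_in t_iv p st)
    have 3: "\<forall>\<^sub>F \<tau> in nhds 0. ?q \<cdot> iv (a \<tau>) = (h \<cdot> iv g) \<cdot> (l \<cdot> iv (a \<tau>))"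
      using a(3) curve_pt[OF a(1)] by eventually_elim (rule assoc, simp_all add: p hg iv_in t_iv)
    show ?thesis
      using c[OF c0(1,2) al(1) 1 2] z unfolding al(2) aq(2) um[OF d(3) al(1)] um[OF d(4) aq(1)]
      unfolding curve_at_cong(2)[OF G aq(1) 3] by simp
  qed
  show "\<gamma> (left_op g v) = \<alpha> (left_op h v)" if v: "v \<in> TG \<G> (e (s g))"
  proof -
    obtain a where a: "curve_at G (e (s g)) a" "velocity G a = proj (s g) v" "\<forall>\<^sub>F \<tau> in nhds 0. s (a \<tau>) = s g"
      "\<forall>g'. g' \<in> pt \<longrightarrow> s g' = s g \<longrightarrow> curve_at G g' (\<lambda>\<tau>. g' \<cdot> iv (a \<tau>)) \<and> left_op g' v = (\<lambda>f. - velocity G (\<lambda>\<tau>. g' \<cdot> iv (a \<tau>)) f)"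
      by (rule left_op_curve[OF s_in[OF p(1)] v])
    have ag: "curve_at G g (\<lambda>\<tau>. g \<cdot> iv (a \<tau>))" "left_op g v = (\<lambda>f. - velocity G (\<lambda>\<tau>. g \<cdot> iv (a \<tau>)) f)"
      and ah: "curve_at G h (\<lambda>\<tau>. h \<cdot> iv (a \<tau>))" "left_op h v = (\<lambda>f. - velocity G (\<lambda>\<tau>. h \<cdot> iv (a \<tau>)) f)"
      using a(4) p st by auto
    have 1: "\<forall>\<^sub>F \<tau> in nhds 0. s (g \<cdot> iv (a \<tau>)) = s (h \<cdot> iv (a \<tau>))"
      using a(3) curve_pt[OF a(1)] by eventually_elim (simp add: s_mul p st iv_in t_iv)
    have 2: "\<forall>\<^sub>F \<tau> in nhds 0. t (g \<cdot> iv (a \<tau>)) = t l"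
      using a(3) curve_pt[OF a(1)] by eventually_elim (simp add: t_mul p st iv_in t_iv)
    have 3: "\<forall>\<^sub>F \<tau> in nhds 0. ?q = ((h \<cdot> iv (a \<tau>)) \<cdot> iv (g \<cdot> iv (a \<tau>))) \<cdot> l"
      using a(3) curve_pt[OF a(1)]
    proof eventually_elim
      case (elim \<tau>)
      let ?b = "iv (a \<tau>)"
      have b: "?b \<in> pt" "t ?b = s g" using elim by (simp_all add: iv_in t_iv)
      have gb: "g \<cdot> ?b \<in> pt" "s (g \<cdot> ?b) = s ?b" "t (g \<cdot> ?b) = t g" using b p by (simp_all add: mul_in s_mul t_mul)
      have hb: "h \<cdot> ?b \<in> pt" "s (h \<cdot> ?b) = s ?b" using b p st by (simp_all add: mul_in s_mul)
      have "h \<cdot> iv g = (h \<cdot> ?b) \<cdot> iv (g \<cdot> ?b)"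
      proof -
        have w: "iv (g \<cdot> ?b) \<in> pt" "t (iv (g \<cdot> ?b)) = s ?b" "s (iv (g \<cdot> ?b)) = t g"
          using gb by (simp_all add: iv_in s_iv t_iv)
        have "(h \<cdot> ?b) \<cdot> iv (g \<cdot> ?b) = h \<cdot> (?b \<cdot> iv (g \<cdot> ?b))" by (rule assoc) (simp_all add: p b st w)
        also have "\<dots> = (h \<cdot> iv g) \<cdot> (g \<cdot> (?b \<cdot> iv (g \<cdot> ?b)))"
          by (rule mul_iv_cancel[symmetric]) (simp_all add: p b st w mul_in t_mul)
        also have "g \<cdot> (?b \<cdot> iv (g \<cdot> ?b)) = (g \<cdot> ?b) \<cdot> iv (g \<cdot> ?b)" by (rule assoc[symmetric]) (simp_all add: p b st w)
        also have "\<dots> = e (t g)" using mul_iv[OF gb(1)] gb(3) by simp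
        also have "(h \<cdot> iv g) \<cdot> e (t g) = h \<cdot> iv g" using mul_e[OF hg(1)] hg(2) st by simp
        finally show ?thesis by simp
      qed
      then show ?case by simp
    qed
    show ?thesis
      using c[OF ag(1) ah(1) c0(3) 1 2] z curve_at_cong(2)[OF G c0(4) 3]
      unfolding ag(2) ah(2) um[OF d(1) ag(1)] um[OF d(2) ah(1)] by simp
  qed
qed

section \<open>Translations at the units\<close>

lemma units_kill_proj:
  assumes x: "x \<in> points M" and v: "v \<in> TG \<G> (e x)" and \<epsilon>: "\<epsilon> \<in> dual (TG \<G> (e x))"
    and k: "\<And>w. w \<in> tangent G (e ` points M) (e x) \<Longrightarrow> \<epsilon> w = 0"
  shows "\<epsilon> (proj x v) = \<epsilon> v"
  unfolding proj_def dual_diff[OF \<epsilon> v push_retr_in[OF x v]] using k[OF push_retr_tangent_units[OF x v]] by simp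

lemma right_op_unit:
  assumes x: "x \<in> points M" and v: "v \<in> TG \<G> (e x)" and \<epsilon>: "\<epsilon> \<in> dual (TG \<G> (e x))"
    and k: "\<And>w. w \<in> tangent G (e ` points M) (e x) \<Longrightarrow> \<epsilon> w = 0"
  shows "\<epsilon> (right_op (e x) v) = \<epsilon> v"
proof -
  obtain a where a: "curve_at G (e x) a" "velocity G a = proj x v" "\<forall>\<^sub>F \<tau> in nhds 0. s (a \<tau>) = x"
    "\<forall>g. g \<in> pt \<longrightarrow> t g = x \<longrightarrow> curve_at G g (\<lambda>\<tau>. a \<tau> \<cdot> g) \<and> right_op g v = velocity G (\<lambda>\<tau>. a \<tau> \<cdot> g)"
    by (rule right_op_curve[OF x v])
  have "\<forall>\<^sub>F \<tau> in nhds 0. a \<tau> = a \<tau> \<cdot> e x"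
    using a(3) curve_pt[OF a(1)]
  proof eventually_elim
    case (elim \<tau>)
    then show ?case using mul_e[OF elim(2)] by simp
  qed
  from curve_at_cong(2)[OF G a(1) this] have "right_op (e x) v = proj x v"
    using a(2,4) e_in[OF x] t_e[OF x] by simp
  then show ?thesis using units_kill_proj[OF x v \<epsilon> k] by simp
qed

text \<open>At a unit, \<open>left_op\<close> is minus the differential of inversion on the
  \<open>A\<close>-component. As \<open>a \<cdot> iv a\<close> consists of units, that component
  plus its image under inversion is tangent to the units and annihilated by
  \<open>\<epsilon>\<close>, so the minus sign is compensated.\<close>

lemma left_op_unit:
  assumes x: "x \<in> points M" and v: "v \<in> TG \<G> (e x)" and \<epsilon>: "\<epsilon> \<in> dual (TG \<G> (e x))"
    and k: "\<And>w. w \<in> tangent G (e ` points M) (e x) \<Longrightarrow> \<epsilon> w = 0"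
  shows "\<epsilon> (left_op (e x) v) = \<epsilon> v"
proof -
  note ex = e_in[OF x] and MG = smooth_manifold_prod[OF M G] and GG = smooth_manifold_prod[OF G G]
  obtain a where a: "curve_at G (e x) a" "velocity G a = proj x v" "\<forall>\<^sub>F \<tau> in nhds 0. s (a \<tau>) = x"
    "\<forall>g. g \<in> pt \<longrightarrow> s g = x \<longrightarrow> curve_at G g (\<lambda>\<tau>. g \<cdot> iv (a \<tau>)) \<and> left_op g v = (\<lambda>f. - velocity G (\<lambda>\<tau>. g \<cdot> iv (a \<tau>)) f)"
    by (rule left_op_curve[OF x v])
  have ia: "curve_at G (e x) (\<lambda>\<tau>. iv (a \<tau>))" using curve_iv[OF a(1)] iv_e[OF x] by simp
  have ti: "\<forall>\<^sub>F \<tau> in nhds 0. t (iv (a \<tau>)) = x" using a(3) curve_pt[OF a(1)] by eventually_elim (simp add: t_iv)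
  have "\<forall>\<^sub>F \<tau> in nhds 0. iv (a \<tau>) = e x \<cdot> iv (a \<tau>)"
    using ti curve_pt[OF ia]
  proof eventually_elim
    case (elim \<tau>)
    then show ?case using e_mul[OF elim(2)] by simp
  qed
  from curve_at_cong(2)[OF G ia this] have lo: "left_op (e x) v = (\<lambda>f. - velocity G (\<lambda>\<tau>. iv (a \<tau>)) f)"
    using a(4) ex s_e[OF x] by simp
  obtain \<sigma> where \<sigma>: "smooth_at (prod_mfd M G) G (t (e x), e x) \<sigma>"
    and \<sigma>1: "\<forall>\<^sub>F p in nh (prod_mfd M G) (t (e x), e x). t (\<sigma> p) = fst p"
    and \<sigma>2: "\<forall>\<^sub>F y in nh G (e x). \<sigma> (t y, y) = y" by (rule submersion_transversal[OF G M sub_t ex])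
  have \<sigma>0: "\<sigma> (x, e x) = e x" using eventually_nh_self[OF G ex \<sigma>2] t_e[OF x] by simp
  have pp: "(e x, e x) \<in> pt \<times> pt" using ex by simp
  have f1: "smooth_at (prod_mfd G G) G (e x, e x) fst" and f2: "smooth_at (prod_mfd G G) G (e x, e x) snd"
    using smooth_at_fst[OF G G pp] smooth_at_snd[OF G G pp] by auto
  have fs: "smooth_at (prod_mfd G G) M (e x, e x) (\<lambda>p. s (fst p))"
    by (rule smooth_at_compose[OF GG G M f1]) (use s_at[OF ex] in simp)
  note A = smooth_at_Pair[OF GG M G fs f2]
  have sA: "smooth_at (prod_mfd G G) G (e x, e x) (\<lambda>p. \<sigma> (s (fst p), snd p))"
    by (rule smooth_at_compose[OF GG MG G A]) (use \<sigma> s_e[OF x] t_e[OF x] in simp)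
  have "\<forall>\<^sub>F p in nh (prod_mfd G G) (e x, e x). t (\<sigma> (s (fst p), snd p)) = s (fst p)"
    using smooth_at_filterlim[OF GG MG A] \<sigma>1 s_e[OF x] t_e[OF x] unfolding filterlim_iff by auto
  then have evA: "\<forall>\<^sub>F p in nh (prod_mfd G G) (e x, e x). s (fst p) = t (\<sigma> (s (fst p), snd p))"
    by eventually_elim simp
  \<comment> \<open>\<open>K\<close> extends the product to a neighbourhood of the pair of units by
    adjusting the second factor, so that the velocity of \<open>a \<cdot> iv a\<close>
    splits.\<close>
  define K where "K p = fst p \<cdot> \<sigma> (s (fst p), snd p)" for p
  have K: "smooth_at (prod_mfd G G) G (e x, e x) K" unfolding K_def by (rule mul_at[OF GG f1 sA evA])
  have K0: "K (e x, e x) = e x" unfolding K_def using \<sigma>0 s_e[OF x] e_mul[OF ex] t_e[OF x] by simp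
  note ci = eventually_curve[OF G ia \<sigma>2]
  have cK: "curve_at G (e x) (\<lambda>\<tau>. K (a \<tau>, iv (a \<tau>)))"
    using curve_at_compose[OF GG G curve_at_Pair[OF G G a(1) ia] K] K0 by simp
  have cK1: "curve_at G (e x) (\<lambda>\<tau>. K (a \<tau>, e x))"
    using curve_at_compose[OF GG G curve_at_Pair[OF G G a(1) curve_at_const[OF G ex]] K] K0 by simp
  have cK2: "curve_at G (e x) (\<lambda>\<tau>. K (e x, iv (a \<tau>)))"
    using curve_at_compose[OF GG G curve_at_Pair[OF G G curve_at_const[OF G ex] ia] K] K0 by simp
  have 1: "\<forall>\<^sub>F \<tau> in nhds 0. K (a \<tau>, iv (a \<tau>)) = e (t (a \<tau>))"
    using a(3) ti ci curve_pt[OF a(1)] by eventually_elim (simp add: K_def mul_iv)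
  have 2: "\<forall>\<^sub>F \<tau> in nhds 0. K (a \<tau>, e x) = a \<tau>"
    using a(3) curve_pt[OF a(1)]
  proof eventually_elim
    case (elim \<tau>)
    then show ?case using mul_e[OF elim(2)] by (simp add: K_def \<sigma>0)
  qed
  have 3: "\<forall>\<^sub>F \<tau> in nhds 0. K (e x, iv (a \<tau>)) = iv (a \<tau>)"
    using ti ci curve_pt[OF ia]
  proof eventually_elim
    case (elim \<tau>)
    then show ?case using e_mul[OF elim(3)] by (simp add: K_def s_e[OF x])
  qed
  have "\<forall>\<^sub>F \<tau> in nhds 0. K (a \<tau>, iv (a \<tau>)) \<in> e ` points M"
    using 1 curve_pt[OF a(1)] by eventually_elim (simp add: t_in)
  then have "velocity G (\<lambda>\<tau>. K (a \<tau>, iv (a \<tau>))) \<in> tangent G (e ` points M) (e x)"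
    by (rule tangentI[OF G cK])
  then have "\<epsilon> (velocity G (\<lambda>\<tau>. K (a \<tau>, iv (a \<tau>)))) = 0" by (rule k)
  moreover have "\<epsilon> (velocity G (\<lambda>\<tau>. K (a \<tau>, iv (a \<tau>)))) = \<epsilon> (velocity G a) + \<epsilon> (velocity G (\<lambda>\<tau>. iv (a \<tau>)))"
    using dual_velocity_add[OF \<epsilon> cK1 cK2 velocity_split[OF G G G K a(1) ia]]
    unfolding curve_at_cong(2)[OF G cK1 2] curve_at_cong(2)[OF G cK2 3] .
  moreover have "\<epsilon> (left_op (e x) v) = - \<epsilon> (velocity G (\<lambda>\<tau>. iv (a \<tau>)))"
    unfolding lo by (rule dual_uminus[OF \<epsilon> velocity_in_tangent_space[OF G ia]])
  ultimately show ?thesis using units_kill_proj[OF x v \<epsilon> k] a(2) by simp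
qed

text \<open>Right multiplication by \<open>g\<close> lives on a source fibre only. The maps \<open>E1\<close> and \<open>E2\<close> replace it by maps
  on open sets which depend smoothly on \<open>g\<close>: for right translations, \<open>E1 (g, y) = y \<cdot> \<sigma> (s y, g)\<close> and
  \<open>E2 (g, y) = \<sigma> (s y, g)\<close> with a local transversal \<open>\<sigma>\<close> of the target map.\<close>

definition smooth_op :: "('g \<Rightarrow> 'm) \<Rightarrow> ('g \<Rightarrow> 'g tvec \<Rightarrow> 'g tvec) \<Rightarrow> bool" where
  "smooth_op b L \<longleftrightarrow> (\<forall>g0\<in>pt. smooth_at G M g0 b \<and> (\<exists>E1 E2.
     smooth_at (prod_mfd G G) G (g0, e (b g0)) E1 \<and> smooth_at (prod_mfd G G) G (g0, e (b g0)) E2 \<and>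
     (\<forall>\<^sub>F g in nh G g0. smooth_at G G (e (b g)) (\<lambda>y. E1 (g, y)) \<and> smooth_at G G (e (b g)) (\<lambda>y. E2 (g, y)) \<and>
        E1 (g, e (b g)) = g \<and> E2 (g, e (b g)) = g \<and>
        (\<forall>v\<in>TG \<G> (e (b g)). L g v = (\<lambda>f. push G (\<lambda>y. E1 (g, y)) (e (b g)) v f - push G (\<lambda>y. E2 (g, y)) (e (b g)) v f)))))"

text \<open>The coordinate vector moves with \<open>g\<close>. Its value on a function is a time
  derivative at 0 of a function smooth jointly in \<open>g\<close> and time, which reduces the claim
  to \<open>smooth_at_deriv_parameter\<close>.\<close>

lemma smooth_at_velocity_parameter:
  assumes x: "smooth_at G G g0 x" and U: "(U, \<phi>) \<in> atlas G" "x g0 \<in> U" and a: "a \<in> model G"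
    and E: "smooth_at (prod_mfd G G) G (g0, x g0) E" and f: "smooth_at G euclid (E (g0, x g0)) f"
    and ev: "\<forall>\<^sub>F g in nh G g0. smooth_at G euclid (x g) (\<lambda>y. f (E (g, y)))"
  shows "smooth_at G euclid g0 (\<lambda>g. velocity G (chart_line G U \<phi> (x g) a) (\<lambda>y. f (E (g, y))))"
proof -
  note Eu = smooth_manifold_euclid and GG = smooth_manifold_prod[OF G G]
  have g0: "g0 \<in> pt" using smooth_at_points[OF x] by simp
  let ?GR = "prod_mfd G (euclid :: (real, real) mfd)"
  have GR: "smooth_manifold ?GR" by (rule smooth_manifold_prod[OF G Eu])
  have p: "(g0, 0::real) \<in> pt \<times> points euclid" using g0 by simp
  have f1: "smooth_at ?GR G (g0, 0) fst" and f2: "smooth_at ?GR euclid (g0, 0) snd"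
    using smooth_at_fst[OF G Eu p] smooth_at_snd[OF G Eu p] by auto
  have fx: "smooth_at ?GR G (g0, 0) (\<lambda>p. x (fst p))"
    by (rule smooth_at_compose[OF GR G G f1]) (use x in simp)
  have fphi: "smooth_at ?GR euclid (g0, 0) (\<lambda>p. \<phi> (x (fst p)))"
    by (rule smooth_at_compose[OF GR G Eu fx]) (use smooth_at_chart[OF G U] in simp)
  have "smooth_at ?GR euclid (g0, 0) (\<lambda>p. snd p *\<^sub>R a)"
    by (rule smooth_at_euclid_linear[OF GR linear_scale_left f2])
  from smooth_at_add[OF GR fphi this]
  have "smooth_at ?GR G (g0, 0) (\<lambda>p. chart_inv G U \<phi> (\<phi> (x (fst p)) + snd p *\<^sub>R a))"
    by (rule smooth_at_compose[OF GR Eu G]) (use chart_inv(2)[OF G U] in simp)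
  then have l: "smooth_at ?GR G (g0, 0) (\<lambda>p. chart_line G U \<phi> (x (fst p)) a (snd p))" by (simp add: chart_line_def)
  have l0: "chart_line G U \<phi> (x g0) a 0 = x g0" unfolding chart_line_def using chart_inv(1)[OF G U] by simp
  have "smooth_at ?GR G (g0, 0) (\<lambda>p. E (fst p, chart_line G U \<phi> (x (fst p)) a (snd p)))"
    by (rule smooth_at_compose[OF GR GG G smooth_at_Pair[OF GR G G f1 l]]) (use E l0 in simp)
  then have "smooth_at ?GR euclid (g0, 0) (\<lambda>p. f (E (fst p, chart_line G U \<phi> (x (fst p)) a (snd p))))"
    by (rule smooth_at_compose[OF GR G Eu]) (use f l0 in simp)
  from smooth_at_deriv_parameter[OF G this]
  have s: "smooth_at G euclid g0 (\<lambda>g. deriv (\<lambda>\<tau>. f (E (g, chart_line G U \<phi> (x g) a \<tau>))) 0)" by simp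
  have "\<forall>\<^sub>F g in nh G g0. x g \<in> U"
    by (rule smooth_at_eventually_in[OF G G x open_subset_chart[OF G U(1)] U(2)])
  with ev have "\<forall>\<^sub>F g in nh G g0. deriv (\<lambda>\<tau>. f (E (g, chart_line G U \<phi> (x g) a \<tau>))) 0 =
      velocity G (chart_line G U \<phi> (x g) a) (\<lambda>y. f (E (g, y)))"
  proof eventually_elim
    case (elim g)
    from has_real_derivative_velocity[OF G chart_line(1)[OF G U(1) elim(2) a] elim(1)]
    show ?case by (rule DERIV_imp_deriv)
  qed
  from smooth_at_cong[OF G s this] show ?thesis .
qed

lemma smooth_op_properties:
  assumes L: "smooth_op b L" and g: "g \<in> pt"
  shows "e (b g) \<in> pt"
    and "v \<in> TG \<G> (e (b g)) \<Longrightarrow> L g v \<in> TG \<G> g"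
    and "v \<in> TG \<G> (e (b g)) \<Longrightarrow> w \<in> TG \<G> (e (b g)) \<Longrightarrow> L g (\<lambda>f. r * v f + q * w f) = (\<lambda>f. r * L g v f + q * L g w f)"
proof -
  obtain E1 E2 where b: "smooth_at G M g b" and ev: "\<forall>\<^sub>F g in nh G g. smooth_at G G (e (b g)) (\<lambda>y. E1 (g, y)) \<and> smooth_at G G (e (b g)) (\<lambda>y. E2 (g, y)) \<and>
        E1 (g, e (b g)) = g \<and> E2 (g, e (b g)) = g \<and>
        (\<forall>v\<in>TG \<G> (e (b g)). L g v = (\<lambda>f. push G (\<lambda>y. E1 (g, y)) (e (b g)) v f - push G (\<lambda>y. E2 (g, y)) (e (b g)) v f))"
    using L g unfolding smooth_op_def by blast
  show "e (b g) \<in> pt" using e_in smooth_at_points(2)[OF b] by blast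
  from eventually_nh_self[OF G g ev]
  have E: "smooth_at G G (e (b g)) (\<lambda>y. E1 (g, y))" "smooth_at G G (e (b g)) (\<lambda>y. E2 (g, y))"
    "E1 (g, e (b g)) = g" "E2 (g, e (b g)) = g"
    "\<And>v. v \<in> TG \<G> (e (b g)) \<Longrightarrow> L g v = (\<lambda>f. push G (\<lambda>y. E1 (g, y)) (e (b g)) v f - push G (\<lambda>y. E2 (g, y)) (e (b g)) v f)"
    by blast+
  show "L g v \<in> TG \<G> g" if "v \<in> TG \<G> (e (b g))"
    unfolding E(5)[OF that]
    using push_in_tangent_space[OF G G E(1) that] push_in_tangent_space[OF G G E(2) that] E(3,4)
    by (intro tangent_space_diff[OF G]) simp_all
  show "L g (\<lambda>f. r * v f + q * w f) = (\<lambda>f. r * L g v f + q * L g w f)"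
    if v: "v \<in> TG \<G> (e (b g))" and w: "w \<in> TG \<G> (e (b g))"
    unfolding E(5)[OF v] E(5)[OF w] E(5)[OF tangent_space_combination[OF G v w]] push_combination
    by (simp add: algebra_simps)
qed

text \<open>The values of \<open>Q\<close> are those of \<open>P\<close> at \<open>e (b g)\<close>
  on pulled back differentials. By \<open>smooth_op\<close> the coefficients of these on coordinate
  vectors are differences of two derivatives along \<open>E1\<close> and \<open>E2\<close>, and
  \<open>smooth_at_kvector_field\<close> turns their smoothness into that of
  \<open>Q\<close>.\<close>

lemma kvector_field_translation:
  assumes P: "kvector_field G k P" and L: "smooth_op b L"
    and Q: "\<And>g \<xi>s. g \<in> pt \<Longrightarrow> Q g \<xi>s = P (e (b g)) (map (pullback (TG \<G> (e (b g))) (L g)) \<xi>s)"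
  shows "kvector_field G k Q"
  unfolding kvector_field_def
proof (intro conjI ballI allI impI)
  note lc = linear_closed_tangent_space[OF G]
  fix g assume g: "g \<in> pt"
  note o = smooth_op_properties[OF L g]
  have kv: "kvector k (TG \<G> (e (b g))) (P (e (b g)))" using P o(1) unfolding kvector_field_def by blast
  have "kvector k (TG \<G> g) (\<lambda>\<xi>s. P (e (b g)) (map (pullback (TG \<G> (e (b g))) (L g)) \<xi>s))"
    by (rule kvector_pushforward[OF lc kv]) (simp_all add: o)
  moreover have "Q g = (\<lambda>\<xi>s. P (e (b g)) (map (pullback (TG \<G> (e (b g))) (L g)) \<xi>s))"
    using Q[OF g] by (intro ext)
  ultimately show "kvector k (TG \<G> g) (Q g)" by simp
next
  note Eu = smooth_manifold_euclid
  fix W and fs :: "('g \<Rightarrow> real) list" assume *: "open_subset G W \<and> length fs = k \<and> (\<forall>f\<in>set fs. smooth_map G euclid W f)"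
  then have W: "open_subset G W" and len: "length fs = k" and fs: "\<And>f. f \<in> set fs \<Longrightarrow> smooth_map G euclid W f" by auto
  show "smooth_map G euclid W (\<lambda>x. Q x (map (fun_differential G x) fs))"
  proof (rule smooth_at_imp_smooth_map[OF G Eu])
    fix g0 assume g0: "g0 \<in> W"
    have g0p: "g0 \<in> pt" using W g0 unfolding open_subset_def by blast
    obtain E1 E2 where b: "smooth_at G M g0 b"
      and E1: "smooth_at (prod_mfd G G) G (g0, e (b g0)) E1" and E2: "smooth_at (prod_mfd G G) G (g0, e (b g0)) E2"
      and ev: "\<forall>\<^sub>F g in nh G g0. smooth_at G G (e (b g)) (\<lambda>y. E1 (g, y)) \<and> smooth_at G G (e (b g)) (\<lambda>y. E2 (g, y)) \<and>
        E1 (g, e (b g)) = g \<and> E2 (g, e (b g)) = g \<and>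
        (\<forall>v\<in>TG \<G> (e (b g)). L g v = (\<lambda>f. push G (\<lambda>y. E1 (g, y)) (e (b g)) v f - push G (\<lambda>y. E2 (g, y)) (e (b g)) v f))"
      using L g0p unfolding smooth_op_def by blast
    have E0: "E1 (g0, e (b g0)) = g0" "E2 (g0, e (b g0)) = g0" using eventually_nh_self[OF G g0p ev] by auto
    have x: "smooth_at G G g0 (\<lambda>g. e (b g))" by (rule smooth_at_compose[OF G M G b e_at[OF smooth_at_points(2)[OF b]]])
    obtain U \<phi> where U: "(U, \<phi>) \<in> atlas G" "e (b g0) \<in> U" by (rule points_chartE[OF smooth_at_points(2)[OF x]])
    have evW: "\<forall>\<^sub>F g in nh G g0. g \<in> W" by (rule eventually_nh_open[OF G W g0])
    have evU: "\<forall>\<^sub>F g in nh G g0. e (b g) \<in> U"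
      by (rule smooth_at_eventually_in[OF G G x open_subset_chart[OF G U(1)] U(2)])
    define \<omega> where "\<omega> f g = pullback (TG \<G> (e (b g))) (L g) (fun_differential G g f)" for f g
    have "smooth_at G euclid g0 (\<lambda>g. P (e (b g)) (map (\<lambda>\<omega>. \<omega> g) (map \<omega> fs)))"
    proof (rule smooth_at_kvector_field[OF G G P x U])
      show "length (map \<omega> fs) = k" using len by simp
      show "\<forall>\<^sub>F g in nh G g0. w g \<in> dual (TG \<G> (e (b g)))" if w: "w \<in> set (map \<omega> fs)" for w
        using eventually_nh_points[OF G g0p]
      proof eventually_elim
        case (elim g)
        obtain f where f: "w = \<omega> f" using w by auto
        show ?case unfolding f \<omega>_def
          by (rule pullback_in_dual[OF linear_closed_tangent_space[OF G] fun_differential_in_dual[OF G] smooth_op_properties(2,3)[OF L elim]])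
      qed
      fix w and i :: 'e assume w: "w \<in> set (map \<omega> fs)" and "i \<in> Basis"
      obtain f where f: "f \<in> set fs" "w = \<omega> f" using w by auto
      let ?a = "lin_proj (model G) i"
      have a: "?a \<in> model G" by (rule lin_proj(2)[OF smooth_manifoldD(1)[OF G]])
      let ?v = "\<lambda>g. velocity G (chart_line G U \<phi> (e (b g)) ?a)"
      have sf: "smooth_at G euclid g f" if "g \<in> W" for g by (rule smooth_map_imp_smooth_at[OF W fs[OF f(1)] that])
      have ev1: "\<forall>\<^sub>F g in nh G g0. smooth_at G euclid (e (b g)) (\<lambda>y. f (E1 (g, y)))"
        using ev evW
      proof eventually_elim
        case (elim g)
        then show ?case using smooth_at_compose[OF G G Eu, of "e (b g)" "\<lambda>y. E1 (g, y)" f] sf[OF elim(2)] by simp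
      qed
      have ev2: "\<forall>\<^sub>F g in nh G g0. smooth_at G euclid (e (b g)) (\<lambda>y. f (E2 (g, y)))"
        using ev evW
      proof eventually_elim
        case (elim g)
        then show ?case using smooth_at_compose[OF G G Eu, of "e (b g)" "\<lambda>y. E2 (g, y)" f] sf[OF elim(2)] by simp
      qed
      have "smooth_at G euclid g0 (\<lambda>g. ?v g (\<lambda>y. f (E1 (g, y))) - ?v g (\<lambda>y. f (E2 (g, y))))"
        by (rule smooth_at_diff[OF G smooth_at_velocity_parameter[OF x U a E1 _ ev1] smooth_at_velocity_parameter[OF x U a E2 _ ev2]])
          (use sf[OF g0] E0 in simp_all)
      moreover have "\<forall>\<^sub>F g in nh G g0. ?v g (\<lambda>y. f (E1 (g, y))) - ?v g (\<lambda>y. f (E2 (g, y))) = w g (?v g)"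
        using ev evW evU eventually_nh_points[OF G g0p]
      proof eventually_elim
        case (elim g)
        have v: "?v g \<in> TG \<G> (e (b g))" by (rule velocity_in_tangent_space[OF G chart_line(1)[OF G U(1) elim(3) a]])
        have "w g (?v g) = L g (?v g) f"
          unfolding f(2) \<omega>_def pullback_def fun_differential_def
          using v smooth_op_properties(2)[OF L elim(4) v] by simp
        also have "\<dots> = push G (\<lambda>y. E1 (g, y)) (e (b g)) (?v g) f - push G (\<lambda>y. E2 (g, y)) (e (b g)) (?v g) f"
          using elim(1) v by (metis (no_types, lifting))
        also have "\<dots> = ?v g (\<lambda>y. f (E1 (g, y))) - ?v g (\<lambda>y. f (E2 (g, y)))"
          unfolding push_def using elim(1) sf[OF elim(2)] by simp
        finally show ?case by simp
      qed
      ultimately show "smooth_at G euclid g0 (\<lambda>g. w g (?v g))" by (rule smooth_at_cong[OF G])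
    qed
    moreover have "\<forall>\<^sub>F g in nh G g0. P (e (b g)) (map (\<lambda>\<omega>. \<omega> g) (map \<omega> fs)) = Q g (map (fun_differential G g) fs)"
      using eventually_nh_points[OF G g0p] by eventually_elim (simp add: Q \<omega>_def comp_def)
    ultimately show "smooth_at G euclid g0 (\<lambda>g. Q g (map (fun_differential G g) fs))" by (rule smooth_at_cong[OF G])
  qed
qed

lemma smooth_op_right: "smooth_op t right_op"
  unfolding smooth_op_def
proof (intro ballI conjI t_at)
  fix g0 assume g0: "g0 \<in> pt"
  note MG = smooth_manifold_prod[OF M G] and GG = smooth_manifold_prod[OF G G]
  note x = t_in[OF g0]
  note ex = e_in[OF x]
  obtain \<sigma> where \<sigma>: "smooth_at (prod_mfd M G) G (t g0, g0) \<sigma>"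
    and \<sigma>1: "\<forall>\<^sub>F p in nh (prod_mfd M G) (t g0, g0). t (\<sigma> p) = fst p"
    and \<sigma>2: "\<forall>\<^sub>F y in nh G g0. \<sigma> (t y, y) = y" by (rule submersion_transversal[OF G M sub_t g0])
  have pp: "(g0, e (t g0)) \<in> pt \<times> pt" using g0 ex by simp
  have f1: "smooth_at (prod_mfd G G) G (g0, e (t g0)) fst" and f2: "smooth_at (prod_mfd G G) G (g0, e (t g0)) snd"
    using smooth_at_fst[OF G G pp] smooth_at_snd[OF G G pp] by auto
  have fs: "smooth_at (prod_mfd G G) M (g0, e (t g0)) (\<lambda>p. s (snd p))"
    by (rule smooth_at_compose[OF GG G M f2]) (use s_at[OF ex] in simp)
  note A = smooth_at_Pair[OF GG M G fs f1]
  have E2: "smooth_at (prod_mfd G G) G (g0, e (t g0)) (\<lambda>p. \<sigma> (s (snd p), fst p))"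
    by (rule smooth_at_compose[OF GG MG G A]) (use \<sigma> s_e[OF x] in simp)
  have "\<forall>\<^sub>F p in nh (prod_mfd G G) (g0, e (t g0)). t (\<sigma> (s (snd p), fst p)) = s (snd p)"
    using smooth_at_filterlim[OF GG MG A] \<sigma>1 s_e[OF x] unfolding filterlim_iff by auto
  then have "\<forall>\<^sub>F p in nh (prod_mfd G G) (g0, e (t g0)). s (snd p) = t (\<sigma> (s (snd p), fst p))"
    by eventually_elim simp
  then have E1: "smooth_at (prod_mfd G G) G (g0, e (t g0)) (\<lambda>p. snd p \<cdot> \<sigma> (s (snd p), fst p))"
    by (rule mul_at[OF GG f2 E2])
  have B: "smooth_at G (prod_mfd M G) g0 (\<lambda>g. (t g, g))" by (rule smooth_at_Pair[OF G M G t_at[OF g0] smooth_at_id[OF G g0]])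
  have "(t g0, g0) \<in> points (prod_mfd M G)" using g0 x by simp
  \<comment> \<open>One transversal, chosen at \<open>g0\<close>, has to serve all nearby
    \<open>g\<close>: its smoothness and the identity \<open>t (\<sigma> p) = fst p\<close> near
    \<open>p\<close> persist when the centre moves to \<open>(t g, g)\<close>.\<close>
  note evs = smooth_at_eventually[OF MG \<sigma>] eventually_nh_eventually[OF MG this \<sigma>1]
  have "\<forall>\<^sub>F g in nh G g0. smooth_at (prod_mfd M G) G (t g, g) \<sigma>"
    "\<forall>\<^sub>F g in nh G g0. \<forall>\<^sub>F p in nh (prod_mfd M G) (t g, g). t (\<sigma> p) = fst p"
    using smooth_at_filterlim[OF G MG B] evs unfolding filterlim_iff by auto
  then have "\<forall>\<^sub>F g in nh G g0. smooth_at G G (e (t g)) (\<lambda>y. y \<cdot> \<sigma> (s y, g)) \<and> smooth_at G G (e (t g)) (\<lambda>y. \<sigma> (s y, g)) \<and>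
        e (t g) \<cdot> \<sigma> (s (e (t g)), g) = g \<and> \<sigma> (s (e (t g)), g) = g \<and>
        (\<forall>v\<in>TG \<G> (e (t g)). right_op g v = (\<lambda>f. push G (\<lambda>y. y \<cdot> \<sigma> (s y, g)) (e (t g)) v f - push G (\<lambda>y. \<sigma> (s y, g)) (e (t g)) v f))"
    using \<sigma>2 eventually_nh_points[OF G g0]
  proof eventually_elim
    case (elim g)
    note r = right_op_smooth[OF elim(4,1,2,3)]
    have z: "(\<lambda>f. 0) \<in> TG \<G> (e (t g))" by (rule tangent_space_zero[OF G e_in[OF t_in[OF elim(4)]]])
    show ?case using r(1) r(2)[OF z] r(3)[OF z] elim(3) e_mul[OF elim(4)] s_e[OF t_in[OF elim(4)]] by simp
  qed
  with E1 E2 show "\<exists>E1 E2. smooth_at (prod_mfd G G) G (g0, e (t g0)) E1 \<and> smooth_at (prod_mfd G G) G (g0, e (t g0)) E2 \<and>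
     (\<forall>\<^sub>F g in nh G g0. smooth_at G G (e (t g)) (\<lambda>y. E1 (g, y)) \<and> smooth_at G G (e (t g)) (\<lambda>y. E2 (g, y)) \<and>
        E1 (g, e (t g)) = g \<and> E2 (g, e (t g)) = g \<and>
        (\<forall>v\<in>TG \<G> (e (t g)). right_op g v = (\<lambda>f. push G (\<lambda>y. E1 (g, y)) (e (t g)) v f - push G (\<lambda>y. E2 (g, y)) (e (t g)) v f)))"
    by (intro exI[of _ "\<lambda>p. snd p \<cdot> \<sigma> (s (snd p), fst p)"] exI[of _ "\<lambda>p. \<sigma> (s (snd p), fst p)"]) simp
qed

lemma smooth_op_left: "smooth_op s left_op"
  unfolding smooth_op_def
proof (intro ballI conjI s_at)
  fix g0 assume g0: "g0 \<in> pt"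
  note MG = smooth_manifold_prod[OF M G] and GG = smooth_manifold_prod[OF G G]
  note x = s_in[OF g0]
  note ex = e_in[OF x]
  obtain \<sigma> where \<sigma>: "smooth_at (prod_mfd M G) G (s g0, g0) \<sigma>"
    and \<sigma>1: "\<forall>\<^sub>F p in nh (prod_mfd M G) (s g0, g0). s (\<sigma> p) = fst p"
    and \<sigma>2: "\<forall>\<^sub>F y in nh G g0. \<sigma> (s y, y) = y" by (rule submersion_transversal[OF G M sub_s g0])
  have pp: "(g0, e (s g0)) \<in> pt \<times> pt" using g0 ex by simp
  have f1: "smooth_at (prod_mfd G G) G (g0, e (s g0)) fst" and f2: "smooth_at (prod_mfd G G) G (g0, e (s g0)) snd"
    using smooth_at_fst[OF G G pp] smooth_at_snd[OF G G pp] by auto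
  have fs: "smooth_at (prod_mfd G G) M (g0, e (s g0)) (\<lambda>p. s (snd p))"
    by (rule smooth_at_compose[OF GG G M f2]) (use s_at[OF ex] in simp)
  have fi: "smooth_at (prod_mfd G G) G (g0, e (s g0)) (\<lambda>p. iv (snd p))"
    by (rule smooth_at_compose[OF GG G G f2]) (use iv_at[OF ex] in simp)
  note A = smooth_at_Pair[OF GG M G fs f1]
  have E1: "smooth_at (prod_mfd G G) G (g0, e (s g0)) (\<lambda>p. \<sigma> (s (snd p), fst p))"
    by (rule smooth_at_compose[OF GG MG G A]) (use \<sigma> s_e[OF x] in simp)
  have "\<forall>\<^sub>F p in nh (prod_mfd G G) (g0, e (s g0)). s (\<sigma> (s (snd p), fst p)) = s (snd p)"
    using smooth_at_filterlim[OF GG MG A] \<sigma>1 s_e[OF x] unfolding filterlim_iff by auto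
  moreover have "\<forall>\<^sub>F p in nh (prod_mfd G G) (g0, e (s g0)). snd p \<in> pt"
    by (rule smooth_at_eventually_in[OF GG G f2 open_subset_points[OF G]]) (use ex in simp)
  ultimately have "\<forall>\<^sub>F p in nh (prod_mfd G G) (g0, e (s g0)). s (\<sigma> (s (snd p), fst p)) = t (iv (snd p))"
    by eventually_elim (simp add: t_iv)
  then have E2: "smooth_at (prod_mfd G G) G (g0, e (s g0)) (\<lambda>p. \<sigma> (s (snd p), fst p) \<cdot> iv (snd p))"
    by (rule mul_at[OF GG E1 fi])
  have B: "smooth_at G (prod_mfd M G) g0 (\<lambda>g. (s g, g))" by (rule smooth_at_Pair[OF G M G s_at[OF g0] smooth_at_id[OF G g0]])
  have "(s g0, g0) \<in> points (prod_mfd M G)" using g0 x by simp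
  note evs = smooth_at_eventually[OF MG \<sigma>] eventually_nh_eventually[OF MG this \<sigma>1]
  have "\<forall>\<^sub>F g in nh G g0. smooth_at (prod_mfd M G) G (s g, g) \<sigma>"
    "\<forall>\<^sub>F g in nh G g0. \<forall>\<^sub>F p in nh (prod_mfd M G) (s g, g). s (\<sigma> p) = fst p"
    using smooth_at_filterlim[OF G MG B] evs unfolding filterlim_iff by auto
  then have "\<forall>\<^sub>F g in nh G g0. smooth_at G G (e (s g)) (\<lambda>y. \<sigma> (s y, g)) \<and> smooth_at G G (e (s g)) (\<lambda>y. \<sigma> (s y, g) \<cdot> iv y) \<and>
        \<sigma> (s (e (s g)), g) = g \<and> \<sigma> (s (e (s g)), g) \<cdot> iv (e (s g)) = g \<and>
        (\<forall>v\<in>TG \<G> (e (s g)). left_op g v = (\<lambda>f. push G (\<lambda>y. \<sigma> (s y, g)) (e (s g)) v f - push G (\<lambda>y. \<sigma> (s y, g) \<cdot> iv y) (e (s g)) v f))"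
    using \<sigma>2 eventually_nh_points[OF G g0]
  proof eventually_elim
    case (elim g)
    note r = left_op_smooth[OF elim(4,1,2,3)]
    note sg = s_in[OF elim(4)]
    have z: "(\<lambda>f. 0) \<in> TG \<G> (e (s g))" by (rule tangent_space_zero[OF G e_in[OF sg]])
    show ?case using r(1) r(2)[OF z] r(3)[OF z] elim(3) mul_e[OF elim(4)] s_e[OF sg] iv_e[OF sg] by simp
  qed
  with E1 E2 show "\<exists>E1 E2. smooth_at (prod_mfd G G) G (g0, e (s g0)) E1 \<and> smooth_at (prod_mfd G G) G (g0, e (s g0)) E2 \<and>
     (\<forall>\<^sub>F g in nh G g0. smooth_at G G (e (s g)) (\<lambda>y. E1 (g, y)) \<and> smooth_at G G (e (s g)) (\<lambda>y. E2 (g, y)) \<and>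
        E1 (g, e (s g)) = g \<and> E2 (g, e (s g)) = g \<and>
        (\<forall>v\<in>TG \<G> (e (s g)). left_op g v = (\<lambda>f. push G (\<lambda>y. E1 (g, y)) (e (s g)) v f - push G (\<lambda>y. E2 (g, y)) (e (s g)) v f)))"
    by (intro exI[of _ "\<lambda>p. \<sigma> (s (snd p), fst p)"] exI[of _ "\<lambda>p. \<sigma> (s (snd p), fst p) \<cdot> iv (snd p)"]) simp
qed

section \<open>Subtracting the translated component and comparing the two conditions\<close>

lemma right_op_unit_pullback:
  assumes x: "x \<in> points M" and \<epsilon>: "\<epsilon> \<in> dual (TG \<G> (e x))" and k: "\<forall>w\<in>tangent G (e ` points M) (e x). \<epsilon> w = 0"
  shows "pullback (TG \<G> (e x)) (right_op (e x)) \<epsilon> = \<epsilon>"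
proof
  fix v show "pullback (TG \<G> (e x)) (right_op (e x)) \<epsilon> v = \<epsilon> v"
    using right_op_unit[OF x _ \<epsilon>, of v] k dualD(2)[OF \<epsilon>, of v] by (simp add: pullback_def)
qed

lemma left_op_unit_pullback:
  assumes x: "x \<in> points M" and \<epsilon>: "\<epsilon> \<in> dual (TG \<G> (e x))" and k: "\<forall>w\<in>tangent G (e ` points M) (e x). \<epsilon> w = 0"
  shows "pullback (TG \<G> (e x)) (left_op (e x)) \<epsilon> = \<epsilon>"
proof
  fix v show "pullback (TG \<G> (e x)) (left_op (e x)) \<epsilon> v = \<epsilon> v"
    using left_op_unit[OF x _ \<epsilon>, of v] k dualD(2)[OF \<epsilon>, of v] by (simp add: pullback_def)
qed

text \<open>Treats both sides at once, with \<open>b\<close> the target or the source map and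
  \<open>Q\<close> the corresponding translation. The affine relation is linear in the field, so
  subtracting the affine \<open>Q\<close> changes nothing; by \<open>unit\<close> the difference
  vanishes on the covectors of \<open>A\<close>, which upgrades affinity to
  multiplicativity.\<close>

lemma affine_field_iff_multiplicative_diff:
  assumes P: "kvector_field G k P" and L: "smooth_op b L"
    and Q: "\<And>g \<xi>s. g \<in> pt \<Longrightarrow> Q g \<xi>s = P (e (b g)) (map (pullback (TG \<G> (e (b g))) (L g)) \<xi>s)"
    and aff: "affine_rel k Q"
    and be: "\<And>x. x \<in> points M \<Longrightarrow> b (e x) = x"
    and unit: "\<And>x \<epsilon>. x \<in> points M \<Longrightarrow> \<epsilon> \<in> dual (TG \<G> (e x)) \<Longrightarrow>
      \<forall>w\<in>tangent G (e ` points M) (e x). \<epsilon> w = 0 \<Longrightarrow> pullback (TG \<G> (e x)) (L (e x)) \<epsilon> = \<epsilon>"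
  shows "affine_field \<G> k P \<longleftrightarrow> multiplicative \<G> k (diff_field P Q)"
proof -
  let ?D = "diff_field P Q"
  have D: "kvector_field G k ?D" by (rule kvector_field_diff[OF G P kvector_field_translation[OF P L Q]])
  have "unit_vanishing k ?D" unfolding unit_vanishing_def
  proof (intro allI impI)
    fix x \<epsilon>s assume x: "x \<in> points M" and "length \<epsilon>s = k" and d: "set \<epsilon>s \<subseteq> dual (TG \<G> (e x))"
      and k: "\<forall>\<epsilon>\<in>set \<epsilon>s. \<forall>v\<in>tangent G (e ` points M) (e x). \<epsilon> v = 0"
    have "pullback (TG \<G> (e x)) (L (e x)) \<epsilon> = \<epsilon>" if \<epsilon>: "\<epsilon> \<in> set \<epsilon>s" for \<epsilon>
      by (rule unit[OF x]) (use d k \<epsilon> in auto)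
    then have "map (pullback (TG \<G> (e x)) (L (e x))) \<epsilon>s = \<epsilon>s" by (simp add: map_idI)
    then show "?D (e x) \<epsilon>s = 0" unfolding diff_field_def using Q[OF e_in[OF x]] be[OF x] by simp
  qed
  then have "affine_rel k ?D \<longleftrightarrow> mult_rel k ?D"
    using affine_rel_imp_mult_rel mult_rel_imp_affine_rel by blast
  moreover have "affine_rel k P \<longleftrightarrow> affine_rel k ?D"
  proof
    assume a: "affine_rel k P"
    show "affine_rel k ?D" unfolding affine_rel_def
    proof (intro allI impI)
      fix g h l \<gamma>s \<alpha>s \<beta>s \<eta>s
      assume h: "g \<in> pt" "h \<in> pt" "l \<in> pt" "s g = s h" "t g = t l"
        "length \<gamma>s = k" "length \<alpha>s = k" "length \<beta>s = k" "length \<eta>s = k"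
        "set \<gamma>s \<subseteq> dual (TG \<G> g)" "set \<alpha>s \<subseteq> dual (TG \<G> h)" "set \<beta>s \<subseteq> dual (TG \<G> l)"
        "set \<eta>s \<subseteq> dual (TG \<G> ((h \<cdot> iv g) \<cdot> l))"
        "\<forall>i<k. affine_cov g h l (\<gamma>s ! i) (\<alpha>s ! i) (\<beta>s ! i) (\<eta>s ! i)"
      have "P ((h \<cdot> iv g) \<cdot> l) \<eta>s + P g \<gamma>s = P h \<alpha>s + P l \<beta>s" using a h unfolding affine_rel_def by blast
      moreover have "Q ((h \<cdot> iv g) \<cdot> l) \<eta>s + Q g \<gamma>s = Q h \<alpha>s + Q l \<beta>s" using aff h unfolding affine_rel_def by blast
      ultimately show "?D ((h \<cdot> iv g) \<cdot> l) \<eta>s + ?D g \<gamma>s = ?D h \<alpha>s + ?D l \<beta>s" unfolding diff_field_def by simp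
    qed
  next
    assume a: "affine_rel k ?D"
    show "affine_rel k P" unfolding affine_rel_def
    proof (intro allI impI)
      fix g h l \<gamma>s \<alpha>s \<beta>s \<eta>s
      assume h: "g \<in> pt" "h \<in> pt" "l \<in> pt" "s g = s h" "t g = t l"
        "length \<gamma>s = k" "length \<alpha>s = k" "length \<beta>s = k" "length \<eta>s = k"
        "set \<gamma>s \<subseteq> dual (TG \<G> g)" "set \<alpha>s \<subseteq> dual (TG \<G> h)" "set \<beta>s \<subseteq> dual (TG \<G> l)"
        "set \<eta>s \<subseteq> dual (TG \<G> ((h \<cdot> iv g) \<cdot> l))"
        "\<forall>i<k. affine_cov g h l (\<gamma>s ! i) (\<alpha>s ! i) (\<beta>s ! i) (\<eta>s ! i)"
      have "?D ((h \<cdot> iv g) \<cdot> l) \<eta>s + ?D g \<gamma>s = ?D h \<alpha>s + ?D l \<beta>s" using a h unfolding affine_rel_def by blast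
      moreover have "Q ((h \<cdot> iv g) \<cdot> l) \<eta>s + Q g \<gamma>s = Q h \<alpha>s + Q l \<beta>s" using aff h unfolding affine_rel_def by blast
      ultimately show "P ((h \<cdot> iv g) \<cdot> l) \<eta>s + P g \<gamma>s = P h \<alpha>s + P l \<beta>s" unfolding diff_field_def by simp
    qed
  qed
  ultimately show ?thesis using affine_field_iff[OF P] multiplicative_iff[OF D] by simp
qed

lemma right_translation_eq:
  assumes g: "g \<in> pt"
  shows "right_translation \<G> (pr_A \<G> P) g \<xi>s = P (e (t g)) (map (pullback (TG \<G> (e (t g))) (right_op g)) \<xi>s)"
proof -
  note x = t_in[OF g]
  have "pullback (TG \<G> (e (t g))) (proj_A \<G> (t g)) (pullback (algebroid \<G> (t g)) (right_mult_d \<G> g) \<xi>)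
      = pullback (TG \<G> (e (t g))) (right_op g) \<xi>" for \<xi>
    unfolding right_op_def by (rule pullback_pullback) (simp add: proj_A_eq[OF x] proj_in_algebroid[OF x])
  then show ?thesis unfolding right_translation_def pr_A_def pushforward_def by (simp add: comp_def)
qed

lemma left_translation_eq:
  assumes g: "g \<in> pt"
  shows "left_translation \<G> (pr_A \<G> P) g \<xi>s = P (e (s g)) (map (pullback (TG \<G> (e (s g))) (left_op g)) \<xi>s)"
proof -
  note x = s_in[OF g]
  have "pullback (TG \<G> (e (s g))) (proj_A \<G> (s g)) (pullback (algebroid \<G> (s g))
        (\<lambda>u f. - left_mult_d \<G> g (differential G pt G iv (e (s g)) u) f) \<xi>)
      = pullback (TG \<G> (e (s g))) (left_op g) \<xi>" for \<xi>
    unfolding left_op_def by (rule pullback_pullback) (simp add: proj_A_eq[OF x] proj_in_algebroid[OF x])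
  then show ?thesis unfolding left_translation_def pr_A_def pushforward_def by (simp add: comp_def)
qed

text \<open>The four terms agree in pairs: by \<open>right_op_affine\<close> the covectors at the
  fourth arrow and at \<open>h\<close> have the same pullback to the unit, and so do those at
  \<open>g\<close> and \<open>l\<close>.\<close>

lemma affine_rel_right_translation: "affine_rel k (right_translation \<G> (pr_A \<G> P))"
  unfolding affine_rel_def
proof (intro allI impI)
  fix g h l \<gamma>s \<alpha>s \<beta>s \<eta>s
  assume p: "g \<in> pt" "h \<in> pt" "l \<in> pt" and st: "s g = s h" "t g = t l"
    and len: "length \<gamma>s = k" "length \<alpha>s = k" "length \<beta>s = k" "length \<eta>s = k"
    and d: "set \<gamma>s \<subseteq> dual (TG \<G> g)" "set \<alpha>s \<subseteq> dual (TG \<G> h)" "set \<beta>s \<subseteq> dual (TG \<G> l)"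
      "set \<eta>s \<subseteq> dual (TG \<G> ((h \<cdot> iv g) \<cdot> l))"
    and cov: "\<forall>i<k. affine_cov g h l (\<gamma>s ! i) (\<alpha>s ! i) (\<beta>s ! i) (\<eta>s ! i)"
  let ?q = "(h \<cdot> iv g) \<cdot> l"
  have q: "?q \<in> pt" "t ?q = t h" using p st by (simp_all add: mul_in s_mul t_mul iv_in s_iv t_iv)
  have di: "\<gamma>s ! i \<in> dual (TG \<G> g)" "\<alpha>s ! i \<in> dual (TG \<G> h)" "\<beta>s ! i \<in> dual (TG \<G> l)" "\<eta>s ! i \<in> dual (TG \<G> ?q)" if "i < k" for i
    using d len that by (auto dest: nth_mem)
  note r = right_op_affine[OF p st di cov[rule_format]]
  have "map (pullback (TG \<G> (e (t h))) (right_op ?q)) \<eta>s = map (pullback (TG \<G> (e (t h))) (right_op h)) \<alpha>s"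
    by (rule map_pullback_eqI[OF len(4,2)]) (rule r(1))
  moreover have "map (pullback (TG \<G> (e (t g))) (right_op g)) \<gamma>s = map (pullback (TG \<G> (e (t g))) (right_op l)) \<beta>s"
    by (rule map_pullback_eqI[OF len(1,3)]) (rule r(2))
  ultimately show "right_translation \<G> (pr_A \<G> P) ?q \<eta>s + right_translation \<G> (pr_A \<G> P) g \<gamma>s =
      right_translation \<G> (pr_A \<G> P) h \<alpha>s + right_translation \<G> (pr_A \<G> P) l \<beta>s"
    using p q st by (simp add: right_translation_eq)
qed

text \<open>Here the fourth arrow is paired with \<open>l\<close>, and \<open>g\<close> with
  \<open>h\<close>, since these are the pairs with equal sources.\<close>

lemma affine_rel_left_translation: "affine_rel k (left_translation \<G> (pr_A \<G> P))"
  unfolding affine_rel_def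
proof (intro allI impI)
  fix g h l \<gamma>s \<alpha>s \<beta>s \<eta>s
  assume p: "g \<in> pt" "h \<in> pt" "l \<in> pt" and st: "s g = s h" "t g = t l"
    and len: "length \<gamma>s = k" "length \<alpha>s = k" "length \<beta>s = k" "length \<eta>s = k"
    and d: "set \<gamma>s \<subseteq> dual (TG \<G> g)" "set \<alpha>s \<subseteq> dual (TG \<G> h)" "set \<beta>s \<subseteq> dual (TG \<G> l)"
      "set \<eta>s \<subseteq> dual (TG \<G> ((h \<cdot> iv g) \<cdot> l))"
    and cov: "\<forall>i<k. affine_cov g h l (\<gamma>s ! i) (\<alpha>s ! i) (\<beta>s ! i) (\<eta>s ! i)"
  let ?q = "(h \<cdot> iv g) \<cdot> l"
  have q: "?q \<in> pt" "s ?q = s l" using p st by (simp_all add: mul_in s_mul t_mul iv_in s_iv t_iv)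
  have di: "\<gamma>s ! i \<in> dual (TG \<G> g)" "\<alpha>s ! i \<in> dual (TG \<G> h)" "\<beta>s ! i \<in> dual (TG \<G> l)" "\<eta>s ! i \<in> dual (TG \<G> ?q)" if "i < k" for i
    using d len that by (auto dest: nth_mem)
  note r = left_op_affine[OF p st di cov[rule_format]]
  have "map (pullback (TG \<G> (e (s l))) (left_op ?q)) \<eta>s = map (pullback (TG \<G> (e (s l))) (left_op l)) \<beta>s"
    by (rule map_pullback_eqI[OF len(4,3)]) (rule r(1))
  moreover have "map (pullback (TG \<G> (e (s g))) (left_op g)) \<gamma>s = map (pullback (TG \<G> (e (s g))) (left_op h)) \<alpha>s"
    by (rule map_pullback_eqI[OF len(1,2)]) (rule r(2))
  ultimately show "left_translation \<G> (pr_A \<G> P) ?q \<eta>s + left_translation \<G> (pr_A \<G> P) g \<gamma>s =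
      left_translation \<G> (pr_A \<G> P) h \<alpha>s + left_translation \<G> (pr_A \<G> P) l \<beta>s"
    using p q st by (simp add: left_translation_eq)
qed

end

theorem proposition3p3:
  fixes \<G> :: "('g, 'e::euclidean_space, 'm, 'f::euclidean_space) groupoid"
    and k :: nat
    and P :: "'g \<Rightarrow> 'g mvec"
  assumes "lie_groupoid \<G>"
    and "kvector_field (arrows \<G>) k P"
  shows "let \<pi> = pr_A \<G> P;
             P\<^sub>r = diff_field P (right_translation \<G> \<pi>);
             P\<^sub>l = diff_field P (left_translation \<G> \<pi>)
         in (affine_field \<G> k P \<longleftrightarrow> multiplicative \<G> k P\<^sub>r) \<and>
            (affine_field \<G> k P \<longleftrightarrow> multiplicative \<G> k P\<^sub>l)"
proof -
  interpret lie_groupoid_loc \<G> by unfold_locales (rule assms(1))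
  show ?thesis unfolding Let_def
  proof
    show "affine_field \<G> k P \<longleftrightarrow> multiplicative \<G> k (diff_field P (right_translation \<G> (pr_A \<G> P)))"
      by (rule affine_field_iff_multiplicative_diff[OF assms(2) smooth_op_right right_translation_eq
            affine_rel_right_translation t_e right_op_unit_pullback])
    show "affine_field \<G> k P \<longleftrightarrow> multiplicative \<G> k (diff_field P (left_translation \<G> (pr_A \<G> P)))"
      by (rule affine_field_iff_multiplicative_diff[OF assms(2) smooth_op_left left_translation_eq
            affine_rel_left_translation s_e left_op_unit_pullback])
  qed
qed

end
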